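(* Let $k$ be a field, let $Q$ be a finite quiver, $I$ an admissible ideal of $kQ$, and suppose that $A=kQ/I$ is a finite dimensional Frobenius algebra. Let $\mathcal{B}$ be a basis of $A$ consisting of (classes of) paths which also contains a basis of the socle of each indecomposable projective $A$-module. Equip $A$ with the bilinear form $\langle a,b\rangle=\mathrm{tr}(ab)$, where $\mathrm{tr}:A\to k$ is the linear map with $\mathrm{tr}(p)=1$ for $p\in \mathrm{Soc}(A)\cap\mathcal{B}$ and $\mathrm{tr}(p)=0$ for $p\in\mathcal{B}\setminus \mathrm{Soc}(A)$. Assume that $\mathcal{B}$ satisfies the following two conditions: (1) for any two paths $p,q\in\mathcal{B}$ there exist a path $r\in\mathcal{B}$ and a constant $\lambda\in k$ such that $p\cdot q=\lambda r$ in $A$; (2) for each path $p\in\mathcal{B}$ there exists a unique element $p^*\in\mathcal{B}$ such that $0\neq p\cdot p^*\in \mathrm{Soc}(A)$. Suppose moreover that $k$ has characteristic $0$, or characteristic $p$ with $p$ strictly bigger than the number of arrows of $Q$. Then the Nakayama automorphism of $A$ is semisimple, and the Hochschild cohomology $HH^*(A)$ of $A$ is a Batalin-Vilkovisky algebra.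
   Context: Frobenius algebras: a finite dimensional $k$-algebra $A$ is Frobenius if it carries a non-degenerate bilinear form $\langle-,-\rangle$ with $\langle ab,c\rangle=\langle a,bc\rangle$. The Nakayama automorphism $\mathfrak{N}$ (associated to this form) is the algebra automorphism determined by $\langle a,b\rangle=\langle b,\mathfrak{N}(a)\rangle$ for all $a,b\in A$. Let $A=kQ/I$ be a finite dimensional Frobenius algebra, where $Q$ is a finite quiver and $I$ an admissible ideal of $kQ$, let $\mathcal{B}$ be a basis of $A$ consisting of (classes of) paths which also contains a basis of the socle of each indecomposable projective $A$-module, and let $\mathrm{tr}:A\to k$ be the linear map with $\mathrm{tr}(p)=1$ for $p\in \mathrm{Soc}(A)\cap\mathcal{B}$ and $\mathrm{tr}(p)=0$ for $p\in\mathcal{B}\setminus \mathrm{Soc}(A)$; then the form $\langle a,b\rangle=\mathrm{tr}(ab)$ is a defining (non-degenerate associative) form of the Frobenius algebra $A$, and $\mathfrak{N}$ is taken with respect to it. $\mathfrak{N}$ is semisimple if, as a $k$-linear endomorphism of $A$, it is diagonalisable over the algebraic closure $\overline{k}$. Hochschild cohomology: put $\overline{A}=A/(k\cdot 1_A)$, $C^r(A,A)=\mathrm{Hom}_k(\overline{A}^{\otimes r},A)$ for $r\ge 0$, with differential $b^r(f)(\overline{a_1}\otimes\cdots\otimes\overline{a_{r+1}})=(-1)^{r+1}a_1f(\overline{a_2}\otimes\cdots\otimes\overline{a_{r+1}})+\sum_{i=1}^r(-1)^{r+1-i}f(\overline{a_1}\otimes\cdots\otimes\overline{a_ia_{i+1}}\otimes\cdots\otimes\overline{a_{r+1}})+f(\overline{a_1}\otimes\cdots\otimes\overline{a_r})a_{r+1}$.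 Its cohomology is $HH^*(A)$. The cup product is induced by $(\alpha\cup\beta)(\overline{a_1}\otimes\cdots\otimes\overline{a_{p+q}})=(-1)^{pq}\alpha(\overline{a_1}\otimes\cdots\otimes\overline{a_p})\beta(\overline{a_{p+1}}\otimes\cdots\otimes\overline{a_{p+q}})$ for $\alpha\in C^p$, $\beta\in C^q$. The Lie bracket of degree $-1$ is induced, for $\alpha\in C^n$, $\beta\in C^m$, by $[\alpha,\beta]=\alpha\,\overline{\circ}\,\beta-(-1)^{(n-1)(m-1)}\beta\,\overline{\circ}\,\alpha$, where $\alpha\,\overline{\circ}\,\beta=\sum_{i=1}^n(-1)^{(m-1)(i-1)}\alpha\,\overline{\circ}_i\,\beta$ and $\alpha\,\overline{\circ}_i\,\beta$ inserts $\beta$ (applied to the $i$-th through $(i+m-1)$-st arguments; the element $\beta\in A$ itself if $m=0$) into the $i$-th slot of $\alpha$; $\alpha\,\overline{\circ}\,\beta=0$ if $n=0$. With these operations $HH^*(A)$ is a Gerstenhaber algebra. Batalin-Vilkovisky algebras: a Gerstenhaber algebra $(\mathcal{H}^*,\cup,[\ ,\ ])$ is a Batalin-Vilkovisky algebra if it has a linear operator $\Delta$ of degree $-1$ with $\Delta\circ\Delta=0$, $\Delta(1)=0$ and $[\alpha,\beta]=(-1)^{|\alpha|+1}\big(\Delta(\alpha\cup\beta)-\Delta(\alpha)\cup\beta-(-1)^{|\alpha|}\alpha\cup\Delta(\beta)\big)$ for all homogeneous $\alpha,\beta$. *)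

theory Defs
  imports
    "HOL-Library.Poly_Mapping"
    "HOL-Algebra.Algebraic_Closure_Type"
    "HOL-Algebra.QuotRing"
    "Graph_Theory.Arc_Walk"
    "Jordan_Normal_Form.Matrix"
begin

section \<open>Algebras over a field\<close>

text \<open>An associative unital algebra over the field \<open>'k\<close>, carried by the whole type \<open>'a\<close>.\<close>

locale k_algebra = vector_space scale
  for scale :: "'k::field \<Rightarrow> 'a::ring_1 \<Rightarrow> 'a" +
  assumes scale_mult_left: "scale c x * y = scale c (x * y)"
    and scale_mult_right: "x * scale c y = scale c (x * y)"

definition is_basis :: "('k::field \<Rightarrow> 'a::ab_group_add \<Rightarrow> 'a) \<Rightarrow> 'a set \<Rightarrow> 'a set \<Rightarrow> bool" where
  "is_basis scale M S \<longleftrightarrow>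
     S \<subseteq> M \<and> \<not> module.dependent scale S \<and> module.span scale S = M"

text \<open>Modules are right modules.\<close>

definition right_submodule :: "'a::ring_1 set \<Rightarrow> bool" where
  "right_submodule M \<longleftrightarrow>
     0 \<in> M \<and> (\<forall>x\<in>M. \<forall>y\<in>M. x + y \<in> M) \<and> (\<forall>x\<in>M. \<forall>a. x * a \<in> M)"

definition simple_submodule :: "'a::ring_1 set \<Rightarrow> bool" where
  "simple_submodule M \<longleftrightarrow> right_submodule M \<and> M \<noteq> {0} \<and>
     (\<forall>N. right_submodule N \<and> N \<subseteq> M \<longrightarrow> N = {0} \<or> N = M)"

text \<open>The socle of a submodule \<open>M\<close> of the regular module is the sum of its simple submodules,
  i.e. the submodule which they generate; \<open>socle UNIV\<close> is the socle of the algebra.\<close>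

definition socle :: "'a::ring_1 set \<Rightarrow> 'a set" where
  "socle M = right_submodule hull \<Union>{S. simple_submodule S \<and> S \<subseteq> M}"


section \<open>Frobenius algebras and the Nakayama automorphism\<close>

definition bilinear_form ::
    "('k::field \<Rightarrow> 'a::ab_group_add \<Rightarrow> 'a) \<Rightarrow> ('a \<Rightarrow> 'a \<Rightarrow> 'k) \<Rightarrow> bool" where
  "bilinear_form scale F \<longleftrightarrow>
     (\<forall>a. Vector_Spaces.linear scale (*) (\<lambda>b. F a b)) \<and>
     (\<forall>b. Vector_Spaces.linear scale (*) (\<lambda>a. F a b))"

definition nondegenerate :: "('a::zero \<Rightarrow> 'a \<Rightarrow> 'k::zero) \<Rightarrow> bool" where
  "nondegenerate F \<longleftrightarrow>
     (\<forall>a. (\<forall>b. F a b = 0) \<longrightarrow> a = 0) \<and> (\<forall>b. (\<forall>a. F a b = 0) \<longrightarrow> b = 0)"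

definition frobenius_algebra :: "('k::field \<Rightarrow> 'a::ring_1 \<Rightarrow> 'a) \<Rightarrow> bool" where
  "frobenius_algebra scale \<longleftrightarrow> k_algebra scale \<and>
     (\<exists>S. finite S \<and> is_basis scale UNIV S) \<and>
     (\<exists>F. bilinear_form scale F \<and> nondegenerate F \<and> (\<forall>a b c. F (a * b) c = F a (b * c)))"

definition algebra_automorphism :: "('k::field \<Rightarrow> 'a::ring_1 \<Rightarrow> 'a) \<Rightarrow> ('a \<Rightarrow> 'a) \<Rightarrow> bool" where
  "algebra_automorphism scale N \<longleftrightarrow>
     Vector_Spaces.linear scale scale N \<and> bij N \<and> N 1 = 1 \<and> (\<forall>a b. N (a * b) = N a * N b)"

definition nakayama_automorphism ::
    "('k::field \<Rightarrow> 'a::ring_1 \<Rightarrow> 'a) \<Rightarrow> ('a \<Rightarrow> 'a \<Rightarrow> 'k) \<Rightarrow> 'a \<Rightarrow> 'a" where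
  "nakayama_automorphism scale F =
     (THE N. algebra_automorphism scale N \<and> (\<forall>a b. F a b = F b (N a)))"

definition matrix_of ::
    "('k::field \<Rightarrow> 'a::ab_group_add \<Rightarrow> 'a) \<Rightarrow> 'a list \<Rightarrow> ('a \<Rightarrow> 'a) \<Rightarrow> 'k mat" where
  "matrix_of scale bs f =
     mat (length bs) (length bs)
       (\<lambda>(i, j). module.representation scale (set bs) (f (bs ! j)) (bs ! i))"

text \<open>The scalar extension of \<open>f\<close> to the algebraic closure is represented, in the basis \<open>bs\<close>,
  by the image of the matrix of \<open>f\<close> under the embedding \<open>to_ac\<close>.\<close>

definition semisimple_endomorphism ::
    "('k::field \<Rightarrow> 'a::ab_group_add \<Rightarrow> 'a) \<Rightarrow> ('a \<Rightarrow> 'a) \<Rightarrow> bool" where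
  "semisimple_endomorphism scale f \<longleftrightarrow> Vector_Spaces.linear scale scale f \<and>
     (\<exists>bs. distinct bs \<and> is_basis scale UNIV (set bs) \<and>
        (\<exists>D. diagonal_mat D \<and> similar_mat (map_mat to_ac (matrix_of scale bs f)) D))"


section \<open>Path algebras and admissible ideals\<close>

text \<open>A path is a pair of its source and its list of arrows, so that \<open>(v, [])\<close> is the trivial
  path at \<open>v\<close>. The product \<open>p \<cdot> q\<close> means first \<open>p\<close>, then \<open>q\<close>.\<close>

type_synonym ('v, 'e) qpath = "'v \<times> 'e list"

definition target :: "('v, 'e) pre_digraph \<Rightarrow> ('v, 'e) qpath \<Rightarrow> 'v" where
  "target Q p = pre_digraph.awlast Q (fst p) (snd p)"

definition paths :: "('v, 'e) pre_digraph \<Rightarrow> ('v, 'e) qpath set" where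
  "paths Q = {p. pre_digraph.awalk Q (fst p) (snd p) (target Q p)}"

definition path_mult :: "('v, 'e) pre_digraph \<Rightarrow> (('v, 'e) qpath \<Rightarrow>\<^sub>0 'k::field) \<Rightarrow>
    (('v, 'e) qpath \<Rightarrow>\<^sub>0 'k) \<Rightarrow> (('v, 'e) qpath \<Rightarrow>\<^sub>0 'k)" where
  "path_mult Q x y = (\<Sum>p\<in>Poly_Mapping.keys x. \<Sum>q\<in>Poly_Mapping.keys y.
     if target Q p = fst q
     then Poly_Mapping.single (fst p, snd p @ snd q) (Poly_Mapping.lookup x p * Poly_Mapping.lookup y q) else 0)"

definition path_algebra ::
    "('v, 'e) pre_digraph \<Rightarrow> ('k::field, ('v, 'e) qpath \<Rightarrow>\<^sub>0 'k) module" where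
  "path_algebra Q =
     \<lparr>carrier = {x. Poly_Mapping.keys x \<subseteq> paths Q},
      monoid.mult = path_mult Q,
      monoid.one = (\<Sum>v\<in>verts Q. Poly_Mapping.single (v, []) 1),
      ring.zero = 0,
      ring.add = (+),
      module.smult = (\<lambda>c. Poly_Mapping.map ((*) c))\<rparr>"

text \<open>The \<open>m\<close>-th power of the arrow ideal is spanned by the paths of length at least \<open>m\<close>.\<close>

definition arrow_ideal_power ::
    "('v, 'e) pre_digraph \<Rightarrow> nat \<Rightarrow> (('v, 'e) qpath \<Rightarrow>\<^sub>0 'k::field) set" where
  "arrow_ideal_power Q m = {x \<in> carrier (path_algebra Q). \<forall>p\<in>Poly_Mapping.keys x. m \<le> length (snd p)}"

definition admissible_ideal ::
    "('v, 'e) pre_digraph \<Rightarrow> (('v, 'e) qpath \<Rightarrow>\<^sub>0 'k::field) set \<Rightarrow> bool" where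
  "admissible_ideal Q I \<longleftrightarrow> ideal I (path_algebra Q) \<and>
     (\<exists>m\<ge>2. arrow_ideal_power Q m \<subseteq> I) \<and> I \<subseteq> arrow_ideal_power Q 2"

text \<open>The algebra on \<open>'a\<close> is identified with the quotient of the path algebra by \<open>I\<close> through a
  surjective homomorphism of algebras \<open>\<pi>\<close>, the quotient map, with kernel \<open>I\<close>.\<close>

definition path_algebra_quotient :: "('v, 'e) pre_digraph \<Rightarrow> (('v, 'e) qpath \<Rightarrow>\<^sub>0 'k::field) set \<Rightarrow>
    ('k \<Rightarrow> 'a::ring_1 \<Rightarrow> 'a) \<Rightarrow> ((('v, 'e) qpath \<Rightarrow>\<^sub>0 'k) \<Rightarrow> 'a) \<Rightarrow> bool" where
  "path_algebra_quotient Q I scale \<pi> \<longleftrightarrow>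
     \<pi> \<in> Ring.ring_hom (path_algebra Q) ring_of_type_algebra \<and>
     (\<forall>c. \<forall>x\<in>carrier (path_algebra Q). \<pi> (c \<odot>\<^bsub>path_algebra Q\<^esub> x) = scale c (\<pi> x)) \<and>
     \<pi> ` carrier (path_algebra Q) = UNIV \<and>
     a_kernel (path_algebra Q) ring_of_type_algebra \<pi> = I"

definition path_class ::
    "((('v, 'e) qpath \<Rightarrow>\<^sub>0 'k::field) \<Rightarrow> 'a) \<Rightarrow> ('v, 'e) qpath \<Rightarrow> 'a" where
  "path_class \<pi> p = \<pi> (Poly_Mapping.single p 1)"

text \<open>The indecomposable projective modules are the right ideals \<open>e\<^sub>v A\<close> for the vertices \<open>v\<close>.\<close>

definition indec_projective ::
    "((('v, 'e) qpath \<Rightarrow>\<^sub>0 'k::field) \<Rightarrow> 'a::ring_1) \<Rightarrow> 'v \<Rightarrow> 'a set" where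
  "indec_projective \<pi> v = range (\<lambda>a. path_class \<pi> (v, []) * a)"

definition path_basis :: "('v, 'e) pre_digraph \<Rightarrow> ('k::field \<Rightarrow> 'a::ring_1 \<Rightarrow> 'a) \<Rightarrow>
    ((('v, 'e) qpath \<Rightarrow>\<^sub>0 'k) \<Rightarrow> 'a) \<Rightarrow> 'a set \<Rightarrow> bool" where
  "path_basis Q scale \<pi> B \<longleftrightarrow> is_basis scale UNIV B \<and> B \<subseteq> path_class \<pi> ` paths Q \<and>
     (\<forall>v\<in>verts Q. \<exists>S\<subseteq>B. is_basis scale (socle (indec_projective \<pi> v)) S)"


section \<open>Gerstenhaber and Batalin-Vilkovisky algebras\<close>

definition with_sign :: "('h, 'b) ring_scheme \<Rightarrow> int \<Rightarrow> 'h \<Rightarrow> 'h" where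
  "with_sign H n x = (if even n then x else \<ominus>\<^bsub>H\<^esub> x)"

text \<open>\<open>gr n\<close> is the homogeneous component of degree \<open>n\<close>.\<close>

locale graded_vector_space =
  fixes K :: "('k, 'b) ring_scheme" and H :: "('k, 'h, 'c) module_scheme" (structure)
    and gr :: "int \<Rightarrow> 'h set"
  assumes vector_space: "field K" "Module.module K H"
    and component: "submodule (gr n) K H"
    and direct_sum: "x \<in> carrier H \<Longrightarrow>
      \<exists>!c. (\<forall>n. c n \<in> gr n) \<and> finite {n. c n \<noteq> \<zero>} \<and> x = finsum H c {n. c n \<noteq> \<zero>}"

locale gerstenhaber_algebra = graded_vector_space K H gr
  for K :: "('k, 'b) ring_scheme" and H :: "('k, 'h, 'c) module_scheme" (structure)
    and gr :: "int \<Rightarrow> 'h set" +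
  fixes br :: "'h \<Rightarrow> 'h \<Rightarrow> 'h"
  assumes unital_associative: "Ring.ring H"
    and smult_mult: "\<lbrakk>c \<in> carrier K; x \<in> carrier H; y \<in> carrier H\<rbrakk> \<Longrightarrow>
      (c \<odot> x) \<otimes> y = c \<odot> (x \<otimes> y) \<and> x \<otimes> (c \<odot> y) = c \<odot> (x \<otimes> y)"
    and one_deg: "\<one> \<in> gr 0"
    and mult_deg: "\<lbrakk>x \<in> gr p; y \<in> gr q\<rbrakk> \<Longrightarrow> x \<otimes> y \<in> gr (p + q)"
    and graded_commutative: "\<lbrakk>x \<in> gr p; y \<in> gr q\<rbrakk> \<Longrightarrow> x \<otimes> y = with_sign H (p * q) (y \<otimes> x)"
    and br_closed: "\<lbrakk>x \<in> carrier H; y \<in> carrier H\<rbrakk> \<Longrightarrow> br x y \<in> carrier H"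
    and br_add: "\<lbrakk>x \<in> carrier H; y \<in> carrier H; z \<in> carrier H\<rbrakk> \<Longrightarrow>
      br (x \<oplus> y) z = br x z \<oplus> br y z \<and> br z (x \<oplus> y) = br z x \<oplus> br z y"
    and br_smult: "\<lbrakk>c \<in> carrier K; x \<in> carrier H; y \<in> carrier H\<rbrakk> \<Longrightarrow>
      br (c \<odot> x) y = c \<odot> br x y \<and> br x (c \<odot> y) = c \<odot> br x y"
    and br_deg: "\<lbrakk>x \<in> gr p; y \<in> gr q\<rbrakk> \<Longrightarrow> br x y \<in> gr (p + q - 1)"
    and br_antisymmetric: "\<lbrakk>x \<in> gr p; y \<in> gr q\<rbrakk> \<Longrightarrow>
      br x y = \<ominus> with_sign H ((p - 1) * (q - 1)) (br y x)"
    and br_jacobi: "\<lbrakk>x \<in> gr p; y \<in> gr q; z \<in> gr r\<rbrakk> \<Longrightarrow>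
      with_sign H ((p - 1) * (r - 1)) (br (br x y) z) \<oplus>
      with_sign H ((q - 1) * (p - 1)) (br (br y z) x) \<oplus>
      with_sign H ((r - 1) * (q - 1)) (br (br z x) y) = \<zero>"
    and br_poisson: "\<lbrakk>x \<in> gr p; y \<in> gr q; z \<in> gr r\<rbrakk> \<Longrightarrow>
      br x (y \<otimes> z) = br x y \<otimes> z \<oplus> with_sign H ((p - 1) * q) (y \<otimes> br x z)"

locale bv_operator = gerstenhaber_algebra K H gr br
  for K :: "('k, 'b) ring_scheme" and H :: "('k, 'h, 'c) module_scheme" (structure)
    and gr :: "int \<Rightarrow> 'h set" and br :: "'h \<Rightarrow> 'h \<Rightarrow> 'h" +
  fixes \<Delta> :: "'h \<Rightarrow> 'h"
  assumes \<Delta>_closed: "x \<in> carrier H \<Longrightarrow> \<Delta> x \<in> carrier H"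
    and \<Delta>_add: "\<lbrakk>x \<in> carrier H; y \<in> carrier H\<rbrakk> \<Longrightarrow> \<Delta> (x \<oplus> y) = \<Delta> x \<oplus> \<Delta> y"
    and \<Delta>_smult: "\<lbrakk>c \<in> carrier K; x \<in> carrier H\<rbrakk> \<Longrightarrow> \<Delta> (c \<odot> x) = c \<odot> \<Delta> x"
    and \<Delta>_deg: "x \<in> gr p \<Longrightarrow> \<Delta> x \<in> gr (p - 1)"
    and \<Delta>_\<Delta>: "x \<in> carrier H \<Longrightarrow> \<Delta> (\<Delta> x) = \<zero>"
    and \<Delta>_one: "\<Delta> \<one> = \<zero>"
    and br_eq: "\<lbrakk>x \<in> gr p; y \<in> gr q\<rbrakk> \<Longrightarrow>
      br x y = with_sign H (p + 1) (\<Delta> (x \<otimes> y) \<ominus> \<Delta> x \<otimes> y \<ominus> with_sign H p (x \<otimes> \<Delta> y))"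

definition batalin_vilkovisky_algebra :: "('k, 'b) ring_scheme \<Rightarrow> ('k, 'h, 'c) module_scheme \<Rightarrow>
    (int \<Rightarrow> 'h set) \<Rightarrow> ('h \<Rightarrow> 'h \<Rightarrow> 'h) \<Rightarrow> bool" where
  "batalin_vilkovisky_algebra K H gr br \<longleftrightarrow>
     gerstenhaber_algebra K H gr br \<and> (\<exists>\<Delta>. bv_operator K H gr br \<Delta>)"


section \<open>Hochschild cohomology\<close>

text \<open>An element of \<open>C\<^sup>r(A,A)\<close> is a linear map on the \<open>r\<close>-fold tensor power of \<open>A\<close> modulo
  \<open>k \<cdot> 1\<close>, that is, an \<open>r\<close>-linear map on \<open>A\<close> that vanishes as soon as one argument lies in
  \<open>k \<cdot> 1\<close>. It is encoded as a function on all lists that is zero on the lists of length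
  different from \<open>r\<close>. Thereby the total complex, the direct sum of the \<open>C\<^sup>r(A,A)\<close>, is a set of
  functions on lists, too.\<close>

type_synonym 'a cochain = "'a list \<Rightarrow> 'a"

definition cochains :: "('k::field \<Rightarrow> 'a::ring_1 \<Rightarrow> 'a) \<Rightarrow> nat \<Rightarrow> 'a cochain set" where
  "cochains scale r = {f.
     (\<forall>as. length as \<noteq> r \<longrightarrow> f as = 0) \<and>
     (\<forall>us vs. length us + 1 + length vs = r \<longrightarrow>
        Vector_Spaces.linear scale scale (\<lambda>a. f (us @ [a] @ vs)) \<and>
        (\<forall>c. f (us @ [scale c 1] @ vs) = 0))}"

definition total_cochains :: "('k::field \<Rightarrow> 'a::ring_1 \<Rightarrow> 'a) \<Rightarrow> 'a cochain set" where
  "total_cochains scale = {f.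
     (\<forall>r. (\<lambda>as. if length as = r then f as else 0) \<in> cochains scale r) \<and>
     (\<exists>N. \<forall>as. length as > N \<longrightarrow> f as = 0)}"

text \<open>On \<open>[a\<^sub>1, \<dots>, a\<^sub>n]\<close> with \<open>n = r + 1\<close> this is \<open>b\<^sup>r\<close>; note that \<open>as ! (i - 1)\<close> is
  \<open>a\<^sub>i\<close>.\<close>

definition hochschild_differential :: "'a::ring_1 cochain \<Rightarrow> 'a cochain" where
  "hochschild_differential f as = (let n = length as in
     if n = 0 then 0
     else (-1) ^ n * (hd as * f (tl as))
        + (\<Sum>i = 1..n - 1. (-1) ^ (n - i)
             * f (take (i - 1) as @ [as ! (i - 1) * as ! i] @ drop (i + 1) as))
        + f (butlast as) * last as)"

text \<open>The cup product of cochains of degrees \<open>p\<close> and \<open>q\<close>, and its bilinear extension to the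
  total complex.\<close>

definition hom_cup :: "nat \<Rightarrow> nat \<Rightarrow> 'a::ring_1 cochain \<Rightarrow> 'a cochain \<Rightarrow> 'a cochain" where
  "hom_cup p q \<alpha> \<beta> as =
     (if length as = p + q then (-1) ^ (p * q) * (\<alpha> (take p as) * \<beta> (drop p as)) else 0)"

definition cup :: "'a::ring_1 cochain \<Rightarrow> 'a cochain \<Rightarrow> 'a cochain" where
  "cup \<alpha> \<beta> as = (\<Sum>p\<le>length as. hom_cup p (length as - p) \<alpha> \<beta> as)"

definition sgn_pow :: "int \<Rightarrow> 'a::ring_1" where
  "sgn_pow n = (if even n then 1 else -1)"

text \<open>The circle product and the bracket of cochains of degrees \<open>n\<close> and \<open>m\<close>, and the bilinear
  extension of the bracket to the total complex.\<close>

definition insert_at :: "nat \<Rightarrow> nat \<Rightarrow> 'a cochain \<Rightarrow> 'a cochain \<Rightarrow> 'a cochain" where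
  "insert_at m i \<alpha> \<beta> as =
     \<alpha> (take (i - 1) as @ [\<beta> (take m (drop (i - 1) as))] @ drop (i - 1 + m) as)"

definition hom_circ :: "nat \<Rightarrow> nat \<Rightarrow> 'a::ring_1 cochain \<Rightarrow> 'a cochain \<Rightarrow> 'a cochain" where
  "hom_circ n m \<alpha> \<beta> as =
     (if length as + 1 = n + m
      then \<Sum>i = 1..n. sgn_pow ((int m - 1) * (int i - 1)) * insert_at m i \<alpha> \<beta> as else 0)"

definition hom_bracket :: "nat \<Rightarrow> nat \<Rightarrow> 'a::ring_1 cochain \<Rightarrow> 'a cochain \<Rightarrow> 'a cochain" where
  "hom_bracket n m \<alpha> \<beta> as =
     hom_circ n m \<alpha> \<beta> as - sgn_pow ((int n - 1) * (int m - 1)) * hom_circ m n \<beta> \<alpha> as"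

definition bracket :: "'a::ring_1 cochain \<Rightarrow> 'a cochain \<Rightarrow> 'a cochain" where
  "bracket \<alpha> \<beta> as = (\<Sum>n\<le>length as + 1. hom_bracket n (length as + 1 - n) \<alpha> \<beta> as)"

definition cocycles :: "('k::field \<Rightarrow> 'a::ring_1 \<Rightarrow> 'a) \<Rightarrow> 'a cochain set" where
  "cocycles scale = {f \<in> total_cochains scale. hochschild_differential f = (\<lambda>_. 0)}"

definition coboundaries :: "('k::field \<Rightarrow> 'a::ring_1 \<Rightarrow> 'a) \<Rightarrow> 'a cochain set" where
  "coboundaries scale = hochschild_differential ` total_cochains scale"

definition coh_class ::
    "('k::field \<Rightarrow> 'a::ring_1 \<Rightarrow> 'a) \<Rightarrow> 'a cochain \<Rightarrow> 'a cochain set" where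
  "coh_class scale f = {\<lambda>as. f as + h as | h. h \<in> coboundaries scale}"

text \<open>The unions below range over the representatives of the classes; all of their members are the
  same coset, since the operations descend to cohomology.\<close>

definition HH :: "('k::field \<Rightarrow> 'a::ring_1 \<Rightarrow> 'a) \<Rightarrow> ('k, 'a cochain set) module" where
  "HH scale =
     \<lparr>carrier = coh_class scale ` cocycles scale,
      monoid.mult = (\<lambda>\<xi> \<eta>. \<Union>f\<in>\<xi>. \<Union>g\<in>\<eta>. coh_class scale (cup f g)),
      monoid.one = coh_class scale (\<lambda>as. if as = [] then 1 else 0),
      ring.zero = coh_class scale (\<lambda>_. 0),
      ring.add = (\<lambda>\<xi> \<eta>. \<Union>f\<in>\<xi>. \<Union>g\<in>\<eta>. coh_class scale (\<lambda>as. f as + g as)),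
      module.smult = (\<lambda>c \<xi>. \<Union>f\<in>\<xi>. coh_class scale (\<lambda>as. scale c (f as)))\<rparr>"

definition HH_bracket :: "('k::field \<Rightarrow> 'a::ring_1 \<Rightarrow> 'a) \<Rightarrow>
    'a cochain set \<Rightarrow> 'a cochain set \<Rightarrow> 'a cochain set" where
  "HH_bracket scale \<xi> \<eta> = (\<Union>f\<in>\<xi>. \<Union>g\<in>\<eta>. coh_class scale (bracket f g))"

definition HH_deg ::
    "('k::field \<Rightarrow> 'a::ring_1 \<Rightarrow> 'a) \<Rightarrow> int \<Rightarrow> 'a cochain set set" where
  "HH_deg scale n =
     (if n < 0 then {\<zero>\<^bsub>HH scale\<^esub>}
      else coh_class scale ` (cocycles scale \<inter> cochains scale (nat n)))"

end

(* The Frobenius form identifies A with its dual, which turns Connes' operator into an operator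
   Delta on Hochschild cochains that commutes with the differential up to 1 - T, where T is
   conjugation of cochains by the Nakayama automorphism N. If some power N^m is diagonal in a basis
   and m is invertible in k, then every cochain is the sum of a T-invariant one and one in the image
   of 1 - T, so that cohomology classes have T-invariant representatives, and on these Delta is a
   Batalin-Vilkovisky operator.

   For a monomial basis B of paths, N permutes B up to scalars, since N p is a multiple of p**.
   It maps trivial paths to trivial paths and permutes the arrows, so with n arrows N^(n!) is diagonal
   in B, and n! is invertible by the assumption on the characteristic. *)

theory Submission
  imports Defs "HOL-Library.Function_Algebras" "Jordan_Normal_Form.Determinant"
begin

section \<open>Sums over decompositions of lists\<close>

text \<open>For the Batalin-Vilkovisky relation, Delta of a cup product is a sum over rotations of
  the argument list, and the seam of a rotation falls into the arguments of one of the two factors.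
  Each of the two partial sums (\<open>zeta\<close>) is homotopic to a circle product plus a product
  with one Delta; the two circle products make up the bracket.

  The invertibility of m acts twice by one mechanism: if (U - c) v = u and U u = c u, then U^m v =
  c^m v + m c^(m-1) u. So an invertible diagonal m-th power excludes Jordan blocks, and for T with c
  = 1 it separates the kernel of 1 - T from its image.

  The map from p to p** permutes B only if different paths have different duals, which the
  uniqueness of the dual of each path does not say by itself. The abstract Frobenius form supplies
  it: socle elements with the same end vertex are proportional.

  Cochains may be inhomogeneous. All operations are therefore sums over decompositions of the
  argument list, with signs read off from the lengths of the pieces.\<close>

definition sg :: "nat \<Rightarrow> 'm::ab_group_add \<Rightarrow> 'm" where
  "sg n x = (if even n then x else - x)"

lemma sg_sg [simp]: "sg m (sg n x) = sg (m + n) x"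
  by (simp add: sg_def)

lemma sg_zero [simp]: "sg n 0 = 0"
  by (simp add: sg_def)

lemma sg_add: "sg n (x + y) = sg n x + sg n y"
  by (simp add: sg_def)

lemma sg_diff: "sg n (x - y) = sg n x - sg n y"
  by (simp add: sg_def)

lemma sg_uminus: "sg n (- x) = - sg n x"
  by (simp add: sg_def)

lemma sg_Suc: "sg (Suc n) x = - sg n x"
  by (simp add: sg_def)

lemma sg_nat_0 [simp]: "sg 0 x = x"
  by (simp add: sg_def)

lemma sg_cong: "even m = even n \<Longrightarrow> sg m x = sg n x"
  by (simp add: sg_def)

lemma sg_mult_left: "sg n x * y = sg n (x * y :: 'm::ring)"
  by (simp add: sg_def)

lemma sg_mult_right: "x * sg n y = sg n (x * y :: 'm::ring)"
  by (simp add: sg_def)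

lemma minus_one_power_mult: "(-1) ^ n * x = sg n (x :: 'm::ring_1)"
  by (simp add: sg_def)

lemma sg_eq_iff: "sg n x = sg n y \<longleftrightarrow> x = y"
  by (simp add: sg_def)

text \<open>Summation over deconcatenation: all cuts \<open>u @ v\<close> of the list. The recursion
  moves the first letter into the summand, so identities follow by induction over the list with
  \<open>F\<close> arbitrary.\<close>

fun spl :: "('a list \<Rightarrow> 'a list \<Rightarrow> 'm::ab_group_add) \<Rightarrow> 'a list \<Rightarrow> 'm" where
  "spl F [] = F [] []"
| "spl F (a # as) = F [] (a # as) + spl (\<lambda>u. F (a # u)) as"

text \<open>A sum over the positions of one marked letter, the common value of the two sides of
  \<open>spl_shift\<close>.\<close>

fun pos :: "('a list \<Rightarrow> 'a \<Rightarrow> 'a list \<Rightarrow> 'm::ab_group_add) \<Rightarrow> 'a list \<Rightarrow> 'm" where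
  "pos F [] = 0"
| "pos F (a # as) = F [] a as + pos (\<lambda>u. F (a # u)) as"

text \<open>The bar differential.\<close>

fun mrg :: "('a::times list \<Rightarrow> 'm::ab_group_add) \<Rightarrow> 'a list \<Rightarrow> 'm" where
  "mrg F [] = 0"
| "mrg F [a] = 0"
| "mrg F (a # b # as) = F (a * b # as) - mrg (\<lambda>v. F (a # v)) (b # as)"

lemma spl_cong: "(\<And>u v. u @ v = as \<Longrightarrow> F u v = G u v) \<Longrightarrow> spl F as = spl G as"
proof (induction as arbitrary: F G)
  case (Cons a as)
  have "spl (\<lambda>u. F (a # u)) as = spl (\<lambda>u. G (a # u)) as"
    by (rule Cons.IH) (simp add: Cons.prems)
  then show ?case using Cons.prems[of "[]"] by simp
qed simp

lemma spl_zero [simp]: "spl (\<lambda>u v. 0) as = 0"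
  by (induction as) auto

lemma spl_add: "spl (\<lambda>u v. F u v + G u v) as = spl F as + spl G as"
  by (induction as arbitrary: F G) (auto simp: algebra_simps)

lemma spl_uminus: "spl (\<lambda>u v. - F u v) as = - spl F as"
  by (induction as arbitrary: F) (auto simp: algebra_simps)

lemma spl_diff: "spl (\<lambda>u v. F u v - G u v) as = spl F as - spl G as"
  by (induction as arbitrary: F G) (auto simp: algebra_simps)

lemma spl_sg: "spl (\<lambda>u v. sg n (F u v)) as = sg n (spl F as)"
  by (simp add: sg_def spl_uminus)

lemma additive_spl:
  assumes "\<And>x y. h (x + y) = h x + (h y :: 'n::ab_group_add)"
  shows "h (spl F as) = spl (\<lambda>u v. h (F u v)) as"
  by (induction as arbitrary: F) (auto simp: assms)

lemma spl_Nil_left: "spl (\<lambda>u v. if u = [] then F u v else 0) as = F [] as"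
  by (cases as) auto

lemma spl_Nil_right: "spl (\<lambda>u v. if v = [] then F u v else 0) as = F as []"
  by (induction as arbitrary: F) auto

text \<open>Coassociativity of deconcatenation: each side runs over the cuts into three
  pieces.\<close>

lemma spl_assoc:
  "spl (\<lambda>u v. spl (F u) v) as = spl (\<lambda>p y. spl (\<lambda>u x. F u x y) p) as"
proof (induction as arbitrary: F)
  case (Cons a as)
  have "spl (\<lambda>u v. spl (F u) v) (a # as)
      = F [] [] (a # as) + (spl (\<lambda>u. F [] (a # u)) as + spl (\<lambda>u v. spl (F (a # u)) v) as)"
    by (simp add: algebra_simps)
  also have "\<dots> = spl (\<lambda>p y. spl (\<lambda>u x. F u x y) p) (a # as)"
    by (simp add: Cons.IH spl_add)
  finally show ?case .
qed auto

lemma spl_append_Cons: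
  "spl F (us @ a # vs) = spl (\<lambda>x y. F x (y @ a # vs)) us + spl (\<lambda>x y. F (us @ a # x) y) vs"
  by (induction us arbitrary: F) (auto simp: algebra_simps)

lemma spl_map: "spl F (map h as) = spl (\<lambda>u v. F (map h u) (map h v)) as"
  by (induction as arbitrary: F) auto

lemma spl_sum: "spl F as = (\<Sum>i\<le>length as. F (take i as) (drop i as))"
proof (induction as arbitrary: F)
  case (Cons a as)
  show ?case
    unfolding length_Cons by (subst sum.atMost_Suc_shift) (simp add: Cons.IH)
qed auto

lemma spl_pos_left: "spl (\<lambda>u v. if u = [] then 0 else F (butlast u) (last u) v) as = pos F as"
proof (induction as arbitrary: F)
  case (Cons a as)
  have "spl (\<lambda>u v. if a # u = [] then 0 else F (butlast (a # u)) (last (a # u)) v) as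
    = spl (\<lambda>u v. (if u = [] then F [] a v else 0) +
        (if u = [] then 0 else F (a # butlast u) (last u) v)) as"
    by (rule spl_cong) auto
  then show ?case
    using Cons.IH[of "\<lambda>u. F (a # u)"] by (simp add: spl_add spl_Nil_left)
qed auto

lemma spl_pos_right: "spl (\<lambda>u v. if v = [] then 0 else F u (hd v) (tl v)) as = pos F as"
  by (induction as arbitrary: F) auto

text \<open>The cancellation device of the development. A cut with a distinguished letter just
  before it and a cut with a distinguished letter just after it are both a marked letter, so a
  letter can be carried across the cut. In this way a product of a value with a neighbouring letter
  is recognised on both sides of an identity.\<close>

lemma spl_shift:
  "spl (\<lambda>u v. if u = [] then 0 else F (butlast u) (last u) v) as
     = spl (\<lambda>u v. if v = [] then 0 else F u (hd v) (tl v)) as"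
  by (simp add: spl_pos_left spl_pos_right)

lemma mrg_cong: "(\<And>u. Suc (length u) = length as \<Longrightarrow> F u = G u) \<Longrightarrow> mrg F as = mrg G as"
proof (induction as arbitrary: F G)
  case (Cons a as)
  show ?case
  proof (cases as)
    case (Cons b bs)
    have "mrg (\<lambda>v. F (a # v)) as = mrg (\<lambda>v. G (a # v)) as"
      by (rule Cons.IH) (simp add: Cons.prems)
    then show ?thesis using Cons.prems[of "a * b # bs"] Cons by simp
  qed simp
qed simp

lemma mrg_zero [simp]: "mrg (\<lambda>v. 0) as = 0"
proof (induction as)
  case (Cons a as)
  then show ?case by (cases as) simp_all
qed simp

lemma mrg_add: "mrg (\<lambda>v. F v + G v) as = mrg F as + mrg G as"
proof (induction as arbitrary: F G)
  case (Cons a as)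
  then show ?case by (cases as) (simp_all add: algebra_simps)
qed simp

lemma mrg_uminus: "mrg (\<lambda>v. - F v) as = - mrg F as"
proof (induction as arbitrary: F)
  case (Cons a as)
  then show ?case by (cases as) (simp_all add: algebra_simps)
qed simp

lemma mrg_diff: "mrg (\<lambda>v. F v - G v) as = mrg F as - mrg G as"
proof (induction as arbitrary: F G)
  case (Cons a as)
  then show ?case by (cases as) (simp_all add: algebra_simps)
qed simp

lemma mrg_sg: "mrg (\<lambda>v. sg n (F v)) as = sg n (mrg F as)"
  by (simp add: sg_def mrg_uminus)

lemma mrg_sg_length:
  assumes "\<And>u. length as = Suc (length u) \<Longrightarrow> even (h u) = even k"
  shows "mrg (\<lambda>v. sg (h v) (F v)) as = sg k (mrg F as)"
  unfolding mrg_sg[symmetric] by (rule mrg_cong) (auto intro!: sg_cong assms)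

lemma additive_mrg:
  assumes "\<And>x y. h (x + y) = h x + (h y :: 'n::ab_group_add)"
  shows "h (mrg F as) = mrg (\<lambda>u. h (F u)) as"
proof -
  have "h 0 = 0" using assms[of 0 0] by simp
  moreover from this have "h (x - y) = h x - h y" for x y
    using assms[of "x - y" y] by simp
  ultimately show ?thesis
  proof (induction as arbitrary: F)
    case (Cons a as)
    then show ?case by (cases as) simp_all
  qed simp
qed

lemma mrg_map:
  assumes "\<And>x y. h (x * y) = h x * h y"
  shows "mrg F (map h as) = mrg (\<lambda>u. F (map h u)) as"
proof (induction as arbitrary: F)
  case (Cons a as)
  then show ?case by (cases as) (simp_all add: assms)
qed simp

text \<open>A cut never separates two letters that have been merged, so it comes from a cut of the
  original list with the merge on one side. A merge in the right piece happens
  \<open>length u\<close> places later, whence the sign.\<close>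

lemma mrg_spl:
  "mrg (spl F) as = spl (\<lambda>u v. mrg (\<lambda>x. F x v) u + sg (length u) (mrg (F u) v)) as"
proof (induction as arbitrary: F)
  case (Cons a as)
  show ?case
  proof (cases as)
    case Nil
    then show ?thesis by simp
  next
    case (Cons b bs)
    have "mrg (spl (\<lambda>u. F (a # u))) (b # bs)
      = spl (\<lambda>u v. mrg (\<lambda>x. F (a # x) v) u + sg (length u) (mrg (F (a # u)) v)) (b # bs)"
      using Cons.IH[of "\<lambda>u. F (a # u)"] Cons by simp
    then show ?thesis unfolding Cons
      by (simp add: sg_Suc mrg_add spl_add spl_diff spl_uminus algebra_simps)
  qed
qed simp

text \<open>The merges before, across and after the junction. The junction sits at position
  \<open>length u - 1\<close>, counted from zero, which accounts for the minus sign.\<close>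

lemma mrg_append:
  "mrg F (u @ v) = mrg (\<lambda>x. F (x @ v)) u
     - (if u = [] \<or> v = [] then 0 else sg (length u) (F (butlast u @ [last u * hd v] @ tl v)))
     + sg (length u) (mrg (\<lambda>y. F (u @ y)) v)"
proof (induction u arbitrary: F)
  case (Cons a u)
  show ?case
  proof (cases u)
    case Nil
    then show ?thesis by (cases v) (auto simp: sg_def)
  next
    case (Cons b u')
    then show ?thesis
      using Cons.IH[of "\<lambda>x. F (a # x)"] by (auto simp: sg_Suc algebra_simps)
  qed
qed auto

lemma mrg_spl_commute: "mrg (\<lambda>x. spl (G x) y) u = spl (\<lambda>v w. mrg (\<lambda>x. G x v w) u) y"
  by (induction y arbitrary: G) (auto simp: mrg_add)

lemmas spl_add_fun = ext[OF spl_add] and spl_diff_fun = ext[OF spl_diff]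
  and spl_uminus_fun = ext[OF spl_uminus] and spl_sg_fun = ext[OF spl_sg]

definition S3 :: "('a list \<Rightarrow> 'a list \<Rightarrow> 'a list \<Rightarrow> 'm::ab_group_add) \<Rightarrow> 'a list \<Rightarrow> 'm" where
  "S3 F as = spl (\<lambda>u. spl (F u)) as"

lemma S3_assoc: "S3 F as = spl (\<lambda>p w. spl (\<lambda>u v. F u v w) p) as"
  unfolding S3_def by (rule spl_assoc)

lemma S3_cong: "(\<And>u v w. u @ v @ w = as \<Longrightarrow> F u v w = G u v w) \<Longrightarrow> S3 F as = S3 G as"
  unfolding S3_def by (intro spl_cong) auto

lemma S3_add: "S3 (\<lambda>u v w. F u v w + G u v w) as = S3 F as + S3 G as"
  by (simp add: S3_def spl_add spl_add_fun)

lemma S3_diff: "S3 (\<lambda>u v w. F u v w - G u v w) as = S3 F as - S3 G as"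
  by (simp add: S3_def spl_diff spl_diff_fun)

lemma S3_uminus: "S3 (\<lambda>u v w. - F u v w) as = - S3 F as"
  by (simp add: S3_def spl_uminus spl_uminus_fun)

lemma S3_sg: "S3 (\<lambda>u v w. sg n (F u v w)) as = sg n (S3 F as)"
  by (simp add: S3_def spl_sg spl_sg_fun)

lemma S3_Cons: "S3 F (a # as) = spl (F []) (a # as) + S3 (\<lambda>u. F (a # u)) as"
  by (simp add: S3_def)

lemma S3_Nil: "S3 F [] = F [] [] []"
  by (simp add: S3_def)

lemma spl_snoc: "spl F (as @ [z]) = spl (\<lambda>u v. F u (v @ [z])) as + F (as @ [z]) []"
  by (simp add: spl_append_Cons)

lemma S3_snoc: "S3 F (as @ [z]) = S3 (\<lambda>u v w. F u v (w @ [z])) as + spl (\<lambda>u v. F u v []) (as @ [z])"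
  by (simp add: S3_assoc spl_snoc)

lemma mrg_S3:
  "mrg (S3 F) as = S3 (\<lambda>u v w. mrg (\<lambda>x. F x v w) u + sg (length u) (mrg (\<lambda>x. F u x w) v)
      + sg (length u + length v) (mrg (F u v) w)) as"
  unfolding S3_def mrg_spl[of "\<lambda>u. spl (F u)"]
  by (rule spl_cong)
    (simp only: mrg_spl_commute mrg_spl spl_sg[symmetric] spl_add[symmetric] sg_add sg_sg add.assoc)

lemma S3_shift_left:
  "S3 (\<lambda>u v w. if u = [] then 0 else F (butlast u) (last u) v w) as
     = S3 (\<lambda>u v w. if v = [] then 0 else F u (hd v) (tl v) w) as"
  unfolding S3_assoc by (intro spl_cong spl_shift)

lemma S3_shift_right:
  "S3 (\<lambda>u v w. if v = [] then 0 else F u (butlast v) (last v) w) as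
     = S3 (\<lambda>u v w. if w = [] then 0 else F u v (hd w) (tl w)) as"
  unfolding S3_def by (intro spl_cong spl_shift)

definition slot_additive :: "('a::plus list \<Rightarrow> 'm::plus) \<Rightarrow> bool" where
  "slot_additive \<Phi> \<longleftrightarrow> (\<forall>us vs a b. \<Phi> (us @ (a + b) # vs) = \<Phi> (us @ a # vs) + \<Phi> (us @ b # vs))"

lemma slot_additiveD:
  fixes \<Phi> :: "'a::ab_group_add list \<Rightarrow> 'm::ab_group_add"
  assumes "slot_additive \<Phi>"
  shows "\<Phi> (us @ (a + b) # vs) = \<Phi> (us @ a # vs) + \<Phi> (us @ b # vs)"
    and "\<Phi> (us @ 0 # vs) = 0"
    and "\<Phi> (us @ (- a) # vs) = - \<Phi> (us @ a # vs)"
    and "\<Phi> (us @ (a - b) # vs) = \<Phi> (us @ a # vs) - \<Phi> (us @ b # vs)"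
    and "\<Phi> (us @ sg n a # vs) = sg n (\<Phi> (us @ a # vs))"
proof -
  show add: "\<Phi> (us @ (a + b) # vs) = \<Phi> (us @ a # vs) + \<Phi> (us @ b # vs)" for a b
    using assms by (simp add: slot_additive_def)
  show zero: "\<Phi> (us @ 0 # vs) = 0"
    using add[of 0 0] by simp
  show minus: "\<Phi> (us @ (- a) # vs) = - \<Phi> (us @ a # vs)" for a
    using add[of a "- a"] zero by (simp add: add_eq_0_iff)
  show "\<Phi> (us @ (a - b) # vs) = \<Phi> (us @ a # vs) - \<Phi> (us @ b # vs)"
    using add[of a "- b"] minus[of b] by simp
  show "\<Phi> (us @ sg n a # vs) = sg n (\<Phi> (us @ a # vs))"
    by (simp add: sg_def minus)
qed

section \<open>Hochschild differential, cup products and insertions\<close>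

definition lft :: "('a::ring_1 list \<Rightarrow> 'a) \<Rightarrow> 'a list \<Rightarrow> 'a" where
  "lft f as = (if as = [] then 0 else hd as * f (tl as))"

definition rgt :: "('a::ring_1 list \<Rightarrow> 'a) \<Rightarrow> 'a list \<Rightarrow> 'a" where
  "rgt f as = (if as = [] then 0 else f (butlast as) * last as)"

text \<open>The Hochschild differential in the convention where the left outer term carries no sign.
  The given one differs by (-1)^n on lists of length n, see
  \<open>hochschild_differential_eq\<close>.\<close>

definition diff :: "('a::ring_1 list \<Rightarrow> 'a) \<Rightarrow> 'a list \<Rightarrow> 'a" where
  "diff f as = lft f as - mrg f as + sg (length as) (rgt f as)"

text \<open>The Koszul sign of \<open>g\<close> in the shifted degree, which governs insertions;
  \<open>eps\<close> is the unshifted sign, which governs cup products.\<close>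

definition hat :: "('a list \<Rightarrow> 'm::ab_group_add) \<Rightarrow> 'a list \<Rightarrow> 'm" where
  "hat g v = sg (Suc (length v)) (g v)"

definition eps :: "('a list \<Rightarrow> 'm::ab_group_add) \<Rightarrow> 'a list \<Rightarrow> 'm" where
  "eps g v = sg (length v) (g v)"

text \<open>Gerstenhaber's circle product of \<Phi> with \<open>g\<close>. The values of \<Phi> may
  lie in any abelian group, so the same identities serve cochains with values in the algebra and
  scalar forms.\<close>

definition ins :: "('a list \<Rightarrow> 'a) \<Rightarrow> ('a list \<Rightarrow> 'm::ab_group_add) \<Rightarrow> 'a list \<Rightarrow> 'm" where
  "ins g \<Phi> = S3 (\<lambda>u v w. sg (length u * Suc (length v)) (\<Phi> (u @ g v # w)))"

definition cat :: "('a::ring_1 list \<Rightarrow> 'a) \<Rightarrow> ('a list \<Rightarrow> 'a) \<Rightarrow> 'a list \<Rightarrow> 'a" where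
  "cat f g = spl (\<lambda>u v. f u * g v)"

definition cp :: "('a::ring_1 list \<Rightarrow> 'a) \<Rightarrow> ('a list \<Rightarrow> 'a) \<Rightarrow> 'a list \<Rightarrow> 'a" where
  "cp f g = spl (\<lambda>u v. sg (length u * length v) (f u * g v))"

lemma lft_simps [simp]: "lft f [] = 0" "lft f (a # as) = a * f as"
  by (simp_all add: lft_def)

lemma rgt_simps [simp]: "rgt f [] = 0" "rgt f (as @ [z]) = f as * z"
  by (simp_all add: rgt_def)

lemma mrg_append_Cons:
  "mrg \<Phi> (u @ c # w) = mrg (\<lambda>x. \<Phi> (x @ c # w)) u
     - (if u = [] then 0 else sg (length u) (\<Phi> (butlast u @ (last u * c) # w)))
     + (if w = [] then 0 else sg (length u) (\<Phi> (u @ (c * hd w) # tl w)))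
     - sg (length u) (mrg (\<lambda>y. \<Phi> (u @ c # y)) w)"
  by (cases w) (auto simp: mrg_append sg_diff)

lemma mrg_diff_eq: "mrg g v = lft g v + sg (length v) (rgt g v) - diff g v"
  by (simp add: diff_def)

text \<open>On the left, merges take place before, inside or after the block \<open>v\<close>; on
  the right also between \<open>g v\<close> and its neighbours. These come from the outer terms in
  \<open>mrg_diff_eq\<close> for \<open>mrg g v\<close>, once the neighbouring letter is carried
  across the cut.\<close>

lemma mrg_ins:
  fixes \<Phi> :: "'a::ring_1 list \<Rightarrow> 'm::ab_group_add"
  assumes "slot_additive \<Phi>"
  shows "mrg (ins g \<Phi>) as = ins (hat g) (mrg \<Phi>) as - ins (diff g) \<Phi> as"
proof -
  note add = slot_additiveD[OF assms]
  have add0: "\<Phi> (- c # w) = - \<Phi> (c # w)" for c w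
    using add(3)[of "[]"] by simp
  have add1: "\<Phi> (u @ b # - c # w) = - \<Phi> (u @ b # c # w)" for u b c w
    using add(3)[of "u @ [b]"] by simp
  define A where "A u v w = sg (Suc (length u) * Suc (length v)) (mrg (\<lambda>x. \<Phi> (x @ g v # w)) u)" for u v w
  define B where "B u v w = sg (length v + length u * length v) (mrg (\<lambda>x. \<Phi> (u @ g v # x)) w)" for u v w
  define L where "L u b v w = sg (length u * length v) (\<Phi> (u @ (b * g v) # w))" for u b v w
  define R where "R u v b w = sg (length u * length v + Suc (length v)) (\<Phi> (u @ (g v * b) # w))" for u v b w
  have "mrg (ins g \<Phi>) as = S3 (\<lambda>u v w. A u v w
      + sg (length u + length u * length v) (\<Phi> (u @ (lft g v + sg (length v) (rgt g v) - diff g v) # w))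
      + B u v w) as"
    unfolding ins_def mrg_S3
  proof (rule S3_cong, goal_cases)
    case (1 u v w)
    have "mrg (\<lambda>x. sg (length x * Suc (length v)) (\<Phi> (x @ g v # w))) u = A u v w"
      unfolding A_def by (rule mrg_sg_length) auto
    moreover have "mrg (\<lambda>x. sg (length u * Suc (length x)) (\<Phi> (u @ g x # w))) v
        = sg (length u * length v) (mrg (\<lambda>x. \<Phi> (u @ g x # w)) v)"
      by (rule mrg_sg_length) auto
    moreover have "mrg (\<lambda>x. \<Phi> (u @ g x # w)) v = \<Phi> (u @ mrg g v # w)"
      by (rule additive_mrg[symmetric]) (rule add)
    moreover have "mrg (\<lambda>x. sg (length u * Suc (length v)) (\<Phi> (u @ g v # x))) w
        = sg (length u * Suc (length v)) (mrg (\<lambda>x. \<Phi> (u @ g v # x)) w)"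
      by (rule mrg_sg)
    moreover have "sg (length u + length v + length u * Suc (length v)) y = sg (length v + length u * length v) y" for y :: 'm
      by (rule sg_cong) auto
    ultimately show ?case by (simp add: B_def mrg_diff_eq)
  qed
  also have "\<dots> = S3 A as + S3 (\<lambda>u v w. if v = [] then 0 else L u (hd v) (tl v) w) as
     + S3 (\<lambda>u v w. if v = [] then 0 else R u (butlast v) (last v) w) as
     - S3 (\<lambda>u v w. sg (length u * Suc (length v)) (\<Phi> (u @ diff g v # w))) as + S3 B as"
    unfolding S3_add[symmetric] S3_diff[symmetric]
  proof (rule S3_cong, goal_cases)
    case (1 u v w)
    show ?case
      by (cases "v = []")
        (auto simp: lft_def rgt_def L_def R_def add sg_add sg_diff sg_def neq_Nil_conv)
  qed
  also have "S3 (\<lambda>u v w. if v = [] then 0 else L u (hd v) (tl v) w) as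
      = S3 (\<lambda>u v w. if u = [] then 0 else L (butlast u) (last u) v w) as"
    by (rule S3_shift_left[symmetric])
  also have "S3 (\<lambda>u v w. if v = [] then 0 else R u (butlast v) (last v) w) as
      = S3 (\<lambda>u v w. if w = [] then 0 else R u v (hd w) (tl w)) as"
    by (rule S3_shift_right)
  also have "S3 A as + S3 (\<lambda>u v w. if u = [] then 0 else L (butlast u) (last u) v w) as
     + S3 (\<lambda>u v w. if w = [] then 0 else R u v (hd w) (tl w)) as
     - S3 (\<lambda>u v w. sg (length u * Suc (length v)) (\<Phi> (u @ diff g v # w))) as + S3 B as
    = ins (hat g) (mrg \<Phi>) as - ins (diff g) \<Phi> as"
    unfolding ins_def S3_add[symmetric] S3_diff[symmetric]
  proof (rule S3_cong, goal_cases)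
    case (1 u v w)
    have [simp]: "mrg (\<lambda>x. \<Phi> (x @ hat g v # w)) u = sg (Suc (length v)) (mrg (\<lambda>x. \<Phi> (x @ g v # w)) u)"
      "mrg (\<lambda>y. \<Phi> (u @ hat g v # y)) w = sg (Suc (length v)) (mrg (\<lambda>y. \<Phi> (u @ g v # y)) w)"
      by (simp_all add: hat_def add mrg_sg)
    show ?case unfolding mrg_append_Cons
      by (cases u rule: rev_cases)
        (auto simp: A_def B_def L_def R_def add add0 add1 sg_def hat_def mrg_uminus)
  qed
  finally show ?thesis .
qed

lemma mrg_mrg: fixes F :: "'a::semigroup_mult list \<Rightarrow> 'm::ab_group_add" shows  "mrg (mrg F) as = 0"
proof (induction as arbitrary: F)
  case (Cons a as)
  show ?case
  proof (cases "as = [] \<or> tl as = []")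
    case True
    then show ?thesis by (cases as) auto
  next
    case False
    then obtain b c cs where as: "as = b # c # cs" by (cases as; cases "tl as") auto
    define bs where "bs = c # cs"
    have "mrg (\<lambda>v. mrg F (a # v)) (b # bs)
        = mrg (\<lambda>v. F (a * hd v # tl v) - mrg (\<lambda>v. F (a # v)) v) (b # bs)"
    proof (rule mrg_cong)
      fix u :: "'a list" assume "Suc (length u) = length (b # bs)"
      show "mrg F (a # u) = F (a * hd u # tl u) - mrg (\<lambda>v. F (a # v)) u"
        using \<open>Suc (length u) = length (b # bs)\<close> by (cases u) (auto simp: bs_def)
    qed
    then show ?thesis
      using Cons.IH[of "\<lambda>v. F (a # v)"] unfolding as bs_def[symmetric]
      by (simp add: mrg_diff) (simp add: bs_def mult.assoc)
  qed
qed simp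

lemma rgt_more_simps [simp]: "rgt f [z] = f [] * z" "rgt f (as @ [y, z]) = f (as @ [y]) * z"
  "rgt f [y, z] = f [y] * z"
  using rgt_simps(2)[of f "[]" z] rgt_simps(2)[of f "as @ [y]" z] rgt_simps(2)[of f "[y]" z]
  by simp_all

lemma mrg_lft: "mrg (lft f) as = lft (lft f) as - lft (mrg f) as"
proof (cases as)
  case (Cons a bs)
  have "mrg (\<lambda>v. a * f v) bs = a * mrg f bs"
    by (rule additive_mrg[symmetric]) (rule distrib_left)
  then show ?thesis using Cons by (cases bs) (auto simp: mult.assoc)
qed simp

lemma mrg_rgt: "mrg (rgt f) as = rgt (mrg f) as + sg (length as) (rgt (rgt f) as)"
proof (cases as rule: rev_cases)
  case (snoc bs z)
  have "mrg (\<lambda>v. f v * z) bs = mrg f bs * z"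
    by (rule additive_mrg[symmetric]) (rule distrib_right)
  then show ?thesis using snoc
    by (cases bs rule: rev_cases) (auto simp: mrg_append algebra_simps sg_mult_left sg_Suc)
qed simp

lemma lft_rgt: "lft (rgt f) as = rgt (lft f) as"
proof (cases as)
  case (Cons a bs)
  then show ?thesis
    by (cases bs rule: rev_cases) (auto simp: lft_def rgt_def mult.assoc butlast_append)
qed simp

lemma diff_diff: "diff (diff f) as = 0"
proof -
  have l: "lft (diff f) as = lft (lft f) as - lft (mrg f) as - sg (length as) (lft (rgt f) as)"
    by (cases as) (auto simp: diff_def algebra_simps sg_mult_right sg_Suc)
  have r: "rgt (diff f) as = rgt (lft f) as - rgt (mrg f) as - sg (length as) (rgt (rgt f) as)"
    by (cases as rule: rev_cases) (auto simp: diff_def algebra_simps sg_mult_left sg_Suc)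
  have "mrg (\<lambda>v. sg (length v) (rgt f v)) as = sg (Suc (length as)) (mrg (rgt f) as)"
    by (rule mrg_sg_length) auto
  then have m: "mrg (diff f) as = mrg (lft f) as - sg (length as) (mrg (rgt f) as)"
    by (simp add: diff_def[abs_def] mrg_add mrg_diff mrg_mrg sg_Suc)
  show ?thesis
    unfolding diff_def[of "diff f"] l r m mrg_lft mrg_rgt lft_rgt
    by (simp add: sg_add sg_diff sg_def)
qed

lemma cp_add_left: "cp (\<lambda>v. f v + f' v) g as = cp f g as + cp f' g as"
  and cp_diff_left: "cp (\<lambda>v. f v - f' v) g as = cp f g as - cp f' g as"
  and cp_add_right: "cp f (\<lambda>v. g v + g' v) as = cp f g as + cp f g' as"
  and cp_diff_right: "cp f (\<lambda>v. g v - g' v) as = cp f g as - cp f g' as"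
  by (simp_all add: cp_def algebra_simps sg_add sg_diff spl_add spl_diff)

lemma mrg_cp: "mrg (cp f g) as = cp (mrg f) (eps g) as + cp f (mrg g) as"
  unfolding cp_def mrg_spl spl_add[symmetric]
proof (rule spl_cong, goal_cases)
  case (1 u v)
  have "mrg (\<lambda>x. sg (length x * length v) (f x * g v)) u
      = sg (Suc (length u) * length v) (mrg (\<lambda>x. f x * g v) u)"
    by (rule mrg_sg_length) auto
  moreover have "mrg (\<lambda>x. f x * g v) u = mrg f u * g v"
    by (rule additive_mrg[symmetric]) (rule distrib_right)
  moreover have "mrg (\<lambda>y. sg (length u * length y) (f u * g y)) v
      = sg (length u * Suc (length v)) (mrg (\<lambda>x. f u * g x) v)"
    by (rule mrg_sg_length) auto
  moreover have "mrg (\<lambda>x. f u * g x) v = f u * mrg g v"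
    by (rule additive_mrg[symmetric]) (rule distrib_left)
  ultimately show ?case
    by (simp add: eps_def sg_mult_right) (simp add: sg_def)
qed

lemma lft_cp: "lft (cp f g) as = cp (lft f) (eps g) as"
proof (cases as)
  case (Cons a bs)
  have "a * spl F bs = spl (\<lambda>u v. a * F u v) bs" for F
    by (rule additive_spl) (rule distrib_left)
  then show ?thesis unfolding Cons
    by (simp add: cp_def eps_def sg_mult_right mult.assoc)
      (rule spl_cong, auto intro: sg_cong)
qed (simp add: cp_def)

lemma rgt_cp: "sg (length as) (rgt (cp f g) as) = cp f (\<lambda>v. sg (length v) (rgt g v)) as"
proof (cases as rule: rev_cases)
  case (snoc bs z)
  have "spl F bs * z = spl (\<lambda>u v. F u v * z) bs" for F
    by (rule additive_spl) (rule distrib_right)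
  then show ?thesis unfolding snoc
    by (simp add: cp_def spl_snoc sg_mult_right sg_mult_left mult.assoc spl_sg[symmetric])
      (rule spl_cong, auto intro: sg_cong)
qed (simp add: cp_def)

text \<open>The letter between the two factors may be attached to either of them. These two
  contributions cancel in the Leibniz rule \<open>diff_cp\<close>.\<close>

lemma cp_rgt_lft: "cp (\<lambda>v. sg (length v) (rgt f v)) (eps g) as = - cp f (lft g) as"
proof -
  define F where "F u b v = sg (length u * length v + Suc (length u)) (f u * b * g v)" for u b v
  have "cp (\<lambda>v. sg (length v) (rgt f v)) (eps g) as
    = spl (\<lambda>u v. if u = [] then 0 else F (butlast u) (last u) v) as"
    unfolding cp_def
  proof (rule spl_cong, goal_cases)
    case (1 u v)
    show ?case
      by (cases u rule: rev_cases)
        (auto simp: rgt_def F_def eps_def sg_mult_left sg_mult_right intro!: sg_cong)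
  qed
  also have "\<dots> = spl (\<lambda>u v. if v = [] then 0 else F u (hd v) (tl v)) as"
    by (rule spl_shift)
  also have "\<dots> = - cp f (lft g) as"
    unfolding cp_def spl_uminus[symmetric]
  proof (rule spl_cong, goal_cases)
    case (1 u v)
    show ?case
      by (cases v) (auto simp: F_def sg_def mult.assoc)
  qed
  finally show ?thesis .
qed

lemma diff_cp: "diff (cp f g) as = cp (diff f) (eps g) as + cp f (diff g) as"
  unfolding diff_def[abs_def] cp_add_left cp_diff_left cp_add_right cp_diff_right
  by (simp add: lft_cp mrg_cp rgt_cp cp_rgt_lft algebra_simps)

lemma ins_add: "ins g (\<lambda>v. \<Phi> v + \<Psi> v) as = ins g \<Phi> as + ins g \<Psi> as"
  and ins_diff: "ins g (\<lambda>v. \<Phi> v - \<Psi> v) as = ins g \<Phi> as - ins g \<Psi> as"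
  by (simp_all add: ins_def sg_add sg_diff S3_add S3_diff)

text \<open>A block at the very front has no letter to its left. Such insertions occur in the first
  summand on the right but not on the left, and the product \<open>cat (eps g) f\<close> compensates
  for them; \<open>rgt_ins\<close> is the mirror image.\<close>

lemma lft_ins:
  assumes "slot_additive f"
  shows "lft (ins g f) as = ins (hat g) (lft f) as + cat (eps g) f as"
proof (cases as)
  case Nil
  then show ?thesis
    by (simp add: ins_def S3_Nil cat_def eps_def hat_def sg_def)
next
  case (Cons a bs)
  note add = slot_additiveD[OF assms]
  have d: "a * S3 F bs = S3 (\<lambda>u v w. a * F u v w) bs" for F
    unfolding S3_def by (simp add: additive_spl[of "(*) a"] distrib_left)
  have "S3 (\<lambda>u v w. a * sg (length u * Suc (length v)) (f (u @ g v # w))) bs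
    = S3 (\<lambda>u v w. sg (length (a # u) * Suc (length v)) (lft f ((a # u) @ hat g v # w))) bs"
    by (rule S3_cong) (auto simp: hat_def add sg_def)
  moreover have "spl (\<lambda>v w. sg (length ([]::'a list) * Suc (length v)) (lft f ([] @ hat g v # w))) (a # bs)
    + cat (eps g) f (a # bs) = 0"
    unfolding cat_def spl_add[symmetric]
    by (rule trans[OF spl_cong spl_zero]) (auto simp: hat_def eps_def sg_def)
  ultimately show ?thesis
    unfolding Cons ins_def lft_simps d S3_Cons by (simp add: algebra_simps)
qed

lemma rgt_ins:
  assumes "slot_additive f"
  shows "sg (length as) (rgt (ins g f) as)
    = ins (hat g) (\<lambda>v. sg (length v) (rgt f v)) as - cp f (eps g) as"
proof (cases as rule: rev_cases)
  case Nil
  then show ?thesis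
    by (simp add: ins_def S3_Nil cp_def eps_def hat_def sg_def rgt_def)
next
  case (snoc bs z)
  note add = slot_additiveD[OF assms]
  have d: "S3 F bs * z = S3 (\<lambda>u v w. F u v w * z) bs" for F
    unfolding S3_def by (simp add: additive_spl[of "\<lambda>x. x * z"] distrib_right)
  have "sg (length as) (rgt (ins g f) as)
    = S3 (\<lambda>u v w. sg (Suc (length bs)) (sg (length u * Suc (length v)) (f (u @ g v # w)) * z)) bs"
    unfolding snoc ins_def rgt_simps d S3_sg by simp
  also have "\<dots> = S3 (\<lambda>u v w. sg (length u * Suc (length v))
      (sg (length (u @ hat g v # w @ [z])) (rgt f (u @ hat g v # w @ [z])))) bs"
  proof (rule S3_cong, goal_cases)
    case (1 u v w)
    have "rgt f (u @ hat g v # w @ [z]) = f (u @ hat g v # w) * z"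
      using rgt_simps(2)[of f "u @ hat g v # w" z] by simp
    then show ?case using 1 by (auto simp: hat_def add sg_def)
  qed
  moreover have "spl (\<lambda>u v. sg (length u * Suc (length v))
      (sg (length (u @ hat g v # [])) (rgt f (u @ hat g v # [])))) as - cp f (eps g) as = 0"
    unfolding cp_def spl_diff[symmetric]
    by (rule trans[OF spl_cong spl_zero]) (auto simp: hat_def eps_def sg_def)
  ultimately show ?thesis
    unfolding snoc ins_def S3_snoc by simp
qed

text \<open>Gerstenhaber's homotopy formula: the circle product fails to be a chain map by the
  commutator of the two factors. It yields graded commutativity, and in the bracket the two
  commutators cancel.\<close>

lemma diff_ins:
  assumes "slot_additive f"
  shows "diff (ins g f) as = ins (hat g) (diff f) as + ins (diff g) f as
     + cat (eps g) f as - cp f (eps g) as"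
  unfolding diff_def[of "ins g f"] lft_ins[OF assms] rgt_ins[OF assms] mrg_ins[OF assms]
  by (simp add: diff_def[of f, abs_def] ins_add ins_diff algebra_simps)

section \<open>Iterated insertions and insertion into two slots\<close>

lemma spl_commute: "spl (\<lambda>v w. spl (\<lambda>a q. G a q v w) p) y = spl (\<lambda>a q. spl (\<lambda>v w. G a q v w) y) p"
  by (induction y arbitrary: G) (auto simp: spl_add)

lemma S3_append_Cons:
  "S3 F (us @ c # vs) = S3 (\<lambda>u v w. F u v (w @ c # vs)) us
     + spl (\<lambda>u v. spl (\<lambda>x w. F u (v @ c # x) w) vs) us
     + S3 (\<lambda>u. F (us @ c # u)) vs"
  unfolding S3_def by (simp add: spl_append_Cons spl_add spl_add_fun)

lemma S3_S3_left:
  "S3 (\<lambda>a b c. S3 (F a b) c) as = S3 (\<lambda>p v w. S3 (\<lambda>a b u. F a b u v w) p) as"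
proof -
  have "S3 (\<lambda>p v w. S3 (\<lambda>a b u. F a b u v w) p) as
      = spl (\<lambda>p y. spl (\<lambda>a q. spl (\<lambda>b u. spl (F a b u) y) q) p) as"
    unfolding S3_def
    by (intro spl_cong, subst spl_commute, intro spl_cong, rule spl_commute)
  also have "\<dots> = S3 (\<lambda>a b c. S3 (F a b) c) as"
    unfolding S3_def spl_assoc[symmetric] ..
  finally show ?thesis by simp
qed

lemma S3_S3_mid:
  "S3 (\<lambda>a b c. spl (\<lambda>u v1. spl (\<lambda>v2 w. F u v1 b v2 w) c) a) as
     = S3 (\<lambda>u v w. S3 (\<lambda>v1 b v2. F u v1 b v2 w) v) as"
proof -
  have "S3 (\<lambda>a b c. spl (\<lambda>u v1. spl (\<lambda>v2 w. F u v1 b v2 w) c) a) as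
     = spl (\<lambda>a y. spl (\<lambda>u v1. spl (\<lambda>b c. spl (\<lambda>v2 w. F u v1 b v2 w) c) y) a) as"
    unfolding S3_def by (intro spl_cong, rule spl_commute)
  also have "\<dots> = spl (\<lambda>u r. spl (\<lambda>v1 y. spl (\<lambda>b c. spl (\<lambda>v2 w. F u v1 b v2 w) c) y) r) as"
    by (rule spl_assoc[symmetric])
  also have "\<dots> = spl (\<lambda>u r. spl (\<lambda>v1 y. spl (\<lambda>q w. spl (\<lambda>b v2. F u v1 b v2 w) q) y) r) as"
    by (intro spl_cong spl_assoc)
  also have "\<dots> = spl (\<lambda>u r. spl (\<lambda>v w. spl (\<lambda>v1 q. spl (\<lambda>b v2. F u v1 b v2 w) q) v) r) as"
    by (intro spl_cong spl_assoc)
  finally show ?thesis unfolding S3_def .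
qed

text \<open>The brace operation that fills two different slots of \<Phi>, with \<open>y\<close> to
  the left of \<open>z\<close>.\<close>

definition ins2 ::
    "('a list \<Rightarrow> 'a) \<Rightarrow> ('a list \<Rightarrow> 'a) \<Rightarrow> ('a list \<Rightarrow> 'm::ab_group_add) \<Rightarrow> 'a list \<Rightarrow> 'm" where
  "ins2 y z \<Phi> = S3 (\<lambda>p s t. sg (length p * Suc (length s)) (ins y (\<lambda>w. \<Phi> (w @ z s # t)) p))"

definition homogeneous :: "nat \<Rightarrow> ('a list \<Rightarrow> 'm::zero) \<Rightarrow> bool" where
  "homogeneous n f \<longleftrightarrow> (\<forall>as. length as \<noteq> n \<longrightarrow> f as = 0)"

lemma homogeneousD: "homogeneous n f \<Longrightarrow> f as \<noteq> 0 \<Longrightarrow> length as = n"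
  by (auto simp: homogeneous_def)

text \<open>The block of \<open>h\<close> lies inside, to the right or to the left of the entry
  produced by \<open>g\<close>. The last two cases are exchanged by swapping \<open>g\<close> and
  \<open>h\<close>, which makes the associator symmetric up to sign (the pre-Lie identity).
  Homogeneity turns the sign of the third case into a constant.\<close>

lemma ins_ins:
  fixes \<Phi> :: "'a::ab_group_add list \<Rightarrow> 'm::ab_group_add"
  assumes "slot_additive \<Phi>" and "homogeneous m g" and "homogeneous k h"
  shows "ins h (ins g \<Phi>) as = ins (ins h g) \<Phi> as + ins2 g h \<Phi> as
     + sg (Suc m * Suc k) (ins2 h g \<Phi> as)"
proof -
  note add = slot_additiveD[OF assms(1)]
  have "ins h (ins g \<Phi>) as =
     S3 (\<lambda>a b c. sg (length a * Suc (length b))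
         (S3 (\<lambda>u v w. sg (length u * Suc (length v)) (\<Phi> (u @ g v # w @ h b # c))) a)) as
   + S3 (\<lambda>a b c. spl (\<lambda>u v1. spl (\<lambda>v2 w. sg (length a * Suc (length b) +
          length u * Suc (Suc (length v1 + length v2))) (\<Phi> (u @ g (v1 @ h b # v2) # w))) c) a) as
   + S3 (\<lambda>a b c. S3 (\<lambda>u v w. sg (length a * Suc (length b) + Suc (length a + length u) * Suc (length v))
          (\<Phi> (a @ h b # u @ g v # w))) c) as"
    unfolding ins_def S3_append_Cons S3_add[symmetric]
    by (rule S3_cong) (simp add: sg_add S3_sg[symmetric] spl_sg[symmetric] spl_sg_fun[symmetric])
  also have "S3 (\<lambda>a b c. sg (length a * Suc (length b))
         (S3 (\<lambda>u v w. sg (length u * Suc (length v)) (\<Phi> (u @ g v # w @ h b # c))) a)) as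
     = ins2 g h \<Phi> as"
    by (simp add: ins2_def ins_def)
  also have "S3 (\<lambda>a b c. spl (\<lambda>u v1. spl (\<lambda>v2 w. sg (length a * Suc (length b) +
          length u * Suc (Suc (length v1 + length v2))) (\<Phi> (u @ g (v1 @ h b # v2) # w))) c) a) as
     = S3 (\<lambda>a b c. spl (\<lambda>u v1. spl (\<lambda>v2 w. sg ((length u + length v1) * Suc (length b) +
          length u * Suc (Suc (length v1 + length v2))) (\<Phi> (u @ g (v1 @ h b # v2) # w))) c) a) as"
    unfolding S3_def by (intro spl_cong) auto
  also have "\<dots> = ins (ins h g) \<Phi> as"
    unfolding S3_S3_mid ins_def
  proof (rule S3_cong, goal_cases)
    case (1 u v w)
    have "\<Phi> (u @ S3 F v # w) = S3 (\<lambda>a b c. \<Phi> (u @ F a b c # w)) v" for F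
      unfolding S3_def by (simp add: additive_spl[of "\<lambda>x. \<Phi> (u @ x # w)"] add)
    then show ?case
      by (simp only: S3_sg[symmetric], intro S3_cong) (auto simp: add intro!: sg_cong)
  qed
  also have "S3 (\<lambda>a b c. S3 (\<lambda>u v w. sg (length a * Suc (length b) + Suc (length a + length u) * Suc (length v))
          (\<Phi> (a @ h b # u @ g v # w))) c) as
     = sg (Suc m * Suc k) (ins2 h g \<Phi> as)"
    unfolding S3_S3_left ins2_def ins_def S3_sg[symmetric]
  proof (intro S3_cong, goal_cases)
    case (1 p v w a b u)
    have z: "\<Phi> (a @ 0 # x) = 0" "\<Phi> (a @ y # u @ 0 # x) = 0" for x y
      using add(2)[of "a @ y # u"] by (simp_all add: add)
    show ?case
    proof (cases "h b = 0 \<or> g v = 0")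
      case False
      then have "length b = k" "length v = m"
        using assms(2,3) by (auto dest: homogeneousD)
      then show ?thesis using 1 by (auto intro!: sg_cong)
    qed (auto simp: z)
  qed
  finally show ?thesis by (simp add: algebra_simps)
qed

lemma cp_append_Cons:
  "cp f g (us @ c # vs)
     = spl (\<lambda>x y. sg (length x * Suc (length y + length vs)) (f x * g (y @ c # vs))) us
     + spl (\<lambda>x y. sg (Suc (length us + length x) * length y) (f (us @ c # x) * g y)) vs"
  by (simp add: cp_def spl_append_Cons)

text \<open>A block lies entirely within the arguments of one factor, so insertion into a cup
  product is a derivation already for cochains. For insertion of a cup product this holds only up to
  homotopy, see \<open>diff_ins2\<close>.\<close>

lemma ins_cp:
  assumes "slot_additive f" and "homogeneous m h" and "homogeneous q g"
  shows "ins h (cp f g) as = sg (Suc m * q) (cp (ins h f) g as) + cp f (ins h g) as"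
proof -
  note add = slot_additiveD[OF assms(1)]
  have dl: "x * S3 F bs = S3 (\<lambda>u v w. x * F u v w) bs" for x :: 'a and F bs
    unfolding S3_def by (simp add: additive_spl[of "(*) x"] distrib_left)
  have dr: "S3 F bs * x = S3 (\<lambda>u v w. F u v w * x) bs" for x :: 'a and F bs
    unfolding S3_def by (simp add: additive_spl[of "\<lambda>y. y * x"] distrib_right)
  have "ins h (cp f g) as =
      S3 (\<lambda>u v w. spl (\<lambda>x y. sg (length u * Suc (length v) + length x * Suc (length y + length w))
          (f x * g (y @ h v # w))) u) as
    + S3 (\<lambda>u v w. spl (\<lambda>x y. sg (length u * Suc (length v) + Suc (length u + length x) * length y)
          (f (u @ h v # x) * g y)) w) as"
    unfolding ins_def cp_append_Cons S3_add[symmetric]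
    by (rule S3_cong) (simp add: sg_add spl_sg[symmetric])
  also have "S3 (\<lambda>u v w. spl (\<lambda>x y. sg (length u * Suc (length v) + length x * Suc (length y + length w))
          (f x * g (y @ h v # w))) u) as = cp f (ins h g) as"
  proof -
    have "S3 (\<lambda>u v w. spl (\<lambda>x y. sg (length u * Suc (length v) + length x * Suc (length y + length w))
          (f x * g (y @ h v # w))) u) as
      = spl (\<lambda>u r. spl (\<lambda>x y. spl (\<lambda>v w. sg ((length x + length y) * Suc (length v) + length x * Suc (length y + length w))
          (f x * g (y @ h v # w))) r) u) as"
      unfolding S3_def by (intro spl_cong, subst spl_commute, intro spl_cong) auto
    also have "\<dots> = cp f (ins h g) as"
      unfolding spl_assoc[symmetric] cp_def ins_def dl S3_sg[symmetric]
      unfolding S3_def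
      by (intro spl_cong) (auto simp: sg_mult_right intro!: sg_cong)
    finally show ?thesis .
  qed
  also have "S3 (\<lambda>u v w. spl (\<lambda>x y. sg (length u * Suc (length v) + Suc (length u + length x) * length y)
          (f (u @ h v # x) * g y)) w) as = sg (Suc m * q) (cp (ins h f) g as)"
  proof -
    have "S3 (\<lambda>u v w. spl (\<lambda>x y. sg (length u * Suc (length v) + Suc (length u + length x) * length y)
          (f (u @ h v # x) * g y)) w) as
      = spl (\<lambda>u r. spl (\<lambda>p y. spl (\<lambda>v x. sg (length u * Suc (length v) + Suc (length u + length x) * length y)
          (f (u @ h v # x) * g y)) p) r) as"
      unfolding S3_def by (intro spl_cong spl_assoc)
    also have "\<dots> = spl (\<lambda>p y. spl (\<lambda>u r. spl (\<lambda>v x. sg (length u * Suc (length v) + Suc (length u + length x) * length y)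
          (f (u @ h v # x) * g y)) r) p) as"
      by (rule spl_assoc)
    also have "\<dots> = sg (Suc m * q) (cp (ins h f) g as)"
      unfolding cp_def ins_def dr S3_sg[symmetric] spl_sg[symmetric]
      unfolding S3_def
    proof (intro spl_cong, goal_cases)
      case (1 p y u r v x)
      show ?case
      proof (cases "h v = 0 \<or> g y = 0")
        case False
        then have "length v = m" "length y = q"
          using assms(2,3) by (auto dest: homogeneousD)
        then show ?thesis using 1 by (auto simp: sg_mult_left intro!: sg_cong)
      qed (auto simp: add)
    qed
    finally show ?thesis .
  qed
  finally show ?thesis by (simp add: algebra_simps)
qed

lemma mrg_S3_commute: "mrg (\<lambda>t. S3 (\<lambda>u v w. F u v w t) p) t = S3 (\<lambda>u v w. mrg (F u v w) t) p"
  unfolding S3_def by (simp add: mrg_spl_commute)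

lemma mrg_ins_commute: "mrg (\<lambda>t. ins y (\<lambda>w. F w t) p) t = ins y (\<lambda>w. mrg (F w) t) p"
  unfolding ins_def by (simp add: mrg_S3_commute mrg_sg)

lemma ins_cong:
  "(\<And>u v w. u @ v @ w = as \<Longrightarrow> \<Phi> (u @ g v # w) = \<Psi> (u @ h v # w)) \<Longrightarrow> ins g \<Phi> as = ins h \<Psi> as"
  unfolding ins_def by (rule S3_cong) simp

lemma spl_zero_fun [simp]: "spl (\<lambda>u v. 0) = (\<lambda>as. 0)"
  by (rule ext) (rule spl_zero)

lemma ins_zero [simp]: "ins g (\<lambda>v. 0) as = 0"
  by (simp add: ins_def S3_def)

lemma ins_sg: "ins g (\<lambda>v. sg n (\<Phi> v)) as = sg n (ins g \<Phi> as)"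
  unfolding ins_def S3_sg[symmetric] by (rule S3_cong) (auto intro: sg_cong)

lemma ins_hat_sg:
  fixes \<Phi> :: "'a::ab_group_add list \<Rightarrow> 'm::ab_group_add"
  assumes "slot_additive \<Phi>"
  shows "ins (hat y) (\<lambda>w. sg (length w) (\<Phi> w)) p = sg (length p) (ins y \<Phi> p)"
  unfolding ins_def S3_sg[symmetric]
  by (rule S3_cong) (auto simp: hat_def slot_additiveD[OF assms] intro!: sg_cong)

lemma ins_hat_sg_add:
  fixes \<Phi> :: "'a::ab_group_add list \<Rightarrow> 'm::ab_group_add"
  assumes "slot_additive \<Phi>"
  shows "ins (hat y) (\<lambda>w. sg (length w + k) (\<Phi> w)) p = sg (length p + k) (ins y \<Phi> p)"
proof -
  have "(\<lambda>w. sg (length w + k) (\<Phi> w)) = (\<lambda>w. sg k (sg (length w) (\<Phi> w)))"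
    by (simp add: add.commute)
  then show ?thesis by (simp only: ins_sg ins_hat_sg[OF assms]) (simp add: add.commute)
qed

text \<open>Either the last letter of the list survives as the last entry, or the inserted block
  takes its place.\<close>

lemma ins_last:
  "ins y (\<lambda>w. if w = [] then 0 else \<Psi> (butlast w) (last w)) p
     = (if p = [] then 0 else ins y (\<lambda>w. \<Psi> w (last p)) (butlast p))
       + spl (\<lambda>u v. sg (length u * Suc (length v)) (\<Psi> u (y v))) p"
proof (cases p rule: rev_cases)
  case Nil
  then show ?thesis by (simp add: ins_def S3_Nil)
next
  case (snoc q b)
  have "butlast (u @ c # w @ [b]) = u @ c # w" "last (u @ c # w @ [b]) = b" for u c w
    by (simp_all add: butlast_append)
  then show ?thesis unfolding snoc by (simp add: ins_def S3_snoc)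
qed

lemma slot_additive_append:
  assumes "slot_additive \<Phi>"
  shows "slot_additive (\<lambda>w. \<Phi> (w @ t))"
  using assms by (auto simp: slot_additive_def)

lemma slot_additive_last:
  fixes \<Phi> :: "'a::ring list \<Rightarrow> 'm::ab_group_add"
  assumes "slot_additive \<Phi>"
  shows "slot_additive (\<lambda>w. if w = [] then 0 else \<Phi> (butlast w @ (last w * c) # t))"
  unfolding slot_additive_def
proof (intro allI)
  fix us vs :: "'a list" and a b :: 'a
  show "(if us @ (a + b) # vs = [] then 0
         else \<Phi> (butlast (us @ (a + b) # vs) @ (last (us @ (a + b) # vs) * c) # t)) =
        (if us @ a # vs = [] then 0 else \<Phi> (butlast (us @ a # vs) @ (last (us @ a # vs) * c) # t)) +
        (if us @ b # vs = [] then 0 else \<Phi> (butlast (us @ b # vs) @ (last (us @ b # vs) * c) # t))"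
    using assms by (cases vs rule: rev_cases) (auto simp: slot_additive_def butlast_append distrib_right)
qed

lemma S3_spl_left:
  "S3 (\<lambda>p s t. spl (\<lambda>u v. F u v s t) p) as = S3 (\<lambda>u q t. spl (\<lambda>v s. F u v s t) q) as"
proof -
  have "S3 (\<lambda>p s t. spl (\<lambda>u v. F u v s t) p) as
      = spl (\<lambda>p r. spl (\<lambda>u v. spl (\<lambda>s t. F u v s t) r) p) as"
    unfolding S3_def by (intro spl_cong, rule spl_commute)
  also have "\<dots> = spl (\<lambda>u r'. spl (\<lambda>v r. spl (\<lambda>s t. F u v s t) r) r') as"
    by (rule spl_assoc[symmetric])
  also have "\<dots> = S3 (\<lambda>u q t. spl (\<lambda>v s. F u v s t) q) as"
    unfolding S3_def by (intro spl_cong spl_assoc)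
  finally show ?thesis .
qed

text \<open>As for \<open>mrg_ins\<close>, with one new feature: for adjacent blocks the
  differential of \<Phi> multiplies \<open>y v\<close> with \<open>z s\<close>. This product has no
  counterpart on the left and produces the insertion of the cup product.\<close>

lemma mrg_ins2:
  fixes \<Phi> :: "'a::ring_1 list \<Rightarrow> 'm::ab_group_add"
  assumes "slot_additive \<Phi>"
  shows "mrg (ins2 y z \<Phi>) as = ins2 (hat y) (hat z) (mrg \<Phi>) as - ins2 (diff y) (hat z) \<Phi> as
     - ins2 y (diff z) \<Phi> as - ins (cp y (eps z)) \<Phi> as"
proof -
  note add = slot_additiveD[OF assms]
  have sa: "slot_additive (\<lambda>w. \<Phi> (w @ c # t))" for c t
    by (rule slot_additive_append[OF assms])
  have ins_add_arg: "ins y (\<lambda>w. \<Phi> (w @ (a + b) # t)) p = ins y (\<lambda>w. \<Phi> (w @ a # t)) p + ins y (\<lambda>w. \<Phi> (w @ b # t)) p"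
    for a b t p by (simp add: add ins_add)
  have ins_sg_arg: "ins y (\<lambda>w. \<Phi> (w @ (sg n b) # t)) p = sg n (ins y (\<lambda>w. \<Phi> (w @ b # t)) p)"
    for n b t p y by (simp add: add ins_sg)
  define A where "A p s t = sg (Suc (length p) * Suc (length s))
    (ins (hat y) (mrg (\<lambda>w. \<Phi> (w @ z s # t))) p)" for p s t
  define A' where "A' p s t = sg (Suc (length p) * Suc (length s))
    (ins (diff y) (\<lambda>w. \<Phi> (w @ z s # t)) p)" for p s t
  define B where "B p s t = sg (length s + length p * length s)
    (ins y (\<lambda>w. mrg (\<lambda>x. \<Phi> (w @ z s # x)) t) p)" for p s t
  define L where "L p b s t = sg (length p * length s) (ins y (\<lambda>w. \<Phi> (w @ (b * z s) # t)) p)" for p b s t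
  define R where "R p s b t = sg (length p * length s + Suc (length s))
    (ins y (\<lambda>w. \<Phi> (w @ (z s * b) # t)) p)" for p s b t
  define E where "E p s t = sg (length p + length p * length s) (ins y (\<lambda>w. \<Phi> (w @ diff z s # t)) p)" for p s t
  \<comment> \<open>Adjacent blocks: the block \<open>v\<close> of \<open>y\<close> ends where the
    block \<open>s\<close> of \<open>z\<close> begins.\<close>
  define C where "C p s t = sg (length p * length s + length s)
    (spl (\<lambda>u v. sg (length u * Suc (length v)) (\<Phi> (u @ (y v * z s) # t))) p)" for p s t
  have "mrg (ins2 y z \<Phi>) as = S3 (\<lambda>p s t. (A p s t - A' p s t)
      + ((if s = [] then 0 else L p (hd s) (tl s) t) + (if s = [] then 0 else R p (butlast s) (last s) t)
        - E p s t) + B p s t) as"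
    unfolding ins2_def mrg_S3
  proof (rule S3_cong, goal_cases)
    case (1 p s t)
    have "mrg (\<lambda>x. sg (length x * Suc (length s)) (ins y (\<lambda>w. \<Phi> (w @ z s # t)) x)) p
       = sg (Suc (length p) * Suc (length s)) (mrg (ins y (\<lambda>w. \<Phi> (w @ z s # t))) p)"
      by (rule mrg_sg_length) auto
    also have "\<dots> = A p s t - A' p s t"
      unfolding mrg_ins[OF sa] A_def A'_def by (simp add: sg_diff)
    finally have 1: "mrg (\<lambda>x. sg (length x * Suc (length s)) (ins y (\<lambda>w. \<Phi> (w @ z s # t)) x)) p
        = A p s t - A' p s t" .
    have "mrg (\<lambda>x. sg (length p * Suc (length x)) (ins y (\<lambda>w. \<Phi> (w @ z x # t)) p)) s
      = sg (length p * length s) (mrg (\<lambda>x. ins y (\<lambda>w. \<Phi> (w @ z x # t)) p) s)"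
      by (rule mrg_sg_length) auto
    also have "mrg (\<lambda>x. ins y (\<lambda>w. \<Phi> (w @ z x # t)) p) s = ins y (\<lambda>w. \<Phi> (w @ mrg z s # t)) p"
      by (rule additive_mrg[symmetric]) (rule ins_add_arg)
    also have "\<dots> = ins y (\<lambda>w. \<Phi> (w @ lft z s # t)) p + sg (length s) (ins y (\<lambda>w. \<Phi> (w @ rgt z s # t)) p)
         - ins y (\<lambda>w. \<Phi> (w @ diff z s # t)) p"
      unfolding mrg_diff_eq by (simp add: add ins_add ins_diff ins_sg)
    finally have 2: "sg (length p) (mrg (\<lambda>x. sg (length p * Suc (length x)) (ins y (\<lambda>w. \<Phi> (w @ z x # t)) p)) s)
      = (if s = [] then 0 else L p (hd s) (tl s) t) + (if s = [] then 0 else R p (butlast s) (last s) t) - E p s t"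
      by (cases "s = []") (auto simp: lft_def rgt_def L_def R_def E_def add sg_def neq_Nil_conv)
    have 3: "sg (length p + length s) (mrg (\<lambda>x. sg (length p * Suc (length s)) (ins y (\<lambda>w. \<Phi> (w @ z s # x)) p)) t)
      = B p s t"
      unfolding mrg_sg mrg_ins_commute B_def by (simp, rule sg_cong) auto
    show ?case unfolding 1 2 3 ..
  qed
  also have "\<dots> = S3 A as - S3 A' as + S3 (\<lambda>p s t. if s = [] then 0 else L p (hd s) (tl s) t) as
      + S3 (\<lambda>p s t. if s = [] then 0 else R p (butlast s) (last s) t) as - S3 E as + S3 B as"
    by (simp add: S3_add S3_diff algebra_simps)
  also have "S3 (\<lambda>p s t. if s = [] then 0 else L p (hd s) (tl s) t) as
      = S3 (\<lambda>p s t. if p = [] then 0 else L (butlast p) (last p) s t) as"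
    by (rule S3_shift_left[symmetric])
  also have "S3 (\<lambda>p s t. if s = [] then 0 else R p (butlast s) (last s) t) as
      = S3 (\<lambda>p s t. if t = [] then 0 else R p s (hd t) (tl t)) as"
    by (rule S3_shift_right)
  finally have lhs: "mrg (ins2 y z \<Phi>) as = S3 A as - S3 A' as
      + S3 (\<lambda>p s t. if p = [] then 0 else L (butlast p) (last p) s t) as
      + S3 (\<lambda>p s t. if t = [] then 0 else R p s (hd t) (tl t)) as - S3 E as + S3 B as" .
  have rhs: "ins2 (hat y) (hat z) (mrg \<Phi>) as = S3 (\<lambda>p s t. A p s t
     + (if p = [] then 0 else L (butlast p) (last p) s t) + C p s t
     + (if t = [] then 0 else R p s (hd t) (tl t)) + B p s t) as"
    unfolding ins2_def
  proof (rule S3_cong, goal_cases)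
    case (1 p s t)
    have a: "ins (hat y) (\<lambda>w. mrg (\<lambda>x. \<Phi> (x @ hat z s # t)) w) p
        = sg (Suc (length s)) (ins (hat y) (mrg (\<lambda>w. \<Phi> (w @ z s # t))) p)"
      by (simp add: hat_def[of z] add mrg_sg ins_sg)
    have "(\<lambda>w. if w = [] then 0 else sg (length w) (\<Phi> (butlast w @ (last w * hat z s) # t)))
      = (\<lambda>w. sg (length w) (if w = [] then 0 else \<Phi> (butlast w @ (last w * hat z s) # t)))"
      by auto
    then have "ins (hat y) (\<lambda>w. if w = [] then 0 else sg (length w) (\<Phi> (butlast w @ (last w * hat z s) # t))) p
      = sg (length p) (ins y (\<lambda>w. if w = [] then 0 else \<Phi> (butlast w @ (last w * hat z s) # t)) p)"
      by (simp only: ins_hat_sg[OF slot_additive_last[OF assms]])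
    also have "\<dots> = sg (length p) ((if p = [] then 0 else ins y (\<lambda>w. \<Phi> (w @ (last p * hat z s) # t)) (butlast p))
       + spl (\<lambda>u v. sg (length u * Suc (length v)) (\<Phi> (u @ (y v * hat z s) # t))) p)"
      by (simp only: ins_last[where \<Psi> = "\<lambda>u b. \<Phi> (u @ (b * hat z s) # t)"])
    also have "\<dots> = sg (length p + Suc (length s)) ((if p = [] then 0 else ins y (\<lambda>w. \<Phi> (w @ (last p * z s) # t)) (butlast p))
       + spl (\<lambda>u v. sg (length u * Suc (length v)) (\<Phi> (u @ (y v * z s) # t))) p)"
    proof -
      have "(\<Phi> (w @ (x * hat z s) # t)) = sg (Suc (length s)) (\<Phi> (w @ (x * z s) # t))" for w x
        by (simp add: hat_def sg_mult_right add)
      then have "ins y (\<lambda>w. \<Phi> (w @ (x * hat z s) # t)) q = sg (Suc (length s)) (ins y (\<lambda>w. \<Phi> (w @ (x * z s) # t)) q)"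
        "spl (\<lambda>u v. sg (length u * Suc (length v)) (\<Phi> (u @ (y v * hat z s) # t))) p
          = sg (Suc (length s)) (spl (\<lambda>u v. sg (length u * Suc (length v)) (\<Phi> (u @ (y v * z s) # t))) p)" for x q
        by (simp_all only: ins_sg spl_sg[symmetric]) (simp_all add: add.commute)
      then show ?thesis by (simp only: sg_add sg_sg[symmetric] if_distrib[of "sg _"] sg_zero)
    qed
    finally have b: "ins (hat y) (\<lambda>w. if w = [] then 0 else sg (length w) (\<Phi> (butlast w @ (last w * hat z s) # t))) p
      = sg (length p + Suc (length s)) ((if p = [] then 0 else ins y (\<lambda>w. \<Phi> (w @ (last p * z s) # t)) (butlast p))
       + spl (\<lambda>u v. sg (length u * Suc (length v)) (\<Phi> (u @ (y v * z s) # t))) p)" .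
    have c: "ins (hat y) (\<lambda>w. if t = [] then 0 else sg (length w) (\<Phi> (w @ (hat z s * hd t) # tl t))) p
      = (if t = [] then 0 else sg (length p + Suc (length s)) (ins y (\<lambda>w. \<Phi> (w @ (z s * hd t) # tl t)) p))"
    proof -
      have "(\<lambda>w. sg (length w) (\<Phi> (w @ (hat z s * hd t) # tl t)))
        = (\<lambda>w. sg (length w + Suc (length s)) (\<Phi> (w @ (z s * hd t) # tl t)))"
        by (simp add: hat_def sg_mult_left add)
      then show ?thesis
        by (cases "t = []") (simp_all only: ins_hat_sg_add[OF sa] if_True if_False simp_thms ins_zero)
    qed
    have sm: "slot_additive (\<lambda>w. mrg (\<lambda>x. \<Phi> (w @ z s # x)) t)"
      using add(1) by (simp add: slot_additive_def mrg_add)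
    have d: "ins (hat y) (\<lambda>w. sg (length w) (mrg (\<lambda>x. \<Phi> (w @ hat z s # x)) t)) p
      = sg (length p + Suc (length s)) (ins y (\<lambda>w. mrg (\<lambda>x. \<Phi> (w @ z s # x)) t) p)"
    proof -
      have "(\<lambda>w. sg (length w) (mrg (\<lambda>x. \<Phi> (w @ hat z s # x)) t))
        = (\<lambda>w. sg (length w + Suc (length s)) (mrg (\<lambda>x. \<Phi> (w @ z s # x)) t))"
        by (simp add: hat_def add mrg_sg)
      then show ?thesis by (simp only: ins_hat_sg_add[OF sm])
    qed
    have "ins (hat y) (\<lambda>w. mrg \<Phi> (w @ hat z s # t)) p
      = sg (Suc (length s)) (ins (hat y) (mrg (\<lambda>w. \<Phi> (w @ z s # t))) p)
        - sg (length p + Suc (length s)) ((if p = [] then 0 else ins y (\<lambda>w. \<Phi> (w @ (last p * z s) # t)) (butlast p))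
       + spl (\<lambda>u v. sg (length u * Suc (length v)) (\<Phi> (u @ (y v * z s) # t))) p)
        + (if t = [] then 0 else sg (length p + Suc (length s)) (ins y (\<lambda>w. \<Phi> (w @ (z s * hd t) # tl t)) p))
        - sg (length p + Suc (length s)) (ins y (\<lambda>w. mrg (\<lambda>x. \<Phi> (w @ z s # x)) t) p)"
      unfolding mrg_append_Cons ins_add ins_diff a b c d ..
    then show ?case
      by (cases p rule: rev_cases) (auto simp: A_def L_def C_def R_def B_def sg_def)
  qed
  have c: "S3 C as = ins (cp y (eps z)) \<Phi> as"
  proof -
    have "S3 C as = S3 (\<lambda>u q t. spl (\<lambda>v s. sg ((length u + length v) * length s + length s + length u * Suc (length v))
       (\<Phi> (u @ (y v * z s) # t))) q) as"
      unfolding C_def spl_sg[symmetric] sg_sg S3_spl_left[symmetric]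
      by (intro S3_cong spl_cong) (auto intro!: sg_cong)
    also have "\<dots> = ins (cp y (eps z)) \<Phi> as"
      unfolding ins_def
    proof (rule S3_cong, goal_cases)
      case (1 u v w)
      have "\<Phi> (u @ spl F v # w) = spl (\<lambda>a b. \<Phi> (u @ F a b # w)) v" for F
        by (simp add: additive_spl[of "\<lambda>x. \<Phi> (u @ x # w)"] add)
      then show ?case unfolding cp_def
        by (simp only: spl_sg[symmetric], intro spl_cong) (auto simp: eps_def sg_mult_right add intro!: sg_cong)
    qed
    finally show ?thesis .
  qed
  have a': "S3 A' as = ins2 (diff y) (hat z) \<Phi> as"
    unfolding ins2_def A'_def by (rule S3_cong) (auto simp: hat_def ins_sg_arg intro!: sg_cong)
  have e: "S3 E as = ins2 y (diff z) \<Phi> as"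
    unfolding ins2_def E_def by (rule S3_cong) simp
  show ?thesis
    unfolding lhs rhs a'[symmetric] e[symmetric] c[symmetric] by (simp add: S3_add algebra_simps)
qed

lemma lft_ins2:
  assumes "slot_additive x"
  shows "lft (ins2 y z x) as = ins2 (hat y) (hat z) (lft x) as
    + S3 (\<lambda>p s t. sg (length p * Suc (length s) + Suc (length s)) (cat (eps y) (\<lambda>w. x (w @ z s # t)) p)) as"
proof -
  note add = slot_additiveD[OF assms]
  have sa: "slot_additive (\<lambda>w. x (w @ c # t))" for c t
    by (rule slot_additive_append[OF assms])
  have "ins2 (hat y) (hat z) (lft x) as
    = S3 (\<lambda>p s t. sg (length p * Suc (length s) + Suc (length s))
        (lft (ins y (\<lambda>w. x (w @ z s # t))) p) -
      sg (length p * Suc (length s) + Suc (length s)) (cat (eps y) (\<lambda>w. x (w @ z s # t)) p)) as"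
    unfolding ins2_def
  proof (rule S3_cong, goal_cases)
    case (1 p s t)
    have add': "x (a @ c # w @ sg n b # t) = sg n (x (a @ c # w @ b # t))" for a c w n b t
      using add(5)[of "a @ c # w"] by simp
    have "ins (hat y) (\<lambda>w. lft x (w @ hat z s # t)) p
      = ins (hat y) (\<lambda>w. sg (Suc (length s)) (lft (\<lambda>w. x (w @ z s # t)) w)) p"
      by (rule ins_cong) (auto simp: lft_def hd_append hat_def add add' sg_mult_right)
    then show ?case
      by (simp add: ins_sg lft_ins[OF sa] sg_add)
  qed
  moreover have "lft (ins2 y z x) as = S3 (\<lambda>p s t. sg (length p * Suc (length s) + Suc (length s))
        (lft (ins y (\<lambda>w. x (w @ z s # t))) p)) as"
  proof (cases as)
    case Nil
    then show ?thesis by (simp add: S3_Nil)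
  next
    case (Cons a bs)
    have d: "a * S3 F bs = S3 (\<lambda>u v w. a * F u v w) bs" for F
      unfolding S3_def by (simp add: additive_spl[of "(*) a"] distrib_left)
    show ?thesis unfolding Cons lft_simps ins2_def d S3_Cons
      by simp (rule S3_cong, auto simp: sg_mult_right intro: sg_cong)
  qed
  ultimately show ?thesis by (simp add: S3_diff)
qed

lemma rgt_ins2:
  assumes "slot_additive x"
  shows "sg (length as) (rgt (ins2 y z x) as) = ins2 (hat y) (hat z) (\<lambda>w. sg (length w) (rgt x w)) as
    - cp (ins y x) (eps z) as"
proof (cases as rule: rev_cases)
  case Nil
  have "(\<lambda>w. - rgt x (w @ [hat z []])) = (\<lambda>w. sg (length w + 0) (eps x w * z []))"
    unfolding rgt_simps by (auto simp: hat_def eps_def sg_mult_left sg_def)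
  with Nil show ?thesis
    by (simp add: ins2_def ins_def S3_Nil cp_def eps_def hat_def sg_def)
      (use rgt_simps(2)[of x "[- y []]" "- z []"] slot_additiveD(3)[OF assms, of "[]" _ "[]"] in simp)
next
  case (snoc bs b)
  note add = slot_additiveD[OF assms]
  have sa: "slot_additive (\<lambda>w. x (w @ c # t))" for c t
    by (rule slot_additive_append[OF assms])
  have d: "S3 F bs * b = S3 (\<lambda>u v w. F u v w * b) bs" for F
    unfolding S3_def by (simp add: additive_spl[of "\<lambda>y. y * b"] distrib_right)
  have sb: "slot_additive (\<lambda>w. f w * c)" if "slot_additive f" for c :: 'a and f
    using that by (auto simp: slot_additive_def distrib_right)
  have "rgt x (w @ hat z s # t @ [b]) = sg (Suc (length s)) (x (w @ z s # t)) * b" for w s t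
    using rgt_simps(2)[of x "w @ hat z s # t" b] by (simp add: hat_def add)
  then have "(\<lambda>w. sg (length (w @ hat z s # t @ [b])) (rgt x (w @ hat z s # t @ [b])))
    = (\<lambda>w. sg (length w + (length s + length t + 1)) (x (w @ z s # t) * b))" for s t
    by (auto simp: sg_mult_left intro!: sg_cong)
  then have "ins (hat y) (\<lambda>w. sg (length (w @ hat z s # t @ [b])) (rgt x (w @ hat z s # t @ [b]))) p
    = sg (length p + (length s + length t + 1)) (ins y (\<lambda>w. x (w @ z s # t) * b) p)" for s t p
    by (simp only: ins_hat_sg_add[OF sb[OF sa]])
  moreover have i: "ins y (\<lambda>w. \<Phi> w * c) p = ins y \<Phi> p * c" for \<Phi> and c :: 'a and p
    unfolding ins_def S3_def
    by (simp add: additive_spl[of "\<lambda>y. y * c"] distrib_right sg_mult_left)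
  moreover have "(\<lambda>w. sg (length (w @ [hat z s])) (rgt x (w @ [hat z s])))
    = (\<lambda>w. sg (length w + length s) (x w * z s))" for s
    by (auto simp: hat_def sg_mult_right intro!: sg_cong)
  then have "ins (hat y) (\<lambda>w. sg (length (w @ [hat z s])) (rgt x (w @ [hat z s]))) p
     = sg (length p + length s) (ins y x p * z s)" for p s
    by (simp only: ins_hat_sg_add[OF sb[OF assms]] i)
  ultimately have "ins2 (hat y) (hat z) (\<lambda>w. sg (length w) (rgt x w)) as
    = S3 (\<lambda>p s t. sg (length p * Suc (length s) + (length p + (length s + length t + 1)))
        (ins y (\<lambda>w. x (w @ z s # t)) p * b)) bs
    + spl (\<lambda>p s. sg (length p * Suc (length s) + (length p + length s)) (ins y x p * z s)) as"
    unfolding snoc ins2_def S3_snoc by simp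
  also have "S3 (\<lambda>p s t. sg (length p * Suc (length s) + (length p + (length s + length t + 1)))
        (ins y (\<lambda>w. x (w @ z s # t)) p * b)) bs = sg (length as) (rgt (ins2 y z x) as)"
    unfolding snoc rgt_simps ins2_def d S3_sg[symmetric]
    by (rule S3_cong) (auto simp: sg_mult_left intro!: sg_cong)
  also have "spl (\<lambda>p s. sg (length p * Suc (length s) + (length p + length s)) (ins y x p * z s)) as
    = cp (ins y x) (eps z) as"
    unfolding cp_def by (rule spl_cong) (auto simp: eps_def sg_mult_right intro!: sg_cong)
  finally show ?thesis by simp
qed

lemma ins2_add: "ins2 y z (\<lambda>v. \<Phi> v + \<Psi> v) as = ins2 y z \<Phi> as + ins2 y z \<Psi> as"
  and ins2_diff: "ins2 y z (\<lambda>v. \<Phi> v - \<Psi> v) as = ins2 y z \<Phi> as - ins2 y z \<Psi> as"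
  by (simp_all add: ins2_def ins_add ins_diff sg_add sg_diff S3_add S3_diff)

text \<open>The homotopy behind the Poisson rule. For cocycles, inserting the product of
  \<open>y\<close> and \<open>z\<close> into \<open>x\<close> differs by a coboundary, up to signs,
  from the two terms in which one factor is inserted and the other one multiplied.\<close>

lemma diff_ins2:
  assumes "slot_additive x"
  shows "diff (ins2 y z x) as = ins2 (hat y) (hat z) (diff x) as + ins2 (diff y) (hat z) x as
     + ins2 y (diff z) x as + ins (cp y (eps z)) x as - cp (ins y x) (eps z) as
     + S3 (\<lambda>p s t. sg (length p * Suc (length s) + Suc (length s)) (cat (eps y) (\<lambda>w. x (w @ z s # t)) p)) as"
  unfolding diff_def[of "ins2 y z x"] lft_ins2[OF assms] rgt_ins2[OF assms] mrg_ins2[OF assms]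
  by (simp add: diff_def[of x, abs_def] ins2_add ins2_diff algebra_simps)

lemma cat_ins_homogeneous:
  assumes "slot_additive x" and "homogeneous q y" and "homogeneous r z"
  shows "S3 (\<lambda>p s t. sg (length p * Suc (length s) + Suc (length s)) (cat (eps y) (\<lambda>w. x (w @ z s # t)) p)) as
     = sg (q + Suc q * Suc r) (cat y (ins z x) as)"
proof -
  note add = slot_additiveD[OF assms(1)]
  have dl: "c * S3 F bs = S3 (\<lambda>u v w. c * F u v w) bs" for c :: 'a and F bs
    unfolding S3_def by (simp add: additive_spl[of "(*) c"] distrib_left)
  have "S3 (\<lambda>p s t. sg (length p * Suc (length s) + Suc (length s)) (cat (eps y) (\<lambda>w. x (w @ z s # t)) p)) as
    = spl (\<lambda>v r'. S3 (\<lambda>w s t. sg ((length v + length w) * Suc (length s) + Suc (length s) + length v)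
         (y v * x (w @ z s # t))) r') as"
  proof -
    have "S3 (\<lambda>p s t. sg (length p * Suc (length s) + Suc (length s)) (cat (eps y) (\<lambda>w. x (w @ z s # t)) p)) as
      = spl (\<lambda>p r. spl (\<lambda>s t. spl (\<lambda>v w. sg ((length v + length w) * Suc (length s) + Suc (length s) + length v)
         (y v * x (w @ z s # t))) p) r) as"
      unfolding S3_def cat_def spl_sg[symmetric]
      by (intro spl_cong) (auto simp: eps_def sg_mult_left)
    also have "\<dots> = spl (\<lambda>p r. spl (\<lambda>v w. spl (\<lambda>s t. sg ((length v + length w) * Suc (length s) + Suc (length s) + length v)
         (y v * x (w @ z s # t))) r) p) as"
      by (intro spl_cong, rule spl_commute)
    finally show ?thesis unfolding spl_assoc[symmetric] S3_def .
  qed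
  also have "\<dots> = sg (q + Suc q * Suc r) (cat y (ins z x) as)"
    unfolding cat_def spl_sg[symmetric] ins_def dl S3_sg[symmetric]
  proof (intro spl_cong S3_cong, goal_cases)
    case (1 v r' w s t)
    show ?case
    proof (cases "y v = 0 \<or> z s = 0")
      case False
      then have "length v = q" "length s = r"
        using assms(2,3) by (auto dest: homogeneousD)
      then show ?thesis by (auto simp: sg_mult_right intro!: sg_cong)
    qed (auto simp: add)
  qed
  finally show ?thesis .
qed

section \<open>The dual complex and cyclic rotations with a twist\<close>

locale twisted_trace =
  fixes tr :: "'a::ring_1 \<Rightarrow> 'm::ab_group_add" and N :: "'a \<Rightarrow> 'a"
  assumes tr_add: "tr (a + b) = tr a + tr b"
    and N_add: "N (a + b) = N a + N b"
    and N_mult: "N (a * b) = N a * N b"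
    and tr_twist: "tr (a * b) = tr (b * N a)"
begin

lemma tr_0 [simp]: "tr 0 = 0"
  using tr_add[of 0 0] by simp

lemma tr_minus [simp]: "tr (- a) = - tr a"
  using tr_add[of a "- a"] by (simp add: add_eq_0_iff)

lemma tr_diff: "tr (a - b) = tr a - tr b"
  using tr_add[of a "- b"] by simp

lemma tr_sg [simp]: "tr (sg n a) = sg n (tr a)"
  by (simp add: sg_def)

lemma N_0 [simp]: "N 0 = 0"
  using N_add[of 0 0] by simp

lemma N_minus [simp]: "N (- a) = - N a"
  using N_add[of a "- a"] by (simp add: add_eq_0_iff)

lemma N_sg [simp]: "N (sg n a) = sg n (N a)"
  by (simp add: sg_def)

text \<open>A cochain becomes a functional with one more argument, the last entry being paired with
  its value. For a Frobenius form this is the isomorphism of the algebra with its dual.\<close>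

definition form :: "('a list \<Rightarrow> 'a) \<Rightarrow> 'a list \<Rightarrow> 'm" where
  "form f as = (if as = [] then 0 else tr (f (butlast as) * last as))"

lemma form_simps [simp]: "form f [] = 0" "form f (as @ [z]) = tr (f as * z)"
  by (simp_all add: form_def)

text \<open>The Hochschild differential of the dual complex.\<close>

definition cyc_mult :: "('a list \<Rightarrow> 'm) \<Rightarrow> 'a list \<Rightarrow> 'm" where
  "cyc_mult \<phi> as = (if length as < 2 then 0 else \<phi> (butlast (tl as) @ [last as * N (hd as)]))"

definition dual_diff :: "('a list \<Rightarrow> 'm) \<Rightarrow> 'a list \<Rightarrow> 'm" where
  "dual_diff \<phi> as = cyc_mult \<phi> as - mrg \<phi> as"

definition rot :: "('a list \<Rightarrow> 'm) \<Rightarrow> 'a list \<Rightarrow> 'm" where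
  "rot \<phi> as = (if as = [] then 0 else \<phi> (tl as @ [N (hd as)]))"

text \<open>Connes' operator on normalised functionals. For \<open>c v = tr (f v)\<close>, which is
  \<open>form f (v @ [1])\<close>, it sums over the cyclic rotations of the arguments; entries that
  pass the end pick up the twist \<open>N\<close>. The condition \<open>y \<noteq> []\<close>
  excludes the full turn.\<close>

definition cyc :: "('a list \<Rightarrow> 'm) \<Rightarrow> 'a list \<Rightarrow> 'm" where
  "cyc c = spl (\<lambda>x y. if y = [] then 0
      else sg (length x * Suc (length x + length y)) (c (y @ map N x)))"

lemma list_cases2:
  obtains "as = []" | a where "as = [a]" | a us z where "as = a # us @ [z :: 'b]"
  by (cases as; cases "tl as" rule: rev_cases) auto

lemma cyc_mult_simps [simp]: "cyc_mult \<phi> [] = 0" "cyc_mult \<phi> [a] = 0"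
  "cyc_mult \<phi> (a # us @ [z]) = \<phi> (us @ [z * N a])"
  by (simp_all add: cyc_mult_def)

text \<open>The left outer term becomes the wrap-around term of the dual complex by
  \<open>tr_twist\<close>; the right outer term becomes the merge with the last entry.\<close>

lemma form_diff: "form (diff f) as = dual_diff (form f) as"
proof (cases as rule: rev_cases)
  case Nil
  then show ?thesis by (simp add: dual_diff_def)
next
  case (snoc us z)
  have m: "mrg (\<lambda>x. tr (f x * z)) us = tr (mrg f us * z)"
    by (rule additive_mrg[symmetric, of "\<lambda>x. tr (x * z)"]) (simp add: distrib_right tr_add)
  have m': "mrg (form f) as = tr (mrg f us * z)
      - (if us = [] then 0 else sg (length us) (tr (f (butlast us) * (last us * z))))"
    by (auto simp: snoc mrg_append m)
  have "cyc_mult (form f) as = tr (lft f us * z)"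
  proof (cases us)
    case (Cons a us')
    have "tr (a * (f us' * z)) = tr (f us' * z * N a)" by (rule tr_twist)
    then show ?thesis by (simp add: snoc Cons cyc_mult_simps(3) mult.assoc)
  qed (simp add: snoc)
  then have "dual_diff (form f) as = tr (lft f us * z) - (tr (mrg f us * z)
      - (if us = [] then 0 else sg (length us) (tr (f (butlast us) * (last us * z)))))"
    by (simp add: dual_diff_def m')
  moreover have "form (diff f) as = tr (diff f us * z)"
    by (simp add: snoc)
  ultimately show ?thesis
    by (cases us rule: rev_cases)
      (simp_all add: diff_def distrib_right left_diff_distrib tr_add tr_diff sg_mult_left mult.assoc)
qed

lemma mrg_if_Nil: "mrg (\<lambda>v. if v = [] then 0 else F v) v = mrg F v"
  by (cases v; cases "tl v") (auto intro!: mrg_cong)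

text \<open>The right-hand side is the negative of \<open>dual_diff (cyc c) as\<close>. Merges in a
  rotated list \<open>y @ map N x\<close> happen in \<open>y\<close>, in \<open>x\<close> or at the
  junction, and the products \<open>last y * N (hd x)\<close> at the junction are the wrap-around
  products of the dual complex.\<close>

lemma mrg_cyc: "cyc (mrg c) as = mrg (cyc c) as - cyc_mult (cyc c) as"
proof -
  define J where "J x y = (if x = [] \<or> y = [] then 0 else
     sg (length x * Suc (length x + length y) + length y)
       (c (butlast y @ [last y * N (hd x)] @ map N (tl x))))" for x y
  have "mrg (cyc c) as = spl (\<lambda>x y. (if y = [] then 0
      else sg (length x * Suc (length x + length y)) (mrg c (y @ map N x))) + J x y) as"
    unfolding cyc_def mrg_spl
  proof (rule spl_cong, goal_cases)
    case (1 x y)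
    have 1: "mrg (\<lambda>x. if y = [] then 0 else sg (length x * Suc (length x + length y)) (c (y @ map N x))) x
        = (if y = [] then 0 else sg (Suc (length x) * (length x + length y)) (mrg (\<lambda>x. c (y @ map N x)) x))"
      by (auto intro!: mrg_sg_length)
    have "mrg (\<lambda>y. sg (length x * Suc (length x + length y)) (c (y @ map N x))) y
       = sg (length x * (length x + length y)) (mrg (\<lambda>y. c (y @ map N x)) y)"
      by (rule mrg_sg_length) auto
    then show ?case unfolding 1 mrg_if_Nil unfolding mrg_append mrg_map[of N, OF N_mult]
      by (cases x; cases "y = []") (auto simp: J_def sg_def)
  qed
  then have "mrg (cyc c) as = cyc (mrg c) as + spl J as"
    by (simp add: spl_add cyc_def)
  moreover have "spl J as = cyc_mult (cyc c) as"
  proof (cases as rule: list_cases2)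
    case (3 a us z)
    have "spl J as = spl (\<lambda>u v. J (a # u) (v @ [z])) us"
      unfolding 3 by (simp add: spl_snoc J_def)
    also have "\<dots> = cyc c (us @ [z * N a])"
      unfolding cyc_def spl_snoc by (simp add: J_def) (rule spl_cong, auto intro: sg_cong)
    finally show ?thesis by (simp add: 3)
  qed (simp_all add: J_def)
  ultimately show ?thesis by simp
qed

text \<open>One more rotation shifts the sum by one step: up to sign, the trivial rotation is lost
  and the full turn, which has applied \<open>N\<close> to every entry, is gained. This is the
  origin of the operator 1 - \<open>T\<close>.\<close>

lemma cyc_rot:
  "cyc (rot \<phi>) as = sg (Suc (length as)) (cyc \<phi> as - \<phi> as + \<phi> (map N as))" if "as \<noteq> []"
proof -
  define F where "F x a y = sg (length x * Suc (Suc (length x + length y))) (\<phi> (y @ map N (x @ [a])))" for x a y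
  have "cyc (rot \<phi>) as = spl (\<lambda>x y. if y = [] then 0 else F x (hd y) (tl y)) as"
    unfolding cyc_def by (rule spl_cong) (auto simp: F_def rot_def neq_Nil_conv)
  also have "\<dots> = spl (\<lambda>x y. if x = [] then 0 else F (butlast x) (last x) y) as"
    by (rule spl_shift[symmetric])
  also have "\<dots> = spl (\<lambda>x y. sg (Suc (length as)) ((if y = [] then 0
      else sg (length x * Suc (length x + length y)) (\<phi> (y @ map N x)))
      - (if x = [] then \<phi> y else 0) + (if y = [] then \<phi> (map N x) else 0))) as"
  proof (rule spl_cong, goal_cases)
    case (1 x y)
    then show ?case using that
      by (cases x rule: rev_cases) (auto simp: F_def sg_def)
  qed
  also have "\<dots> = sg (Suc (length as)) (cyc \<phi> as - \<phi> as + \<phi> (map N as))"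
    unfolding spl_sg spl_add spl_diff spl_Nil_left spl_Nil_right cyc_def ..
  finally show ?thesis .
qed

lemma cyc_add: "cyc (\<lambda>v. f v + g v) as = cyc f as + cyc g as"
  and cyc_diff: "cyc (\<lambda>v. f v - g v) as = cyc f as - cyc g as"
  and cyc_Nil [simp]: "cyc f [] = 0"
  unfolding cyc_def spl_add[symmetric] spl_diff[symmetric]
  by (auto intro!: spl_cong simp: sg_add sg_diff)

lemma cyc_sg_length: "cyc (\<lambda>v. sg (length v) (f v)) as = sg (length as) (cyc f as)"
  unfolding cyc_def spl_sg[symmetric] by (rule spl_cong) (auto intro: sg_cong)

lemma tr_diff_eq:
  "tr (diff f as) = rot (form f) as - mrg (\<lambda>v. tr (f v)) as + sg (length as) (form f as)"
proof -
  have "mrg (\<lambda>v. tr (f v)) as = tr (mrg f as)"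
    by (rule additive_mrg[symmetric]) (rule tr_add)
  then show ?thesis
    by (auto simp: diff_def tr_add tr_diff rot_def form_def lft_def rgt_def tr_twist[of "hd as"])
qed

lemma cyc_tr_diff:
  "cyc (\<lambda>v. tr (diff f v)) as
     = sg (Suc (length as)) (form f (map N as) - form f as) + dual_diff (cyc (\<lambda>v. tr (f v))) as"
proof (cases "as = []")
  case False
  show ?thesis
    unfolding tr_diff_eq cyc_add cyc_diff cyc_sg_length cyc_rot[OF False] mrg_cyc dual_diff_def
    by (simp add: sg_def)
qed (simp add: dual_diff_def)

text \<open>Insertions that leave the last entry alone, because \<open>form f\<close> pairs that
  entry with the value of \<open>f\<close>. The circle product of cochains corresponds to this
  operation on forms.\<close>

definition insr :: "('a list \<Rightarrow> 'a) \<Rightarrow> ('a list \<Rightarrow> 'm) \<Rightarrow> 'a list \<Rightarrow> 'm" where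
  "insr g \<Phi> = S3 (\<lambda>u v w. if w = [] then 0 else sg (length u * Suc (length v)) (\<Phi> (u @ g v # w)))"

lemma insr_snoc: "insr g \<Phi> (as @ [z]) = ins g (\<lambda>w. \<Phi> (w @ [z])) as"
  by (simp add: insr_def ins_def S3_snoc)

lemma insr_Nil [simp]: "insr g \<Phi> [] = 0"
  by (simp add: insr_def S3_Nil)

lemma insr_eq: "insr g \<Phi> as = ins g \<Phi> as - spl (\<lambda>u v. sg (length u * Suc (length v)) (\<Phi> (u @ [g v]))) as"
  by (cases as rule: rev_cases) (simp_all add: insr_snoc ins_def S3_snoc S3_Nil)

text \<open>When a block ends just before the last entry, the differential of \<Phi> merges the two,
  so that the block moves into the last place. Blocks there do not occur on the left, and the
  additional sum compensates for these merges.\<close>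

lemma mrg_insr:
  assumes "slot_additive \<Phi>" and "\<And>v. diff g v = 0"
  shows "mrg (insr g \<Phi>) as = insr (hat g) (mrg \<Phi>) as
     + (if as = [] then 0 else spl (\<lambda>u v. sg (length u * length v + length v) (\<Phi> (u @ [g v * last as]))) (butlast as))"
proof -
  note add = slot_additiveD[OF assms(1)]
  define L where "L u b v = sg (length u * length v) (\<Phi> (u @ [b * g v]))" for u b v
  define A where "A u v = sg (Suc (length u) * Suc (length v)) (mrg (\<lambda>x. \<Phi> (x @ [g v])) u)" for u v
  define R where "R u v = (if v = [] then 0 else
     sg (length u * length v + length u + length v) (\<Phi> (u @ [g (butlast v) * last v])))" for u v
  have d0: "ins (diff g) \<Phi> as = 0"
    using assms(2) by (simp add: ins_def add S3_def)
  have "mrg (spl (\<lambda>u v. sg (length u * Suc (length v)) (\<Phi> (u @ [g v])))) as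
     = spl (\<lambda>u v. A u v + (if v = [] then 0 else L u (hd v) (tl v)) + R u v) as"
    unfolding mrg_spl
  proof (rule spl_cong, goal_cases)
    case (1 u v)
    have "mrg (\<lambda>x. sg (length x * Suc (length v)) (\<Phi> (x @ [g v]))) u = A u v"
      unfolding A_def by (rule mrg_sg_length) auto
    moreover have "mrg (\<lambda>x. sg (length u * Suc (length x)) (\<Phi> (u @ [g x]))) v
       = sg (length u * length v) (mrg (\<lambda>x. \<Phi> (u @ [g x])) v)"
      by (rule mrg_sg_length) auto
    moreover have "mrg (\<lambda>x. \<Phi> (u @ [g x])) v = \<Phi> (u @ [mrg g v])"
      by (rule additive_mrg[symmetric, of "\<lambda>x. \<Phi> (u @ [x])"]) (rule add)
    moreover have "mrg g v = lft g v + sg (length v) (rgt g v)"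
      using mrg_diff_eq[of g v] assms(2) by simp
    ultimately show ?case
      by (cases "v = []") (auto simp: L_def R_def lft_def rgt_def add sg_add sg_def neq_Nil_conv)
  qed
  also have "\<dots> = spl A as + spl (\<lambda>u v. if u = [] then 0 else L (butlast u) (last u) v) as + spl R as"
    unfolding spl_add spl_shift ..
  finally have 1: "mrg (spl (\<lambda>u v. sg (length u * Suc (length v)) (\<Phi> (u @ [g v])))) as
    = spl A as + spl (\<lambda>u v. if u = [] then 0 else L (butlast u) (last u) v) as + spl R as" .
  have 2: "spl (\<lambda>u v. sg (length u * Suc (length v)) (mrg \<Phi> (u @ [hat g v]))) as
    = spl A as + spl (\<lambda>u v. if u = [] then 0 else L (butlast u) (last u) v) as"
    unfolding spl_add[symmetric]
  proof (rule spl_cong, goal_cases)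
    case (1 u v)
    have "\<Phi> (x @ [y, - g v]) = - \<Phi> (x @ [y, g v])" for x y
      using add(3)[of "x @ [y]" _ "[]"] by simp
    then show ?case
      by (cases u rule: rev_cases)
        (auto simp: mrg_append A_def L_def hat_def add mrg_uminus sg_def)
  qed
  have 3: "spl R as = - (if as = [] then 0 else
     spl (\<lambda>u v. sg (length u * length v + length v) (\<Phi> (u @ [g v * last as]))) (butlast as))"
    by (cases as rule: rev_cases)
      (auto simp: R_def spl_snoc spl_uminus[symmetric] intro!: spl_cong, auto simp: sg_def)
  have "insr g \<Phi> = (\<lambda>as. ins g \<Phi> as - spl (\<lambda>u v. sg (length u * Suc (length v)) (\<Phi> (u @ [g v]))) as)"
    by (rule ext) (rule insr_eq)
  then have "mrg (insr g \<Phi>) as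
      = mrg (ins g \<Phi>) as - mrg (spl (\<lambda>u v. sg (length u * Suc (length v)) (\<Phi> (u @ [g v])))) as"
    by (simp only: mrg_diff)
  then show ?thesis
    unfolding insr_eq[of "hat g"] mrg_ins[OF assms(1)] d0 1 2 3 by simp
qed

lemma insr_cong:
  "(\<And>u v w. u @ v @ w = as \<Longrightarrow> w \<noteq> [] \<Longrightarrow> \<Phi> (u @ g v # w) = \<Psi> (u @ h v # w))
    \<Longrightarrow> insr g \<Phi> as = insr h \<Psi> as"
  unfolding insr_def by (rule S3_cong) simp

lemma insr_add: "insr g (\<lambda>v. \<Phi> v + \<Psi> v) as = insr g \<Phi> as + insr g \<Psi> as"
  and insr_diff: "insr g (\<lambda>v. \<Phi> v - \<Psi> v) as = insr g \<Phi> as - insr g \<Psi> as"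
  and insr_sg: "insr g (\<lambda>v. sg n (\<Phi> v)) as = sg n (insr g \<Phi> as)"
  unfolding insr_def S3_add[symmetric] S3_diff[symmetric] S3_sg[symmetric]
  by (auto intro!: S3_cong sg_cong simp: sg_add sg_diff)

lemma insr_hat_sg:
  assumes "slot_additive \<Phi>"
  shows "insr (hat y) (\<lambda>w. sg (length w) (\<Phi> w)) p = sg (length p) (insr y \<Phi> p)"
  unfolding insr_def S3_sg[symmetric]
  by (rule S3_cong) (auto simp: hat_def slot_additiveD[OF assms] intro!: sg_cong)

lemma mrg_insr_commute: "mrg (\<lambda>x. insr g (\<lambda>w. F w x) y) x = insr g (\<lambda>w. mrg (F w) x) y"
  unfolding insr_def mrg_S3_commute by (intro S3_cong) (auto simp: mrg_sg)

text \<open>Rotate the arguments and insert \<open>g\<close> into the part \<open>y\<close> that has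
  not passed the end, always keeping its last entry. For \<open>c v = tr (f v)\<close> this is the
  chain homotopy of \<open>dual_diff_homotopy_zeta\<close>.\<close>

definition homotopy :: "('a list \<Rightarrow> 'a) \<Rightarrow> ('a list \<Rightarrow> 'm) \<Rightarrow> 'a list \<Rightarrow> 'm" where
  "homotopy g c = spl (\<lambda>x y. sg (length x * Suc (length x + length y))
      (insr g (\<lambda>w. c (w @ map N x)) y))"

definition edge :: "('a list \<Rightarrow> 'a) \<Rightarrow> ('a list \<Rightarrow> 'm) \<Rightarrow> 'a list \<Rightarrow> 'm" where
  "edge g c as = (if as = [] then 0
     else spl (\<lambda>u v. sg (length u * length v + length v) (c (u @ [g v * last as]))) (butlast as))"

lemma dual_diff_homotopy:
  assumes "slot_additive c" and "\<And>v. diff g v = 0"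
  shows "dual_diff (homotopy g c) as = - spl (\<lambda>x y. sg (length x * Suc (length x + length y))
        (insr (hat g) (\<lambda>w. mrg c (w @ map N x)) y)) as
     - spl (\<lambda>x y. sg (length x * Suc (length x + length y)) (edge g (\<lambda>w. c (w @ map N x)) y)) as"
proof -
  note add = slot_additiveD[OF assms(1)]
  have sa: "slot_additive (\<lambda>w. c (w @ t))" for t
    by (rule slot_additive_append[OF assms(1)])
  \<comment> \<open>The products across the junction of \<open>y\<close> and the rotated letters;
    they cancel against the wrap-around term of \<open>dual_diff\<close>.\<close>
  define J where "J x y = (if x = [] then 0 else sg (length x * Suc (length x + length y) + length y)
     (insr g (\<lambda>w. if w = [] then 0 else c (butlast w @ (last w * N (hd x)) # map N (tl x))) y))" for x y
  have "mrg (homotopy g c) as = spl (\<lambda>x y.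
      sg (length x * Suc (length x + length y)) (insr (hat g) (\<lambda>w. mrg c (w @ map N x)) y) + J x y
      + sg (length x * Suc (length x + length y)) (edge g (\<lambda>w. c (w @ map N x)) y)) as"
    unfolding homotopy_def mrg_spl
  proof (rule spl_cong, goal_cases)
    case (1 x y)
    have 1: "mrg (\<lambda>x. sg (length x * Suc (length x + length y)) (insr g (\<lambda>w. c (w @ map N x)) y)) x
      = sg (Suc (length x) * (length x + length y)) (insr g (\<lambda>w. mrg (\<lambda>x. c (w @ map N x)) x) y)"
      unfolding mrg_insr_commute[symmetric] by (rule mrg_sg_length) auto
    have "mrg (\<lambda>y. sg (length x * Suc (length x + length y)) (insr g (\<lambda>w. c (w @ map N x)) y)) y
      = sg (length x * (length x + length y)) (mrg (insr g (\<lambda>w. c (w @ map N x))) y)"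
      by (rule mrg_sg_length) auto
    also have "mrg (insr g (\<lambda>w. c (w @ map N x))) y
        = insr (hat g) (mrg (\<lambda>w. c (w @ map N x))) y + edge g (\<lambda>w. c (w @ map N x)) y"
      unfolding edge_def by (rule mrg_insr[OF sa assms(2)])
    finally have 2: "mrg (\<lambda>y. sg (length x * Suc (length x + length y)) (insr g (\<lambda>w. c (w @ map N x)) y)) y
      = sg (length x * (length x + length y)) (insr (hat g) (mrg (\<lambda>w. c (w @ map N x))) y
          + edge g (\<lambda>w. c (w @ map N x)) y)" .
    have key: "mrg c (w @ map N x) = mrg (\<lambda>w. c (w @ map N x)) w
          - sg (length w) (if x = [] \<or> w = [] then 0 else c (butlast w @ (last w * N (hd x)) # map N (tl x)))
          + sg (length w) (mrg (\<lambda>x. c (w @ map N x)) x)" for w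
      unfolding mrg_append mrg_map[of N, OF N_mult] by (cases x) auto
    have "insr (hat g) (\<lambda>w. mrg c (w @ map N x)) y
       = insr (hat g) (\<lambda>w. mrg (\<lambda>w. c (w @ map N x)) w
          - sg (length w) (if x = [] \<or> w = [] then 0 else c (butlast w @ (last w * N (hd x)) # map N (tl x)))
          + sg (length w) (mrg (\<lambda>x. c (w @ map N x)) x)) y"
      by (simp only: key)
    also have "\<dots> = insr (hat g) (mrg (\<lambda>w. c (w @ map N x))) y
       - sg (length y) (insr g (\<lambda>w. if x = [] \<or> w = [] then 0 else c (butlast w @ (last w * N (hd x)) # map N (tl x))) y)
       + sg (length y) (insr g (\<lambda>w. mrg (\<lambda>x. c (w @ map N x)) x) y)"
    proof -
      have "slot_additive (\<lambda>w. if x = [] \<or> w = [] then 0 else c (butlast w @ (last w * N (hd x)) # map N (tl x)))"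
        using slot_additive_last[OF assms(1), of "N (hd x)" "map N (tl x)"]
        by (cases "x = []") (simp_all add: slot_additive_def)
      moreover have "slot_additive (\<lambda>w. mrg (\<lambda>x. c (w @ map N x)) x)"
        using add(1) by (simp add: slot_additive_def mrg_add)
      ultimately show ?thesis unfolding insr_add insr_diff by (simp only: insr_hat_sg)
    qed
    finally have 3: "insr (hat g) (mrg (\<lambda>w. c (w @ map N x))) y = insr (hat g) (\<lambda>w. mrg c (w @ map N x)) y
       + sg (length y) (insr g (\<lambda>w. if x = [] \<or> w = [] then 0 else c (butlast w @ (last w * N (hd x)) # map N (tl x))) y)
       - sg (length y) (insr g (\<lambda>w. mrg (\<lambda>x. c (w @ map N x)) x) y)"
      by simp
    have z: "insr g (\<lambda>w. 0) y = 0"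
      using insr_diff[of g "\<lambda>w. 0" "\<lambda>w. 0" y] by simp
    show ?case unfolding 1 2 3
      by (cases "x = []") (auto simp: J_def z sg_def)
  qed
  moreover have "cyc_mult (homotopy g c) as = spl J as"
  proof (cases as rule: list_cases2)
    case 1
    then show ?thesis by (simp add: J_def)
  next
    case (2 a)
    then show ?thesis by (simp add: J_def)
  next
    case (3 a us z)
    have "spl J as = spl (\<lambda>u v. J (a # u) (v @ [z])) us"
      unfolding 3 by (simp add: spl_snoc J_def)
    also have "\<dots> = homotopy g c (us @ [z * N a])"
      unfolding homotopy_def spl_snoc
    proof (simp add: insr_snoc, rule spl_cong, goal_cases)
      case (1 u v)
      have i: "insr g (\<lambda>w. if w = [] then 0 else c (butlast w @ (last w * N (hd (a # u))) # map N (tl (a # u)))) (v @ [z])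
        = ins g (\<lambda>w. c (w @ (z * N a) # map N u)) v"
        by (simp add: insr_snoc)
      show ?case using 1 unfolding J_def i
        by (auto intro: sg_cong)
    qed
    finally show ?thesis by (simp add: 3)
  qed
  ultimately show ?thesis by (simp add: dual_diff_def spl_add)
qed

text \<open>The entry that \<open>rot\<close> carries past the end is either the inserted block or
  the first letter of \<open>y\<close>.\<close>

lemma insr_rot:
  assumes "slot_additive \<phi>"
  shows "insr (hat g) (\<lambda>w. rot \<phi> (w @ map N x)) y
    = spl (\<lambda>v w. if w = [] then 0 else sg (Suc (length v)) (\<phi> (w @ map N x @ [N (g v)]))) y
      + (if y = [] then 0 else insr g (\<lambda>w. \<phi> (w @ map N (x @ [hd y]))) (tl y))"
proof (cases y)
  case (Cons a q)
  note add = slot_additiveD[OF assms]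
  have "\<phi> (w @ map N x @ [sg n b]) = sg n (\<phi> (w @ map N x @ [b]))" for w n b
    using add(5)[of "w @ map N x" _ _ "[]"] by simp
  then have "spl (\<lambda>v w. if w = [] then 0 else sg (length ([]::'a list) * Suc (length v)) (rot \<phi> (([] @ hat g v # w) @ map N x))) y
    = spl (\<lambda>v w. if w = [] then 0 else sg (Suc (length v)) (\<phi> (w @ map N x @ [N (g v)]))) y"
    by (intro spl_cong) (auto simp: rot_def hat_def)
  moreover have "S3 (\<lambda>u v w. if w = [] then 0 else sg (length (a # u) * Suc (length v))
      (rot \<phi> (((a # u) @ hat g v # w) @ map N x))) q = insr g (\<lambda>w. \<phi> (w @ map N (x @ [a]))) q"
    unfolding insr_def by (rule S3_cong) (auto simp: rot_def hat_def add intro!: sg_cong)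
  ultimately show ?thesis unfolding Cons insr_def S3_Cons list.sel by (simp only: list.distinct if_False)
qed simp

text \<open>The hypothesis on \<open>mrg c\<close> holds for \<open>c v = tr (f v)\<close> with a
  cocycle \<open>f\<close> and \<open>\<phi> = form f\<close>. It replaces the bar differential by
  one more rotation and a signed copy; these telescope along the cut. What survives is the insertion
  without rotation, the terms where the block itself has passed the end, and the edge terms.\<close>

lemma dual_diff_homotopy_cocycle:
  assumes "slot_additive c" and "slot_additive \<phi>" and "\<And>v. diff g v = 0"
    and "\<And>v. mrg c v = rot \<phi> v + sg (length v) (\<phi> v)"
  shows "dual_diff (homotopy g c) as =
     spl (\<lambda>x y. sg (length x * Suc (length x + length y)) (spl (\<lambda>v w. if w = [] then 0
        else sg (length v) (\<phi> (w @ map N x @ [N (g v)]))) y)) as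
     - sg (length as) (insr g \<phi> as)
     - spl (\<lambda>x y. sg (length x * Suc (length x + length y)) (edge g (\<lambda>w. c (w @ map N x)) y)) as"
proof -
  have sa: "slot_additive (\<lambda>w. \<phi> (w @ t))" for t
    by (rule slot_additive_append[OF assms(2)])
  define Z where "Z x y = sg (length x * Suc (length x + length y)) (spl (\<lambda>v w. if w = [] then 0
        else sg (length v) (\<phi> (w @ map N x @ [N (g v)]))) y)" for x y
  define F where "F x a y = sg (length x * Suc (Suc (length x + length y)))
       (insr g (\<lambda>w. \<phi> (w @ map N (x @ [a]))) y)" for x a y
  have "spl (\<lambda>x y. sg (length x * Suc (length x + length y))
        (insr (hat g) (\<lambda>w. mrg c (w @ map N x)) y)) as
     = spl (\<lambda>x y. - Z x y + (if y = [] then 0 else F x (hd y) (tl y))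
        + sg (length x * Suc (length x + length y) + length x + length y) (insr g (\<lambda>w. \<phi> (w @ map N x)) y)) as"
  proof (rule spl_cong, goal_cases)
    case (1 x y)
    have "insr (hat g) (\<lambda>w. mrg c (w @ map N x)) y
      = insr (hat g) (\<lambda>w. rot \<phi> (w @ map N x) + sg (length x) (sg (length w) (\<phi> (w @ map N x)))) y"
      by (rule insr_cong) (auto simp: assms(4) hat_def intro!: sg_cong)
    also have "\<dots> = insr (hat g) (\<lambda>w. rot \<phi> (w @ map N x)) y
        + sg (length x) (sg (length y) (insr g (\<lambda>w. \<phi> (w @ map N x)) y))"
      by (simp only: insr_add insr_sg insr_hat_sg[OF sa])
    finally have i: "insr (hat g) (\<lambda>w. mrg c (w @ map N x)) y
      = insr (hat g) (\<lambda>w. rot \<phi> (w @ map N x)) y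
        + sg (length x) (sg (length y) (insr g (\<lambda>w. \<phi> (w @ map N x)) y))" .
    have j: "spl (\<lambda>v w. if w = [] then 0 else sg (Suc (length v)) (\<phi> (w @ map N x @ [N (g v)]))) y
      = - spl (\<lambda>v w. if w = [] then 0 else sg (length v) (\<phi> (w @ map N x @ [N (g v)]))) y"
      unfolding spl_uminus[symmetric] by (rule spl_cong) (auto simp: sg_def)
    show ?case unfolding i insr_rot[OF assms(2)] j Z_def F_def
      by (cases y) (simp_all add: sg_add sg_diff sg_uminus add.assoc)
  qed
  also have "\<dots> = - spl Z as + spl (\<lambda>x y. if x = [] then 0 else F (butlast x) (last x) y) as
     + spl (\<lambda>x y. sg (length x * Suc (length x + length y) + length x + length y) (insr g (\<lambda>w. \<phi> (w @ map N x)) y)) as"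
    unfolding spl_add spl_uminus spl_shift ..
  also have "\<dots> = - spl Z as + spl (\<lambda>x y. if x = [] then sg (length y) (insr g \<phi> y) else 0) as"
    unfolding add.assoc spl_add[symmetric] add_left_cancel
  proof (rule spl_cong, goal_cases)
    case (1 x y)
    show ?case by (cases x rule: rev_cases) (auto simp: F_def sg_def)
  qed
  also have "\<dots> = - spl Z as + sg (length as) (insr g \<phi> as)"
    unfolding spl_Nil_left ..
  finally show ?thesis
    unfolding dual_diff_homotopy[OF assms(1,3)] Z_def[symmetric] by simp
qed

end

section \<open>The cyclic sum of a cup product\<close>

lemma spl_append:
  "spl F (us @ vs) = spl (\<lambda>a b. if b = [] then 0 else F a (b @ vs)) us + spl (\<lambda>a b. F (us @ a) b) vs"
  by (induction us arbitrary: F) (auto simp: algebra_simps)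

context twisted_trace begin

text \<open>The part of the cyclic sum of a product in which \<open>f\<close> receives a block of
  letters that have not passed the end, while all rotated letters go to \<open>g\<close>.\<close>

definition zeta :: "('a list \<Rightarrow> 'a) \<Rightarrow> ('a list \<Rightarrow> 'a) \<Rightarrow> 'a list \<Rightarrow> 'm" where
  "zeta f g = spl (\<lambda>x y. sg (length x * Suc (length x + length y))
     (spl (\<lambda>v w. if w = [] then 0 else sg (length v) (tr (f v * g (w @ map N x)))) y))"

lemma tr_spl: "tr (spl F as) = spl (\<lambda>u v. tr (F u v)) as"
  by (rule additive_spl) (rule tr_add)

lemma tr_S3: "tr (S3 F as) = S3 (\<lambda>u v w. tr (F u v w)) as"
  unfolding S3_def by (simp add: tr_spl)

lemma spl_mult_right: "spl F as * (z :: 'b::ring) = spl (\<lambda>u v. F u v * z) as"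
  by (rule additive_spl[of "\<lambda>x. x * z"]) (rule distrib_right)

lemma S3_mult_right: "S3 F as * (z :: 'b::ring) = S3 (\<lambda>u v w. F u v w * z) as"
  unfolding S3_def by (simp add: spl_mult_right)

text \<open>The form of \<open>d\<close> is a sum over rotations. The cut of the cup product and the
  cut of the rotation are interchanged by coassociativity.\<close>

lemma edge_sum:
  assumes "\<And>as. form d as = cyc c as"
  shows "spl (\<lambda>x y. sg (length x * Suc (length x + length y)) (edge g (\<lambda>w. c (w @ map N x)) y)) as
    = form (cp d (eps g)) as"
proof (cases as rule: rev_cases)
  case (snoc bs z)
  have "form (cp d (eps g)) as = spl (\<lambda>s v. sg (length s * length v + length v) (tr (d s * (g v * z)))) bs"
    by (simp add: snoc cp_def eps_def spl_mult_right tr_spl sg_mult_left sg_mult_right mult.assoc)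
  also have "\<dots> = spl (\<lambda>s v. spl (\<lambda>x u. sg ((length x + length u) * length v + length v
        + length x * Suc (Suc (length x + length u))) (c (u @ (g v * z) # map N x))) s) bs"
  proof (rule spl_cong, goal_cases)
    case (1 s v)
    have "tr (d s * (g v * z)) = form d (s @ [g v * z])" by simp
    also have "\<dots> = spl (\<lambda>x u. sg (length x * Suc (Suc (length x + length u))) (c (u @ (g v * z) # map N x))) s"
      unfolding assms cyc_def by (simp add: spl_snoc)
    finally show ?case
      by (simp only: spl_sg[symmetric]) (rule spl_cong, auto intro: sg_cong)
  qed
  also have "\<dots> = spl (\<lambda>x y. spl (\<lambda>u v. sg ((length x + length u) * length v + length v
        + length x * Suc (Suc (length x + length u))) (c (u @ (g v * z) # map N x))) y) bs"
    by (rule spl_assoc[symmetric])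
  also have "\<dots> = spl (\<lambda>x y. sg (length x * Suc (length x + length y)) (edge g (\<lambda>w. c (w @ map N x)) y)) as"
    unfolding snoc spl_snoc
    by (simp add: edge_def spl_sg[symmetric]) (intro spl_cong, auto intro: sg_cong)
  finally show ?thesis ..
qed (simp add: edge_def)

lemma slot_additive_tr: "slot_additive f \<Longrightarrow> slot_additive (\<lambda>v. tr (f v))"
  by (simp add: slot_additive_def tr_add)

lemma slot_additive_form:
  assumes "slot_additive f"
  shows "slot_additive (form f)"
  unfolding slot_additive_def
proof (intro allI)
  fix us vs :: "'a list" and a b :: 'a
  show "form f (us @ (a + b) # vs) = form f (us @ a # vs) + form f (us @ b # vs)"
    using assms by (cases vs rule: rev_cases)
      (auto simp: slot_additive_def form_def butlast_append distrib_right distrib_left tr_add)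
qed

text \<open>Half of the Batalin-Vilkovisky relation, where \<open>d\<close> stands for Delta of
  \<open>f\<close>. In \<open>dual_diff_homotopy_cocycle\<close> the block that has passed the end
  is moved to the front by \<open>tr_twist\<close>, which gives \<open>zeta g f\<close>.\<close>

theorem dual_diff_homotopy_zeta:
  assumes "slot_additive f" and "\<And>v. diff f v = 0" and "\<And>v. diff g v = 0"
    and d: "\<And>as. form d as = cyc (\<lambda>v. tr (f v)) as"
  shows "dual_diff (homotopy g (\<lambda>v. tr (f v))) as
    = zeta g f as - sg (length as) (form (ins g f) as) - form (cp d (eps g)) as"
proof -
  have "mrg (\<lambda>v. tr (f v)) v = rot (form f) v + sg (length v) (form f v)" for v
    using tr_diff_eq[of f v] assms(2) by (simp add: diff_add_eq)
  moreover have "insr g (form f) as = form (ins g f) as"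
  proof (cases as rule: rev_cases)
    case (snoc bs z)
    have "form f (u @ c # w @ [z]) = tr (f (u @ c # w) * z)" for u c w
      using form_simps(2)[of f "u @ c # w" z] by simp
    then have "insr g (form f) as = S3 (\<lambda>u v w. tr (sg (length u * Suc (length v)) (f (u @ g v # w)) * z)) bs"
      unfolding snoc insr_snoc ins_def by (intro S3_cong) (simp add: sg_mult_left)
    then show ?thesis
      unfolding snoc form_simps ins_def S3_mult_right tr_S3 .
  qed simp
  moreover have "form f (w @ map N x @ [N (g v)]) = tr (g v * f (w @ map N x))" for v w x
    using form_simps(2)[of f "w @ map N x" "N (g v)"] by (simp add: tr_twist[symmetric])
  ultimately show ?thesis
    unfolding dual_diff_homotopy_cocycle[OF slot_additive_tr[OF assms(1)] slot_additive_form[OF assms(1)]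
        assms(3) \<open>\<And>v. mrg (\<lambda>v. tr (f v)) v = rot (form f) v + sg (length v) (form f v)\<close>]
      edge_sum[OF d] by (simp only: zeta_def)
qed

text \<open>In a rotated list \<open>y @ map N x\<close> the cut between the arguments of
  \<open>f\<close> and \<open>g\<close> falls into \<open>y\<close> or into \<open>x\<close>. In the
  second case \<open>g\<close> sees only twisted letters; its invariance and \<open>tr_twist\<close>
  bring its untwisted value to the front, where the roles of \<open>f\<close> and \<open>g\<close>
  are exchanged.\<close>

theorem cyc_cp:
  assumes "homogeneous p f" and "homogeneous q g" and "\<And>v. g (map N v) = N (g v)"
  shows "cyc (\<lambda>v. tr (cp f g v)) as = sg (p * q + p) (zeta f g as) + sg q (zeta g f as)"
proof -
  have "cyc (\<lambda>v. tr (cp f g v)) as = spl (\<lambda>x y.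
      spl (\<lambda>v w. if w = [] then 0 else sg (length x * Suc (length x + length y) + length v * (length w + length x))
          (tr (f v * g (w @ map N x)))) y
    + spl (\<lambda>a b. if y = [] then 0 else sg ((length a + length b) * Suc (length a + length b + length y) + (length y + length a) * length b)
          (tr (g b * f (y @ map N a)))) x) as"
    unfolding cyc_def
  proof (rule spl_cong, goal_cases)
    case (1 x y)
    have t: "tr (f (y @ map N a) * N (g b)) = tr (g b * f (y @ map N a))" for a b
      by (simp add: tr_twist[symmetric])
    show ?case
    proof (cases "y = []")
      case False
      have "tr (cp f g (y @ map N x))
       = spl (\<lambda>v w. if w = [] then 0 else sg (length v * (length w + length x)) (tr (f v * g (w @ map N x)))) y
       + spl (\<lambda>a b. sg ((length y + length a) * length b) (tr (g b * f (y @ map N a)))) x"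
        unfolding cp_def spl_append spl_map tr_add tr_spl
        by (intro arg_cong2[of _ _ _ _ "(+)"] spl_cong) (auto simp: assms(3) t)
      then have "sg (length x * Suc (length x + length y)) (tr (cp f g (y @ map N x)))
        = spl (\<lambda>v w. sg (length x * Suc (length x + length y)) (if w = [] then 0
            else sg (length v * (length w + length x)) (tr (f v * g (w @ map N x))))) y
        + spl (\<lambda>a b. sg (length x * Suc (length x + length y))
            (sg ((length y + length a) * length b) (tr (g b * f (y @ map N a))))) x"
        by (simp only: sg_add spl_sg)
      also have "spl (\<lambda>v w. sg (length x * Suc (length x + length y)) (if w = [] then 0
            else sg (length v * (length w + length x)) (tr (f v * g (w @ map N x))))) y
        = spl (\<lambda>v w. if w = [] then 0 else sg (length x * Suc (length x + length y) + length v * (length w + length x))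
          (tr (f v * g (w @ map N x)))) y"
        by (rule spl_cong) auto
      also have "spl (\<lambda>a b. sg (length x * Suc (length x + length y))
            (sg ((length y + length a) * length b) (tr (g b * f (y @ map N a))))) x
        = spl (\<lambda>a b. if y = [] then 0 else sg ((length a + length b) * Suc (length a + length b + length y) + (length y + length a) * length b)
          (tr (g b * f (y @ map N a)))) x"
        using False by (intro spl_cong) auto
      finally show ?thesis using False by simp
    qed simp
  qed
  also have "\<dots> = spl (\<lambda>x y. spl (\<lambda>v w. if w = [] then 0 else
        sg (length x * Suc (length x + length y) + length v * (length w + length x)) (tr (f v * g (w @ map N x)))) y) as
    + spl (\<lambda>a r. spl (\<lambda>b y. if y = [] then 0 else
        sg ((length a + length b) * Suc (length a + length b + length y) + (length y + length a) * length b)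
          (tr (g b * f (y @ map N a)))) r) as"
    unfolding spl_add spl_assoc[symmetric] ..
  also have "spl (\<lambda>x y. spl (\<lambda>v w. if w = [] then 0 else
        sg (length x * Suc (length x + length y) + length v * (length w + length x)) (tr (f v * g (w @ map N x)))) y) as
     = sg (p * q + p) (zeta f g as)"
    unfolding zeta_def spl_sg[symmetric]
  proof (intro spl_cong, goal_cases)
    case (1 x y v w)
    show ?case
    proof (cases "f v = 0 \<or> g (w @ map N x) = 0")
      case False
      then have "length v = p" "length w + length x = q"
        using assms(1) homogeneousD[OF assms(2), of "w @ map N x"] by (auto dest: homogeneousD)
      then show ?thesis by (auto intro!: sg_cong)
    qed auto
  qed
  also have "spl (\<lambda>a r. spl (\<lambda>b y. if y = [] then 0 else
        sg ((length a + length b) * Suc (length a + length b + length y) + (length y + length a) * length b)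
          (tr (g b * f (y @ map N a)))) r) as = sg q (zeta g f as)"
    unfolding zeta_def spl_sg[symmetric]
  proof (intro spl_cong, goal_cases)
    case (1 x y v w)
    show ?case
    proof (cases "g v = 0 \<or> f (w @ map N x) = 0")
      case False
      then have "length v = q" "length w + length x = p"
        using assms(2) homogeneousD[OF assms(1), of "w @ map N x"] by (auto dest: homogeneousD)
      with 1 show ?thesis by (auto intro!: sg_cong)
    qed auto
  qed
  finally show ?thesis .
qed

end

section \<open>Normalised Hochschild cochains\<close>

context k_algebra begin

text \<open>Multilinear and normalised, for all lengths at once, so that the predicate covers the
  total complex. The scalar action \<open>sc\<close> on the target is a parameter because scalar
  forms are treated as well.\<close>

definition ml :: "('k \<Rightarrow> 'm::ab_group_add \<Rightarrow> 'm) \<Rightarrow> ('a list \<Rightarrow> 'm) \<Rightarrow> bool" where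
  "ml sc \<Phi> \<longleftrightarrow> (\<forall>us vs. (\<forall>a b. \<Phi> (us @ (a + b) # vs) = \<Phi> (us @ a # vs) + \<Phi> (us @ b # vs)) \<and>
     (\<forall>c a. \<Phi> (us @ scale c a # vs) = sc c (\<Phi> (us @ a # vs))) \<and> \<Phi> (us @ 1 # vs) = 0)"

lemma mlI:
  assumes "\<And>us vs a b. \<Phi> (us @ (a + b) # vs) = \<Phi> (us @ a # vs) + \<Phi> (us @ b # vs)"
    and "\<And>us vs c a. \<Phi> (us @ scale c a # vs) = sc c (\<Phi> (us @ a # vs))"
    and "\<And>us vs. \<Phi> (us @ 1 # vs) = 0"
  shows "ml sc \<Phi>"
  using assms by (auto simp: ml_def)

lemma mlD:
  assumes "ml sc \<Phi>"
  shows "\<Phi> (us @ (a + b) # vs) = \<Phi> (us @ a # vs) + \<Phi> (us @ b # vs)"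
    and "\<Phi> (us @ scale c a # vs) = sc c (\<Phi> (us @ a # vs))"
    and "\<Phi> (us @ 1 # vs) = 0"
  using assms by (auto simp: ml_def)

lemma ml_slot_additive: "ml sc \<Phi> \<Longrightarrow> slot_additive \<Phi>"
  by (simp add: ml_def slot_additive_def)

context
  fixes sc :: "'k \<Rightarrow> 'm::ab_group_add \<Rightarrow> 'm"
  assumes sc: "Modules.module sc"
begin

interpretation sc: Modules.module sc by (rule sc)

lemma sc_sg: "sc c (sg n x) = sg n (sc c x)"
  by (simp add: sg_def)

lemma sc_spl: "sc c (spl F as) = spl (\<lambda>u v. sc c (F u v)) as"
  by (rule additive_spl) (rule sc.scale_right_distrib)

lemma ml_zero: "ml sc (\<lambda>as. 0)"
  by (simp add: ml_def)

lemma ml_add: "ml sc f \<Longrightarrow> ml sc g \<Longrightarrow> ml sc (\<lambda>as. f as + g as)"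
  by (simp add: ml_def sc.scale_right_distrib)

lemma ml_uminus: "ml sc f \<Longrightarrow> ml sc (\<lambda>as. - f as)"
  by (simp add: ml_def)

lemma ml_minus: "ml sc f \<Longrightarrow> ml sc g \<Longrightarrow> ml sc (\<lambda>as. f as - g as)"
  by (simp add: ml_def sc.scale_right_diff_distrib)

lemma ml_scale: "ml sc f \<Longrightarrow> ml sc (\<lambda>as. sc c (f as))"
  by (simp add: ml_def sc.scale_right_distrib mult.commute)

lemma ml_sg: "ml sc f \<Longrightarrow> ml sc (\<lambda>as. sg (h (length as)) (f as))"
  by (simp add: ml_def sg_add sc_sg)

lemma ml_restrict: "ml sc f \<Longrightarrow> ml sc (\<lambda>as. if P (length as) then f as else 0)"
  by (simp add: ml_def)

lemma ml_append_left: "ml sc f \<Longrightarrow> ml sc (\<lambda>as. f (x @ as))"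
  unfolding ml_def by (metis append.assoc)

lemma ml_append_right: "ml sc f \<Longrightarrow> ml sc (\<lambda>as. f (as @ x))"
  by (simp add: ml_def)

lemma ml_Cons_right: "ml sc f \<Longrightarrow> ml sc (\<lambda>as. f (x @ a # as))"
  using ml_append_left[of f "x @ [a]"] by simp

lemma ml_spl:
  assumes "\<And>v. ml sc (\<lambda>u. F u v)" and "\<And>u. ml sc (F u)"
  shows "ml sc (spl F)"
proof (rule mlI)
  note l = mlD[OF assms(1)] and r = mlD[OF assms(2)]
  have *: "spl (\<lambda>x. F (us @ (a + b) # x)) vs = spl (\<lambda>x. F (us @ a # x)) vs + spl (\<lambda>x. F (us @ b # x)) vs"
    "spl (\<lambda>x. F (us @ scale c a # x)) vs = sc c (spl (\<lambda>x. F (us @ a # x)) vs)"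
    "spl (\<lambda>x. F (us @ 1 # x)) vs = 0" for us vs a b c
    unfolding spl_add[symmetric] sc_spl
    by (rule spl_cong, simp add: l)+ (rule trans[OF spl_cong spl_zero], simp add: l)
  show "spl F (us @ (a + b) # vs) = spl F (us @ a # vs) + spl F (us @ b # vs)" for us vs a b
    unfolding spl_append_Cons by (simp add: * r spl_add)
  show "spl F (us @ scale c a # vs) = sc c (spl F (us @ a # vs))" for us vs c a
    unfolding spl_append_Cons by (simp add: * r sc.scale_right_distrib sc_spl)
  show "spl F (us @ 1 # vs) = 0" for us vs
    unfolding spl_append_Cons by (simp add: * r)
qed

lemma ml_S3:
  assumes "\<And>v w. ml sc (\<lambda>u. F u v w)" and "\<And>u w. ml sc (\<lambda>v. F u v w)" and "\<And>u v. ml sc (F u v)"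
  shows "ml sc (S3 F)"
  unfolding S3_def
proof (rule ml_spl)
  show "ml sc (spl (F u))" for u
    by (rule ml_spl) (use assms in auto)
  show "ml sc (\<lambda>u. spl (F u) v)" for v
  proof (rule mlI)
    note a = mlD[OF assms(1)]
    show "spl (F (us @ (a + b) # vs)) v = spl (F (us @ a # vs)) v + spl (F (us @ b # vs)) v" for us vs a b
      unfolding spl_add[symmetric] by (rule spl_cong) (simp add: a)
    show "spl (F (us @ scale c a # vs)) v = sc c (spl (F (us @ a # vs)) v)" for us vs a c
      unfolding sc_spl by (rule spl_cong) (simp add: a)
    show "spl (F (us @ 1 # vs)) v = 0" for us vs
      by (rule trans[OF spl_cong spl_zero]) (simp add: a)
  qed
qed

lemma ml_map:
  assumes "ml sc f" and "\<And>a b. N (a + b) = N a + N b" and "\<And>c a. N (scale c a) = scale c (N a)" and "N 1 = 1"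
  shows "ml sc (\<lambda>as. f (map N as))"
  using assms by (simp add: ml_def)

lemma ml_ins:
  assumes "ml sc f" and "ml scale g"
  shows "ml sc (ins g f)"
  unfolding ins_def
proof (rule ml_S3)
  show "ml sc (\<lambda>u. sg (length u * Suc (length v)) (f (u @ g v # w)))" for v w
    using ml_sg[OF ml_append_right[OF assms(1), of "g v # w"], of "\<lambda>n. n * Suc (length v)"] by simp
  show "ml sc (\<lambda>w. sg (length u * Suc (length v)) (f (u @ g v # w)))" for u v
    using ml_sg[OF ml_Cons_right[OF assms(1)], of "\<lambda>n. length u * Suc (length v)" u "g v"] by simp
  show "ml sc (\<lambda>v. sg (length u * Suc (length v)) (f (u @ g v # w)))" for u w
  proof (rule ml_sg)
    show "ml sc (\<lambda>v. f (u @ g v # w))"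
      using slot_additiveD[OF ml_slot_additive[OF assms(1)]]
      by (intro mlI) (simp_all add: mlD[OF assms(2)] mlD[OF assms(1)])
  qed
qed

end

lemma module_scale: "Modules.module scale"
  by unfold_locales

lemmas ml_closed = ml_zero[OF module_scale] ml_add[OF module_scale] ml_uminus[OF module_scale]
  ml_minus[OF module_scale] ml_scale[OF module_scale] ml_restrict[OF module_scale]

lemma ml_comp:
  assumes "ml scale f" and "\<And>a b. h (a + b) = h a + h b" and "\<And>c a. h (scale c a) = sc c (h a)"
  shows "ml sc (\<lambda>as. h (f as))"
proof -
  have "h 0 = 0" using assms(2)[of 0 0] by simp
  with assms show ?thesis by (simp add: ml_def)
qed

lemma ml_cp:
  assumes "ml scale f" and "ml scale g"
  shows "ml scale (cp f g)"
  unfolding cp_def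
proof (rule ml_spl[OF module_scale])
  show "ml scale (\<lambda>u. sg (length u * length v) (f u * g v))" for v
    using ml_sg[OF module_scale ml_comp[OF assms(1), of "\<lambda>x. x * g v" scale], of "\<lambda>n. n * length v"]
    by (simp add: distrib_right scale_mult_left)
  show "ml scale (\<lambda>v. sg (length u * length v) (f u * g v))" for u
    using ml_sg[OF module_scale ml_comp[OF assms(2), of "\<lambda>x. f u * x" scale], of "\<lambda>n. length u * n"]
    by (simp add: distrib_left scale_mult_right)
qed

lemma mrg_scale: "mrg (\<lambda>v. scale c (F v)) as = scale c (mrg F as)"
  by (rule additive_mrg[symmetric]) (rule scale_right_distrib)

lemma ml_diff:
  assumes "ml scale f"
  shows "ml scale (diff f)"
proof (rule mlI)
  note f = mlD[OF assms]
  have f0: "f (as @ 0 # bs) = 0" for as bs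
    using f(2)[of as 0] by simp
  have n0: "f ((a + b) # vs) = f (a # vs) + f (b # vs)" "f (scale c a # vs) = scale c (f (a # vs))"
    "f (1 # vs) = 0" for a b c vs
    using f[of "[]"] by simp_all
  have n1: "f (as @ x # (a + b) # vs) = f (as @ x # a # vs) + f (as @ x # b # vs)"
    "f (as @ x # scale c a # vs) = scale c (f (as @ x # a # vs))"
    "f (as @ x # 1 # vs) = 0" for as x a b c vs
    using f[of "as @ [x]"] by simp_all
  have n2: "f (x # as @ (a + b) # vs) = f (x # as @ a # vs) + f (x # as @ b # vs)"
    "f (x # as @ scale c a # vs) = scale c (f (x # as @ a # vs))"
    "f (x # as @ 1 # vs) = 0" for as x a b c vs
    using f[of "x # as"] by simp_all
  show "diff f (us @ (a + b) # vs) = diff f (us @ a # vs) + diff f (us @ b # vs)" for us vs a b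
  proof -
    have "mrg f (us @ (a + b) # vs) = mrg f (us @ a # vs) + mrg f (us @ b # vs)"
      unfolding mrg_append_Cons
      by (auto simp: f distrib_left distrib_right mrg_add sg_add)
    moreover have "lft f (us @ (a + b) # vs) = lft f (us @ a # vs) + lft f (us @ b # vs)"
      by (cases us) (auto simp: f distrib_left distrib_right)
    moreover have "rgt f (us @ (a + b) # vs) = rgt f (us @ a # vs) + rgt f (us @ b # vs)"
      by (cases vs rule: rev_cases) (auto simp: rgt_def butlast_append f distrib_left distrib_right)
    ultimately show ?thesis by (simp add: diff_def sg_add)
  qed
  show "diff f (us @ scale c a # vs) = scale c (diff f (us @ a # vs))" for us vs c a
  proof -
    have "mrg f (us @ scale c a # vs) = scale c (mrg f (us @ a # vs))"
      unfolding mrg_append_Cons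
      by (auto simp: f mrg_scale scale_mult_left scale_mult_right scale_right_distrib
          scale_right_diff_distrib sc_sg[OF module_scale])
    moreover have "lft f (us @ scale c a # vs) = scale c (lft f (us @ a # vs))"
      by (cases us) (auto simp: f scale_mult_left scale_mult_right)
    moreover have "rgt f (us @ scale c a # vs) = scale c (rgt f (us @ a # vs))"
      by (cases vs rule: rev_cases) (auto simp: rgt_def butlast_append f scale_mult_left scale_mult_right)
    ultimately show ?thesis
      by (simp add: diff_def scale_right_distrib scale_right_diff_distrib sc_sg[OF module_scale])
  qed
  \<comment> \<open>An entry 1 merges with its two neighbours to the same shorter list with opposite
    signs; at an end of the list the outer term replaces the missing neighbour.\<close>
  show "diff f (us @ 1 # vs) = 0" for us vs
  proof -
    have "mrg f (us @ 1 # vs) = (if us = [] then 0 else - sg (length us) (f (us @ vs)))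
        + (if vs = [] then 0 else sg (length us) (f (us @ vs)))"
      unfolding mrg_append_Cons using append_butlast_last_id[of us]
      by (auto simp: f simp flip: append.assoc simp del: append_butlast_last_id)
        (metis append.assoc append_Cons append_Nil)+
    moreover have "lft f (us @ 1 # vs) = (if us = [] then f vs else 0)"
      by (cases us) (auto simp: f)
    moreover have "rgt f (us @ 1 # vs) = (if vs = [] then f us else 0)"
      by (cases vs rule: rev_cases) (auto simp: rgt_def butlast_append f)
    ultimately show ?thesis by (simp add: diff_def sg_Suc)
  qed
qed

lemma cochains_iff: "f \<in> cochains scale r \<longleftrightarrow> ml scale f \<and> homogeneous r f"
proof
  assume f: "f \<in> cochains scale r"
  then have h: "homogeneous r f" by (auto simp: cochains_def homogeneous_def)
  have "Vector_Spaces.linear scale scale (\<lambda>a. f (us @ a # vs)) \<and> f (us @ 1 # vs) = 0" for us vs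
  proof (cases "length us + 1 + length vs = r")
    case True
    then have "Vector_Spaces.linear scale scale (\<lambda>a. f (us @ [a] @ vs)) \<and> f (us @ [scale 1 1] @ vs) = 0"
      using f unfolding cochains_def by blast
    then show ?thesis by simp
  next
    case False
    then have "f (us @ a # vs) = 0" for a
      using h by (auto simp: homogeneous_def)
    then show ?thesis
      by (simp add: Vector_Spaces.linear_iff vector_space_axioms)
  qed
  then have "ml scale f"
    unfolding ml_def Vector_Spaces.linear_iff by simp
  with h show "ml scale f \<and> homogeneous r f" by simp
next
  assume f: "ml scale f \<and> homogeneous r f"
  then have "Vector_Spaces.linear scale scale (\<lambda>a. f (us @ [a] @ vs)) \<and> (\<forall>c. f (us @ [scale c 1] @ vs) = 0)" for us vs
    unfolding ml_def Vector_Spaces.linear_iff by (simp add: vector_space_axioms)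
  with f show "f \<in> cochains scale r"
    by (auto simp: cochains_def homogeneous_def)
qed

lemma total_cochains_iff:
  "f \<in> total_cochains scale \<longleftrightarrow> ml scale f \<and> (\<exists>N. \<forall>as. length as > N \<longrightarrow> f as = 0)"
proof -
  have "(\<forall>r. ml scale (\<lambda>as. if length as = r then f as else 0)) \<longleftrightarrow> ml scale f"
  proof
    assume *: "\<forall>r. ml scale (\<lambda>as. if length as = r then f as else 0)"
    show "ml scale f"
    proof (rule mlI)
      show "f (us @ (a + b) # vs) = f (us @ a # vs) + f (us @ b # vs)" for us vs a b
        using mlD(1)[OF *[rule_format, of "length us + Suc (length vs)"], of us a b vs] by simp
      show "f (us @ scale c a # vs) = scale c (f (us @ a # vs))" for us vs c a
        using mlD(2)[OF *[rule_format, of "length us + Suc (length vs)"], of us c a vs] by simp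
      show "f (us @ 1 # vs) = 0" for us vs
        using mlD(3)[OF *[rule_format, of "length us + Suc (length vs)"], of us vs] by simp
    qed
  qed (simp add: ml_restrict[OF module_scale, of _ "\<lambda>n. n = _"])
  then show ?thesis
    unfolding total_cochains_def cochains_iff by (auto simp: homogeneous_def)
qed

end

section \<open>The given operations as sums over decompositions\<close>

lemma hochschild_differential_eq: "hochschild_differential f as = sg (length as) (diff f as)"
proof -
  have m: "mrg F bs = (\<Sum>k<length bs - 1. sg k (F (take k bs @ [bs ! k * bs ! Suc k] @ drop (Suc (Suc k)) bs)))"
    for F :: "'a list \<Rightarrow> 'a" and bs
  proof (induction bs arbitrary: F)
    case (Cons a bs)
    show ?case
    proof (cases bs)
      case (Cons b cs)
      then show ?thesis
        using Cons.IH[of "\<lambda>v. F (a # v)"]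
        by (simp del: sum.lessThan_Suc add: sum.lessThan_Suc_shift sg_Suc sum_negf)
    qed simp
  qed simp
  show ?thesis
  proof (cases "as = []")
    case False
    have "(\<Sum>i = 1..length as - 1. (-1) ^ (length as - i) * f (take (i - 1) as @ [as ! (i - 1) * as ! i] @ drop (i + 1) as))
      = (\<Sum>k<length as - 1. sg (Suc (length as)) (sg k (f (take k as @ [as ! k * as ! Suc k] @ drop (Suc (Suc k)) as))))"
      unfolding One_nat_def sum.atLeast1_atMost_eq
      by (rule sum.cong) (auto simp: minus_one_power_mult intro!: sg_cong)
    also have "\<dots> = sg (Suc (length as)) (mrg f as)"
      unfolding m by (simp add: sg_def sum_negf)
    finally show ?thesis using False
      by (simp add: hochschild_differential_def Let_def diff_def lft_def rgt_def minus_one_power_mult sg_add sg_diff)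
        (simp add: sg_def)
  qed (simp add: hochschild_differential_def diff_def)
qed

lemma cup_eq: "cup f g = cp f g"
  unfolding cup_def[abs_def] cp_def spl_sum hom_cup_def
  by (intro ext sum.cong) (auto simp: minus_one_power_mult min_def)

lemma sgn_pow_mult: "even (nat \<bar>k\<bar>) = even n \<Longrightarrow> sgn_pow k * x = sg n (x :: 'a::ring_1)"
  by (auto simp: sgn_pow_def sg_def)

text \<open>For a list of fixed length, the degree of the outer cochain and the length of the
  inserted block determine each other. Hence summing over degrees and slots is summing over all
  blocks, given by their start i and length j.\<close>

lemma sum_triangle:
  "(\<Sum>n\<le>Suc N. \<Sum>i = 1..n. G (i - 1) (Suc N - n)) = (\<Sum>i\<le>N. \<Sum>j\<le>N - i. G i j)"
  "(\<Sum>n\<le>Suc N. \<Sum>i = 1..Suc N - n. G (i - 1) n) = (\<Sum>i\<le>N. \<Sum>j\<le>N - i. G i j)"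
  for G :: "nat \<Rightarrow> nat \<Rightarrow> 'm::comm_monoid_add"
   apply (subst (1 2) sum.Sigma, simp, simp, simp, simp)
   apply (rule sum.reindex_bij_witness[of _ "\<lambda>(i, j). (Suc N - j, Suc i)" "\<lambda>(n, i). (i - 1, Suc N - n)"]; auto)
  apply (subst (1 2) sum.Sigma, simp, simp, simp, simp)
  apply (rule sum.reindex_bij_witness[of _ "\<lambda>(i, j). (j, Suc i)" "\<lambda>(n, i). (i - 1, n)"]; auto)
  done

text \<open>The second half of the bracket. With |v| = n and outer degree m = |u| + |w| + 1, the
  sign exponent (n - 1)(m - 1) + (n - 1)|u| has the parity of (n - 1)|w|, which can be read off
  without knowing m.\<close>

definition coins :: "('a list \<Rightarrow> 'a) \<Rightarrow> ('a list \<Rightarrow> 'm::ab_group_add) \<Rightarrow> 'a list \<Rightarrow> 'm" where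
  "coins f g = S3 (\<lambda>u v w. sg (length w * Suc (length v)) (g (u @ f v # w)))"

lemma S3_sum:
  "S3 F as = (\<Sum>i\<le>length as. \<Sum>j\<le>length as - i. F (take i as) (take j (drop i as)) (drop (i + j) as))"
  unfolding S3_def spl_sum by (simp add: add.commute)

lemma bracket_eq: "bracket f g as = ins g f as - coins f g as"
proof -
  let ?N = "length as"
  define G1 where "G1 i j = sg (i * Suc j) (f (take i as @ g (take j (drop i as)) # drop (i + j) as))" for i j
  define G2 where "G2 i j = sg ((?N - i - j) * Suc j) (g (take i as @ f (take j (drop i as)) # drop (i + j) as))" for i j
  have "(\<Sum>n\<le>Suc ?N. hom_circ n (Suc ?N - n) f g as)
     = (\<Sum>n\<le>Suc ?N. \<Sum>i = 1..n. G1 (i - 1) (Suc ?N - n))"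
  proof (rule sum.cong, simp, goal_cases)
    case (1 n)
    then have "hom_circ n (Suc ?N - n) f g as = (\<Sum>i = 1..n. sgn_pow ((int (Suc ?N - n) - 1) * (int i - 1)) *
        f (take (i - 1) as @ g (take (Suc ?N - n) (drop (i - 1) as)) # drop ((i - 1) + (Suc ?N - n)) as))"
      by (simp add: hom_circ_def insert_at_def)
    also have "\<dots> = (\<Sum>i = 1..n. G1 (i - 1) (Suc ?N - n))"
      unfolding G1_def by (rule sum.cong, simp, rule sgn_pow_mult) (use 1 in \<open>auto simp: even_nat_iff\<close>)
    finally show ?case .
  qed
  also have "\<dots> = ins g f as"
    unfolding sum_triangle(1)[of G1] unfolding ins_def S3_sum G1_def by (intro sum.cong) (auto simp: min_def)
  finally have 1: "(\<Sum>n\<le>Suc ?N. hom_circ n (Suc ?N - n) f g as) = ins g f as" .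
  have "(\<Sum>n\<le>Suc ?N. sgn_pow ((int n - 1) * (int (Suc ?N - n) - 1)) * hom_circ (Suc ?N - n) n g f as)
     = (\<Sum>n\<le>Suc ?N. \<Sum>i = 1..Suc ?N - n. G2 (i - 1) n)"
  proof (rule sum.cong, simp, goal_cases)
    case (1 n)
    then have "sgn_pow ((int n - 1) * (int (Suc ?N - n) - 1)) * hom_circ (Suc ?N - n) n g f as
      = (\<Sum>i = 1..Suc ?N - n. sgn_pow ((int n - 1) * (int (Suc ?N - n) - 1)) * (sgn_pow ((int n - 1) * (int i - 1)) *
        g (take (i - 1) as @ f (take n (drop (i - 1) as)) # drop ((i - 1) + n) as)))"
      by (simp add: hom_circ_def insert_at_def sum_distrib_left)
    also have "\<dots> = (\<Sum>i = 1..Suc ?N - n. G2 (i - 1) n)"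
      unfolding G2_def by (rule sum.cong, simp) (use 1 in \<open>auto simp: sgn_pow_def sg_def\<close>)
    finally show ?case .
  qed
  also have "\<dots> = coins f g as"
    unfolding sum_triangle(2)[of G2] unfolding coins_def S3_sum G2_def by (intro sum.cong) (auto simp: min_def)
  finally have 2: "(\<Sum>n\<le>Suc ?N. sgn_pow ((int n - 1) * (int (Suc ?N - n) - 1)) * hom_circ (Suc ?N - n) n g f as) = coins f g as" .
  show ?thesis
    unfolding bracket_def hom_bracket_def Suc_eq_plus1[symmetric] sum_subtractf 1 2 ..
qed

lemma coins_homogeneous:
  fixes f g :: "'a::ring_1 list \<Rightarrow> 'a"
  assumes "slot_additive g" and "homogeneous p f" and "homogeneous q g"
  shows "coins f g as = sg (Suc p * Suc q) (ins f g as)"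
  unfolding coins_def ins_def S3_sg[symmetric]
proof (rule S3_cong, goal_cases)
  case (1 u v w)
  show ?case
  proof (cases "f v = 0 \<or> g (u @ f v # w) = 0")
    case False
    then have "length v = p" "length u + 1 + length w = q"
      using assms(2) homogeneousD[OF assms(3), of "u @ f v # w"] by (auto dest: homogeneousD)
    then show ?thesis by (auto intro!: sg_cong)
  qed (auto simp: slot_additiveD[OF assms(1)])
qed

lemma bracket_homogeneous:
  fixes f g :: "'a::ring_1 list \<Rightarrow> 'a"
  assumes "slot_additive g" and "homogeneous p f" and "homogeneous q g"
  shows "bracket f g as = ins g f as - sg (Suc p * Suc q) (ins f g as)"
  by (simp add: bracket_eq coins_homogeneous[OF assms])

lemma S3_zero: "(\<And>u v w. u @ v @ w = as \<Longrightarrow> F u v w = 0) \<Longrightarrow> S3 F as = 0"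
  unfolding S3_def by (rule trans[OF spl_cong spl_zero]) (auto intro: trans[OF spl_cong spl_zero])

lemma homogeneous_ins:
  fixes f g :: "'a::ring_1 list \<Rightarrow> 'a"
  assumes "slot_additive f" and "homogeneous p f" and "homogeneous q g" and "p + q = Suc r"
  shows "homogeneous r (ins g f)"
  unfolding homogeneous_def ins_def
proof (intro allI impI S3_zero, goal_cases)
  case (1 as u v w)
  have "f (u @ g v # w) = 0"
  proof (rule ccontr)
    assume *: "f (u @ g v # w) \<noteq> 0"
    then have "g v \<noteq> 0" using slot_additiveD(2)[OF assms(1)] by metis
    then have "length v = q" using assms(3) by (rule homogeneousD[rotated])
    moreover have "length (u @ g v # w) = p" using homogeneousD[OF assms(2) *] .
    ultimately show False using 1 assms(4) by auto
  qed
  then show ?case by simp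
qed

lemma ins_homogeneous_0: "homogeneous 0 f \<Longrightarrow> ins g f as = 0"
  unfolding ins_def by (rule S3_zero) (simp add: homogeneous_def)

lemma homogeneous_cp:
  assumes "homogeneous p f" and "homogeneous q g"
  shows "homogeneous (p + q) (cp f g)"
  unfolding homogeneous_def cp_def
proof (intro allI impI, goal_cases)
  case (1 as)
  have "f u * g v = 0" if "u @ v = as" for u v
    using that 1 homogeneousD[OF assms(1), of u] homogeneousD[OF assms(2), of v] by force
  then show ?case by (intro trans[OF spl_cong spl_zero]) simp
qed

lemma homogeneous_diff:
  assumes "homogeneous p f"
  shows "homogeneous (Suc p) (diff f)"
  unfolding homogeneous_def
proof (intro allI impI)
  fix as :: "'a list" assume as: "length as \<noteq> Suc p"
  have "mrg f as = mrg (\<lambda>v. 0) as"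
    by (rule mrg_cong) (use as assms in \<open>auto simp: homogeneous_def\<close>)
  then show "diff f as = 0"
    using as assms by (cases as) (auto simp: diff_def lft_def rgt_def homogeneous_def)
qed

lemma diff_plus: "diff (\<lambda>v. f v + g v) as = diff f as + diff g as"
  by (simp add: diff_def lft_def rgt_def mrg_add distrib_left distrib_right sg_add)

lemma diff_uminus: "diff (\<lambda>v. - f v) as = - diff f as"
  by (simp add: diff_def lft_def rgt_def mrg_uminus sg_uminus)

lemma diff_minus: "diff (\<lambda>v. f v - g v) as = diff f as - diff g as"
  using diff_plus[of f "\<lambda>v. - g v" as] by (simp add: diff_uminus)

lemma diff_sg: "diff (\<lambda>v. sg n (f v)) as = sg n (diff f as)"
  by (simp add: sg_def diff_uminus)

lemma diff_zero [simp]: "diff (\<lambda>v. 0) as = 0"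
  by (simp add: diff_def lft_def rgt_def)

lemma diff_restrict: "diff (\<lambda>v. if length v = n then f v else 0) as = (if length as = Suc n then diff f as else 0)"
proof -
  have "mrg (\<lambda>v. if length v = n then f v else 0) as = (if length as = Suc n then mrg f as else 0)"
  proof (cases "length as = Suc n")
    case False
    then have "mrg (\<lambda>v. if length v = n then f v else 0) as = mrg (\<lambda>v. 0) as"
      by (intro mrg_cong) auto
    with False show ?thesis by simp
  qed (auto intro!: mrg_cong)
  then show ?thesis by (cases as) (auto simp: diff_def lft_def rgt_def)
qed

lemma diff_eps: "diff (eps f) as = - sg (length as) (diff f as)"
proof (cases as)
  case (Cons a bs)
  have "mrg (eps f) as = sg (Suc (length as)) (mrg f as)"
    unfolding eps_def[abs_def] by (rule mrg_sg_length) auto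
  then show ?thesis using Cons
    by (simp add: diff_def lft_def rgt_def eps_def sg_mult_left sg_mult_right sg_add sg_diff) (simp add: sg_def)
qed (simp add: diff_def)

lemma ins_add_left:
  fixes f g :: "'a::ring_1 list \<Rightarrow> 'a"
  assumes "slot_additive f"
  shows "ins (\<lambda>v. g v + h v) f as = ins g f as + ins h f as"
  by (simp add: ins_def slot_additiveD[OF assms] sg_add S3_add)

lemma coins_add: "coins f (\<lambda>v. g v + h v) as = coins f g as + coins f h as"
  by (simp add: coins_def sg_add S3_add)

lemma coins_add_left:
  fixes f g :: "'a::ring_1 list \<Rightarrow> 'a"
  assumes "slot_additive f"
  shows "coins (\<lambda>v. g v + h v) f as = coins g f as + coins h f as"
  by (simp add: coins_def slot_additiveD[OF assms] sg_add S3_add)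

lemma bracket_add_right: "slot_additive f \<Longrightarrow> bracket f (\<lambda>v. g v + h v) as = bracket f g as + bracket f h as"
  by (simp add: bracket_eq ins_add_left coins_add)

lemma bracket_add_left: "slot_additive f \<Longrightarrow> bracket (\<lambda>v. g v + h v) f as = bracket g f as + bracket h f as"
  by (simp add: bracket_eq coins_add_left ins_add)

lemma sg_double [simp]: "sg (n + n) x = x"
  by (simp add: sg_def)

lemma spl_zeroI: "(\<And>u v. u @ v = as \<Longrightarrow> F u v = 0) \<Longrightarrow> spl F as = 0"
  by (rule trans[OF spl_cong spl_zero])

lemma cp_homogeneous:
  fixes f g :: "'a::ring_1 list \<Rightarrow> 'a"
  assumes "homogeneous p f" and "homogeneous q g"
  shows "cp f g as = sg (p * q) (cat f g as)" and "cp f (eps g) as = sg (p * q + q) (cat f g as)"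
    and "cat (eps g) f as = sg q (cat g f as)"
proof -
  have *: "sg (length u * length v) (f u * g v) = sg (p * q) (f u * g v)" "eps g v = sg q (g v)" for u v
    using assms by (cases "f u = 0 \<or> g v = 0"; auto simp: homogeneous_def eps_def)+
  show 1: "cp f g as = sg (p * q) (cat f g as)"
    by (simp add: cp_def cat_def * spl_sg)
  show "cat (eps g) f as = sg q (cat g f as)"
    unfolding cat_def * by (simp add: sg_mult_left spl_sg)
  have "cp f (eps g) as = sg q (cp f g as)"
    unfolding cp_def *(2) spl_sg[symmetric] by (simp add: sg_mult_right add.commute)
  then show "cp f (eps g) as = sg (p * q + q) (cat f g as)"
    by (simp add: 1 add.commute)
qed

section \<open>Cocycles and coboundaries of the total complex\<close>

context k_algebra begin

abbreviation "cls \<equiv> coh_class scale"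
abbreviation "tot \<equiv> total_cochains scale"
abbreviation "cyl \<equiv> cocycles scale"
abbreviation "bdy \<equiv> coboundaries scale"

lemma ml_coins:
  assumes "ml scale f" and "ml scale g"
  shows "ml scale (coins g f)"
  unfolding coins_def
proof (rule ml_S3[OF module_scale])
  show "ml scale (\<lambda>u. sg (length w * Suc (length v)) (f (u @ g v # w)))" for v w
    using ml_sg[OF module_scale ml_append_right[OF module_scale assms(1), of "g v # w"], of "\<lambda>n. length w * Suc (length v)"] by simp
  show "ml scale (\<lambda>w. sg (length w * Suc (length v)) (f (u @ g v # w)))" for u v
    using ml_sg[OF module_scale ml_Cons_right[OF module_scale assms(1)], of "\<lambda>n. n * Suc (length v)" u "g v"] by simp
  show "ml scale (\<lambda>v. sg (length w * Suc (length v)) (f (u @ g v # w)))" for u w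
  proof (rule ml_sg[OF module_scale])
    show "ml scale (\<lambda>v. f (u @ g v # w))"
      using slot_additiveD[OF ml_slot_additive[OF assms(1)]]
      by (intro mlI) (simp_all add: mlD[OF assms(2)] mlD[OF assms(1)])
  qed
qed

lemma totD: "f \<in> tot \<Longrightarrow> ml scale f" "f \<in> tot \<Longrightarrow> slot_additive f"
  by (auto simp: total_cochains_iff intro: ml_slot_additive)

lemma tot_homogeneous: "ml scale f \<Longrightarrow> homogeneous n f \<Longrightarrow> f \<in> tot"
  by (auto simp: total_cochains_iff homogeneous_def intro!: exI[of _ n])

lemma tot_add:
  assumes "f \<in> tot" and "g \<in> tot"
  shows "(\<lambda>as. f as + g as) \<in> tot"
proof -
  obtain M N where "\<forall>as. length as > M \<longrightarrow> f as = 0" "\<forall>as. length as > N \<longrightarrow> g as = 0"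
    using assms by (auto simp: total_cochains_iff)
  then have "\<forall>as. length as > max M N \<longrightarrow> f as + g as = 0" by simp
  then show ?thesis using assms unfolding total_cochains_iff by (blast intro: ml_closed)
qed

lemma tot_scale: "f \<in> tot \<Longrightarrow> (\<lambda>as. scale c (f as)) \<in> tot"
  unfolding total_cochains_iff by (metis ml_scale module_scale scale_zero_right)

lemma tot_uminus: "f \<in> tot \<Longrightarrow> (\<lambda>as. - f as) \<in> tot"
  using tot_scale[of f "-1"] by simp

lemma tot_minus: "f \<in> tot \<Longrightarrow> g \<in> tot \<Longrightarrow> (\<lambda>as. f as - g as) \<in> tot"
  using tot_add[of f "\<lambda>as. - g as"] tot_uminus by simp

lemma tot_zero: "(\<lambda>as. 0) \<in> tot"
  using tot_homogeneous[of "\<lambda>as. 0" 0] ml_closed(1) by (simp add: homogeneous_def)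

lemma tot_sg: "f \<in> tot \<Longrightarrow> (\<lambda>as. sg n (f as)) \<in> tot"
  by (cases "even n") (simp_all add: sg_def tot_uminus)

lemma tot_restrict: "f \<in> tot \<Longrightarrow> (\<lambda>as. if P (length as) then f as else 0) \<in> tot"
  unfolding total_cochains_iff using ml_restrict[OF module_scale, of f P] by auto

lemma tot_eps: "f \<in> tot \<Longrightarrow> eps f \<in> tot"
  unfolding total_cochains_iff eps_def[abs_def] using ml_sg[OF module_scale, of f "\<lambda>n. n"] by (metis sg_zero)

lemma tot_diff:
  assumes "f \<in> tot"
  shows "diff f \<in> tot"
proof -
  obtain N where N: "\<forall>as. length as > N \<longrightarrow> f as = 0"
    using assms by (auto simp: total_cochains_iff)
  have "diff f as = 0" if "length as > Suc N" for as
  proof -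
    have "mrg f as = mrg (\<lambda>v. 0) as" by (rule mrg_cong) (use that N in auto)
    then show ?thesis using that N by (auto simp: diff_def lft_def rgt_def)
  qed
  then show ?thesis using assms ml_diff by (auto simp: total_cochains_iff)
qed

lemma tot_cp:
  assumes "f \<in> tot" and "g \<in> tot"
  shows "cp f g \<in> tot"
proof -
  obtain M N where *: "\<forall>as. length as > M \<longrightarrow> f as = 0" "\<forall>as. length as > N \<longrightarrow> g as = 0"
    using assms by (auto simp: total_cochains_iff)
  have "cp f g as = 0" if "length as > M + N" for as
    unfolding cp_def
  proof (rule spl_zeroI)
    fix u v assume "u @ v = as"
    then have "length u > M \<or> length v > N" using that by auto
    then show "sg (length u * length v) (f u * g v) = 0" using * by auto
  qed
  then show ?thesis using assms ml_cp unfolding total_cochains_iff by blast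
qed

lemma bounded_insertion:
  assumes "f \<in> tot" and "g \<in> tot"
  shows "\<exists>K. \<forall>u v w. length (u @ v @ w) > K \<longrightarrow> f (u @ g v # w) = 0"
proof -
  obtain M N where *: "\<forall>as. length as > M \<longrightarrow> f as = 0" "\<forall>as. length as > N \<longrightarrow> g as = 0"
    using assms by (auto simp: total_cochains_iff)
  have "f (u @ g v # w) = 0" if "length (u @ v @ w) > M + N" for u v w
  proof (cases "length v > N")
    case True
    then show ?thesis using * slot_additiveD(2)[OF totD(2)[OF assms(1)]] by simp
  next
    case False
    then show ?thesis using * that by auto
  qed
  then show ?thesis by blast
qed

lemma tot_ins:
  assumes "f \<in> tot" and "g \<in> tot"
  shows "ins g f \<in> tot"
proof -
  obtain K where K: "\<And>u v w. length (u @ v @ w) > K \<Longrightarrow> f (u @ g v # w) = 0"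
    using bounded_insertion[OF assms] by blast
  have "ins g f as = 0" if "length as > K" for as
    unfolding ins_def by (rule S3_zero) (use K that in auto)
  then show ?thesis
    unfolding total_cochains_iff using ml_ins[OF module_scale totD(1)[OF assms(1)] totD(1)[OF assms(2)]] by blast
qed

lemma tot_bracket:
  assumes "f \<in> tot" and "g \<in> tot"
  shows "bracket f g \<in> tot"
proof -
  obtain K where K: "\<And>u v w. length (u @ v @ w) > K \<Longrightarrow> g (u @ f v # w) = 0"
    using bounded_insertion[OF assms(2,1)] by blast
  have "coins f g as = 0" if "length as > K" for as
    unfolding coins_def by (rule S3_zero) (use K that in auto)
  then have "coins f g \<in> tot"
    unfolding total_cochains_iff using ml_coins[OF totD(1)[OF assms(2)] totD(1)[OF assms(1)]] by blast
  with tot_ins[OF assms] show ?thesis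
    unfolding bracket_eq[abs_def] by (rule tot_minus)
qed

lemma cocycles_iff: "f \<in> cyl \<longleftrightarrow> f \<in> tot \<and> diff f = (\<lambda>as. 0)"
proof -
  have "hochschild_differential f = (\<lambda>as. 0) \<longleftrightarrow> diff f = (\<lambda>as. 0)"
    unfolding fun_eq_iff hochschild_differential_eq by (metis sg_eq_iff sg_zero)
  then show ?thesis by (auto simp: cocycles_def)
qed

lemma cyl_diffD: "f \<in> cyl \<Longrightarrow> diff f as = 0"
  by (simp add: cocycles_iff)

lemma cyl_tot: "f \<in> cyl \<Longrightarrow> f \<in> tot"
  by (simp add: cocycles_iff)

text \<open>The two sign conventions have the same image: by \<open>diff_eps\<close> the sign (-1)^n
  moves into the argument, where \<open>h\<close> becomes the negative of
  \<open>eps h\<close>.\<close>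

lemma coboundaries_iff: "f \<in> bdy \<longleftrightarrow> (\<exists>h\<in>tot. f = diff h)"
proof
  assume "f \<in> bdy"
  then obtain h where h: "h \<in> tot" "f = hochschild_differential h"
    by (auto simp: coboundaries_def)
  then have "f = diff (\<lambda>as. - eps h as)"
    by (auto simp: hochschild_differential_eq diff_uminus diff_eps intro!: ext)
  with h show "\<exists>h\<in>tot. f = diff h" by (blast intro: tot_uminus tot_eps)
next
  assume "\<exists>h\<in>tot. f = diff h"
  then obtain h where h: "h \<in> tot" "f = diff h" by auto
  then have "f = hochschild_differential (\<lambda>as. - eps h as)"
    by (auto simp: hochschild_differential_eq diff_uminus diff_eps intro!: ext)
  with h show "f \<in> bdy" unfolding coboundaries_def by (blast intro: tot_uminus tot_eps)
qed

lemma bdyI: "h \<in> tot \<Longrightarrow> (\<And>as. f as = diff h as) \<Longrightarrow> f \<in> bdy"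
  unfolding coboundaries_iff by blast

lemma bdyE:
  assumes "f \<in> bdy"
  obtains h where "h \<in> tot" "f = diff h"
  using assms unfolding coboundaries_iff by blast

lemma bdy_cyl: "f \<in> bdy \<Longrightarrow> f \<in> cyl"
  by (auto elim!: bdyE simp: cocycles_iff tot_diff diff_diff)

lemma bdy_add: "f \<in> bdy \<Longrightarrow> g \<in> bdy \<Longrightarrow> (\<lambda>as. f as + g as) \<in> bdy"
  unfolding coboundaries_iff by (auto simp: diff_plus[symmetric] intro!: bexI tot_add)

lemma diff_scale: "diff (\<lambda>v. scale c (f v)) as = scale c (diff f as)"
  by (simp add: diff_def lft_def rgt_def mrg_scale scale_mult_left scale_mult_right
      scale_right_distrib scale_right_diff_distrib sc_sg[OF module_scale])

lemma bdy_scale: "f \<in> bdy \<Longrightarrow> (\<lambda>as. scale c (f as)) \<in> bdy"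
  unfolding coboundaries_iff by (auto simp: diff_scale[symmetric] intro!: bexI tot_scale)

lemma bdy_uminus: "f \<in> bdy \<Longrightarrow> (\<lambda>as. - f as) \<in> bdy"
  using bdy_scale[of f "-1"] by simp

lemma bdy_minus: "f \<in> bdy \<Longrightarrow> g \<in> bdy \<Longrightarrow> (\<lambda>as. f as - g as) \<in> bdy"
  using bdy_add[of f "\<lambda>as. - g as"] bdy_uminus by simp

lemma bdy_zero: "(\<lambda>as. 0) \<in> bdy"
  using tot_zero by (rule bdyI) simp

lemma bdy_sg: "f \<in> bdy \<Longrightarrow> (\<lambda>as. sg n (f as)) \<in> bdy"
  by (cases "even n") (simp_all add: sg_def bdy_uminus)

lemma cyl_add: "f \<in> cyl \<Longrightarrow> g \<in> cyl \<Longrightarrow> (\<lambda>as. f as + g as) \<in> cyl"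
  by (auto simp: cocycles_iff tot_add diff_plus)

lemma cyl_minus: "f \<in> cyl \<Longrightarrow> g \<in> cyl \<Longrightarrow> (\<lambda>as. f as - g as) \<in> cyl"
  by (auto simp: cocycles_iff tot_minus diff_minus)

lemma cyl_uminus: "f \<in> cyl \<Longrightarrow> (\<lambda>as. - f as) \<in> cyl"
  by (auto simp: cocycles_iff tot_uminus diff_uminus)

lemma cyl_scale: "f \<in> cyl \<Longrightarrow> (\<lambda>as. scale c (f as)) \<in> cyl"
  by (auto simp: cocycles_iff tot_scale diff_scale)

lemma cyl_zero: "(\<lambda>as. 0) \<in> cyl"
  using bdy_zero by (rule bdy_cyl)

lemma cyl_sg: "f \<in> cyl \<Longrightarrow> (\<lambda>as. sg n (f as)) \<in> cyl"
  by (cases "even n") (simp_all add: sg_def cyl_uminus)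

lemma cyl_restrict: "f \<in> cyl \<Longrightarrow> (\<lambda>as. if length as = n then f as else 0) \<in> cyl"
  using tot_restrict[of f "\<lambda>m. m = n"] by (auto simp: cocycles_iff diff_restrict)

lemma cp_zero [simp]: "cp (\<lambda>as. 0) g as = 0" "cp f (\<lambda>as. 0) as = 0"
  by (simp_all add: cp_def)

lemma cyl_cp: "f \<in> cyl \<Longrightarrow> g \<in> cyl \<Longrightarrow> cp f g \<in> cyl"
  by (auto simp: cocycles_iff tot_cp diff_cp)

lemma cp_bdy_right:
  assumes "f \<in> cyl" and "g \<in> bdy"
  shows "cp f g \<in> bdy"
proof -
  obtain h where h: "h \<in> tot" "g = diff h" using assms(2) by (rule bdyE)
  then show ?thesis
    using assms(1) by (intro bdyI[OF tot_cp[of f h]]) (auto simp: cyl_tot diff_cp cocycles_iff)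
qed

lemma cp_bdy_left:
  assumes "f \<in> bdy" and "g \<in> cyl"
  shows "cp f g \<in> bdy"
proof -
  obtain h where h: "h \<in> tot" "f = diff h" using assms(1) by (rule bdyE)
  \<comment> \<open>The Leibniz rule twists the second factor by \<open>eps\<close>, so the
    primitive has to use \<open>eps g\<close>.\<close>
  have "eps (eps g) = g" by (auto simp: eps_def sg_def)
  moreover have "diff (eps g) = (\<lambda>as. 0)" using assms(2) by (auto simp: diff_eps cocycles_iff)
  ultimately show ?thesis
    using h assms(2) by (intro bdyI[OF tot_cp[of h "eps g"]]) (auto simp: tot_eps cyl_tot diff_cp)
qed

text \<open>The component of top length is split off. The closure properties of \<open>S\<close>
  keep all pieces inside it, so the same argument serves cochains and cocycles.\<close>

lemma tot_induct_aux:
  assumes "\<And>f n. f \<in> S \<Longrightarrow> (\<lambda>as. if length as = n then f as else 0) \<in> S"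
    and "\<And>f g. f \<in> S \<Longrightarrow> g \<in> S \<Longrightarrow> (\<lambda>as. f as - g as) \<in> S"
    and "P (\<lambda>as. 0)"
    and "\<And>f g. f \<in> S \<Longrightarrow> g \<in> S \<Longrightarrow> P f \<Longrightarrow> P g \<Longrightarrow> P (\<lambda>as. f as + (g as :: 'a))"
    and "\<And>f n. f \<in> S \<Longrightarrow> homogeneous n f \<Longrightarrow> P f"
  shows "f \<in> S \<Longrightarrow> \<forall>as. length as \<ge> N \<longrightarrow> f as = 0 \<Longrightarrow> P f"
proof (induction N arbitrary: f)
  case 0
  then have "f = (\<lambda>as. 0)" by auto
  then show ?case using assms(3) by simp
next
  case (Suc N)
  let ?g = "\<lambda>as. if length as = N then f as else 0"
  have g: "?g \<in> S" "P ?g"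
    using assms(1)[OF Suc.prems(1), of N] assms(5)[of ?g N] by (auto simp: homogeneous_def)
  let ?h = "\<lambda>as. f as - ?g as"
  have h: "?h \<in> S" using assms(2)[OF Suc.prems(1) g(1)] .
  moreover have "\<forall>as. length as \<ge> N \<longrightarrow> ?h as = 0"
    using Suc.prems(2) by auto
  ultimately have "P ?h" by (rule Suc.IH)
  then have "P (\<lambda>as. ?h as + ?g as)" using assms(4)[OF h g(1)] g(2) by simp
  then show ?case by simp
qed

lemma tot_induct [consumes 1, case_names zero add homogeneous]:
  assumes "f \<in> tot" and "P (\<lambda>as. 0)"
    and "\<And>f g. f \<in> tot \<Longrightarrow> g \<in> tot \<Longrightarrow> P f \<Longrightarrow> P g \<Longrightarrow> P (\<lambda>as. f as + g as)"
    and "\<And>f n. f \<in> tot \<Longrightarrow> homogeneous n f \<Longrightarrow> P f"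
  shows "P f"
proof -
  obtain N where "\<forall>as. length as > N \<longrightarrow> f as = 0"
    using assms(1) by (auto simp: total_cochains_iff)
  then have "\<forall>as. length as \<ge> Suc N \<longrightarrow> f as = 0" by auto
  with assms(1) show ?thesis
    by (rule tot_induct_aux[rotated 5, where S = tot])
      (use assms tot_restrict[of _ "\<lambda>m. m = _"] in \<open>auto intro: tot_minus\<close>)
qed

lemma cyl_induct [consumes 1, case_names zero add homogeneous]:
  assumes "f \<in> cyl" and "P (\<lambda>as. 0)"
    and "\<And>f g. f \<in> cyl \<Longrightarrow> g \<in> cyl \<Longrightarrow> P f \<Longrightarrow> P g \<Longrightarrow> P (\<lambda>as. f as + g as)"
    and "\<And>f n. f \<in> cyl \<Longrightarrow> homogeneous n f \<Longrightarrow> P f"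
  shows "P f"
proof -
  obtain N where "\<forall>as. length as > N \<longrightarrow> f as = 0"
    using cyl_tot[OF assms(1)] by (auto simp: total_cochains_iff)
  then have "\<forall>as. length as \<ge> Suc N \<longrightarrow> f as = 0" by auto
  with assms(1) show ?thesis
    by (rule tot_induct_aux[rotated 5, where S = cyl])
      (use assms cyl_restrict in \<open>auto intro: cyl_minus\<close>)
qed

lemma bracket_zero:
  fixes f :: "'a list \<Rightarrow> 'a"
  assumes "slot_additive f"
  shows "bracket (\<lambda>as. 0) f as = 0" and "bracket f (\<lambda>as. 0) as = 0"
  using bracket_add_left[OF assms, of "\<lambda>as. 0" "\<lambda>as. 0" as]
    bracket_add_right[OF assms, of "\<lambda>as. 0" "\<lambda>as. 0" as] by simp_all

lemma ins_zero_left: fixes f :: "'a list \<Rightarrow> 'a" shows "slot_additive f \<Longrightarrow> ins (\<lambda>as. 0) f as = (0::'a)"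
  using ins_add_left[of f "\<lambda>as. 0" "\<lambda>as. 0" as] by simp

lemma ins_hat_homogeneous:
  fixes f h :: "'a list \<Rightarrow> 'a"
  assumes "slot_additive h" and "homogeneous p f"
  shows "ins (hat f) h as = sg (Suc p) (ins f h as :: 'a)"
  unfolding ins_def S3_sg[symmetric]
proof (rule S3_cong, goal_cases)
  case (1 u v w)
  show ?case
  proof (cases "f v = 0")
    case False
    then show ?thesis using homogeneousD[OF assms(2)] 
      by (auto simp: hat_def slot_additiveD[OF assms(1)] intro!: sg_cong)
  qed (auto simp: hat_def slot_additiveD[OF assms(1)])
qed

text \<open>By \<open>diff_ins\<close> each of the two circle products commutes with the
  differential up to sign and up to a commutator of \<open>f\<close> and \<open>h\<close>. The sign
  of the bracket makes the two commutators cancel.\<close>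

lemma bracket_diff:
  assumes f: "f \<in> cyl" and h: "h \<in> tot"
  shows "bracket f (diff h) as = diff (bracket f h) as"
  using f
proof (induction f rule: cyl_induct)
  case zero
  have "bracket (\<lambda>as. 0) h = (\<lambda>as. 0)"
    using bracket_zero[OF totD(2)[OF h]] by (auto intro!: ext)
  then show ?case using bracket_zero[OF totD(2)[OF tot_diff[OF h]]] by simp
next
  case (add f g)
  note sa = totD(2)[OF h] totD(2)[OF tot_diff[OF h]]
  have "bracket (\<lambda>as. f as + g as) h = (\<lambda>as. bracket f h as + bracket g h as)"
    using bracket_add_left[OF sa(1)] by auto
  then show ?case using add by (simp add: bracket_add_left[OF sa(2)] diff_plus)
next
  case (homogeneous f p)
  note fa = totD(2)[OF cyl_tot[OF homogeneous(1)]]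
  have f0: "diff f = (\<lambda>as. 0)" using homogeneous by (simp add: cocycles_iff)
  show ?case using h
  proof (induction h rule: tot_induct)
    case zero
    have "bracket f (\<lambda>as. 0) = (\<lambda>as. 0)" "diff (\<lambda>as. 0) = (\<lambda>as. 0::'a)"
      using bracket_zero[OF fa] by (auto intro!: ext)
    then show ?case by simp
  next
    case (add g h)
    have "bracket f (\<lambda>as. g as + h as) = (\<lambda>as. bracket f g as + bracket f h as)"
      "diff (\<lambda>as. g as + h as) = (\<lambda>as. diff g as + diff h as)"
      by (auto simp: bracket_add_right[OF fa] diff_plus intro!: ext)
    then show ?case using add by (simp add: bracket_add_right[OF fa] diff_plus)
  next
    case h: (homogeneous h q)
    note ha = totD(2)[OF h(1)] and da = totD(2)[OF tot_diff[OF h(1)]]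
    have b: "bracket f h = (\<lambda>as. ins h f as - sg (Suc p * Suc q) (ins f h as))"
      using bracket_homogeneous[OF ha homogeneous(2) h(2)] by auto
    have "diff (ins h f) as = ins (diff h) f as + sg q (cat h f as) - sg (p * q + q) (cat f h as)"
      unfolding diff_ins[OF fa] f0 cp_homogeneous(2,3)[OF homogeneous(2) h(2)] by simp
    moreover have "diff (ins f h) as = sg (Suc p) (ins f (diff h) as) + sg p (cat f h as) - sg (q * p + p) (cat h f as)"
      unfolding diff_ins[OF ha] f0 cp_homogeneous(2,3)[OF h(2) homogeneous(2)]
        ins_hat_homogeneous[OF da homogeneous(2)] ins_zero_left[OF ha] by simp
    ultimately show ?case
      unfolding b diff_minus diff_sg bracket_homogeneous[OF da homogeneous(2) homogeneous_diff[OF h(2)]]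
      by (auto simp: sg_add sg_diff sg_def)
  qed
qed

lemma cyl_bracket: "f \<in> cyl \<Longrightarrow> g \<in> cyl \<Longrightarrow> bracket f g \<in> cyl"
  using bracket_diff[of f g] bracket_zero(2)[OF totD(2)[OF cyl_tot[of f]]]
  by (auto simp: cocycles_iff tot_bracket intro!: ext)

lemma bracket_bdy_right:
  assumes "f \<in> cyl" and "g \<in> bdy"
  shows "bracket f g \<in> bdy"
proof -
  obtain h where h: "h \<in> tot" "g = diff h" using assms(2) by (rule bdyE)
  then show ?thesis
    using assms(1) by (intro bdyI[OF tot_bracket[of f h]]) (auto simp: cyl_tot bracket_diff)
qed

lemma bracket_antisym:
  fixes f g :: "'a list \<Rightarrow> 'a"
  assumes "slot_additive f" and "slot_additive g" and "homogeneous p f" and "homogeneous q g"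
  shows "bracket f g as = - sg (Suc p * Suc q) (bracket g f as :: 'a)"
  unfolding bracket_homogeneous[OF assms(2,3,4)] bracket_homogeneous[OF assms(1,4,3)]
  by (cases "even p"; cases "even q") (simp_all add: sg_def)

text \<open>Reduced to \<open>bracket_bdy_right\<close> by antisymmetry. The sign there depends on
  both degrees, hence the double induction down to homogeneous cochains.\<close>

lemma bracket_bdy_left:
  assumes f: "f \<in> cyl" and g: "g \<in> bdy"
  shows "bracket g f \<in> bdy"
proof -
  obtain h where h: "h \<in> tot" "g = diff h" using g by (rule bdyE)
  have "bracket (diff h) f \<in> bdy" using f
  proof (induction f rule: cyl_induct)
    case zero
    have "bracket (diff h) (\<lambda>as. 0) = (\<lambda>as. 0)"
      using bracket_zero[OF totD(2)[OF tot_diff[OF h(1)]]] by auto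
    then show ?case using bdy_zero by simp
  next
    case (add f g)
    have "bracket (diff h) (\<lambda>as. f as + g as) = (\<lambda>as. bracket (diff h) f as + bracket (diff h) g as)"
      using bracket_add_right[OF totD(2)[OF tot_diff[OF h(1)]]] by auto
    then show ?case using add bdy_add by simp
  next
    case (homogeneous f p)
    note fa = totD(2)[OF cyl_tot[OF homogeneous(1)]]
    show ?case using h(1)
    proof (induction h rule: tot_induct)
      case zero
      have "bracket (\<lambda>as. 0) f = (\<lambda>as. 0)" "diff (\<lambda>as. 0) = (\<lambda>as. 0::'a)"
        using bracket_zero[OF fa] by (auto intro!: ext)
      then show ?case using bdy_zero by simp
    next
      case (add g h)
      have "diff (\<lambda>as. g as + h as) = (\<lambda>as. diff g as + diff h as)"
        by (auto simp: diff_plus intro!: ext)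
      then have "bracket (diff (\<lambda>as. g as + h as)) f = (\<lambda>as. bracket (diff g) f as + bracket (diff h) f as)"
        using bracket_add_left[OF fa] by auto
      then show ?case using add bdy_add by simp
    next
      case h: (homogeneous h q)
      have "bracket (diff h) f = (\<lambda>as. - sg (Suc (Suc q) * Suc p) (bracket f (diff h) as))"
        using bracket_antisym[OF totD(2)[OF tot_diff[OF h(1)]] fa homogeneous_diff[OF h(2)] homogeneous(2)] by auto
      moreover have "bracket f (diff h) \<in> bdy"
        using bracket_bdy_right[OF homogeneous(1)] h(1) by (auto intro: bdyI)
      ultimately show ?case using bdy_uminus[OF bdy_sg] by simp
    qed
  qed
  then show ?thesis using h by simp
qed

end

section \<open>Hochschild cohomology as a Gerstenhaber algebra\<close>

context k_algebra begin

lemma mem_cls: "g \<in> cls f \<longleftrightarrow> (\<lambda>as. g as - f as) \<in> bdy"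
proof
  assume "(\<lambda>as. g as - f as) \<in> bdy"
  then show "g \<in> cls f"
    unfolding coh_class_def by (intro CollectI exI[of _ "\<lambda>as. g as - f as"]) auto
qed (auto simp: coh_class_def)

lemma cls_self: "f \<in> cls f"
  by (simp add: mem_cls bdy_zero)

lemma cls_eq_iff: "cls f = cls g \<longleftrightarrow> (\<lambda>as. f as - g as) \<in> bdy"
proof
  show "(\<lambda>as. f as - g as) \<in> bdy" if "cls f = cls g"
    using cls_self[of f] that by (simp add: mem_cls)
next
  assume fg: "(\<lambda>as. f as - g as) \<in> bdy"
  show "cls f = cls g"
  proof (intro Set.set_eqI iffI)
    fix h
    show "h \<in> cls g" if "h \<in> cls f"
      using bdy_add[OF that[unfolded mem_cls] fg] by (simp add: mem_cls)
    show "h \<in> cls f" if "h \<in> cls g"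
      using bdy_minus[OF that[unfolded mem_cls] fg] by (simp add: mem_cls)
  qed
qed

lemmas cls_eqI = cls_eq_iff[THEN iffD2]

text \<open>The operations of \<open>HH\<close> are unions over representatives. Such a union is a
  single class once a change of representative alters the result by a coboundary.\<close>

lemma cls_Union:
  assumes "\<And>h. h \<in> bdy \<Longrightarrow> (\<lambda>as. F (\<lambda>as. f as + h as) as - F f as) \<in> bdy"
  shows "(\<Union>f'\<in>cls f. cls (F f')) = cls (F f)"
proof -
  have "cls (F f') = cls (F f)" if "f' \<in> cls f" for f'
    using that assms by (auto simp: coh_class_def[of _ f] cls_eq_iff)
  then show ?thesis using cls_self[of f] by blast
qed

lemma cls_Union2:
  assumes "\<And>h k. h \<in> bdy \<Longrightarrow> k \<in> bdy \<Longrightarrow>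
    (\<lambda>as. F (\<lambda>as. f as + h as) (\<lambda>as. g as + k as) as - F f g as) \<in> bdy"
  shows "(\<Union>f'\<in>cls f. \<Union>g'\<in>cls g. cls (F f' g')) = cls (F f g)"
proof -
  have "cls (F f' g') = cls (F f g)" if "f' \<in> cls f" "g' \<in> cls g" for f' g'
    using that assms by (auto simp: coh_class_def[of _ f] coh_class_def[of _ g] cls_eq_iff)
  then show ?thesis using cls_self[of f] cls_self[of g] by blast
qed

abbreviation HHk (\<open>\<H>\<close>) where "HHk \<equiv> HH scale"

lemma HH_carrier: "carrier \<H> = cls ` cyl"
  by (simp add: HH_def)

lemma HH_zero: "\<zero>\<^bsub>\<H>\<^esub> = cls (\<lambda>as. 0)"
  by (simp add: HH_def)

lemma HH_one: "\<one>\<^bsub>\<H>\<^esub> = cls (\<lambda>as. if as = [] then 1 else 0)"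
  by (simp add: HH_def)

lemma HH_add: "cls f \<oplus>\<^bsub>\<H>\<^esub> cls g = cls (\<lambda>as. f as + g as)"
  unfolding HH_def by (simp, rule cls_Union2) (auto simp: algebra_simps intro: bdy_add)

lemma HH_smult: "c \<odot>\<^bsub>\<H>\<^esub> cls f = cls (\<lambda>as. scale c (f as))"
  unfolding HH_def by (simp, rule cls_Union) (auto simp: scale_right_distrib intro: bdy_scale)

lemma HH_mult:
  assumes "f \<in> cyl" and "g \<in> cyl"
  shows "cls f \<otimes>\<^bsub>\<H>\<^esub> cls g = cls (cp f g)"
  unfolding HH_def cup_eq
proof (simp, rule cls_Union2)
  fix h k assume hk: "h \<in> bdy" "k \<in> bdy"
  then have "(\<lambda>as. cp f k as + cp h (\<lambda>as. g as + k as) as) \<in> bdy"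
    using assms bdy_cyl[OF hk(2)] by (intro bdy_add cp_bdy_right cp_bdy_left cyl_add)
  then show "(\<lambda>as. cp (\<lambda>as. f as + h as) (\<lambda>as. g as + k as) as - cp f g as) \<in> bdy"
    by (simp add: cp_add_left cp_add_right algebra_simps)
qed

lemma HH_bracket_cls:
  assumes "f \<in> cyl" and "g \<in> cyl"
  shows "HH_bracket scale (cls f) (cls g) = cls (bracket f g)"
  unfolding HH_bracket_def
proof (rule cls_Union2)
  fix h k assume hk: "h \<in> bdy" "k \<in> bdy"
  then have "(\<lambda>as. bracket f k as + bracket h (\<lambda>as. g as + k as) as) \<in> bdy"
    using assms bdy_cyl[OF hk(2)] by (intro bdy_add bracket_bdy_right bracket_bdy_left cyl_add)
  moreover have "slot_additive f" "slot_additive (\<lambda>as. g as + k as)"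
    using assms bdy_cyl[OF hk(2)] by (auto intro!: totD(2) cyl_tot cyl_add)
  ultimately show "(\<lambda>as. bracket (\<lambda>as. f as + h as) (\<lambda>as. g as + k as) as - bracket f g as) \<in> bdy"
    by (simp add: bracket_add_left bracket_add_right add.assoc)
qed

lemma one_cyl: "(\<lambda>as. if as = [] then 1 else 0) \<in> cyl"
proof -
  have "ml scale (\<lambda>as. if as = [] then 1 else 0)"
    by (rule mlI) auto
  then have "(\<lambda>as. if as = [] then 1 else 0) \<in> tot"
    by (rule tot_homogeneous[of _ 0]) (simp add: homogeneous_def)
  moreover have "diff (\<lambda>as. if as = [] then 1 else 0) as = 0" for as :: "'a list"
  proof (cases "length as = 1")
    case True
    then show ?thesis by (cases as) (auto simp: diff_def lft_def rgt_def sg_def)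
  next
    case False
    then have "mrg (\<lambda>as. if as = [] then 1 else 0) as = mrg (\<lambda>as. 0::'a) as"
      by (intro mrg_cong) auto
    with False show ?thesis
      by (cases as; cases "tl as") (auto simp: diff_def lft_def rgt_def)
  qed
  ultimately show ?thesis by (auto simp: cocycles_iff)
qed

lemma cp_one_left: "cp (\<lambda>as. if as = [] then 1 else 0) f as = f as"
proof -
  have "cp (\<lambda>as. if as = [] then 1 else 0) f as = spl (\<lambda>u v. if u = [] then f v else 0) as"
    unfolding cp_def by (rule spl_cong) auto
  then show ?thesis by (simp add: spl_Nil_left)
qed

lemma cp_one_right: "cp f (\<lambda>as. if as = [] then 1 else 0) as = f as"
proof -
  have "cp f (\<lambda>as. if as = [] then 1 else 0) as = spl (\<lambda>u v. if v = [] then f u else 0) as"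
    unfolding cp_def by (rule spl_cong) auto
  then show ?thesis by (simp add: spl_Nil_right)
qed

lemma cp_assoc:
  fixes f g h :: "'a list \<Rightarrow> 'a"
  shows "cp (cp f g) h as = cp f (cp g h) as"
proof -
  have l: "x * spl F bs = spl (\<lambda>u v. x * F u v) bs" for x :: 'a and F and bs :: "'a list"
    by (rule additive_spl) (rule distrib_left)
  have r: "spl F bs * x = spl (\<lambda>u v. F u v * x) bs" for x :: 'a and F bs
    by (rule additive_spl[of "\<lambda>y. y * x"]) (rule distrib_right)
  have "cp (cp f g) h as = spl (\<lambda>p w. spl (\<lambda>u v. sg ((length u + length v) * length w + length u * length v) (f u * g v * h w)) p) as"
    unfolding cp_def by (intro spl_cong) (auto simp: sg_mult_left r spl_sg[symmetric] intro!: spl_cong sg_cong)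
  also have "\<dots> = spl (\<lambda>u q. spl (\<lambda>v w. sg ((length u + length v) * length w + length u * length v) (f u * g v * h w)) q) as"
    by (rule spl_assoc[symmetric])
  also have "\<dots> = cp f (cp g h) as"
    unfolding cp_def
    by (intro spl_cong) (auto simp: l spl_sg[symmetric] sg_mult_right mult.assoc intro!: spl_cong sg_cong)
  finally show ?thesis .
qed

lemma abelian_group_HH: "abelian_group \<H>"
proof (rule abelian_groupI, unfold HH_carrier HH_zero, goal_cases)
  case (1 x y)
  then show ?case by (auto simp: HH_add intro!: imageI cyl_add)
next
  case 2
  then show ?case using cyl_zero by auto
next
  case (3 x y z)
  then show ?case by (auto simp: HH_add add.assoc)
next
  case (4 x y)
  then show ?case by (auto simp: HH_add add.commute)
next
  case (5 x)
  then show ?case by (auto simp: HH_add)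
next
  case (6 x)
  then obtain f where f: "f \<in> cyl" "x = cls f" by auto
  then show ?case
    by (intro bexI[of _ "cls (\<lambda>as. - f as)"]) (auto simp: HH_add cyl_uminus)
qed

lemma monoid_HH: "Group.monoid \<H>"
proof (rule monoidI, unfold HH_carrier HH_one, goal_cases)
  case (1 x y)
  then show ?case by (auto simp: HH_mult intro!: imageI cyl_cp)
next
  case 2
  then show ?case using one_cyl by auto
next
  case (3 x y z)
  then show ?case by (auto simp: HH_mult cyl_cp cp_assoc[abs_def])
next
  case (4 x)
  then show ?case using one_cyl by (auto simp: HH_mult cp_one_left[abs_def])
next
  case (5 x)
  then show ?case using one_cyl by (auto simp: HH_mult cp_one_right[abs_def])
qed

lemma ring_HH: "Ring.ring \<H>"
proof (rule ringI[OF abelian_group_HH monoid_HH], unfold HH_carrier, goal_cases)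
  case (1 x y z)
  then show ?case by (auto simp: HH_mult HH_add cyl_cp cyl_add cp_add_left[abs_def])
next
  case (2 x y z)
  then show ?case by (auto simp: HH_mult HH_add cyl_cp cyl_add cp_add_right[abs_def])
qed

abbreviation Kr (\<open>\<K>\<close>) where "Kr \<equiv> (ring_of_type_algebra :: 'k ring)"

lemma module_HH: "Module.module \<K> \<H>"
proof (rule moduleI[OF cring_from_type_algebra abelian_group_HH], unfold HH_carrier, goal_cases)
  case (1 a x)
  then show ?case by (auto simp: HH_smult intro!: imageI cyl_scale)
next
  case (2 a b x)
  then show ?case by (auto simp: HH_smult HH_add ring_of_type_algebra_def scale_left_distrib)
next
  case (3 a x y)
  then show ?case by (auto simp: HH_smult HH_add scale_right_distrib)
next
  case (4 a b x)
  then show ?case by (auto simp: HH_smult ring_of_type_algebra_def)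
next
  case (5 x)
  then show ?case by (auto simp: HH_smult ring_of_type_algebra_def)
qed

lemma HH_uminus: "f \<in> cyl \<Longrightarrow> \<ominus>\<^bsub>\<H>\<^esub> cls f = cls (\<lambda>as. - f as)"
  by (rule abelian_group.minus_equality[OF abelian_group_HH])
    (auto simp: HH_add HH_carrier HH_zero cyl_uminus)

lemma HH_minus: "f \<in> cyl \<Longrightarrow> g \<in> cyl \<Longrightarrow> cls f \<ominus>\<^bsub>\<H>\<^esub> cls g = cls (\<lambda>as. f as - g as)"
  by (simp add: a_minus_def HH_uminus HH_add)

lemma HH_with_sign: "f \<in> cyl \<Longrightarrow> even n = even k \<Longrightarrow> with_sign \<H> n (cls f) = cls (\<lambda>as. sg k (f as))"
  by (simp add: with_sign_def HH_uminus sg_def)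

text \<open>Homogeneity in an integer degree, since the bracket of two elements of degree 0 has
  degree -1. In negative degrees only the zero cochain is left.\<close>

definition homI :: "int \<Rightarrow> ('a list \<Rightarrow> 'a) \<Rightarrow> bool" where
  "homI p f \<longleftrightarrow> (\<forall>as. int (length as) \<noteq> p \<longrightarrow> f as = 0)"

lemma homI_int: "homI (int n) f \<longleftrightarrow> homogeneous n f"
  by (simp add: homI_def homogeneous_def)

text \<open>In negative degrees both sides only contain the zero cochain.\<close>

lemma homI_homogeneous: "homI p f \<Longrightarrow> homogeneous (nat \<bar>p\<bar>) f"
  by (auto simp: homI_def homogeneous_def)

lemma HH_deg_iff: "x \<in> HH_deg scale p \<longleftrightarrow> (\<exists>f\<in>cyl. homI p f \<and> x = cls f)"
proof (cases "p < 0")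
  case True
  then have "homI p f \<longleftrightarrow> f = (\<lambda>as. 0)" for f
    by (auto simp: homI_def)
  then show ?thesis using True cyl_zero by (auto simp: HH_deg_def HH_zero)
next
  case False
  then obtain n where p: "p = int n" by (metis nonneg_int_cases linorder_not_less)
  have "cyl \<inter> cochains scale n = {f \<in> cyl. homogeneous n f}"
    using totD(1)[OF cyl_tot] by (auto simp: cochains_iff)
  then show ?thesis by (auto simp: HH_deg_def p homI_int)
qed

lemma homI_zero_add_scale:
  "homI p (\<lambda>as. 0)" "homI p f \<Longrightarrow> homI p g \<Longrightarrow> homI p (\<lambda>as. f as + g as)"
  "homI p f \<Longrightarrow> homI p (\<lambda>as. scale c (f as))" "homI p f \<Longrightarrow> homI p (\<lambda>as. - f as)"
  by (auto simp: homI_def)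

lemma homI_cases:
  assumes "homI p f"
  obtains n where "p = int n" "homogeneous n f" | "p < 0" "f = (\<lambda>as. 0)"
proof (cases "p < 0")
  case True
  then show ?thesis using assms that(2) by (auto simp: homI_def)
next
  case False
  then obtain n where "p = int n" by (metis nonneg_int_cases linorder_not_less)
  then show ?thesis using assms that(1) by (auto simp: homI_int)
qed

lemma homI_cp:
  assumes "homI p f" and "homI q g"
  shows "homI (p + q) (cp f g)"
proof (cases rule: homI_cases[OF assms(1)])
  case (1 m)
  note m = this
  show ?thesis
  proof (cases rule: homI_cases[OF assms(2)])
    case (1 n)
    then show ?thesis using homogeneous_cp[OF m(2) 1(2)] m(1)
      by (simp add: homI_int flip: of_nat_add)
  qed (simp add: homI_def)
qed (simp add: homI_def)

lemma homI_ins: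
  fixes f g :: "'a list \<Rightarrow> 'a"
  assumes "slot_additive f" and "homI p f" and "homI q g"
  shows "homI (p + q - 1) (ins g f)"
proof (cases rule: homI_cases[OF assms(2)])
  case (1 m)
  note m = this
  show ?thesis
  proof (cases rule: homI_cases[OF assms(3)])
    case (1 n)
    show ?thesis
    proof (cases "m + n")
      case 0
      then show ?thesis using m by (simp add: homI_def ins_homogeneous_0)
    next
      case (Suc r)
      then have "p + q - 1 = int r" using m 1 by simp
      then show ?thesis using homogeneous_ins[OF assms(1) m(2) 1(2) Suc] by (simp add: homI_int)
    qed
  qed (simp add: homI_def ins_zero_left[OF assms(1)])
qed (simp add: homI_def)

lemma homI_bracket:
  assumes "f \<in> cyl" and "g \<in> cyl" and "homI p f" and "homI q g"
  shows "homI (p + q - 1) (bracket f g)"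
proof -
  note a = totD(2)[OF cyl_tot[OF assms(1)]] totD(2)[OF cyl_tot[OF assms(2)]]
  show ?thesis
    using homI_ins[OF a(1) assms(3,4)] homI_ins[OF a(2) assms(4,3)]
    by (auto simp: homI_def add.commute
        bracket_homogeneous[OF a(2) homI_homogeneous[OF assms(3)] homI_homogeneous[OF assms(4)]])
qed

text \<open>The differential raises the length by exactly one, so it maps components to components.
  This makes the decomposition of cohomology into degrees unique.\<close>

lemma restrict_bdy: "f \<in> bdy \<Longrightarrow> (\<lambda>as. if length as = n then f as else 0) \<in> bdy"
proof (elim bdyE)
  fix h assume h: "h \<in> tot" "f = diff h"
  show "(\<lambda>as. if length as = n then f as else 0) \<in> bdy"
  proof (cases n)
    case 0
    then show ?thesis using h bdy_zero by (simp add: diff_def cong: if_cong)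
  next
    case (Suc m)
    show ?thesis
      using h tot_restrict[OF h(1), of "\<lambda>l. l = m"]
      by (intro bdyI[of "\<lambda>as. if length as = m then h as else 0"]) (auto simp: diff_restrict Suc)
  qed
qed

lemma finsum_cls:
  assumes "finite A" and "\<And>n. n \<in> A \<Longrightarrow> F n \<in> cyl"
  shows "finsum \<H> (\<lambda>n. cls (F n)) A = cls (\<lambda>as. \<Sum>n\<in>A. F n as) \<and> (\<lambda>as. \<Sum>n\<in>A. F n as) \<in> cyl"
  using assms
proof (induction A)
  case empty
  interpret abelian_group \<H> by (rule abelian_group_HH)
  show ?case by (simp add: HH_zero cyl_zero)
next
  case (insert a A)
  interpret abelian_group \<H> by (rule abelian_group_HH)
  have "finsum \<H> (\<lambda>n. cls (F n)) (insert a A) = cls (F a) \<oplus>\<^bsub>\<H>\<^esub> finsum \<H> (\<lambda>n. cls (F n)) A"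
    using insert by (intro finsum_insert) (auto simp: HH_carrier)
  then show ?case using insert by (simp add: HH_add cyl_add)
qed

lemma graded_vector_space_HH: "graded_vector_space \<K> \<H> (HH_deg scale)"
proof (rule graded_vector_space.intro)
  show "field \<K>" by (rule field_from_type_algebra)
  show "Module.module \<K> \<H>" by (rule module_HH)
  show "submodule (HH_deg scale n) \<K> \<H>" for n
  proof (rule Module.module.submoduleI[OF module_HH], goal_cases)
    case 1
    then show ?case by (auto simp: HH_deg_iff HH_carrier)
  next
    case 2
    then show ?case using cyl_zero homI_zero_add_scale by (auto simp: HH_deg_iff HH_zero)
  next
    case (3 a)
    then obtain f where "f \<in> cyl" "homI n f" "a = cls f" by (auto simp: HH_deg_iff)
    then show ?case
      unfolding HH_deg_iff by (intro bexI[of _ "\<lambda>as. - f as"]) (auto simp: HH_uminus homI_zero_add_scale cyl_uminus)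
  next
    case (4 a b)
    then obtain f g where "f \<in> cyl" "homI n f" "a = cls f" "g \<in> cyl" "homI n g" "b = cls g" by (auto simp: HH_deg_iff)
    then show ?case
      unfolding HH_deg_iff by (intro bexI[of _ "\<lambda>as. f as + g as"]) (auto simp: HH_add homI_zero_add_scale cyl_add)
  next
    case (5 c a)
    then obtain f where "f \<in> cyl" "homI n f" "a = cls f" by (auto simp: HH_deg_iff)
    then show ?case
      unfolding HH_deg_iff by (intro bexI[of _ "\<lambda>as. scale c (f as)"]) (auto simp: HH_smult homI_zero_add_scale cyl_scale)
  qed
  fix x assume "x \<in> carrier \<H>"
  then obtain f where f: "f \<in> cyl" "x = cls f" by (auto simp: HH_carrier)
  obtain N where N: "\<And>as. length as > N \<Longrightarrow> f as = 0"
    using cyl_tot[OF f(1)] by (auto simp: total_cochains_iff)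
  define F where "F n = (\<lambda>as. if int (length as) = n then f as else 0)" for n
  have FZ: "F n \<in> cyl" for n
  proof (cases "n < 0")
    case True
    then have "F n = (\<lambda>as. 0)" by (auto simp: F_def)
    then show ?thesis using cyl_zero by simp
  next
    case False
    then have "int (length as) = n \<longleftrightarrow> length as = nat n" for as :: "'a list" by auto
    then have "F n = (\<lambda>as. if length as = nat n then f as else 0)" by (simp add: F_def)
    then show ?thesis using cyl_restrict[OF f(1)] by simp
  qed
  have sub: "{n. cls (F n) \<noteq> \<zero>\<^bsub>\<H>\<^esub>} \<subseteq> {0..int N}"
  proof
    fix n assume "n \<in> {n. cls (F n) \<noteq> \<zero>\<^bsub>\<H>\<^esub>}"
    moreover have "F n = (\<lambda>as. 0)" if "n \<notin> {0..int N}" using that N by (auto simp: F_def)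
    ultimately show "n \<in> {0..int N}" by (cases "n \<in> {0..int N}") (simp_all add: HH_zero)
  qed
  interpret H: abelian_group \<H> by (rule abelian_group_HH)
  have fin_eq: "finsum \<H> c {n. c n \<noteq> \<zero>\<^bsub>\<H>\<^esub>} = finsum \<H> c A"
    if "finite A" "{n. c n \<noteq> \<zero>\<^bsub>\<H>\<^esub>} \<subseteq> A" "\<And>n. c n \<in> carrier \<H>" for A and c :: "int \<Rightarrow> _"
    using that by (intro H.add.finprod_mono_neutral_cong_left) auto
  show "\<exists>!c. (\<forall>n. c n \<in> HH_deg scale n) \<and> finite {n. c n \<noteq> \<zero>\<^bsub>\<H>\<^esub>}
      \<and> x = finsum \<H> c {n. c n \<noteq> \<zero>\<^bsub>\<H>\<^esub>}"
  proof (rule ex1I[of _ "\<lambda>n. cls (F n)"], intro conjI allI)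
    show "cls (F n) \<in> HH_deg scale n" for n
      unfolding HH_deg_iff using FZ[of n] by (intro bexI[of _ "F n"]) (auto simp: homI_def F_def)
    show "finite {n. cls (F n) \<noteq> \<zero>\<^bsub>\<H>\<^esub>}" using sub by (rule finite_subset) simp
    have "(\<lambda>as. \<Sum>n\<in>{0..int N}. F n as) = f"
      using N by (auto simp: F_def sum.delta not_less)
    then show "x = finsum \<H> (\<lambda>n. cls (F n)) {n. cls (F n) \<noteq> \<zero>\<^bsub>\<H>\<^esub>}"
      using finsum_cls[of "{0..int N}" F] FZ by (subst fin_eq[OF _ sub]) (auto simp: f(2) HH_carrier)
  next
    fix c assume c: "(\<forall>n. c n \<in> HH_deg scale n) \<and> finite {n. c n \<noteq> \<zero>\<^bsub>\<H>\<^esub>}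
      \<and> x = finsum \<H> c {n. c n \<noteq> \<zero>\<^bsub>\<H>\<^esub>}"
    then obtain G where G: "\<And>n. G n \<in> cyl" "\<And>n. homI n (G n)" "\<And>n. c n = cls (G n)"
      unfolding HH_deg_iff by metis
    let ?A = "{n. c n \<noteq> \<zero>\<^bsub>\<H>\<^esub>}"
    have "x = cls (\<lambda>as. \<Sum>n\<in>?A. G n as)"
      using c finsum_cls[of ?A G] G(1) unfolding G(3)[abs_def] by simp
    then have d: "(\<lambda>as. f as - (\<Sum>n\<in>?A. G n as)) \<in> bdy"
      by (simp add: f(2) cls_eq_iff)
    show "c = (\<lambda>n. cls (F n))"
    proof
      fix n
      show "c n = cls (F n)"
      proof (cases "n < 0")
        case True
        then have "F n = (\<lambda>as. 0)" "G n = (\<lambda>as. 0)" using G(2)[of n] by (auto simp: F_def homI_def)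
        then show ?thesis by (simp add: G(3))
      next
        case False
        then obtain k where n: "n = int k" by (metis nonneg_int_cases linorder_not_less)
        \<comment> \<open>Uniqueness: in the component of length k of this coboundary only the
          summand of degree n survives.\<close>
        have "(\<lambda>as. if length as = k then f as - (\<Sum>n\<in>?A. G n as) else 0) \<in> bdy"
          using restrict_bdy[OF d] .
        also have "(\<lambda>as. if length as = k then f as - (\<Sum>n\<in>?A. G n as) else 0)
          = (\<lambda>as. F n as - (if n \<in> ?A then G n as else 0))"
        proof
          fix as :: "'a list"
          have "(\<Sum>m\<in>?A. G m as) = (if n \<in> ?A then G n as else 0)" if "length as = k"
          proof -
            have "(\<Sum>m\<in>?A. G m as) = (\<Sum>m\<in>?A. if m = n then G n as else 0)"
              by (rule sum.cong) (use G(2) that n in \<open>auto simp: homI_def\<close>)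
            then show ?thesis using c by (simp add: sum.delta)
          qed
          moreover have "G n as = 0" if "length as \<noteq> k"
            using G(2)[of n] that n by (simp add: homI_def)
          ultimately show "(if length as = k then f as - (\<Sum>n\<in>?A. G n as) else 0)
            = F n as - (if n \<in> ?A then G n as else 0)"
            by (auto simp: F_def n)
        qed
        finally have *: "(\<lambda>as. F n as - (if n \<in> ?A then G n as else 0)) \<in> bdy" .
        show ?thesis
        proof (cases "n \<in> ?A")
          case True
          then have "cls (F n) = cls (G n)" using * by (simp add: cls_eq_iff)
          then show ?thesis by (simp add: G(3))
        next
          case False
          then have "cls (F n) = cls (\<lambda>as. 0)" using * by (simp add: cls_eq_iff)
          then show ?thesis using False by (simp add: HH_zero)
        qed
      qed
    qed
  qed
qed

section \<open>Graded commutativity, Jacobi identity and Poisson rule\<close>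

lemma graded_commutative_bdy:
  assumes "f \<in> cyl" and "g \<in> cyl" and "homogeneous p f" and "homogeneous q g"
  shows "(\<lambda>as. cp f g as - sg (p * q) (cp g f as)) \<in> bdy"
proof -
  note fa = totD(2)[OF cyl_tot[OF assms(1)]]
  have "diff f = (\<lambda>as. 0)" "diff g = (\<lambda>as. 0)" using assms by (auto simp: cocycles_iff)
  \<comment> \<open>The homotopy is the circle product: for cocycles only the commutator remains in
    \<open>diff_ins\<close>.\<close>
  then have "diff (ins g f) as = sg q (cat g f as) - sg (p * q + q) (cat f g as)" for as
    unfolding diff_ins[OF fa] cp_homogeneous(2,3)[OF assms(3,4)] by (simp add: ins_zero_left[OF fa])
  then have "cp f g as - sg (p * q) (cp g f as) = - sg q (diff (ins g f) as)" for as
    unfolding cp_homogeneous(1)[OF assms(3,4)] cp_homogeneous(1)[OF assms(4,3)]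
    by (simp add: sg_diff) (simp add: sg_def)
  moreover have "(\<lambda>as. - sg q (diff (ins g f) as)) \<in> bdy"
    using tot_ins[OF cyl_tot[OF assms(1)] cyl_tot[OF assms(2)]]
    by (intro bdy_uminus bdy_sg) (auto intro: bdyI)
  ultimately show ?thesis by simp
qed

lemma ins_minus_sg_left:
  fixes f g h :: "'a list \<Rightarrow> 'a"
  assumes "slot_additive f"
  shows "ins (\<lambda>as. g as - sg n (h as)) f as = ins g f as - sg n (ins h f as)"
proof -
  have "ins (\<lambda>as. g as + - sg n (h as)) f as = ins g f as + ins (\<lambda>as. - sg n (h as)) f as"
    by (rule ins_add_left[OF assms])
  moreover have "ins (\<lambda>as. - sg n (h as)) f as = - sg n (ins h f as)"
    unfolding ins_def S3_sg[symmetric] S3_uminus[symmetric]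
    by (rule S3_cong) (simp add: slot_additiveD[OF assms] sg_uminus add.commute)
  ultimately show ?thesis by simp
qed

lemma ins_minus_sg: "ins g (\<lambda>as. \<Phi> as - sg n (\<Psi> as)) as = ins g \<Phi> as - sg n (ins g \<Psi> as)"
  by (simp add: ins_diff ins_sg)

text \<open>The degrees of the inner brackets enter the signs only through their parity. They are
  therefore arbitrary numbers of the right parity, which covers degree -1, where the absolute value
  is taken.\<close>

lemma bracket_jacobi:
  fixes f g h :: "'a list \<Rightarrow> 'a"
  assumes fgh: "slot_additive f" "slot_additive g" "slot_additive h"
    and hom: "homogeneous p f" "homogeneous q g" "homogeneous r h"
    and b: "homogeneous pq (bracket f g)" "homogeneous qr (bracket g h)" "homogeneous rp (bracket h f)"
    and par: "even pq = odd (p + q)" "even qr = odd (q + r)" "even rp = odd (r + p)"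
  shows "sg (Suc p * Suc r) (bracket (bracket f g) h as) + sg (Suc q * Suc p) (bracket (bracket g h) f as)
     + sg (Suc r * Suc q) (bracket (bracket h f) g as) = 0"
proof -
  have e: "bracket f g = (\<lambda>as. ins g f as - sg (Suc p * Suc q) (ins f g as))"
    "bracket g h = (\<lambda>as. ins h g as - sg (Suc q * Suc r) (ins g h as))"
    "bracket h f = (\<lambda>as. ins f h as - sg (Suc r * Suc p) (ins h f as))"
    using bracket_homogeneous[OF fgh(2) hom(1,2)] bracket_homogeneous[OF fgh(3) hom(2,3)]
      bracket_homogeneous[OF fgh(1) hom(3,1)] by auto
  \<comment> \<open>The pre-Lie identity: the two-slot insertions in \<open>ins_ins\<close> are
    eliminated by comparing both orders of insertion.\<close>
  have pre: "ins z (ins y x) as = ins (ins z y) x as + sg (Suc m * Suc k) (ins y (ins z x) as - ins (ins y z) x as)"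
    if "slot_additive x" "homogeneous m y" "homogeneous k z" for x y z :: "'a list \<Rightarrow> 'a" and m k
    using ins_ins[OF that, of as] ins_ins[OF that(1,3,2), of as]
    by (simp add: algebra_simps sg_add sg_diff) (simp add: sg_def)
  note pre1 = pre[OF fgh(1) hom(2,3)] and pre2 = pre[OF fgh(2) hom(1,3)] and pre3 = pre[OF fgh(3) hom(1,2)]
  have sgp: "sg (Suc pq * Suc r) x = sg ((p + q) * Suc r) x" "sg (Suc qr * Suc p) x = sg ((q + r) * Suc p) x"
    "sg (Suc rp * Suc q) x = sg ((r + p) * Suc q) x" for x :: 'a
    using par by (auto intro!: sg_cong)
  show ?thesis
    unfolding bracket_homogeneous[OF fgh(3) b(1) hom(3)] bracket_homogeneous[OF fgh(1) b(2) hom(1)]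
      bracket_homogeneous[OF fgh(2) b(3) hom(2)] sgp
    unfolding e ins_minus_sg ins_minus_sg_left[OF fgh(1)] ins_minus_sg_left[OF fgh(2)] ins_minus_sg_left[OF fgh(3)]
      pre1 pre2 pre3
    by (cases "even p"; cases "even q"; cases "even r") (simp_all add: sg_def)
qed

lemma ins_scale: "ins g (\<lambda>v. scale c (\<Phi> v)) as = scale c (ins g \<Phi> as)"
  unfolding ins_def S3_def sc_spl[OF module_scale] by (intro spl_cong) (simp add: sc_sg[OF module_scale])

lemma tot_ins2:
  assumes "x \<in> tot" "y \<in> tot" "z \<in> tot"
    and hom: "homogeneous p x" "homogeneous q y" "homogeneous r z"
  shows "ins2 y z x \<in> tot"
proof -
  note mx = totD(1)[OF assms(1)]
  note x = mlD[OF mx] slot_additiveD[OF ml_slot_additive[OF mx]]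
  have "ml scale (ins2 y z x)"
    unfolding ins2_def
  proof (rule ml_S3[OF module_scale])
    show "ml scale (\<lambda>p. sg (length p * Suc (length s)) (ins y (\<lambda>w. x (w @ z s # t)) p))" for s t
      using ml_sg[OF module_scale ml_ins[OF module_scale ml_append_right[OF module_scale mx] totD(1)[OF assms(2)]],
          of "\<lambda>n. n * Suc (length s)"] by simp
    show "ml scale (\<lambda>s. sg (length p * Suc (length s)) (ins y (\<lambda>w. x (w @ z s # t)) p))" for p t
      by (rule ml_sg[OF module_scale], rule ml_comp[OF totD(1)[OF assms(3)]])
        (simp_all add: x ins_add ins_scale)
    show "ml scale (\<lambda>t. sg (length p * Suc (length s)) (ins y (\<lambda>w. x (w @ z s # t)) p))" for p s
    proof (rule ml_sg[OF module_scale], rule mlI)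
      note l = mlD[OF ml_Cons_right[OF module_scale mx]]
      show "ins y (\<lambda>w. x (w @ z s # us @ (a + b) # vs)) p
        = ins y (\<lambda>w. x (w @ z s # us @ a # vs)) p + ins y (\<lambda>w. x (w @ z s # us @ b # vs)) p" for us vs a b
        by (simp add: l ins_add)
      show "ins y (\<lambda>w. x (w @ z s # us @ scale c a # vs)) p
        = scale c (ins y (\<lambda>w. x (w @ z s # us @ a # vs)) p)" for us vs a c
        by (simp add: l ins_scale)
      show "ins y (\<lambda>w. x (w @ z s # us @ 1 # vs)) p = 0" for us vs
        by (simp add: l)
    qed
  qed
  moreover have "ins2 y z x as = 0" if "length as > p + q + r" for as
    unfolding ins2_def
  proof (rule S3_zero)
    fix p' s t assume as: "p' @ s @ t = as"
    have "ins y (\<lambda>w. x (w @ z s # t)) p' = 0"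
    proof (cases "z s = 0")
      case False
      show ?thesis unfolding ins_def
      proof (rule S3_zero)
        fix u v w assume uvw: "u @ v @ w = p'"
        have "x (u @ y v # w @ z s # t) = 0"
        proof (cases "y v = 0")
          case False
          have "length v = q" "length s = r"
            using homogeneousD[OF hom(2) False] homogeneousD[OF hom(3) \<open>z s \<noteq> 0\<close>] by auto
          then have "length (u @ y v # w @ z s # t) \<noteq> p"
            using that as uvw by auto
          then show ?thesis using hom(1) by (simp add: homogeneous_def)
        qed (simp add: x)
        then show "sg (length u * Suc (length v)) (x ((u @ y v # w) @ z s # t)) = 0" by simp
      qed
    qed (simp add: x)
    then show "sg (length p' * Suc (length s)) (ins y (\<lambda>w. x (w @ z s # t)) p') = 0" by simp
  qed
  ultimately show ?thesis unfolding total_cochains_iff by blast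
qed

text \<open>The bracket consists of two circle products. Inserting \<open>x\<close> into the product
  of \<open>y\<close> and \<open>z\<close> is a derivation on the nose by \<open>ins_cp\<close>;
  inserting that product into \<open>x\<close> is one up to the coboundary of
  \<open>ins2 y z x\<close>.\<close>

lemma bracket_poisson_bdy:
  assumes xyz: "x \<in> cyl" "y \<in> cyl" "z \<in> cyl"
    and hom: "homogeneous p x" "homogeneous q y" "homogeneous r z"
    and b: "homogeneous pq (bracket x y)" "homogeneous pr (bracket x z)"
    and par: "even pq = odd (p + q)" "even pr = odd (p + r)"
  shows "(\<lambda>as. bracket x (cp y z) as - (cp (bracket x y) z as + sg (Suc p * q) (cp y (bracket x z) as))) \<in> bdy"
proof -
  note a = totD(2)[OF cyl_tot[OF xyz(1)]] totD(2)[OF cyl_tot[OF xyz(2)]] totD(2)[OF cyl_tot[OF xyz(3)]]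
  have d0: "diff x = (\<lambda>as. 0)" "diff y = (\<lambda>as. 0)" "diff z = (\<lambda>as. 0)"
    using xyz by (auto simp: cocycles_iff)
  have z2: "ins2 g h (\<lambda>as. 0) as = (0::'a)" for g h as
    by (simp add: ins2_def S3_def)
  have z3: "ins2 (\<lambda>as. 0) h x as = (0::'a)" for h as
    using ins_zero_left[OF slot_additive_append[OF a(1)]] by (simp add: ins2_def S3_def)
  have z4: "ins2 g (\<lambda>as. 0) x as = (0::'a)" for g as
    using slot_additiveD(2)[OF a(1)] by (simp add: ins2_def S3_def)
  define T where "T as = S3 (\<lambda>pa s t. sg (length pa * Suc (length s) + Suc (length s)) (cat (eps y) (\<lambda>w. x (w @ z s # t)) pa)) as" for as
  have T: "T as = sg (q + Suc q * Suc r) (cat y (ins z x) as)" for as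
    unfolding T_def by (rule cat_ins_homogeneous[OF a(1) hom(2,3)])
  have ce: "cp y (eps z) = (\<lambda>as. sg r (cp y z as))"
    using cp_homogeneous(1,2)[OF hom(2,3)] by (auto simp: add.commute)
  have ins_sg_left: "ins (\<lambda>as. sg n (g as)) x as = sg n (ins g x as)" for n and g :: "'a list \<Rightarrow> 'a" and as
    unfolding ins_def S3_sg[symmetric]
    by (rule S3_cong) (simp add: slot_additiveD[OF a(1)] add.commute)
  have ez: "cp (ins y x) (eps z) as = sg r (cp (ins y x) z as)" for as
    unfolding cp_def spl_sg[symmetric]
    by (rule spl_cong) (use hom(3) in \<open>auto simp: eps_def homogeneous_def sg_mult_right add.commute sg_def\<close>)
  have main: "diff (ins2 y z x) as = sg r (ins (cp y z) x as) - sg r (cp (ins y x) z as)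
      + sg (q + Suc q * Suc r) (cat y (ins z x) as)" for as
    unfolding diff_ins2[OF a(1)] T_def[symmetric] T d0 z2 z3 z4 ce ins_sg_left ez by simp
  have tot2: "ins2 y z x \<in> tot"
    by (rule tot_ins2) (use xyz hom in \<open>auto intro: cyl_tot\<close>)
  have cph: "homogeneous (q + r) (cp y z)"
    by (rule homogeneous_cp[OF hom(2,3)])
  have ac: "slot_additive (cp y z)" using xyz by (intro totD(2) cyl_tot cyl_cp)
  have bx: "bracket x (cp y z) as = ins (cp y z) x as - sg (Suc p * Suc (q + r)) (sg (Suc p * r) (cp (ins x y) z as) + cp y (ins x z) as)" for as
    unfolding bracket_homogeneous[OF ac hom(1) cph] ins_cp[OF a(2) hom(1,3)] ..
  have c1: "cp (bracket x y) z as = cp (ins y x) z as - sg (Suc p * Suc q) (cp (ins x y) z as)" for as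
  proof -
    have "bracket x y = (\<lambda>as. ins y x as - sg (Suc p * Suc q) (ins x y as))"
      using bracket_homogeneous[OF a(2) hom(1,2)] by auto
    then show ?thesis
      by (simp add: cp_diff_left) (simp add: cp_def spl_sg[symmetric] sg_mult_left add.commute)
  qed
  have c2: "cp y (bracket x z) as = cp y (ins z x) as - sg (Suc p * Suc r) (cp y (ins x z) as)" for as
  proof -
    have "bracket x z = (\<lambda>as. ins z x as - sg (Suc p * Suc r) (ins x z as))"
      using bracket_homogeneous[OF a(3) hom(1,3)] by auto
    then show ?thesis
      by (simp add: cp_diff_right) (simp add: cp_def spl_sg[symmetric] sg_mult_right add.commute)
  qed
  have c3: "cat y (ins z x) as = sg (q * (p + r) + q) (cp y (ins z x) as)" for as
  \<comment> \<open>For p + r = 0 the degree p + r - 1 is not a natural number; then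
    \<open>x\<close> has degree 0 and offers no slot for an insertion.\<close>
  proof (cases "p + r")
    case 0
    then have "ins z x = (\<lambda>as. 0)" using ins_homogeneous_0[of x] hom(1) by auto
    then show ?thesis by (simp add: cat_def)
  next
    case (Suc m)
    show ?thesis
      unfolding cp_homogeneous(1)[OF hom(2) homogeneous_ins[OF a(1) hom(1,3) Suc]] Suc
      by (simp add: sg_def)
  qed
  have "bracket x (cp y z) as - (cp (bracket x y) z as + sg (Suc p * q) (cp y (bracket x z) as))
      = sg r (diff (ins2 y z x) as)" for as
    unfolding main bx c1 c2 c3
    by (cases "even p"; cases "even q"; cases "even r") (simp_all add: sg_def)
  then show ?thesis using tot2 by (intro bdyI[of "\<lambda>as. sg r (ins2 y z x as)"]) (auto simp: diff_sg tot_sg)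
qed

lemma cp_scale:
  "cp (\<lambda>as. scale c (f as)) g as = scale c (cp f g as)"
  "cp f (\<lambda>as. scale c (g as)) as = scale c (cp f g as)"
  unfolding cp_def sc_spl[OF module_scale]
  by (auto intro!: spl_cong simp: scale_mult_left scale_mult_right sc_sg[OF module_scale])

lemma bracket_scale:
  assumes "ml scale f" and "ml scale g"
  shows "bracket (\<lambda>as. scale c (f as)) g as = scale c (bracket f g as)"
    and "bracket f (\<lambda>as. scale c (g as)) as = scale c (bracket f g as)"
  unfolding bracket_eq ins_def coins_def S3_def scale_right_diff_distrib sc_spl[OF module_scale]
  by (intro arg_cong2[of _ _ _ _ "(-)"] spl_cong; simp add: mlD[OF assms(1)] mlD[OF assms(2)] sc_sg[OF module_scale])+

lemma even_nat_abs [simp]: "even (nat \<bar>k\<bar>) = even (k :: int)"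
  by (simp add: even_nat_iff)

lemma in_HH_deg:
  assumes "x \<in> HH_deg scale p"
  obtains f where "f \<in> cyl" "homI p f" "x = cls f" "homogeneous (nat \<bar>p\<bar>) f" "slot_additive f"
  using assms unfolding HH_deg_iff by (auto intro: homI_homogeneous totD(2) cyl_tot)

theorem gerstenhaber_algebra_HH:
  "gerstenhaber_algebra \<K> \<H> (HH_deg scale) (HH_bracket scale)"
proof (rule gerstenhaber_algebra.intro[OF graded_vector_space_HH], rule gerstenhaber_algebra_axioms.intro, goal_cases)
  case 1
  show ?case by (rule ring_HH)
next
  case (2 c x y)
  then show ?case
    by (auto simp: HH_carrier HH_smult HH_mult cyl_scale cyl_cp cp_scale[abs_def])
next
  case 3
  show ?case
    unfolding HH_one HH_deg_iff using one_cyl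
    by (intro bexI[of _ "\<lambda>as. if as = [] then 1 else 0"]) (auto simp: homI_def)
next
  case (4 x p y q)
  from 4(1) obtain f where f: "f \<in> cyl" "homI p f" "x = cls f" by (rule in_HH_deg)
  from 4(2) obtain g where g: "g \<in> cyl" "homI q g" "y = cls g" by (rule in_HH_deg)
  show ?case
    unfolding HH_deg_iff using f g by (intro bexI[of _ "cp f g"]) (auto simp: HH_mult homI_cp cyl_cp)
next
  case (5 x p y q)
  from 5(1) obtain f where f: "f \<in> cyl" "homI p f" "x = cls f" "homogeneous (nat \<bar>p\<bar>) f" by (rule in_HH_deg)
  from 5(2) obtain g where g: "g \<in> cyl" "homI q g" "y = cls g" "homogeneous (nat \<bar>q\<bar>) g" by (rule in_HH_deg)
  have "even (p * q) = even (nat \<bar>p\<bar> * nat \<bar>q\<bar>)" by simp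
  then show ?case
    unfolding f(3) g(3) HH_mult[OF f(1) g(1)] HH_mult[OF g(1) f(1)]
    by (subst HH_with_sign[OF cyl_cp[OF g(1) f(1)]], assumption)
      (rule cls_eqI, rule graded_commutative_bdy[OF f(1) g(1) f(4) g(4)])
next
  case (6 x y)
  then show ?case by (auto simp: HH_carrier HH_bracket_cls intro!: imageI cyl_bracket)
next
  case (7 x y z)
  then obtain f g h where fgh: "f \<in> cyl" "g \<in> cyl" "h \<in> cyl" "x = cls f" "y = cls g" "z = cls h"
    by (auto simp: HH_carrier)
  then have "bracket (\<lambda>as. f as + g as) h = (\<lambda>as. bracket f h as + bracket g h as)"
    "bracket h (\<lambda>as. f as + g as) = (\<lambda>as. bracket h f as + bracket h g as)"
    using bracket_add_left[of h f g] bracket_add_right[of h f g] by (auto simp: totD cyl_tot intro!: ext)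
  then show ?case using fgh by (simp add: HH_add HH_bracket_cls cyl_add)
next
  case (8 c x y)
  then obtain f g where fg: "f \<in> cyl" "g \<in> cyl" "x = cls f" "y = cls g"
    by (auto simp: HH_carrier)
  then have "bracket (\<lambda>as. scale c (f as)) g = (\<lambda>as. scale c (bracket f g as))"
    "bracket f (\<lambda>as. scale c (g as)) = (\<lambda>as. scale c (bracket f g as))"
    using bracket_scale[of f g c] by (auto simp: totD cyl_tot intro!: ext)
  then show ?case using fg by (simp add: HH_smult HH_bracket_cls cyl_scale)
next
  case (9 x p y q)
  from 9(1) obtain f where f: "f \<in> cyl" "homI p f" "x = cls f" by (rule in_HH_deg)
  from 9(2) obtain g where g: "g \<in> cyl" "homI q g" "y = cls g" by (rule in_HH_deg)
  show ?case
    unfolding HH_deg_iff using f g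
    by (intro bexI[of _ "bracket f g"]) (auto simp: HH_bracket_cls homI_bracket cyl_bracket)
next
  case (10 x p y q)
  from 10(1) obtain f where f: "f \<in> cyl" "homI p f" "x = cls f" "homogeneous (nat \<bar>p\<bar>) f" "slot_additive f" by (rule in_HH_deg)
  from 10(2) obtain g where g: "g \<in> cyl" "homI q g" "y = cls g" "homogeneous (nat \<bar>q\<bar>) g" "slot_additive g" by (rule in_HH_deg)
  have e: "even ((p - 1) * (q - 1)) = even (Suc (nat \<bar>p\<bar>) * Suc (nat \<bar>q\<bar>))" by auto
  have "bracket f g = (\<lambda>as. - sg (Suc (nat \<bar>p\<bar>) * Suc (nat \<bar>q\<bar>)) (bracket g f as))"
    using bracket_antisym[OF f(5) g(5) f(4) g(4)] by auto
  then show ?case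
    unfolding f(3) g(3) HH_bracket_cls[OF f(1) g(1)] HH_bracket_cls[OF g(1) f(1)]
      HH_with_sign[OF cyl_bracket[OF g(1) f(1)] e]
    by (simp add: HH_uminus cyl_sg cyl_bracket f g)
next
  case (11 x p y q z r)
  from 11(1) obtain f where f: "f \<in> cyl" "homI p f" "x = cls f" "homogeneous (nat \<bar>p\<bar>) f" "slot_additive f" by (rule in_HH_deg)
  from 11(2) obtain g where g: "g \<in> cyl" "homI q g" "y = cls g" "homogeneous (nat \<bar>q\<bar>) g" "slot_additive g" by (rule in_HH_deg)
  from 11(3) obtain h where h: "h \<in> cyl" "homI r h" "z = cls h" "homogeneous (nat \<bar>r\<bar>) h" "slot_additive h" by (rule in_HH_deg)
  have e: "even ((p - 1) * (r - 1)) = even (Suc (nat \<bar>p\<bar>) * Suc (nat \<bar>r\<bar>))"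
    "even ((q - 1) * (p - 1)) = even (Suc (nat \<bar>q\<bar>) * Suc (nat \<bar>p\<bar>))"
    "even ((r - 1) * (q - 1)) = even (Suc (nat \<bar>r\<bar>) * Suc (nat \<bar>q\<bar>))" by auto
  note b = cyl_bracket[OF f(1) g(1)] cyl_bracket[OF g(1) h(1)] cyl_bracket[OF h(1) f(1)]
  note bb = cyl_bracket[OF b(1) h(1)] cyl_bracket[OF b(2) f(1)] cyl_bracket[OF b(3) g(1)]
  have "sg (Suc (nat \<bar>p\<bar>) * Suc (nat \<bar>r\<bar>)) (bracket (bracket f g) h as)
      + sg (Suc (nat \<bar>q\<bar>) * Suc (nat \<bar>p\<bar>)) (bracket (bracket g h) f as)
      + sg (Suc (nat \<bar>r\<bar>) * Suc (nat \<bar>q\<bar>)) (bracket (bracket h f) g as) = 0" for as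
    by (rule bracket_jacobi[OF f(5) g(5) h(5) f(4) g(4) h(4)
          homI_homogeneous[OF homI_bracket[OF f(1) g(1) f(2) g(2)]]
          homI_homogeneous[OF homI_bracket[OF g(1) h(1) g(2) h(2)]]
          homI_homogeneous[OF homI_bracket[OF h(1) f(1) h(2) f(2)]]]) simp_all
  then show ?case
    unfolding f(3) g(3) h(3) HH_bracket_cls[OF f(1) g(1)] HH_bracket_cls[OF g(1) h(1)] HH_bracket_cls[OF h(1) f(1)]
      HH_bracket_cls[OF b(1) h(1)] HH_bracket_cls[OF b(2) f(1)] HH_bracket_cls[OF b(3) g(1)]
      HH_with_sign[OF bb(1) e(1)] HH_with_sign[OF bb(2) e(2)] HH_with_sign[OF bb(3) e(3)] HH_add HH_zero
    by simp
next
  case (12 x p y q z r)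
  from 12(1) obtain f where f: "f \<in> cyl" "homI p f" "x = cls f" "homogeneous (nat \<bar>p\<bar>) f" "slot_additive f" by (rule in_HH_deg)
  from 12(2) obtain g where g: "g \<in> cyl" "homI q g" "y = cls g" "homogeneous (nat \<bar>q\<bar>) g" "slot_additive g" by (rule in_HH_deg)
  from 12(3) obtain h where h: "h \<in> cyl" "homI r h" "z = cls h" "homogeneous (nat \<bar>r\<bar>) h" "slot_additive h" by (rule in_HH_deg)
  have e: "even ((p - 1) * q) = even (Suc (nat \<bar>p\<bar>) * nat \<bar>q\<bar>)" by auto
  note c = cyl_cp[OF g(1) h(1)] cyl_bracket[OF f(1) g(1)] cyl_bracket[OF f(1) h(1)]
  have "(\<lambda>as. bracket f (cp g h) as - (cp (bracket f g) h as + sg (Suc (nat \<bar>p\<bar>) * nat \<bar>q\<bar>) (cp g (bracket f h) as))) \<in> bdy"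
    by (rule bracket_poisson_bdy[OF f(1) g(1) h(1) f(4) g(4) h(4)
          homI_homogeneous[OF homI_bracket[OF f(1) g(1) f(2) g(2)]]
          homI_homogeneous[OF homI_bracket[OF f(1) h(1) f(2) h(2)]]]) simp_all
  then show ?case
    unfolding f(3) g(3) h(3) HH_mult[OF g(1) h(1)] HH_bracket_cls[OF f(1) c(1)] HH_bracket_cls[OF f(1) g(1)]
      HH_bracket_cls[OF f(1) h(1)] HH_mult[OF c(2) h(1)] HH_mult[OF g(1) c(3)]
      HH_with_sign[OF cyl_cp[OF g(1) c(3)] e] HH_add
    by (rule cls_eqI)
qed

end

section \<open>The operator Delta for a Frobenius form\<close>

locale frobenius_form = k_algebra scale
  for scale :: "'k::field \<Rightarrow> 'a::ring_1 \<Rightarrow> 'a" +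
  fixes tr :: "'a \<Rightarrow> 'k" and N Ni :: "'a \<Rightarrow> 'a" and rep :: "('a \<Rightarrow> 'k) \<Rightarrow> 'a"
  assumes tr_plus: "tr (a + b) = tr a + tr b"
    and tr_scale: "tr (scale c a) = c * tr a"
    and N_plus: "N (a + b) = N a + N b"
    and N_scale: "N (scale c a) = scale c (N a)"
    and N_times: "N (a * b) = N a * N b"
    and N_one: "N 1 = 1"
    and Ni_N: "Ni (N a) = a"
    and N_Ni: "N (Ni a) = a"
    and tr_N_twist: "tr (a * b) = tr (b * N a)"
    and rep: "(\<And>a b. \<phi> (a + b) = \<phi> a + \<phi> b) \<Longrightarrow> (\<And>c a. \<phi> (scale c a) = c * \<phi> a) \<Longrightarrow> tr (rep \<phi> * a) = \<phi> a"
    and tr_inj: "(\<And>a. tr (x * a) = tr (y * a)) \<Longrightarrow> x = y"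

sublocale frobenius_form \<subseteq> twisted_trace tr N
  by unfold_locales (fact tr_plus N_plus N_times tr_N_twist)+

context frobenius_form begin

lemma module_mult: "Modules.module ((*) :: 'k \<Rightarrow> 'k \<Rightarrow> 'k)"
  by unfold_locales (auto simp: algebra_simps)

lemma tr_N: "tr (N a) = tr a"
  using tr_N_twist[of a 1] by simp

lemma Ni_plus: "Ni (a + b) = Ni a + Ni b"
  by (metis N_Ni N_plus Ni_N)

lemma Ni_scale: "Ni (scale c a) = scale c (Ni a)"
  by (metis N_Ni N_scale Ni_N)

lemma Ni_times: "Ni (a * b) = Ni a * Ni b"
  by (metis N_Ni N_times Ni_N)

lemma Ni_0 [simp]: "Ni 0 = 0"
  using Ni_N[of 0] by simp

lemma Ni_uminus [simp]: "Ni (- a) = - Ni a"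
  by (metis N_Ni N_minus Ni_N)

lemma tr_Ni: "tr (Ni a) = tr a"
  by (metis N_Ni tr_N)

definition T :: "('a list \<Rightarrow> 'a) \<Rightarrow> 'a list \<Rightarrow> 'a" where
  "T f as = Ni (f (map N as))"

lemma T_add: "T (\<lambda>as. f as + g as) = (\<lambda>as. T f as + T g as)"
  and T_minus: "T (\<lambda>as. f as - g as) = (\<lambda>as. T f as - T g as)"
  and T_scale: "T (\<lambda>as. scale c (f as)) = (\<lambda>as. scale c (T f as))"
  and T_uminus: "T (\<lambda>as. - f as) = (\<lambda>as. - T f as)"
  and T_zero: "T (\<lambda>as. 0) = (\<lambda>as. 0)"
  by (auto simp: T_def Ni_plus Ni_scale diff_conv_add_uminus simp del: add_uminus_conv_diff intro!: ext)

lemma T_restrict: "T (\<lambda>as. if P (length as) then f as else 0) = (\<lambda>as. if P (length as) then T f as else 0)"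
  by (auto simp: T_def)

lemma tot_T:
  assumes "f \<in> tot"
  shows "T f \<in> tot"
proof -
  have "ml scale (T f)"
    unfolding T_def
    by (rule ml_comp[OF ml_map[OF module_scale totD(1)[OF assms]]])
      (simp_all add: N_plus N_scale N_one Ni_plus Ni_scale)
  moreover obtain K where "\<And>as. length as > K \<Longrightarrow> f as = 0"
    using assms by (auto simp: total_cochains_iff)
  then have "\<forall>as. length as > K \<longrightarrow> T f as = 0" by (simp add: T_def)
  ultimately show ?thesis unfolding total_cochains_iff by blast
qed

lemma T_diff: "T (diff f) = diff (T f)"
proof
  fix as
  have "Ni (mrg f (map N as)) = mrg (T f) as"
    unfolding mrg_map[of N, OF N_times] T_def by (rule additive_mrg) (rule Ni_plus)
  moreover have "Ni (lft f (map N as)) = lft (T f) as"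
    by (cases as) (simp_all add: T_def Ni_times Ni_N)
  moreover have "Ni (rgt f (map N as)) = rgt (T f) as"
    by (cases as rule: rev_cases) (simp_all add: T_def Ni_times Ni_N)
  ultimately show "T (diff f) as = diff (T f) as"
    unfolding T_def[of "diff f"] diff_def by (simp add: Ni_plus sg_def diff_conv_add_uminus del: add_uminus_conv_diff)
qed

lemma T_cp: "T (cp f g) = cp (T f) (T g)"
proof
  fix as
  have "Ni (spl F as) = spl (\<lambda>u v. Ni (F u v)) as" for F :: "'a list \<Rightarrow> 'a list \<Rightarrow> 'a"
    by (rule additive_spl) (rule Ni_plus)
  moreover have "Ni (sg n a) = sg n (Ni a)" for n a by (simp add: sg_def)
  ultimately show "T (cp f g) as = cp (T f) (T g) as"
    by (simp add: T_def cp_def spl_map Ni_times)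
qed

text \<open>On forms, \<open>T\<close> is the full turn of \<open>cyc_rot\<close>. The invariance of
  the trace under \<open>N\<close> moves the inverse from the value of \<open>f\<close> to the last
  entry.\<close>

lemma form_T: "form (T f) as = form f (map N as)"
proof (cases as rule: rev_cases)
  case (snoc bs z)
  have "tr (Ni (f (map N bs)) * z) = tr (N (Ni (f (map N bs)) * z))" by (simp add: tr_N)
  then show ?thesis by (simp add: snoc T_def N_times N_Ni)
qed simp

lemma form_inj:
  assumes "\<And>as. form f as = form g as"
  shows "f = g"
proof
  fix as
  show "f as = g as"
    by (rule tr_inj) (use assms[of "as @ [_]"] in simp)
qed

lemma form_add: "form (\<lambda>as. f as + g as) as = form f as + form g as"
  and form_minus: "form (\<lambda>as. f as - g as) as = form f as - form g as"
  and form_sg: "form (\<lambda>as. sg n (f as)) as = sg n (form f as)"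
  and form_scale: "form (\<lambda>as. scale c (f as)) as = c * form f as"
  and form_eps: "form (\<lambda>as. sg (length as) (f as)) as = sg (Suc (length as)) (form f as)"
  by (cases as rule: rev_cases;
      simp add: distrib_right left_diff_distrib tr_plus tr_diff sg_mult_left scale_mult_left tr_scale sg_Suc)+

subsection \<open>The operator on cochains\<close>

definition dual_cochain :: "('a list \<Rightarrow> 'k) \<Rightarrow> 'a list \<Rightarrow> 'a" where
  "dual_cochain \<phi> as = rep (\<lambda>z. \<phi> (as @ [z]))"

text \<open>These are the forms of normalised cochains. Normalisation concerns all entries but the
  last, which is paired with the value and need not give zero at 1.\<close>

definition admissible :: "('a list \<Rightarrow> 'k) \<Rightarrow> bool" where
  "admissible \<phi> \<longleftrightarrow> \<phi> [] = 0 \<and> (\<forall>z. ml (*) (\<lambda>as. \<phi> (as @ [z])))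
     \<and> (\<forall>as a b. \<phi> (as @ [a + b]) = \<phi> (as @ [a]) + \<phi> (as @ [b]))
     \<and> (\<forall>as c a. \<phi> (as @ [scale c a]) = c * \<phi> (as @ [a]))"

lemma form_dual_cochain:
  assumes "admissible \<phi>"
  shows "form (dual_cochain \<phi>) = \<phi>"
proof
  fix as
  show "form (dual_cochain \<phi>) as = \<phi> as"
    using assms by (cases as rule: rev_cases) (auto simp: admissible_def dual_cochain_def intro!: rep)
qed

lemma ml_dual_cochain:
  assumes "admissible \<phi>"
  shows "ml scale (dual_cochain \<phi>)"
proof (rule mlI)
  have r: "tr (dual_cochain \<phi> as * z) = \<phi> (as @ [z])" for as z
    using fun_cong[OF form_dual_cochain[OF assms], of "as @ [z]"] by simp
  have m: "ml (*) (\<lambda>as. \<phi> (as @ [z]))" for z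
    using assms by (simp add: admissible_def)
  note l = mlD[OF m, simplified]
  show "dual_cochain \<phi> (us @ (a + b) # vs) = dual_cochain \<phi> (us @ a # vs) + dual_cochain \<phi> (us @ b # vs)" for us vs a b
    by (rule tr_inj) (simp add: distrib_right tr_plus r l)
  show "dual_cochain \<phi> (us @ scale c a # vs) = scale c (dual_cochain \<phi> (us @ a # vs))" for us vs a c
    by (rule tr_inj) (simp add: scale_mult_left tr_scale r l)
  show "dual_cochain \<phi> (us @ 1 # vs) = 0" for us vs
    by (rule tr_inj) (simp add: r l)
qed

lemma tot_dual_cochain:
  assumes "admissible \<phi>" and "\<And>as. length as > K \<Longrightarrow> \<phi> as = 0"
  shows "dual_cochain \<phi> \<in> tot"
proof -
  have "dual_cochain \<phi> as = 0" if "length as > K" for as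
    by (rule tr_inj)
      (use fun_cong[OF form_dual_cochain[OF assms(1)], of "as @ [_]"] assms(2)[of "as @ [_]"] that in simp)
  then show ?thesis using ml_dual_cochain[OF assms(1)] by (auto simp: total_cochains_iff)
qed

text \<open>Connes' operator carried over from functionals to cochains. The Batalin-Vilkovisky
  operator is its negative, see \<open>bv\<close>.\<close>

definition dlt :: "('a list \<Rightarrow> 'a) \<Rightarrow> 'a list \<Rightarrow> 'a" where
  "dlt f = dual_cochain (cyc (\<lambda>v. tr (f v)))"

lemma ml_tr: "ml scale f \<Longrightarrow> ml (*) (\<lambda>v. tr (f v))"
  by (rule ml_comp) (simp_all add: tr_plus tr_scale)

lemma cyc_snoc: "cyc c (as @ [z]) = spl (\<lambda>x y. sg (length x * Suc (Suc (length x + length y))) (c (y @ z # map N x))) as"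
  by (simp add: cyc_def spl_snoc)

lemma mult_spl: "(c :: 'k) * spl F as = spl (\<lambda>u v. c * F u v) as"
  by (rule additive_spl) (rule distrib_left)

lemma admissible_cyc:
  assumes "ml (*) c"
  shows "admissible (cyc c)"
  unfolding admissible_def
proof (intro conjI allI)
  note c = mlD[OF assms]
  show "cyc c [] = 0" by simp
  show "ml (*) (\<lambda>as. cyc c (as @ [z]))" for z
    unfolding cyc_snoc
  proof (rule ml_spl[OF module_mult])
    show "ml (*) (\<lambda>x. sg (length x * Suc (Suc (length x + length y))) (c (y @ z # map N x)))" for y
      using ml_sg[OF module_mult ml_map[OF module_mult ml_Cons_right[OF module_mult assms, of y z], of N],
          of "\<lambda>n. n * Suc (Suc (n + length y))"]
      by (simp add: N_plus N_scale N_one)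
    show "ml (*) (\<lambda>y. sg (length x * Suc (Suc (length x + length y))) (c (y @ z # map N x)))" for x
      using ml_sg[OF module_mult ml_append_right[OF module_mult assms, of "z # map N x"],
          of "\<lambda>n. length x * Suc (Suc (length x + n))"] by simp
  qed
  show "cyc c (as @ [a + b]) = cyc c (as @ [a]) + cyc c (as @ [b])" for as a b
    unfolding cyc_snoc by (simp add: c sg_add spl_add)
  show "cyc c (as @ [scale r a]) = r * cyc c (as @ [a])" for as a r
    unfolding cyc_snoc by (simp add: c mult_spl sg_mult_right)
qed

lemma form_dlt: "ml scale f \<Longrightarrow> form (dlt f) = cyc (\<lambda>v. tr (f v))"
  unfolding dlt_def by (intro form_dual_cochain admissible_cyc ml_tr)

lemma tot_dlt:
  assumes "f \<in> tot"
  shows "dlt f \<in> tot"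
proof -
  obtain K where K: "\<And>as. length as > K \<Longrightarrow> f as = 0"
    using assms by (auto simp: total_cochains_iff)
  have "cyc (\<lambda>v. tr (f v)) as = 0" if "length as > K" for as
    unfolding cyc_def by (rule spl_zeroI) (use K that in auto)
  then show ?thesis
    unfolding dlt_def by (intro tot_dual_cochain[of _ K] admissible_cyc ml_tr totD(1)[OF assms])
qed

lemma dlt_homI:
  assumes "f \<in> tot" and "homI p f"
  shows "homI (p - 1) (dlt f)"
  unfolding homI_def
proof (intro allI impI tr_inj)
  fix as :: "'a list" and z assume as: "int (length as) \<noteq> p - 1"
  have "f (y @ z # map N x) = 0" if "x @ y = as" for x y
    using assms(2) as that by (auto simp: homI_def)
  then have "cyc (\<lambda>v. tr (f v)) (as @ [z]) = 0"
    unfolding cyc_snoc by (intro spl_zeroI) auto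
  then show "tr (dlt f as * z) = tr (0 * z)"
    using fun_cong[OF form_dlt[OF totD(1)[OF assms(1)]], of "as @ [z]"] by simp
qed

lemma dlt_add:
  assumes "f \<in> tot" "g \<in> tot"
  shows "dlt (\<lambda>as. f as + g as) = (\<lambda>as. dlt f as + dlt g as)"
  by (rule form_inj)
    (simp add: form_add form_dlt totD assms tot_add tr_plus cyc_add)

lemma cyc_scale: "cyc (\<lambda>v. r * c v) as = r * cyc c as"
  unfolding cyc_def mult_spl by (rule spl_cong) (auto simp: sg_mult_right)

lemma dlt_scale:
  assumes "f \<in> tot"
  shows "dlt (\<lambda>as. scale c (f as)) = (\<lambda>as. scale c (dlt f as))"
  by (rule form_inj)
    (simp add: form_scale form_dlt totD assms tot_scale tr_scale cyc_scale)

lemma dlt_T: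
  assumes "f \<in> tot"
  shows "T (dlt f) = dlt (T f)"
proof (rule form_inj)
  fix as
  have "cyc c (map N as) = cyc (\<lambda>v. c (map N v)) as" for c :: "'a list \<Rightarrow> 'k"
    unfolding cyc_def spl_map by (rule spl_cong) auto
  then show "form (T (dlt f)) as = form (dlt (T f)) as"
    unfolding form_T form_dlt[OF totD(1)[OF assms]] form_dlt[OF totD(1)[OF tot_T[OF assms]]]
    by (simp add: T_def tr_Ni)
qed

text \<open>The trace of a value of \<open>dlt f\<close> is the form of \<open>dlt f\<close> with 1
  as its last entry. That is a sum of values of \<open>f\<close> on lists containing 1, which vanish
  by normalisation, so the second cyclic sum has only zero summands.\<close>

lemma dlt_dlt:
  assumes "f \<in> tot"
  shows "dlt (dlt f) = (\<lambda>as. 0)"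
proof (rule form_inj)
  fix as
  have "tr (dlt f v) = 0" for v
  proof -
    have "tr (dlt f v) = cyc (\<lambda>v. tr (f v)) (v @ [1])"
      using fun_cong[OF form_dlt[OF totD(1)[OF assms]], of "v @ [1]"] by simp
    also have "\<dots> = 0"
      unfolding cyc_snoc by (rule spl_zeroI) (simp add: mlD[OF totD(1)[OF assms]])
    finally show ?thesis .
  qed
  then show "form (dlt (dlt f)) as = form (\<lambda>as. 0) as"
    unfolding form_dlt[OF totD(1)[OF tot_dlt[OF assms]]] by (simp add: cyc_def form_def cong: if_cong)
qed

lemma dlt_diff:
  assumes "f \<in> tot"
  shows "dlt (diff f) as = sg (length as) (T f as - f as) + diff (dlt f) as"
proof -
  have "dlt (diff f) = (\<lambda>as. sg (length as) (T f as - f as) + diff (dlt f) as)"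
  proof (rule form_inj)
    fix as
    show "form (dlt (diff f)) as = form (\<lambda>as. sg (length as) (T f as - f as) + diff (dlt f) as) as"
      unfolding form_add form_eps form_minus form_T form_dlt[OF totD(1)[OF tot_diff[OF assms]]]
        form_diff form_dlt[OF totD(1)[OF assms]] cyc_tr_diff ..
  qed
  then show ?thesis by simp
qed

lemma ml_ins_param:
  fixes y :: "'a list \<Rightarrow> 'a"
  assumes "\<And>w. ml (*) (F w)"
  shows "ml (*) (\<lambda>t. ins y (\<lambda>w. F w t) p :: 'k)"
proof (rule mlI)
  note l = mlD[OF assms]
  have s: "ins y (\<lambda>w. c * G w) p = c * ins y G p" for c and G :: "'a list \<Rightarrow> 'k"
    unfolding ins_def S3_def mult_spl by (intro spl_cong) (simp add: sg_mult_right)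
  show "ins y (\<lambda>w. F w (us @ (a + b) # vs)) p = ins y (\<lambda>w. F w (us @ a # vs)) p + ins y (\<lambda>w. F w (us @ b # vs)) p" for us vs a b
    by (simp add: l ins_add)
  show "ins y (\<lambda>w. F w (us @ scale c a # vs)) p = c * ins y (\<lambda>w. F w (us @ a # vs)) p" for us vs a c
    by (simp add: l s)
  show "ins y (\<lambda>w. F w (us @ 1 # vs)) p = 0" for us vs
    by (simp add: l)
qed

lemma homotopy_snoc: "homotopy g c (as @ [z]) = spl (\<lambda>x y. sg (length x * Suc (Suc (length x + length y)))
    (ins g (\<lambda>w. c (w @ z # map N x)) y)) as"
  by (simp add: homotopy_def spl_snoc insr_snoc)

lemma admissible_homotopy:
  assumes "ml (*) c" and "ml scale g"
  shows "admissible (homotopy g c)"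
  unfolding admissible_def
proof (intro conjI allI)
  note c = mlD[OF assms(1)]
  have s: "ins y (\<lambda>w. r * G w) p = r * ins y G p" for r and y :: "'a list \<Rightarrow> 'a" and p and G :: "'a list \<Rightarrow> 'k"
    unfolding ins_def S3_def mult_spl by (intro spl_cong) (simp add: sg_mult_right)
  show "homotopy g c [] = 0" by (simp add: homotopy_def)
  show "ml (*) (\<lambda>as. homotopy g c (as @ [z]))" for z
    unfolding homotopy_snoc
  proof (rule ml_spl[OF module_mult])
    have "ml (*) (\<lambda>x. ins g (\<lambda>w. c (w @ z # map N x)) y)" for y
      by (rule ml_ins_param)
        (use ml_map[OF module_mult ml_Cons_right[OF module_mult assms(1)], of N] in \<open>simp add: N_plus N_scale N_one\<close>)
    from ml_sg[OF module_mult this, of "\<lambda>n. n * Suc (Suc (n + length _))"]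
    show "ml (*) (\<lambda>x. sg (length x * Suc (Suc (length x + length y))) (ins g (\<lambda>w. c (w @ z # map N x)) y))" for y
      by simp
    show "ml (*) (\<lambda>y. sg (length x * Suc (Suc (length x + length y))) (ins g (\<lambda>w. c (w @ z # map N x)) y))" for x
      using ml_sg[OF module_mult ml_ins[OF module_mult ml_append_right[OF module_mult assms(1), of "z # map N x"] assms(2)],
          of "\<lambda>n. length x * Suc (Suc (length x + n))"] by simp
  qed
  show "homotopy g c (as @ [a + b]) = homotopy g c (as @ [a]) + homotopy g c (as @ [b])" for as a b
    unfolding homotopy_snoc by (simp add: c ins_add sg_add spl_add)
  show "homotopy g c (as @ [scale r a]) = r * homotopy g c (as @ [a])" for as a r
    unfolding homotopy_snoc by (simp add: c mult_spl sg_mult_right s)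
qed

text \<open>\<open>dual_diff_homotopy_zeta\<close> read back on cochains: \<open>homotopy\<close> is
  the form of a cochain \<open>k\<close>, and its dual differential is the form of the coboundary
  \<open>diff k\<close>.\<close>

lemma zeta_form:
  assumes f: "f \<in> cyl" "homogeneous q f" and g: "g \<in> cyl" "homogeneous p g"
  obtains h where "h \<in> bdy"
    "zeta g f = form (\<lambda>as. h as + sg (p + q) (ins g f as) + sg p (cp (dlt f) g as))"
proof -
  note tf = cyl_tot[OF f(1)] and tg = cyl_tot[OF g(1)]
  let ?c = "\<lambda>v. tr (f v)"
  define k where "k = dual_cochain (homotopy g ?c)"
  have adm: "admissible (homotopy g ?c)"
    by (rule admissible_homotopy[OF ml_tr[OF totD(1)[OF tf]] totD(1)[OF tg]])
  have "homotopy g ?c as = 0" if as: "length as > p + q" for as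
    unfolding homotopy_def
  proof (rule spl_zeroI)
    fix x y assume xy: "x @ y = as"
    have "f (u @ g v # w @ map N x) = 0" if "u @ v @ w = y" for u v w
    proof (cases "g v = 0")
      case False
      then have "length v = p" by (rule homogeneousD[OF g(2)])
      then have "length (u @ g v # w @ map N x) \<noteq> q" using that xy as by auto
      then show ?thesis using f(2) by (simp add: homogeneous_def)
    qed (simp add: slot_additiveD(2)[OF totD(2)[OF tf]])
    then have "insr g (\<lambda>w. tr (f (w @ map N x))) y = 0"
      unfolding insr_def by (intro S3_zero) auto
    then show "sg (length x * Suc (length x + length y)) (insr g (\<lambda>w. tr (f (w @ map N x))) y) = 0" by simp
  qed
  then have k: "k \<in> tot" unfolding k_def by (rule tot_dual_cochain[OF adm])
  have fk: "form (diff k) as = dual_diff (homotopy g ?c) as" for as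
    unfolding form_diff by (simp add: k_def form_dual_cochain[OF adm])
  have "form (\<lambda>as. diff k as + sg (p + q) (ins g f as) + sg p (cp (dlt f) g as)) as = zeta g f as" for as
  proof -
    have h: "form (cp (dlt f) (eps g)) as = sg p (form (cp (dlt f) g) as)"
    proof -
      have "eps g v = sg p (g v)" for v using g(2) by (auto simp: eps_def homogeneous_def)
      then have "cp (dlt f) (eps g) = (\<lambda>as. sg p (cp (dlt f) g as))"
        by (auto simp: cp_def spl_sg[symmetric] sg_mult_right add.commute intro!: ext)
      then show ?thesis by (simp add: form_sg)
    qed
    \<comment> \<open>\<open>ins g f\<close> lives on lists of length p + q - 1 and
      \<open>form\<close> adds one entry, so the sign is constant on all nonzero values.\<close>
    have i: "sg (length as) (form (ins g f) as) = sg (p + q) (form (ins g f) as)"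
    proof (cases as rule: rev_cases)
      case (snoc bs z)
      have "ins g f bs = 0" if "length as \<noteq> p + q"
      proof (cases "q + p")
        case 0
        then show ?thesis using f(2) by (simp add: ins_homogeneous_0)
      next
        case (Suc r)
        then show ?thesis using homogeneous_ins[OF totD(2)[OF tf] f(2) g(2) Suc] that snoc
          by (auto simp: homogeneous_def)
      qed
      then show ?thesis by (cases "length as = p + q") (auto simp: snoc)
    qed simp
    show ?thesis
      unfolding form_add form_sg fk
        dual_diff_homotopy_zeta[OF totD(2)[OF tf] cyl_diffD[OF f(1)] cyl_diffD[OF g(1)] fun_cong[OF form_dlt[OF totD(1)[OF tf]]]] h i
      by simp
  qed
  moreover have "diff k \<in> bdy" using k by (auto intro: bdyI)
  ultimately show ?thesis by (intro that) auto
qed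

text \<open>By \<open>cyc_cp\<close> the term \<open>dlt (cp f g)\<close> consists of two partial
  sums, and by \<open>zeta_form\<close> each of them is a circle product plus a product with one
  \<open>dlt\<close>, up to coboundaries and signs. Finally \<open>dlt g\<close> is moved behind
  \<open>f\<close> by graded commutativity, for which it has to be a cocycle.\<close>

lemma bv_cochain:
  assumes f: "f \<in> cyl" "homI p f" and g: "g \<in> cyl" "homI q g" "T g = g"
    and b: "dlt g \<in> cyl"
    and e: "even P = even p" "even Q = even q"
  shows "(\<lambda>as. bracket f g as - sg (Suc P) (- dlt (cp f g) as + cp (dlt f) g as + sg P (cp f (dlt g) as))) \<in> bdy"
proof -
  note hf = homI_homogeneous[OF f(2)] and hg = homI_homogeneous[OF g(2)]
  let ?P = "nat \<bar>p\<bar>" and ?Q = "nat \<bar>q\<bar>"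
  note tf = cyl_tot[OF f(1)] and tg = cyl_tot[OF g(1)]
  obtain h1 where h1: "h1 \<in> bdy"
    "zeta f g = form (\<lambda>as. h1 as + sg (?P + ?Q) (ins f g as) + sg ?P (cp (dlt g) f as))"
    by (rule zeta_form[OF g(1) hg f(1) hf])
  obtain h2 where h2: "h2 \<in> bdy"
    "zeta g f = form (\<lambda>as. h2 as + sg (?Q + ?P) (ins g f as) + sg ?Q (cp (dlt f) g as))"
    by (rule zeta_form[OF f(1) hf g(1) hg])
  have gN: "g (map N v) = N (g v)" for v
    using fun_cong[OF g(3), of v] by (metis N_Ni T_def)
  have "dlt (cp f g) = (\<lambda>as. sg (?P * ?Q + ?P) (h1 as + sg (?P + ?Q) (ins f g as) + sg ?P (cp (dlt g) f as))
      + sg ?Q (h2 as + sg (?Q + ?P) (ins g f as) + sg ?Q (cp (dlt f) g as)))"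
    by (rule form_inj)
      (simp only: form_dlt[OF totD(1)[OF tot_cp[OF tf tg]]] cyc_cp[OF hf hg gN] h1(2) h2(2) form_add form_sg)
  moreover have c: "(\<lambda>as. cp (dlt g) f as - sg (nat \<bar>q - 1\<bar> * ?P) (cp f (dlt g) as)) \<in> bdy"
    by (rule graded_commutative_bdy[OF b f(1) homI_homogeneous[OF dlt_homI[OF tg g(2)]] hf])
  let ?c = "\<lambda>as. cp (dlt g) f as - sg (nat \<bar>q - 1\<bar> * ?P) (cp f (dlt g) as)"
  have "(\<lambda>as. sg (Suc P) (sg (?P * ?Q + ?P) (h1 as) + sg ?Q (h2 as) + sg (?P * ?Q) (?c as))) \<in> bdy"
    by (intro bdy_sg bdy_add h1 h2 c)
  have sgs: "sg (nat \<bar>q - 1\<bar> * ?P) y = sg (Suc ?Q * ?P) y" "sg P y = sg ?P y" "sg (Suc P) y = sg (Suc ?P) y" for y :: 'a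
    using e by (auto intro!: sg_cong)
  have "bracket f g as - sg (Suc P) (- dlt (cp f g) as + cp (dlt f) g as + sg P (cp f (dlt g) as))
    = sg (Suc P) (sg (?P * ?Q + ?P) (h1 as) + sg ?Q (h2 as) + sg (?P * ?Q) (?c as))" for as
    unfolding calculation sgs bracket_homogeneous[OF totD(2)[OF tg] hf hg]
    by (cases "even ?P"; cases "even ?Q") (simp_all add: sg_def)
  with \<open>(\<lambda>as. sg (Suc P) (sg (?P * ?Q + ?P) (h1 as) + sg ?Q (h2 as) + sg (?P * ?Q) (?c as))) \<in> bdy\<close>
  show ?thesis by simp
qed

end

section \<open>Passage to cohomology through invariant cocycles\<close>

locale frobenius_bv = frobenius_form scale tr N Ni rep
  for scale :: "'k::field \<Rightarrow> 'a::ring_1 \<Rightarrow> 'a" and tr :: "'a \<Rightarrow> 'k" and N Ni :: "'a \<Rightarrow> 'a" and rep :: "('a \<Rightarrow> 'k) \<Rightarrow> 'a" +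
  assumes decomp: "f \<in> tot \<Longrightarrow> \<exists>g\<in>tot. \<exists>h\<in>tot. T g = g \<and> f = (\<lambda>as. g as + (h as - T h as))"
    and ker_im: "w \<in> tot \<Longrightarrow> T (\<lambda>as. w as - T w as) = (\<lambda>as. w as - T w as) \<Longrightarrow> T w = w"
begin

lemma diff_one_minus_T: "diff (\<lambda>as. h as - T h as) = (\<lambda>as. diff h as - T (diff h) as)"
  by (auto simp: diff_minus T_diff intro!: ext)

text \<open>Write \<open>f\<close> as \<open>g\<close> plus (1 - \<open>T\<close>) \<open>h\<close>
  with \<open>g\<close> invariant. Then \<open>diff g\<close> is invariant and lies in the image of
  1 - \<open>T\<close>, hence is zero. Replacing \<open>h\<close> by its part \<open>k\<close> in
  the image of 1 - \<open>T\<close> does not change (1 - \<open>T\<close>) \<open>h\<close>. This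
  \<open>k\<close> is a cocycle, and for a cocycle \<open>dlt_diff\<close> exhibits (1 -
  \<open>T\<close>) \<open>k\<close> as a coboundary, with primitive \<open>dlt k\<close> up to
  sign.\<close>

lemma invariant_rep:
  assumes f: "f \<in> cyl"
  obtains g where "g \<in> cyl" "T g = g" "cls g = cls f"
proof -
  obtain g h where g: "g \<in> tot" "T g = g" and h: "h \<in> tot" and fgh: "f = (\<lambda>as. g as + (h as - T h as))"
    using decomp[OF cyl_tot[OF f]] by auto
  have "diff f as = diff g as + (diff h as - T (diff h) as)" for as
    unfolding fgh diff_plus diff_one_minus_T ..
  then have dg: "diff g as = T (diff h) as - diff h as" for as
    using cyl_diffD[OF f] by (simp add: eq_neg_iff_add_eq_0[symmetric] algebra_simps)
  have dT: "T (diff h) = diff h"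
  proof (rule ker_im[OF tot_diff[OF h]])
    have "T (\<lambda>as. - diff g as) = (\<lambda>as. - diff g as)"
      unfolding T_uminus T_diff g(2) ..
    then show "T (\<lambda>as. diff h as - T (diff h) as) = (\<lambda>as. diff h as - T (diff h) as)"
      by (simp add: dg)
  qed
  then have g0: "diff g = (\<lambda>as. 0)" using dg by auto
  obtain h0 h1 where h0: "h0 \<in> tot" "T h0 = h0" and h1: "h1 \<in> tot"
    and hh: "h = (\<lambda>as. h0 as + (h1 as - T h1 as))"
    using decomp[OF h] by auto
  let ?k = "\<lambda>as. h1 as - T h1 as"
  have tk: "?k \<in> tot" using h1 tot_T by (intro tot_minus)
  have Tk: "h as - T h as = ?k as - T ?k as" for as
    unfolding hh by (simp add: T_add T_minus h0(2))
  \<comment> \<open>\<open>diff ?k\<close> is invariant, and as \<open>?k\<close> lies in the image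
    of 1 - \<open>T\<close> so does its differential; hence it vanishes by
    \<open>ker_im\<close>.\<close>
  have "diff ?k as - T (diff ?k) as = 0" for as
    using fun_cong[OF diff_one_minus_T[of ?k], of as] fun_cong[OF diff_one_minus_T[of h], of as]
    by (simp add: Tk dT)
  then have "T (diff ?k) = diff ?k" by auto
  then have "T (\<lambda>as. diff h1 as - T (diff h1) as) = (\<lambda>as. diff h1 as - T (diff h1) as)"
    by (simp only: diff_one_minus_T)
  then have "T (diff h1) = diff h1" by (rule ker_im[OF tot_diff[OF h1]])
  then have dk: "diff ?k = (\<lambda>as. 0)" by (simp add: diff_one_minus_T)
  have "dlt (\<lambda>as. 0) = (\<lambda>as. 0)"
    using dlt_scale[OF tot_zero, of 0] by simp
  then have "sg (length as) (T ?k as - ?k as) + diff (dlt ?k) as = 0" for as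
    using dlt_diff[OF tk, of as] dk by simp
  then have "?k as - T ?k as = diff (eps (\<lambda>as. - dlt ?k as)) as" for as
    unfolding diff_eps diff_uminus
    by (metis (no_types, lifting) add_eq_0_iff minus_diff_eq sg_double sg_sg sg_uminus)
  then have "(\<lambda>as. h as - T h as) \<in> bdy"
    unfolding Tk by (intro bdyI[OF tot_eps[OF tot_uminus[OF tot_dlt[OF tk]]]])
  then have "cls f = cls g"
    unfolding cls_eq_iff fgh by simp
  moreover have "g \<in> cyl" using g g0 by (simp add: cocycles_iff)
  ultimately show ?thesis using that g(2) by simp
qed

lemma invariant_homI_rep:
  assumes f: "f \<in> cyl" "homI p f"
  obtains g where "g \<in> cyl" "T g = g" "cls g = cls f" "homI p g"
proof (cases rule: homI_cases[OF f(2)])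
  case (1 n)
  obtain g where g: "g \<in> cyl" "T g = g" "cls g = cls f" by (rule invariant_rep[OF f(1)])
  let ?r = "\<lambda>g as. if length as = n then g as else (0 :: 'a)"
  have "(\<lambda>as. if length as = n then g as - f as else 0) \<in> bdy"
    using g(3) by (intro restrict_bdy) (simp add: cls_eq_iff)
  also have "(\<lambda>as. if length as = n then g as - f as else 0) = (\<lambda>as. ?r g as - f as)"
    using 1(2) by (auto simp: homogeneous_def)
  finally have "cls (?r g) = cls f" by (simp add: cls_eq_iff)
  moreover have "T (?r g) = ?r g"
    using T_restrict[of "\<lambda>m. m = n" g] unfolding g(2) .
  moreover have "?r g \<in> cyl" by (rule cyl_restrict[OF g(1)])
  moreover have "homI p (?r g)" using 1(1) by (simp add: homI_def)
  ultimately show ?thesis using that by blast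
next
  case 2
  then show ?thesis using that[of "\<lambda>as. 0"] cyl_zero T_zero by (simp add: homI_def)
qed

text \<open>Needed for Delta to be well defined on classes. Split a primitive into an invariant part
  and one in the image of 1 - \<open>T\<close>; the differential of the second part is invariant and
  in that image, so it vanishes.\<close>

lemma invariant_bdy:
  assumes "f \<in> bdy" and "T f = f"
  obtains h where "h \<in> tot" "T h = h" "f = diff h"
proof -
  obtain h where h: "h \<in> tot" "f = diff h" using assms(1) by (rule bdyE)
  obtain h0 h1 where h0: "h0 \<in> tot" "T h0 = h0" and h1: "h1 \<in> tot"
    and hh: "h = (\<lambda>as. h0 as + (h1 as - T h1 as))"
    using decomp[OF h(1)] by auto
  have d: "diff h as = diff h0 as + (diff h1 as - T (diff h1) as)" for as
    unfolding hh diff_plus diff_one_minus_T ..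
  then have e: "(\<lambda>as. diff h1 as - T (diff h1) as) = (\<lambda>as. diff h as - diff h0 as)" by auto
  have "T (\<lambda>as. diff h1 as - T (diff h1) as) = (\<lambda>as. diff h1 as - T (diff h1) as)"
    unfolding e T_minus using assms(2) h(2) T_diff[of h0] h0(2) by simp
  then have "T (diff h1) = diff h1" by (rule ker_im[OF tot_diff[OF h1]])
  then have "f = diff h0" using d h(2) by auto
  then show ?thesis using that h0 by blast
qed

lemma dlt_cyl:
  assumes "f \<in> cyl" and "T f = f"
  shows "dlt f \<in> cyl"
proof -
  have "dlt (\<lambda>as. 0) = (\<lambda>as. 0)"
    using dlt_scale[OF tot_zero, of 0] by simp
  then have "diff (dlt f) as = 0" for as
    using dlt_diff[OF cyl_tot[OF assms(1)], of as] assms by (simp add: cocycles_iff)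
  then show ?thesis using assms by (auto simp: cocycles_iff tot_dlt)
qed

lemma dlt_minus: "f \<in> tot \<Longrightarrow> g \<in> tot \<Longrightarrow> dlt (\<lambda>as. f as - g as) = (\<lambda>as. dlt f as - dlt g as)"
  using dlt_add[of f "\<lambda>as. - g as"] dlt_scale[of g "-1"] tot_uminus[of g] by simp

lemma dlt_cls:
  assumes "f \<in> cyl" "T f = f" "g \<in> cyl" "T g = g" "cls f = cls g"
  shows "cls (dlt f) = cls (dlt g)"
proof -
  have "(\<lambda>as. f as - g as) \<in> bdy" using assms(5) by (simp add: cls_eq_iff)
  moreover have "T (\<lambda>as. f as - g as) = (\<lambda>as. f as - g as)" by (simp add: T_minus assms)
  ultimately obtain h where h: "h \<in> tot" "T h = h" "(\<lambda>as. f as - g as) = diff h"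
    by (rule invariant_bdy)
  have "dlt f as - dlt g as = diff (dlt h) as" for as
    using dlt_diff[OF h(1), of as] fun_cong[OF dlt_minus[of f g], of as] assms h by (simp add: cyl_tot)
  then show ?thesis
    unfolding cls_eq_iff by (intro bdyI[OF tot_dlt[OF h(1)]])
qed

lemma invariant_carrier:
  assumes "x \<in> carrier \<H>"
  obtains f where "f \<in> cyl" "T f = f" "x = cls f"
proof -
  obtain g where g: "g \<in> cyl" "x = cls g" using assms by (auto simp: HH_carrier)
  obtain f where "f \<in> cyl" "T f = f" "cls f = cls g" by (rule invariant_rep[OF g(1)])
  then show ?thesis using that g(2) by simp
qed

lemma invariant_deg:
  assumes "x \<in> HH_deg scale p"
  obtains f where "f \<in> cyl" "T f = f" "x = cls f" "homI p f"
proof -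
  obtain g where g: "g \<in> cyl" "homI p g" "x = cls g" using assms by (auto simp: HH_deg_iff)
  obtain f where "f \<in> cyl" "T f = f" "cls f = cls g" "homI p f" by (rule invariant_homI_rep[OF g(1,2)])
  then show ?thesis using that g(3) by simp
qed

text \<open>The class of \<open>dlt f\<close> is independent of the chosen invariant cocycle by
  \<open>dlt_cls\<close>. The minus sign matches the sign convention of
  \<open>br_eq\<close>.\<close>

definition bv :: "'a cochain set \<Rightarrow> 'a cochain set" where
  "bv x = cls (\<lambda>as. - dlt (SOME f. f \<in> cyl \<and> T f = f \<and> cls f = x) as)"

lemma bv_cls:
  assumes "f \<in> cyl" "T f = f"
  shows "bv (cls f) = cls (\<lambda>as. - dlt f as)"
proof -
  let ?g = "SOME g. g \<in> cyl \<and> T g = g \<and> cls g = cls f"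
  have g: "?g \<in> cyl \<and> T ?g = ?g \<and> cls ?g = cls f"
    by (rule someI[of _ f]) (use assms in simp)
  then have "cls (dlt ?g) = cls (dlt f)"
    using assms by (intro dlt_cls) simp_all
  then have "(\<lambda>as. - (dlt ?g as - dlt f as)) \<in> bdy"
    unfolding cls_eq_iff by (rule bdy_uminus)
  then show ?thesis unfolding bv_def cls_eq_iff by (simp add: algebra_simps)
qed

theorem bv_operator_HH: "bv_operator \<K> \<H> (HH_deg scale) (HH_bracket scale) bv"
proof (rule bv_operator.intro[OF gerstenhaber_algebra_HH], rule bv_operator_axioms.intro, goal_cases)
  case (1 x)
  then obtain f where f: "f \<in> cyl" "T f = f" "x = cls f" by (rule invariant_carrier)
  show ?case unfolding f(3) bv_cls[OF f(1,2)] HH_carrier by (intro imageI cyl_uminus dlt_cyl f)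
next
  case (2 x y)
  from 2(1) obtain f where f: "f \<in> cyl" "T f = f" "x = cls f" by (rule invariant_carrier)
  from 2(2) obtain g where g: "g \<in> cyl" "T g = g" "y = cls g" by (rule invariant_carrier)
  have "T (\<lambda>as. f as + g as) = (\<lambda>as. f as + g as)" by (simp add: T_add f g)
  then show ?case
    unfolding f(3) g(3) HH_add bv_cls[OF f(1,2)] bv_cls[OF g(1,2)] dlt_add[OF cyl_tot[OF f(1)] cyl_tot[OF g(1)], symmetric]
    by (subst bv_cls[OF cyl_add[OF f(1) g(1)]]) (auto simp: dlt_add[OF cyl_tot[OF f(1)] cyl_tot[OF g(1)]] HH_add add.commute)
next
  case (3 c x)
  from 3(2) obtain f where f: "f \<in> cyl" "T f = f" "x = cls f" by (rule invariant_carrier)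
  have "T (\<lambda>as. scale c (f as)) = (\<lambda>as. scale c (f as))" by (simp add: T_scale f)
  then show ?case
    unfolding f(3) HH_smult bv_cls[OF f(1,2)]
    by (subst bv_cls[OF cyl_scale[OF f(1)]]) (auto simp: dlt_scale[OF cyl_tot[OF f(1)]])
next
  case (4 x p)
  then obtain f where f: "f \<in> cyl" "T f = f" "x = cls f" "homI p f" by (rule invariant_deg)
  show ?case unfolding HH_deg_iff f(3) bv_cls[OF f(1,2)]
    by (intro bexI[of _ "\<lambda>as. - dlt f as"] conjI homI_zero_add_scale(4) dlt_homI cyl_uminus dlt_cyl cyl_tot f refl)
next
  case (5 x)
  then obtain f where f: "f \<in> cyl" "T f = f" "x = cls f" by (rule invariant_carrier)
  have "T (\<lambda>as. - dlt f as) = (\<lambda>as. - dlt f as)"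
    by (simp add: T_uminus dlt_T cyl_tot f)
  moreover have "dlt (\<lambda>as. - dlt f as) = (\<lambda>as. 0)"
    using dlt_scale[OF tot_dlt[OF cyl_tot[OF f(1)]], of "-1"] dlt_dlt[OF cyl_tot[OF f(1)]] by simp
  ultimately show ?case
    unfolding f(3) bv_cls[OF f(1,2)]
    by (subst bv_cls[OF cyl_uminus[OF dlt_cyl[OF f(1,2)]]]) (simp_all add: HH_zero)
next
  case 6
  let ?e = "\<lambda>as::'a list. if as = [] then 1 else (0 :: 'a)"
  have Te: "T ?e = ?e" using Ni_N[of 1] by (auto simp: T_def N_one)
  have "dlt ?e = (\<lambda>as. 0)"
  proof (rule form_inj)
    fix as
    have "cyc (\<lambda>v. tr (?e v)) as = 0" unfolding cyc_def by (rule spl_zeroI) auto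
    then show "form (dlt ?e) as = form (\<lambda>as. 0) as"
      unfolding form_dlt[OF totD(1)[OF cyl_tot[OF one_cyl]]] by (simp add: form_def)
  qed
  then show ?case by (simp add: HH_one HH_zero bv_cls[OF one_cyl Te])
next
  case (7 x p y q)
  from 7(1) obtain f where f: "f \<in> cyl" "T f = f" "x = cls f" "homI p f" by (rule invariant_deg)
  from 7(2) obtain g where g: "g \<in> cyl" "T g = g" "y = cls g" "homI q g" by (rule invariant_deg)
  note df = dlt_cyl[OF f(1,2)] and dg = dlt_cyl[OF g(1,2)]
  have Tc: "T (cp f g) = cp f g" by (simp add: T_cp f g)
  note cfg = cyl_cp[OF f(1) g(1)] and dfg = dlt_cyl[OF cyl_cp[OF f(1) g(1)] Tc]
  have e: "even (p + 1) = even (Suc (nat \<bar>p\<bar>))" "even p = even (nat \<bar>p\<bar>)" by auto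
  have u: "cp (\<lambda>as. - u as) v as = - cp u v as" "cp u (\<lambda>as. - v as) as = - cp u v as" for u v :: "'a list \<Rightarrow> 'a" and as
    using cp_diff_left[of "\<lambda>as. 0" u v as] cp_diff_right[of u "\<lambda>as. 0" v as] by simp_all
  have main: "(\<lambda>as. bracket f g as - sg (Suc (nat \<bar>p\<bar>)) (- dlt (cp f g) as + cp (dlt f) g as + sg (nat \<bar>p\<bar>) (cp f (dlt g) as))) \<in> bdy"
    by (rule bv_cochain[OF f(1,4) g(1,4,2) dg, of _ "nat \<bar>q\<bar>"]) simp_all
  have "with_sign \<H> p (cls (cp f (\<lambda>as. - dlt g as))) = cls (\<lambda>as. sg (nat \<bar>p\<bar>) (cp f (\<lambda>as. - dlt g as) as))"
    by (rule HH_with_sign[OF cyl_cp[OF f(1) cyl_uminus[OF dg]] e(2)])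
  then have "bv (x \<otimes>\<^bsub>\<H>\<^esub> y) \<ominus>\<^bsub>\<H>\<^esub> bv x \<otimes>\<^bsub>\<H>\<^esub> y \<ominus>\<^bsub>\<H>\<^esub> with_sign \<H> p (x \<otimes>\<^bsub>\<H>\<^esub> bv y)
     = cls (\<lambda>as. - dlt (cp f g) as - cp (\<lambda>as. - dlt f as) g as - sg (nat \<bar>p\<bar>) (cp f (\<lambda>as. - dlt g as) as))"
    unfolding f(3) g(3) HH_mult[OF f(1) g(1)] bv_cls[OF f(1,2)] bv_cls[OF g(1,2)] bv_cls[OF cfg Tc]
      HH_mult[OF cyl_uminus[OF df] g(1)] HH_mult[OF f(1) cyl_uminus[OF dg]]
    by (simp only: HH_minus[OF cyl_uminus[OF dfg] cyl_cp[OF cyl_uminus[OF df] g(1)]]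
        HH_minus[OF cyl_minus[OF cyl_uminus[OF dfg] cyl_cp[OF cyl_uminus[OF df] g(1)]] cyl_sg[OF cyl_cp[OF f(1) cyl_uminus[OF dg]]]])
  also have "\<dots> = cls (\<lambda>as. - dlt (cp f g) as + cp (dlt f) g as + sg (nat \<bar>p\<bar>) (cp f (dlt g) as))"
    by (simp add: u sg_uminus)
  finally have "with_sign \<H> (p + 1) (bv (x \<otimes>\<^bsub>\<H>\<^esub> y) \<ominus>\<^bsub>\<H>\<^esub> bv x \<otimes>\<^bsub>\<H>\<^esub> y \<ominus>\<^bsub>\<H>\<^esub> with_sign \<H> p (x \<otimes>\<^bsub>\<H>\<^esub> bv y))
    = cls (\<lambda>as. sg (Suc (nat \<bar>p\<bar>)) (- dlt (cp f g) as + cp (dlt f) g as + sg (nat \<bar>p\<bar>) (cp f (dlt g) as)))"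
    using f(1) g(1) df dg dfg cfg
    by (simp only:) (rule HH_with_sign[OF _ e(1)], intro cyl_add cyl_uminus cyl_sg cyl_cp)
  also have "\<dots> = HH_bracket scale x y"
    unfolding f(3) g(3) HH_bracket_cls[OF f(1) g(1)] by (rule sym, rule cls_eqI, rule main)
  finally show ?case ..
qed

corollary batalin_vilkovisky_HH:
  "batalin_vilkovisky_algebra \<K> \<H> (HH_deg scale) (HH_bracket scale)"
  unfolding batalin_vilkovisky_algebra_def
  using gerstenhaber_algebra_HH bv_operator_HH by blast

end

section \<open>Splitting cochains when a power of the twist is diagonal\<close>

context k_algebra begin

lemma ml_ext:
  assumes "ml scale f" and "ml scale g" and B: "span B = UNIV"
    and eq: "\<And>bs. set bs \<subseteq> B \<Longrightarrow> f bs = g bs"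
  shows "f = g"
proof -
  have "\<forall>vs. set vs \<subseteq> B \<longrightarrow> f (us @ vs) = g (us @ vs)" for us
  proof (induction us rule: rev_induct)
    case (snoc a us)
    show ?case
    proof (intro allI impI)
      fix vs assume vs: "set vs \<subseteq> B"
      have "a \<in> span B" using B by simp
      then have "f (us @ a # vs) = g (us @ a # vs)"
      proof (induction rule: span_induct_alt)
        case base
        show ?case
          using slot_additiveD(2)[OF ml_slot_additive[OF assms(1)]] slot_additiveD(2)[OF ml_slot_additive[OF assms(2)]] by simp
      next
        case (step c x y)
        have "f (us @ x # vs) = g (us @ x # vs)" using snoc vs step(1) by simp
        then show ?case using step by (simp add: mlD[OF assms(1)] mlD[OF assms(2)])
      qed
      then show "f ((us @ [a]) @ vs) = g ((us @ [a]) @ vs)" by simp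
    qed
  qed (simp add: eq)
  from this[rule_format, of "[]"] show ?thesis by auto
qed

lemma ml_scale_list:
  assumes "ml scale f"
  shows "f (us @ map (\<lambda>b. scale (\<mu> b) b) bs) = scale (prod_list (map \<mu> bs)) (f (us @ bs))"
proof (induction bs arbitrary: us)
  case (Cons b bs)
  then show ?case
    using Cons[of "us @ [scale (\<mu> b) b]"] by (simp add: mlD[OF assms] mult.commute)
qed simp

end

locale frobenius_finite_order = frobenius_form scale tr N Ni rep
  for scale :: "'k::field \<Rightarrow> 'a::ring_1 \<Rightarrow> 'a" and tr :: "'a \<Rightarrow> 'k" and N Ni :: "'a \<Rightarrow> 'a" and rep :: "('a \<Rightarrow> 'k) \<Rightarrow> 'a" +
  fixes B :: "'a set" and m :: nat and \<mu> :: "'a \<Rightarrow> 'k"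
  assumes finite_B: "finite B" and basis_B: "is_basis scale UNIV B"
    and N_power: "b \<in> B \<Longrightarrow> (N ^^ m) b = scale (\<mu> b) b"
    and m_nz: "of_nat m \<noteq> (0 :: 'k)"
begin

lemma B: "independent B" "span B = UNIV"
  using basis_B by (auto simp: is_basis_def)

abbreviation "coord \<equiv> representation B"

lemma coord_add: "coord (x + y) b = coord x b + coord y b"
  using representation_add[OF B(1), of y x] B(2) by simp

lemma coord_scale: "coord (scale c x) b = c * coord x b"
  using representation_scale[OF B(1), of x c] B(2) by simp

lemma coord_minus: "coord (x - y) b = coord x b - coord y b"
  using representation_diff[OF B(1), of y x] B(2) by simp

lemma coord_ext: "(\<And>b. b \<in> B \<Longrightarrow> coord x b = coord y b) \<Longrightarrow> x = y"
proof -
  assume *: "\<And>b. b \<in> B \<Longrightarrow> coord x b = coord y b"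
  have "(\<Sum>b\<in>B. scale (coord x b) b) = x" for x
    using sum_representation_eq[OF B(1) _ finite_B order_refl, of x] B(2) by simp
  from this[of x] this[of y] * show ?thesis by (metis (mono_tags, lifting) sum.cong)
qed

lemma Npow_linear: "(N ^^ j) (x + y) = (N ^^ j) x + (N ^^ j) y" "(N ^^ j) (scale c x) = scale c ((N ^^ j) x)"
  by (induction j) (simp_all add: N_plus N_scale)

lemma coord_Npow: "coord ((N ^^ m) x) b = \<mu> b * coord x b" if "b \<in> B"
proof -
  have "x \<in> span B" using B by simp
  then show ?thesis
  proof (induction rule: span_induct_alt)
    case base
    then show ?case using Npow_linear(2)[of m 0 0] by (simp add: representation_zero)
  next
    case (step c x y)
    then show ?case
      using that by (auto simp: Npow_linear coord_add coord_scale N_power representation_basis[OF B(1)] algebra_simps)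
  qed
qed

lemma Nipow: "(N ^^ j) ((Ni ^^ j) x) = x"
proof (induction j)
  case (Suc j)
  have "(N ^^ Suc j) ((Ni ^^ Suc j) x) = (N ^^ j) (N (Ni ((Ni ^^ j) x)))"
    by (simp add: funpow_swap1)
  then show ?case by (simp only: N_Ni Suc)
qed simp

text \<open>The factor by which \<open>T ^^ m\<close> multiplies the coefficient of \<open>b\<close>
  in the value of a cochain at the basis list \<open>bs\<close>, see
  \<open>coord_T_pow\<close>.\<close>

definition \<theta> :: "'a list \<Rightarrow> 'a \<Rightarrow> 'k" where
  "\<theta> bs b = prod_list (map \<mu> bs) / \<mu> b"

lemma \<mu>_nz: "b \<in> B \<Longrightarrow> \<mu> b \<noteq> 0"
proof
  assume b: "b \<in> B" "\<mu> b = 0"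
  then have "coord ((N ^^ m) ((Ni ^^ m) b)) b = 0" by (simp add: coord_Npow)
  then show False using b by (simp add: Nipow representation_basis[OF B(1)])
qed

lemma T_pow: "(T ^^ j) f as = (Ni ^^ j) (f (map (N ^^ j) as))"
proof (induction j arbitrary: f as)
  case (Suc j)
  then show ?case by (simp add: T_def funpow_swap1 o_def)
qed simp

lemma coord_T_pow:
  assumes "f \<in> tot" and bs: "set bs \<subseteq> B" and b: "b \<in> B"
  shows "coord ((T ^^ m) f bs) b = \<theta> bs b * coord (f bs) b"
proof -
  have "f (map (N ^^ m) bs) = scale (prod_list (map \<mu> bs)) (f bs)"
    using ml_scale_list[OF totD(1)[OF assms(1)], of "[]" \<mu> bs] bs N_power
    by (metis (mono_tags, lifting) append_Nil map_eq_conv subset_iff)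
  then have "(N ^^ m) ((T ^^ m) f bs) = scale (prod_list (map \<mu> bs)) (f bs)"
    by (simp add: T_pow Nipow)
  then have "\<mu> b * coord ((T ^^ m) f bs) b = prod_list (map \<mu> bs) * coord (f bs) b"
    by (metis coord_Npow[OF b] coord_scale)
  then show ?thesis using \<mu>_nz[OF b] by (simp add: \<theta>_def field_simps)
qed

lemma tot_ext:
  assumes "f \<in> tot" "g \<in> tot" "\<And>bs b. set bs \<subseteq> B \<Longrightarrow> b \<in> B \<Longrightarrow> coord (f bs) b = coord (g bs) b"
  shows "f = g"
  using ml_ext[OF totD(1)[OF assms(1)] totD(1)[OF assms(2)] B(2)] coord_ext assms(3) by metis

lemma tot_T_pow: "f \<in> tot \<Longrightarrow> (T ^^ j) f \<in> tot"
  by (induction j) (simp_all add: tot_T)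

text \<open>Let v = (1 - \<open>T\<close>) \<open>w\<close> be invariant. Then the m-th power of
  \<open>T\<close> sends \<open>w\<close> to \<open>w\<close> - m v, while on coefficients it
  multiplies by \<theta>. Where \<theta> is 1 this gives m v = 0; where it is not 1, the invariance
  of v gives v = 0.\<close>

lemma ker_im:
  assumes w: "w \<in> tot" and v: "T (\<lambda>as. w as - T w as) = (\<lambda>as. w as - T w as)"
  shows "T w = w"
proof -
  let ?v = "\<lambda>as. w as - T w as"
  have vt: "?v \<in> tot" using w by (intro tot_minus tot_T)
  have "(T ^^ j) w = (\<lambda>as. w as - scale (of_nat j) (?v as))" for j
  proof (induction j)
    case (Suc j)
    have "(T ^^ Suc j) w = (\<lambda>as. T w as - scale (of_nat j) (T ?v as))"
      using Suc by (simp add: T_minus[of w] T_scale del: v)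
    then show ?case unfolding v by (simp add: scale_left_distrib)
  qed simp
  from this[of m] have D: "(T ^^ m) w = (\<lambda>as. w as - scale (of_nat m) (?v as))" .
  have Dv: "(T ^^ j) ?v = ?v" for j by (induction j) (simp_all add: v)
  have "?v = (\<lambda>as. 0)"
  proof (rule tot_ext[OF vt tot_zero])
    fix bs b assume bs: "set bs \<subseteq> B" "b \<in> B"
    have 1: "\<theta> bs b * coord (w bs) b = coord (w bs) b - of_nat m * coord (?v bs) b"
      using coord_T_pow[OF w bs] D by (simp add: coord_minus coord_scale)
    have 2: "\<theta> bs b * coord (?v bs) b = coord (?v bs) b"
      using coord_T_pow[OF vt bs] unfolding Dv by simp
    show "coord (?v bs) b = coord 0 b"
      using 1 2 m_nz by (cases "\<theta> bs b = 1") (auto simp: representation_zero)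
  qed
  then show ?thesis by (metis (no_types, lifting) eq_iff_diff_eq_0 ext)
qed

definition split_off :: "('a list \<Rightarrow> 'a) \<Rightarrow> bool" where
  "split_off f \<longleftrightarrow> (\<exists>g\<in>tot. \<exists>h\<in>tot. T g = g \<and> f = (\<lambda>as. g as + (h as - T h as)))"

primrec psum :: "nat \<Rightarrow> ('a list \<Rightarrow> 'a) \<Rightarrow> 'a list \<Rightarrow> 'a" where
  "psum 0 f = (\<lambda>as. 0)"
| "psum (Suc j) f = (\<lambda>as. psum j f as + (T ^^ j) f as)"

lemma tot_psum: "f \<in> tot \<Longrightarrow> psum j f \<in> tot"
  by (induction j) (simp_all only: psum.simps tot_zero tot_add tot_T_pow)

lemma psum_telescope: "(T ^^ j) f as = f as - (psum j f as - T (psum j f) as)"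
proof (induction j)
  case (Suc j)
  have "T (psum (Suc j) f) as = T (psum j f) as + (T ^^ Suc j) f as"
    by (simp add: T_add)
  then show ?case using Suc by (simp del: funpow.simps)
qed (simp add: T_zero)

lemmas psum = tot_psum psum_telescope

text \<open>By \<open>psum_telescope\<close>, \<open>f\<close> and its image under
  \<open>T ^^ m\<close> differ by an element of the image of 1 - \<open>T\<close>. So up to such an
  element the assumption splits (1 - l) \<open>f\<close>, and 1 - l can be divided out.\<close>

lemma split_off_eigen:
  assumes "f \<in> tot" and "l \<noteq> 1" and "split_off (\<lambda>as. (T ^^ m) f as - scale l (f as))"
  shows "split_off f"
proof -
  let ?s = "psum m f"
  obtain g h where g: "g \<in> tot" "T g = g" and h: "h \<in> tot"
    and e: "(\<lambda>as. (T ^^ m) f as - scale l (f as)) = (\<lambda>as. g as + (h as - T h as))"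
    using assms(3) unfolding split_off_def by auto
  let ?r = "inverse (1 - l)"
  let ?h = "\<lambda>as. h as + ?s as"
  have "scale (1 - l) (f as) = g as + (?h as - T ?h as)" for as
    using fun_cong[OF e, of as] psum(2)[of m f as]
    by (simp add: scale_left_diff_distrib T_add algebra_simps)
  then have "f as = scale ?r (g as + (?h as - T ?h as))" for as
    using assms(2) by (metis eq_iff_diff_eq_0 left_inverse scale_one scale_scale)
  then have "f = (\<lambda>as. scale ?r (g as) + (scale ?r (?h as) - T (\<lambda>as. scale ?r (?h as)) as))"
    unfolding T_scale[of ?r ?h] scale_right_distrib[symmetric] scale_right_diff_distrib[symmetric] by (rule ext)
  moreover have "T (\<lambda>as. scale ?r (g as)) = (\<lambda>as. scale ?r (g as))" by (simp add: T_scale g)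
  ultimately show ?thesis
    unfolding split_off_def
    by (intro bexI[of _ "\<lambda>as. scale ?r (g as)"] bexI[of _ "\<lambda>as. scale ?r (?h as)"] conjI
        tot_scale tot_add g(1) h tot_psum[OF assms(1)])
qed

text \<open>Averaging: each power of \<open>T\<close> moves \<open>f\<close> only by an element of
  the image of 1 - \<open>T\<close>, so m \<open>f\<close> is congruent to \<open>psum m f\<close>,
  which is invariant because \<open>T ^^ m\<close> fixes \<open>f\<close>. Then m is divided
  out.\<close>

lemma split_off_invariant:
  assumes "f \<in> tot" and D: "(T ^^ m) f = f"
  shows "split_off f"
proof -
  have "\<exists>u\<in>tot. \<forall>as. scale (of_nat j) (f as) = psum j f as + (u as - T u as)" for j
  proof (induction j)
    case 0
    then show ?case using tot_zero by (intro bexI[of _ "\<lambda>as. 0"]) (auto simp: T_zero)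
  next
    case (Suc j)
    then obtain u where u: "u \<in> tot" "\<And>as. scale (of_nat j) (f as) = psum j f as + (u as - T u as)" by auto
    let ?u = "\<lambda>as. u as + psum j f as"
    have "scale (of_nat (Suc j)) (f as) = psum (Suc j) f as + (?u as - T ?u as)" for as
      using u(2)[of as] psum(2)[of j f as] by (simp add: scale_left_distrib T_add algebra_simps)
    then show ?case using u psum(1)[OF assms(1)] by (intro bexI[of _ ?u] tot_add) auto
  qed
  then obtain u where u: "u \<in> tot" "\<And>as. scale (of_nat m) (f as) = psum m f as + (u as - T u as)" by blast
  let ?r = "inverse (of_nat m)"
  have "f as = scale ?r (psum m f as + (u as - T u as))" for as
    using u(2)[of as] m_nz by (metis left_inverse scale_one scale_scale)
  then have "f = (\<lambda>as. scale ?r (psum m f as) + (scale ?r (u as) - T (\<lambda>as. scale ?r (u as)) as))"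
    unfolding T_scale[of ?r u] scale_right_distrib[symmetric] scale_right_diff_distrib[symmetric] by (rule ext)
  moreover have "T (psum m f) = psum m f"
    using psum(2)[of m f] D by auto
  then have "T (\<lambda>as. scale ?r (psum m f as)) = (\<lambda>as. scale ?r (psum m f as))" by (simp add: T_scale)
  ultimately show ?thesis
    unfolding split_off_def
    by (intro bexI[of _ "\<lambda>as. scale ?r (psum m f as)"] bexI[of _ "\<lambda>as. scale ?r (u as)"] conjI
        tot_scale u(1) tot_psum[OF assms(1)])
qed

text \<open>Applying \<open>T ^^ m\<close> - l removes the coefficients with \<theta> = l. Once all
  values other than 1 are used up, \<open>T ^^ m\<close> fixes what is left.\<close>

lemma split_off_list:
  assumes "1 \<notin> set ls" and "f \<in> tot"
    and "\<And>bs b. set bs \<subseteq> B \<Longrightarrow> b \<in> B \<Longrightarrow> coord (f bs) b \<noteq> 0 \<Longrightarrow> \<theta> bs b = 1 \<or> \<theta> bs b \<in> set ls"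
  shows "split_off f"
  using assms
proof (induction ls arbitrary: f)
  case Nil
  have "(T ^^ m) f = f"
    by (rule tot_ext[OF tot_T_pow[OF Nil(2)] Nil(2)]) (use Nil coord_T_pow in force)
  with Nil(2) show ?case by (rule split_off_invariant)
next
  case (Cons l ls)
  let ?f = "\<lambda>as. (T ^^ m) f as - scale l (f as)"
  have "?f \<in> tot" using Cons.prems(2) by (intro tot_minus tot_scale tot_T_pow)
  moreover have "coord (?f bs) b = (\<theta> bs b - l) * coord (f bs) b" if "set bs \<subseteq> B" "b \<in> B" for bs b
    using coord_T_pow[OF Cons.prems(2) that] by (simp add: coord_minus coord_scale algebra_simps)
  ultimately have so: "split_off ?f"
    using Cons.prems by (intro Cons.IH) auto
  have "l \<noteq> 1" using Cons.prems(1) by auto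
  then show ?case by (rule split_off_eigen[OF Cons.prems(2) _ so])
qed

lemma decomp:
  assumes "f \<in> tot"
  shows "\<exists>g\<in>tot. \<exists>h\<in>tot. T g = g \<and> f = (\<lambda>as. g as + (h as - T h as))"
proof -
  obtain K where K: "\<And>as. length as > K \<Longrightarrow> f as = 0"
    using assms by (auto simp: total_cochains_iff)
  \<comment> \<open>A cochain vanishes on long lists, so only finitely many values of \<theta>
    matter for it.\<close>
  have "finite ((\<lambda>(bs, b). \<theta> bs b) ` ({bs. set bs \<subseteq> B \<and> length bs \<le> K} \<times> B) - {1})"
    using finite_lists_length_le[OF finite_B] finite_B by (intro finite_Diff finite_imageI finite_cartesian_product)
  then obtain ls where ls: "set ls = (\<lambda>(bs, b). \<theta> bs b) ` ({bs. set bs \<subseteq> B \<and> length bs \<le> K} \<times> B) - {1}"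
    by (metis finite_list)
  have "split_off f"
  proof (rule split_off_list[OF _ assms])
    show "1 \<notin> set ls" using ls by simp
    fix bs b assume *: "set bs \<subseteq> B" "b \<in> B" "coord (f bs) b \<noteq> 0"
    have "length bs \<le> K"
      using K[of bs] *(3) by (cases "length bs > K") (auto simp: representation_zero)
    then show "\<theta> bs b = 1 \<or> \<theta> bs b \<in> set ls" using * unfolding ls by auto
  qed
  then show ?thesis by (simp add: split_off_def)
qed

end

section \<open>Diagonalisation of a matrix with a diagonal power\<close>

text \<open>Column vectors are encoded as functions on the natural numbers, so that the results on
  \<open>vector_space\<close> apply to a whole type; the subspace of functions supported below n is
  singled out as \<open>W\<close> later.\<close>

definition fun_scale :: "'k::field \<Rightarrow> (nat \<Rightarrow> 'k) \<Rightarrow> nat \<Rightarrow> 'k" where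
  "fun_scale c f i = c * f i"

interpretation fs: vector_space fun_scale
  by unfold_locales (auto simp: fun_scale_def algebra_simps fun_eq_iff)

definition mat_op :: "'k::field mat \<Rightarrow> nat \<Rightarrow> (nat \<Rightarrow> 'k) \<Rightarrow> nat \<Rightarrow> 'k" where
  "mat_op A n f i = (if i < n then \<Sum>j<n. A $$ (i, j) * f j else 0)"

lemma mat_op_add: "mat_op A n (f + g) = mat_op A n f + mat_op A n g"
  and mat_op_diff: "mat_op A n (f - g) = mat_op A n f - mat_op A n g"
  and mat_op_scale: "mat_op A n (fun_scale c f) = fun_scale c (mat_op A n f)"
  by (auto simp: mat_op_def fun_eq_iff algebra_simps sum.distrib sum_subtractf fun_scale_def sum_distrib_left)

lemma sum_fun_apply: "sum g S i = (\<Sum>x\<in>S. g x i)" for g :: "'b \<Rightarrow> nat \<Rightarrow> 'k::field"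
  by (induction S rule: infinite_finite_induct) simp_all

lemma mat_op_pow:
  assumes "A \<in> carrier_mat n n" and "i < n"
  shows "(mat_op A n ^^ Suc k) f i = (\<Sum>j<n. (A ^\<^sub>m Suc k) $$ (i, j) * f j)"
proof (induction k arbitrary: f)
  case 0
  then show ?case using assms by (simp add: mat_op_def)
next
  case (Suc k)
  have "(mat_op A n ^^ Suc (Suc k)) f i = (mat_op A n ^^ Suc k) (mat_op A n f) i"
    by (simp only: funpow_Suc_right o_apply)
  also have "\<dots> = (\<Sum>j<n. (A ^\<^sub>m Suc k) $$ (i, j) * (\<Sum>l<n. A $$ (j, l) * f l))"
    unfolding Suc by (intro sum.cong) (auto simp: mat_op_def)
  also have "\<dots> = (\<Sum>l<n. (\<Sum>j<n. (A ^\<^sub>m Suc k) $$ (i, j) * A $$ (j, l)) * f l)"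
    by (simp add: sum_distrib_left sum_distrib_right mult.assoc) (rule sum.swap)
  also have "\<dots> = (\<Sum>l<n. (A ^\<^sub>m Suc (Suc k)) $$ (i, l) * f l)"
  proof (rule sum.cong, simp, goal_cases)
    case (1 l)
    have "A ^\<^sub>m Suc k \<in> carrier_mat n n" using assms by (intro pow_carrier_mat)
    then have "(A ^\<^sub>m Suc k * A) $$ (i, l) = (\<Sum>j<n. (A ^\<^sub>m Suc k) $$ (i, j) * A $$ (j, l))"
      using assms 1 by (simp add: scalar_prod_def lessThan_atLeast0 del: pow_mat.simps)
    then show ?case by simp
  qed
  finally show ?case .
qed

text \<open>The polynomial \<open>p\<close> evaluated at the operator \<open>U\<close> and applied
  to \<open>f\<close>, in Horner form.\<close>

definition poly_op :: "((nat \<Rightarrow> 'k) \<Rightarrow> nat \<Rightarrow> 'k) \<Rightarrow> 'k::field poly \<Rightarrow> (nat \<Rightarrow> 'k) \<Rightarrow> nat \<Rightarrow> 'k" where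
  "poly_op U p f = fold_coeffs (\<lambda>a g. fun_scale a f + U g) p 0"

text \<open>The heart is \<open>step\<close>: if (U - c) \<open>w\<close> is a sum of eigenvectors,
  so is \<open>w\<close>. The i-th unit vector is annihilated by X^m - \<open>d i\<close>, which
  splits into linear factors over an algebraically closed field, so \<open>step\<close> puts it into
  the span of the eigenvectors.\<close>

theorem similar_diagonal_of_power:
  fixes A :: "'k::alg_closed_field mat"
  assumes A: "A \<in> carrier_mat n n"
    and m: "of_nat m \<noteq> (0 :: 'k)"
    and pow: "\<And>i j. i < n \<Longrightarrow> j < n \<Longrightarrow> (A ^\<^sub>m m) $$ (i, j) = (if i = j then d i else 0)"
    and d: "\<And>i. i < n \<Longrightarrow> d i \<noteq> 0"
  shows "\<exists>D. diagonal_mat D \<and> similar_mat A D"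
proof -
  let ?U = "mat_op A n"
  obtain k where k: "m = Suc k" using m by (cases m) auto
  define W where "W = {f :: nat \<Rightarrow> 'k. \<forall>i\<ge>n. f i = 0}"
  have subW: "fs.subspace W" by (auto simp: W_def fs.subspace_def fun_scale_def)
  have UW: "?U f \<in> W" for f by (auto simp: W_def mat_op_def)
  have Um: "(?U ^^ m) f i = d i * f i" if "i < n" for f i
  proof -
    have "(?U ^^ m) f i = (\<Sum>j<n. (if j = i then d i * f i else 0))"
      unfolding k mat_op_pow[OF A that] by (intro sum.cong) (use pow[OF that] k in \<open>auto simp del: pow_mat.simps\<close>)
    then show ?thesis using that by simp
  qed
  define E where "E = {f \<in> W. \<exists>c. ?U f = fun_scale c f}"
  have spanE: "fs.span E \<subseteq> W" by (rule fs.span_minimal[OF _ subW]) (auto simp: E_def)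
  have step: "w \<in> fs.span E" if w: "w \<in> W" "?U w - fun_scale c w \<in> fs.span E" for w c
  proof -
    \<comment> \<open>U - c acts invertibly on eigenvectors with an eigenvalue b different from c,
      so only the c-eigenvector part \<open>u\<close> of \<open>s\<close> has to be kept
      apart.\<close>
    have "\<exists>t\<in>fs.span E. \<exists>u\<in>W. ?U u = fun_scale c u \<and> s = ?U t - fun_scale c t + u" if "s \<in> fs.span E" for s
      using that
    proof (induction rule: fs.span_induct_alt)
      case base
      have U0: "?U 0 = 0" by (auto simp: mat_op_def fun_eq_iff)
      show ?case
        by (intro bexI[of _ 0])
          (simp_all only: U0 fs.scale_zero_right diff_self add_0_right fs.span_zero fs.subspace_0[OF subW] simp_thms)
    next
      case (step r e s)
      from step.IH obtain t u where tu: "t \<in> fs.span E" "u \<in> W" "?U u = fun_scale c u" "s = ?U t - fun_scale c t + u" by blast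
      obtain b where e: "e \<in> W" "?U e = fun_scale b e" "e \<in> E" using step(1) by (auto simp: E_def)
      show ?case
      proof (cases "b = c")
        case True
        have "?U (fun_scale r e + u) = fun_scale c (fun_scale r e + u)"
          by (simp only: mat_op_add mat_op_scale e(2) tu(3) True fs.scale_right_distrib fs.scale_scale mult.commute[of r c])
        moreover have "fun_scale r e + u \<in> W"
          by (rule fs.subspace_add[OF subW fs.subspace_scale[OF subW e(1)] tu(2)])
        moreover have "fun_scale r e + s = ?U t - fun_scale c t + (fun_scale r e + u)"
          unfolding tu(4) by (rule add.left_commute)
        ultimately show ?thesis using tu(1) by blast
      next
        case False
        let ?x = "fun_scale (r / (b - c)) e"
        have "(b - c) * (r / (b - c)) = r" using False by simp
        then have k: "r / (b - c) * b - c * (r / (b - c)) = r" by (simp only: left_diff_distrib mult.commute)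
        have x: "fun_scale r e = ?U ?x - fun_scale c ?x"
          unfolding mat_op_scale e(2) fs.scale_scale fs.scale_left_diff_distrib[symmetric] using k by simp
        have "fun_scale r e + s = ?U (?x + t) - fun_scale c (?x + t) + u"
          unfolding x tu(4) mat_op_add fs.scale_right_distrib by (simp only: add_diff_add add.assoc)
        moreover have "?x + t \<in> fs.span E"
          by (rule fs.span_add[OF fs.span_scale[OF fs.span_base[OF e(3)]] tu(1)])
        ultimately show ?thesis using tu by blast
      qed
    qed
    from this[OF w(2)] obtain t u where t: "t \<in> fs.span E" and u: "u \<in> W" "?U u = fun_scale c u"
      and e: "?U w - fun_scale c w = ?U t - fun_scale c t + u" by blast
    \<comment> \<open>Now (U - c) \<open>v\<close> = \<open>u\<close>, so \<open>v\<close> would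
      generate a Jordan block of size two unless \<open>u\<close> vanishes.\<close>
    define v where "v = w - t"
    have Uv: "?U v = fun_scale c v + u"
      using e by (simp add: v_def mat_op_diff fs.scale_right_diff_distrib algebra_simps)
    have vW: "v \<in> W" using w(1) t spanE subW by (auto simp: v_def intro: fs.subspace_diff)
    have Uu: "(?U ^^ j) u = fun_scale (c ^ j) u" for j
      by (induction j) (auto simp: mat_op_scale u mult.commute)
    have Uvj: "(?U ^^ Suc j) v = fun_scale (c ^ Suc j) v + fun_scale (of_nat (Suc j) * c ^ j) u" for j
    proof (induction j)
      case (Suc j)
      show ?case
        by (subst funpow.simps(2), subst o_apply, subst Suc)
          (auto simp: mat_op_add mat_op_scale Uv u fun_scale_def fun_eq_iff algebra_simps)
    qed (simp add: Uv)
    have "u i = 0" for i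
    proof (cases "i < n")
      case True
      \<comment> \<open>As U^m is diagonal, the i-th coordinates can be compared: a nonzero
        \<open>u i\<close> would give \<open>d i\<close> = c^m from \<open>u\<close>, and then m
        c^(m-1) \<open>u i\<close> = 0 from \<open>v\<close>. Here \<open>k\<close> is m -
        1.\<close>
      have 1: "d i * u i = c ^ m * u i" 
        using trans[OF Um[OF True, of u, symmetric] fun_cong[OF Uu[of m], of i]] by (simp only: fun_scale_def)
      have 2: "d i * v i = c ^ m * v i + of_nat m * c ^ k * u i"
        using trans[OF Um[OF True, of v, symmetric] fun_cong[OF Uvj[of k, folded k], of i]]
        by (simp only: fun_scale_def plus_fun_def mult.assoc)
      show ?thesis
      proof (rule ccontr)
        assume ui: "u i \<noteq> 0"
        with 1 have di: "d i = c ^ m" by simp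
        with 2 have "c ^ k = 0" using m ui by simp
        then have "c ^ m = 0" by (simp add: k)
        with d[OF True] di show False by simp
      qed
    qed (use u in \<open>auto simp: W_def\<close>)
    then have "?U v = fun_scale c v" using Uv by (auto simp: fun_eq_iff)
    then have "v \<in> E" using vW by (auto simp: E_def)
    then show ?thesis using t fs.span_add[OF fs.span_base[of v E] t] by (simp add: v_def)
  qed
  have ev_pCons: "poly_op ?U (pCons a p) f = fun_scale a f + ?U (poly_op ?U p f)" for a p f
  proof (cases "p = 0 \<and> a = 0")
    case True
    have "?U 0 = 0" by (auto simp: mat_op_def fun_eq_iff)
    with True show ?thesis by (simp add: poly_op_def)
  next
    case False
    then show ?thesis by (auto simp: poly_op_def)
  qed
  have ev_0: "poly_op ?U 0 f = 0" for f by (simp add: poly_op_def)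
  have U0: "?U 0 = 0" by (auto simp: mat_op_def fun_eq_iff)
  have ev_add: "poly_op ?U (p + q) f = poly_op ?U p f + poly_op ?U q f" for p q f
  proof (induction p arbitrary: q)
    case 0
    show ?case by (simp add: poly_op_def)
  next
    case IH: (pCons a p)
    obtain b r where q: "q = pCons b r" by (cases q)
    show ?case
      unfolding q add_pCons ev_pCons IH.IH mat_op_add fs.scale_left_distrib by (simp only: ac_simps)
  qed
  have ev_smult: "poly_op ?U (smult c p) f = fun_scale c (poly_op ?U p f)" for c p f
  proof (induction p)
    case 0
    show ?case by (simp only: smult_0_right ev_0 fs.scale_zero_right)
  next
    case (pCons a p)
    then show ?case by (simp only: smult_pCons ev_pCons mat_op_scale fs.scale_right_distrib fs.scale_scale)
  qed
  have evW: "poly_op ?U p f \<in> W" if "f \<in> W" for p f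
  proof (cases p)
    case (pCons a q)
    show ?thesis
      unfolding pCons ev_pCons by (rule fs.subspace_add[OF subW fs.subspace_scale[OF subW that] UW])
  qed
  \<comment> \<open>Induction on the degree: a root c of \<open>p\<close> is split off, and
    \<open>step\<close> is applied to the value of the quotient.\<close>
  have ev_span: "f \<in> fs.span E" if "f \<in> W" "p \<noteq> 0" "poly_op ?U p f \<in> fs.span E" for p f
    using that
  proof (induction "degree p" arbitrary: p)
    case 0
    then obtain a where p: "p = [:a:]" "a \<noteq> 0" by (metis degree_eq_zeroE pCons_0_0)
    have *: "poly_op ?U p f = fun_scale a f" by (simp only: p(1) ev_pCons ev_0 U0 add_0_right)
    have "fun_scale a f \<in> fs.span E" using 0(4) by (simp only: *)
    from fs.span_scale[OF this, of "inverse a"] show ?case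
      by (simp only: fs.scale_scale left_inverse[OF p(2)] fs.scale_one)
  next
    case (Suc k)
    then obtain c where "poly p c = 0" using alg_closed_imp_poly_has_root[of p] by auto
    then obtain q where q: "p = [:- c, 1:] * q" by (auto simp: poly_eq_0_iff_dvd)
    have q0: "q \<noteq> 0" using Suc.prems(2) q by auto
    then have "degree p = Suc (degree q)" unfolding q by (subst degree_mult_eq) auto
    then have dq: "k = degree q" using Suc.hyps(2) by simp
    have "p = smult (- c) q + pCons 0 q" using q by simp
    then have *: "poly_op ?U p f = ?U (poly_op ?U q f) - fun_scale c (poly_op ?U q f)"
      by (simp only: ev_add ev_smult ev_pCons fs.scale_zero_left add_0_left fs.scale_minus_left
        diff_conv_add_uminus add.commute)
    have "?U (poly_op ?U q f) - fun_scale c (poly_op ?U q f) \<in> fs.span E"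
      using Suc.prems(3) by (simp only: *)
    then have "poly_op ?U q f \<in> fs.span E" by (rule step[OF evW[OF Suc.prems(1)]])
    then show ?case by (rule Suc.hyps(1)[OF dq Suc.prems(1) q0])
  qed
  define e where "e i = (\<lambda>j. if j = i then 1 else 0 :: 'k)" for i :: nat
  have eE: "e i \<in> fs.span E" if "i < n" for i
  proof (rule ev_span)
    show "e i \<in> W" using that by (auto simp: W_def e_def)
    show "monom 1 m - [:d i:] \<noteq> 0"
    proof
      assume "monom 1 m - [:d i:] = 0"
      then have "coeff (monom 1 m) m = coeff [:d i:] m" by simp
      then show False by (simp add: k)
    qed
    have mon: "poly_op ?U (monom 1 j) f = (?U ^^ j) f" for j f
    proof (induction j)
      case 0
      show ?case by (simp only: monom_0 ev_pCons ev_0 U0 fs.scale_one add_0_right funpow.simps id_apply)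
    next
      case (Suc j)
      then show ?case by (simp only: monom_Suc ev_pCons fs.scale_zero_left add_0_left funpow.simps o_apply)
    qed
    have "poly_op ?U (monom 1 m + [:- d i:]) (e i) = (?U ^^ m) (e i) + fun_scale (- d i) (e i)"
      by (simp only: ev_add mon ev_pCons ev_0 U0 add_0_right)
    also have "\<dots> = 0"
    proof
      fix j
      show "((?U ^^ m) (e i) + fun_scale (- d i) (e i)) j = 0 j"
      proof (cases "j < n")
        case True
        then show ?thesis by (auto simp: Um fun_scale_def e_def)
      next
        case False
        have "(?U ^^ m) (e i) \<in> W" using UW by (simp add: k)
        with False that show ?thesis by (auto simp: W_def fun_scale_def e_def)
      qed
    qed
    finally show "poly_op ?U (monom 1 m - [:d i:]) (e i) \<in> fs.span E"
      by (simp only: diff_conv_add_uminus minus_pCons minus_zero fs.span_zero)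
  qed
  \<comment> \<open>A basis of \<open>W\<close> consisting of eigenvectors. Comparison with the unit
    vectors shows that it has n elements, which become the columns of \<open>P\<close>.\<close>
  obtain C where C: "C \<subseteq> E" "fs.independent C" "E \<subseteq> fs.span C"
    using fs.maximal_independent_subset[of E] by blast
  have sC: "fs.span E \<subseteq> fs.span C" using C(3) by (simp add: fs.span_minimal)
  have We: "W \<subseteq> fs.span (e ` {..<n})"
  proof
    fix f assume f: "f \<in> W"
    have "f = (\<Sum>i<n. fun_scale (f i) (e i))"
    proof
      fix x
      have "(\<Sum>i<n. fun_scale (f i) (e i)) x = (\<Sum>i<n. if x = i then f i else 0)"
        unfolding sum_fun_apply by (rule sum.cong) (auto simp: fun_scale_def e_def)
      also have "\<dots> = f x" using f by (auto simp: W_def)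
      finally show "f x = (\<Sum>i<n. fun_scale (f i) (e i)) x" ..
    qed
    also have "\<dots> \<in> fs.span (e ` {..<n})"
      by (intro fs.span_sum fs.span_scale fs.span_base) auto
    finally show "f \<in> fs.span (e ` {..<n})" .
  qed
  have inj_e: "inj_on e {..<n}" by (auto simp: inj_on_def e_def fun_eq_iff split: if_splits)
  have ind_e: "fs.independent (e ` {..<n})"
  proof (subst fs.independent_explicit_finite_subsets, intro allI impI ballI)
    fix S u v assume S: "S \<subseteq> e ` {..<n}" "finite S" "(\<Sum>v\<in>S. fun_scale (u v) v) = 0" and v: "v \<in> S"
    then obtain i where i: "i < n" "v = e i" by auto
    have "(\<Sum>w\<in>S. u w * w i) = 0"
      using fun_cong[OF S(3), of i] by (simp add: fun_scale_def sum_fun_apply)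
    also have "(\<Sum>w\<in>S. u w * w i) = (\<Sum>w\<in>S. if w = v then u v else 0)"
    proof (rule sum.cong[OF refl])
      fix w assume "w \<in> S"
      then obtain l where l: "w = e l" using S(1) by blast
      show "u w * w i = (if w = v then u v else 0)"
      proof (cases "l = i")
        case True
        then have "w = v" "w i = 1" using l i by (simp_all add: e_def)
        then show ?thesis by simp
      next
        case False
        then have "w i = 0" "v i = 1" using l i by (simp_all add: e_def)
        then have "w i = 0" "w \<noteq> v" by auto
        then show ?thesis by simp
      qed
    qed
    finally show "u v = 0" using S(2) v by simp
  qed
  have CW: "C \<subseteq> W" "W \<subseteq> fs.span C"
  proof -
    show "C \<subseteq> W" using C(1) by (auto simp: E_def)
    have "fs.span (e ` {..<n}) \<subseteq> fs.span E" using eE by (intro fs.span_minimal) auto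
    then show "W \<subseteq> fs.span C" using We sC by blast
  qed
  have "card C = fs.dim W" by (rule fs.basis_card_eq_dim[OF CW C(2)])
  also have "\<dots> = card (e ` {..<n})"
    by (rule fs.basis_card_eq_dim[symmetric]) (use We ind_e in \<open>auto simp: W_def e_def\<close>)
  also have "\<dots> = n" using inj_e by (simp add: card_image)
  finally have cardC: "card C = n" .
  \<comment> \<open>A positive cardinality forces finiteness; for n = 0 an infinite set would also
    have \<open>card\<close> 0, so this case is treated through \<open>W\<close>.\<close>
  have finC: "finite C"
  proof (cases "n = 0")
    case True
    have "W = {0}" using True by (auto simp: W_def)
    then show ?thesis using CW(1) finite_subset by blast
  next
    case False
    then show ?thesis using cardC by (metis card.infinite)
  qed
  obtain cs where cs: "set cs = C" "distinct cs" using finite_distinct_list[OF finC] by blast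
  have len: "length cs = n" using distinct_card[OF cs(2)] cs(1) cardC by simp
  have nth: "cs ! i \<in> E" if "i < n" for i using that len cs C(1) by (metis nth_mem subsetD)
  define ev where "ev v = (SOME c. ?U v = fun_scale c v)" for v
  have ev: "?U (cs ! i) = fun_scale (ev (cs ! i)) (cs ! i)" if "i < n" for i
    unfolding ev_def by (rule someI_ex) (use nth[OF that] in \<open>auto simp: E_def\<close>)
  define P where "P = mat n n (\<lambda>(i, j). (cs ! j) i)"
  define R where "R = mat n n (\<lambda>(i, j). fs.representation C (e j) (cs ! i))"
  define D where "D = mat n n (\<lambda>(i, j). if i = j then ev (cs ! i) else 0)"
  have car: "P \<in> carrier_mat n n" "R \<in> carrier_mat n n" "D \<in> carrier_mat n n"
    by (simp_all add: P_def R_def D_def)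
  have PR: "P * R = 1\<^sub>m n"
  proof (rule eq_matI)
    fix i j assume ij: "i < dim_row (1\<^sub>m n :: 'k mat)" "j < dim_col (1\<^sub>m n :: 'k mat)"
    then have "e j \<in> fs.span C" using eE sC by auto
    then have "(\<Sum>v\<in>C. fun_scale (fs.representation C (e j) v) v) = e j"
      using fs.sum_representation_eq[OF C(2) _ finC order_refl] by simp
    from fun_cong[OF this, of i] have "(\<Sum>v\<in>C. fs.representation C (e j) v * v i) = e j i"
      by (simp add: fun_scale_def sum_fun_apply)
    also have "(\<Sum>v\<in>C. fs.representation C (e j) v * v i) = (\<Sum>l<n. fs.representation C (e j) (cs ! l) * (cs ! l) i)"
      by (rule sum.reindex_bij_betw[symmetric, of "(!) cs"]) (use bij_betw_nth[OF cs(2), of "{..<n}" C] cs(1) len in simp)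
    finally show "(P * R) $$ (i, j) = 1\<^sub>m n $$ (i, j)"
      using ij by (simp add: P_def R_def scalar_prod_def lessThan_atLeast0 mult.commute e_def)
  qed (simp_all add: P_def R_def)
  have AP: "A * P = P * D"
  proof (rule eq_matI)
    fix i j assume "i < dim_row (P * D)" "j < dim_col (P * D)"
    then have ij: "i < n" "j < n" by (simp_all add: P_def D_def)
    have "(A * P) $$ (i, j) = ?U (cs ! j) i"
      using ij A by (simp add: P_def scalar_prod_def lessThan_atLeast0 mat_op_def)
    also have "\<dots> = (cs ! j) i * ev (cs ! j)" by (simp add: ev[OF ij(2)] fun_scale_def mult.commute)
    also have "\<dots> = (\<Sum>l<n. if l = j then (cs ! j) i * ev (cs ! j) else 0)" using ij by simp
    also have "\<dots> = (P * D) $$ (i, j)"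
      using ij by (simp add: P_def D_def scalar_prod_def lessThan_atLeast0 del: sum.delta)
        (intro sum.cong, auto)
    finally show "(A * P) $$ (i, j) = (P * D) $$ (i, j)" .
  qed (use A in \<open>simp_all add: P_def D_def\<close>)
  have "A = A * (P * R)" using A by (simp add: PR)
  also have "\<dots> = P * D * R" using A car by (simp add: AP flip: assoc_mult_mat[of A n n P n R n])
  finally have "A = P * D * R" .
  then have "similar_mat_wit A D P R"
    using A car PR mat_mult_left_right_inverse[OF car(1,2) PR] by (auto simp: similar_mat_wit_def Let_def)
  then have "similar_mat A D" by (auto simp: similar_mat_def)
  moreover have "diagonal_mat D" by (auto simp: diagonal_mat_def D_def)
  ultimately show ?thesis by blast
qed

section \<open>The matrix of an endomorphism\<close>

context vector_space begin

lemma matrix_of_power: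
  assumes f: "Vector_Spaces.linear scale scale f" and bs: "distinct bs" "independent (set bs)" "span (set bs) = UNIV"
  shows "i < length bs \<Longrightarrow> j < length bs \<Longrightarrow>
    (matrix_of scale bs f ^\<^sub>m k) $$ (i, j) = representation (set bs) ((f ^^ k) (bs ! j)) (bs ! i)"
proof (induction k arbitrary: i j)
  case 0
  then show ?case
    using bs by (auto simp: matrix_of_def representation_basis nth_eq_iff_index_eq)
next
  case (Suc k)
  interpret f: Vector_Spaces.linear scale scale f by (rule f)
  let ?n = "length bs" and ?R = "representation (set bs)"
  have fk: "Vector_Spaces.linear scale scale (f ^^ k)" for k
  proof (induction k)
    case (Suc k)
    then show ?case using Vector_Spaces.linear_compose[OF Suc f] by (simp only: funpow.simps)
  qed (simp add: linear_id flip: id_def)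
  interpret fk: Vector_Spaces.linear scale scale "f ^^ k" by (rule fk)
  have M: "matrix_of scale bs f \<in> carrier_mat ?n ?n" by (simp add: matrix_of_def)
  have "(f ^^ Suc k) (bs ! j) = (f ^^ k) (f (bs ! j))" by (simp add: funpow_swap1)
  also have "f (bs ! j) = (\<Sum>b\<in>set bs. scale (?R (f (bs ! j)) b) b)"
    using sum_representation_eq[OF bs(2) _ _ order_refl, of "f (bs ! j)"] bs(3) by simp
  also have "\<dots> = (\<Sum>l<?n. scale (?R (f (bs ! j)) (bs ! l)) (bs ! l))"
    by (rule sum.reindex_bij_betw[symmetric, of "(!) bs"]) (use bij_betw_nth[OF bs(1), of "{..<?n}" "set bs"] in simp)
  finally have "(f ^^ Suc k) (bs ! j) = (\<Sum>l<?n. scale (?R (f (bs ! j)) (bs ! l)) ((f ^^ k) (bs ! l)))"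
    by (simp only: fk.sum fk.scale)
  then have "?R ((f ^^ Suc k) (bs ! j)) (bs ! i) = (\<Sum>l<?n. ?R (f (bs ! j)) (bs ! l) * ?R ((f ^^ k) (bs ! l)) (bs ! i))"
    using representation_sum[OF bs(2), of "{..<?n}" "\<lambda>l. scale (?R (f (bs ! j)) (bs ! l)) ((f ^^ k) (bs ! l))"]
      representation_scale[OF bs(2)] bs(3) by simp
  also have "\<dots> = (\<Sum>l<?n. (matrix_of scale bs f ^\<^sub>m k) $$ (i, l) * matrix_of scale bs f $$ (l, j))"
    by (rule sum.cong) (use Suc in \<open>auto simp: matrix_of_def mult.commute\<close>)
  also have "\<dots> = (matrix_of scale bs f ^\<^sub>m Suc k) $$ (i, j)"
    using Suc.prems M pow_carrier_mat[OF M, of k] by (simp add: scalar_prod_def lessThan_atLeast0)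
  finally show ?case ..
qed

lemma semisimple_of_diagonal_power:
  assumes f: "Vector_Spaces.linear scale scale f" and B: "finite B" "is_basis scale UNIV B"
    and m: "of_nat m \<noteq> (0 :: 'a)" and \<mu>: "\<And>b. b \<in> B \<Longrightarrow> (f ^^ m) b = scale (\<mu> b) b" "\<And>b. b \<in> B \<Longrightarrow> \<mu> b \<noteq> 0"
  shows "semisimple_endomorphism scale f"
proof -
  obtain bs where bs: "set bs = B" "distinct bs" using finite_distinct_list[OF B(1)] by blast
  have ind: "independent (set bs)" "span (set bs) = UNIV" using B(2) bs by (auto simp: is_basis_def)
  let ?M = "matrix_of scale bs f" and ?n = "length bs"
  let ?A = "map_mat to_ac ?M :: 'a alg_closure mat"
  have M: "?M \<in> carrier_mat ?n ?n" by (simp add: matrix_of_def)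
  interpret h: semiring_hom "to_ac :: 'a \<Rightarrow> 'a alg_closure"
    by unfold_locales auto
  have "?A ^\<^sub>m m = map_mat to_ac (?M ^\<^sub>m m)"
    using M by (rule h.mat_hom_pow[symmetric])
  then have pow: "(?A ^\<^sub>m m) $$ (i, j) = (if i = j then to_ac (\<mu> (bs ! i)) else 0)" if "i < ?n" "j < ?n" for i j
    using that matrix_of_power[OF f bs(2) ind that, of m] \<mu>(1)[of "bs ! j"] carrier_matD[OF pow_carrier_mat[OF M, of m]] bs ind
    by (auto simp: representation_scale representation_basis nth_eq_iff_index_eq)
  have "\<exists>D. diagonal_mat D \<and> similar_mat ?A D"
  proof (rule similar_diagonal_of_power[where m = m and n = ?n and d = "\<lambda>i. to_ac (\<mu> (bs ! i))"])
    show "of_nat m \<noteq> (0 :: 'a alg_closure)" using m by (metis to_ac_eq_0_iff to_ac_of_nat)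
    show "to_ac (\<mu> (bs ! i)) \<noteq> 0" if "i < ?n" for i using \<mu>(2)[of "bs ! i"] that bs by auto
  qed (use M pow in auto)
  then show ?thesis
    unfolding semisimple_endomorphism_def using f bs B(2) by blast
qed

end

section \<open>The Nakayama automorphism of a monomial Frobenius algebra\<close>

locale quiver_algebra = fin_digraph Q + k_algebra scale
  for Q :: "('v, 'e) pre_digraph" and scale :: "'k::field \<Rightarrow> 'a::ring_1 \<Rightarrow> 'a" +
  fixes I :: "(('v, 'e) qpath \<Rightarrow>\<^sub>0 'k) set" and \<pi> :: "(('v, 'e) qpath \<Rightarrow>\<^sub>0 'k) \<Rightarrow> 'a"
  assumes admissible: "admissible_ideal Q I"
    and quotient: "path_algebra_quotient Q I scale \<pi>"
begin

abbreviation "pc \<equiv> path_class \<pi>"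
abbreviation "PA \<equiv> path_algebra Q :: ('k, ('v, 'e) qpath \<Rightarrow>\<^sub>0 'k) module"

lemma carrier_PA: "x \<in> carrier PA \<longleftrightarrow> Poly_Mapping.keys x \<subseteq> paths Q"
  by (simp add: path_algebra_def)

lemma single_PA: "p \<in> paths Q \<Longrightarrow> Poly_Mapping.single p c \<in> carrier PA"
  by (simp add: carrier_PA)

lemma \<pi>_add: "x \<in> carrier PA \<Longrightarrow> y \<in> carrier PA \<Longrightarrow> \<pi> (x + y) = \<pi> x + \<pi> y"
  using quotient ring_hom_add[of \<pi> PA ring_of_type_algebra x y]
  by (simp add: path_algebra_quotient_def path_algebra_def ring_of_type_algebra_def)

lemma \<pi>_mult: "x \<in> carrier PA \<Longrightarrow> y \<in> carrier PA \<Longrightarrow> \<pi> (path_mult Q x y) = \<pi> x * \<pi> y"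
  using quotient ring_hom_mult[of \<pi> PA ring_of_type_algebra x y]
  by (simp add: path_algebra_quotient_def path_algebra_def ring_of_type_algebra_def)

lemma \<pi>_one: "\<pi> (\<Sum>v\<in>verts Q. Poly_Mapping.single (v, []) 1) = 1"
  using quotient ring_hom_one[of \<pi> PA ring_of_type_algebra]
  by (simp add: path_algebra_quotient_def path_algebra_def ring_of_type_algebra_def)

lemma \<pi>_zero: "\<pi> 0 = 0"
  using \<pi>_add[of 0 0] by (simp add: carrier_PA)

lemma \<pi>_sum: "finite S \<Longrightarrow> (\<And>s. s \<in> S \<Longrightarrow> g s \<in> carrier PA) \<Longrightarrow>
   sum g S \<in> carrier PA \<and> \<pi> (sum g S) = (\<Sum>s\<in>S. \<pi> (g s))"
proof (induction S rule: finite_induct)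
  case (insert x S)
  then have "sum g S \<in> carrier PA" "g x \<in> carrier PA" by auto
  moreover from this have "g x + sum g S \<in> carrier PA"
    unfolding carrier_PA by (meson Poly_Mapping.keys_add le_sup_iff order_trans)
  ultimately show ?case using insert by (simp add: \<pi>_add)
qed (simp add: carrier_PA \<pi>_zero)

lemma trivial_path: "v \<in> verts Q \<Longrightarrow> (v, []) \<in> paths Q"
  by (simp add: paths_def target_def awalk_Nil_iff)

lemma arc_path: "a \<in> arcs Q \<Longrightarrow> (tail Q a, [a]) \<in> paths Q"
  by (simp add: paths_def target_def awalk_def)

lemma one_eq: "1 = (\<Sum>v\<in>verts Q. pc (v, []))"
  using \<pi>_sum[OF finite_verts, of "\<lambda>v. Poly_Mapping.single (v, []) 1"] \<pi>_one trivial_path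
  by (simp add: single_PA path_class_def)

lemma path_append:
  assumes "p \<in> paths Q" "q \<in> paths Q" "target Q p = fst q"
  shows "(fst p, snd p @ snd q) \<in> paths Q"
proof -
  have "awalk (fst p) (snd p @ snd q) (target Q q)"
    using assms by (intro awalk_appendI[of _ _ "target Q p"]) (auto simp: paths_def)
  moreover have "target Q (fst p, snd p @ snd q) = target Q q"
    using calculation by (auto simp: target_def awalk_def)
  ultimately show ?thesis by (simp add: paths_def)
qed

lemma pc_mult:
  assumes "p \<in> paths Q" "q \<in> paths Q"
  shows "pc p * pc q = (if target Q p = fst q then pc (fst p, snd p @ snd q) else 0)"
proof -
  have "path_mult Q (Poly_Mapping.single p 1) (Poly_Mapping.single q (1 :: 'k))
     = (if target Q p = fst q then Poly_Mapping.single (fst p, snd p @ snd q) 1 else 0)"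
    by (simp add: path_mult_def)
  then show ?thesis
    using \<pi>_mult[OF single_PA[OF assms(1), of 1] single_PA[OF assms(2), of 1]]
    by (simp add: path_class_def \<pi>_zero split: if_splits)
qed

lemma kernel: "x \<in> carrier PA \<Longrightarrow> \<pi> x = 0 \<Longrightarrow> x \<in> I"
  using quotient by (auto simp: path_algebra_quotient_def a_kernel_def' ring_of_type_algebra_def)

lemma I_zero: "x \<in> I \<Longrightarrow> \<pi> x = 0"
  using quotient by (auto simp: path_algebra_quotient_def a_kernel_def' ring_of_type_algebra_def)

lemma nilpotency:
  obtains M where "\<And>p. p \<in> paths Q \<Longrightarrow> length (snd p) \<ge> M \<Longrightarrow> pc p = 0"
proof -
  obtain M where M: "arrow_ideal_power Q M \<subseteq> I" using admissible by (auto simp: admissible_ideal_def)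
  have "pc p = 0" if "p \<in> paths Q" "length (snd p) \<ge> M" for p
    unfolding path_class_def using that M single_PA[OF that(1), of 1]
    by (intro I_zero) (auto simp: arrow_ideal_power_def)
  then show ?thesis by (rule that)
qed

text \<open>Such a dependence would put an element with \<open>p\<close> in its support into the
  ideal, whereas every path in the support of an element of an admissible ideal has length at least
  two.\<close>

lemma short_independent:
  assumes p: "p \<in> paths Q" "length (snd p) < 2"
    and x: "pc p \<in> span (pc ` {q \<in> paths Q. q \<noteq> p})"
  shows False
proof -
  \<comment> \<open>The elements that have a representative without \<open>p\<close> form a subspace
    containing the classes of all other paths.\<close>
  have "span (pc ` {q \<in> paths Q. q \<noteq> p}) \<subseteq> {\<pi> x |x. x \<in> carrier PA \<and> p \<notin> Poly_Mapping.keys x}"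
  proof (rule span_minimal)
    show "pc ` {q \<in> paths Q. q \<noteq> p} \<subseteq> {\<pi> x |x. x \<in> carrier PA \<and> p \<notin> Poly_Mapping.keys x}"
    proof
      fix y assume "y \<in> pc ` {q \<in> paths Q. q \<noteq> p}"
      then obtain q where "q \<in> paths Q" "q \<noteq> p" "y = pc q" by auto
      then show "y \<in> {\<pi> x |x. x \<in> carrier PA \<and> p \<notin> Poly_Mapping.keys x}"
        using single_PA[of q 1] by (auto simp: path_class_def intro!: exI[of _ "Poly_Mapping.single q 1"])
    qed
    show "subspace {\<pi> x |x. x \<in> carrier PA \<and> p \<notin> Poly_Mapping.keys x}"
      unfolding subspace_def
    proof (intro conjI ballI allI)
      show "0 \<in> {\<pi> x |x. x \<in> carrier PA \<and> p \<notin> Poly_Mapping.keys x}"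
        using \<pi>_zero by (force simp: carrier_PA intro!: exI[of _ 0])
      fix a b assume a: "a \<in> {\<pi> x |x. x \<in> carrier PA \<and> p \<notin> Poly_Mapping.keys x}"
      then obtain x where x: "a = \<pi> x" "x \<in> carrier PA" "p \<notin> Poly_Mapping.keys x" by auto
      { assume "b \<in> {\<pi> x |x. x \<in> carrier PA \<and> p \<notin> Poly_Mapping.keys x}"
        then obtain y where y: "b = \<pi> y" "y \<in> carrier PA" "p \<notin> Poly_Mapping.keys y" by auto
        have k: "Poly_Mapping.keys (x + y) \<subseteq> Poly_Mapping.keys x \<union> Poly_Mapping.keys y" by (rule Poly_Mapping.keys_add)
        then have "x + y \<in> carrier PA" "p \<notin> Poly_Mapping.keys (x + y)"
          using x y by (auto simp: carrier_PA)
        then show "a + b \<in> {\<pi> x |x. x \<in> carrier PA \<and> p \<notin> Poly_Mapping.keys x}"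
          using \<pi>_add[OF x(2) y(2)] x(1) y(1) by (intro CollectI exI[of _ "x + y"]) simp }
      fix c :: 'k
      have k: "Poly_Mapping.keys (Poly_Mapping.map ((*) c) x) \<subseteq> Poly_Mapping.keys x"
        by (auto simp: in_keys_iff Poly_Mapping.map.rep_eq when_def split: if_splits)
      moreover have "\<pi> (Poly_Mapping.map ((*) c) x) = scale c a"
        using quotient x by (simp add: path_algebra_quotient_def path_algebra_def)
      ultimately show "scale c a \<in> {\<pi> x |x. x \<in> carrier PA \<and> p \<notin> Poly_Mapping.keys x}"
        using x unfolding carrier_PA by (auto intro!: exI[of _ "Poly_Mapping.map ((*) c) x"])
    qed
  qed
  then obtain x where x: "x \<in> carrier PA" "p \<notin> Poly_Mapping.keys x" "pc p = \<pi> x" using x by auto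
  let ?y = "Poly_Mapping.single p 1 + Poly_Mapping.map ((*) (-1)) x"
  have mx: "Poly_Mapping.map ((*) (-1)) x \<in> carrier PA"
    using x(1) by (auto simp: carrier_PA in_keys_iff Poly_Mapping.map.rep_eq when_def split: if_splits)
  have "\<pi> (Poly_Mapping.map ((*) (-1)) x) = scale (-1) (\<pi> x)"
    using quotient x by (simp add: path_algebra_quotient_def path_algebra_def)
  then have "\<pi> ?y = 0" using \<pi>_add[OF single_PA[OF p(1), of 1] mx] x by (simp add: path_class_def)
  moreover have "?y \<in> carrier PA"
    using single_PA[OF p(1), of 1] mx Poly_Mapping.keys_add[of "Poly_Mapping.single p 1" "Poly_Mapping.map ((*) (-1)) x"]
    unfolding carrier_PA by blast
  ultimately have "?y \<in> I" by (intro kernel)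
  then have "?y \<in> arrow_ideal_power Q 2" using admissible by (auto simp: admissible_ideal_def)
  moreover have "p \<in> Poly_Mapping.keys ?y"
    using x(2) by (simp add: in_keys_iff lookup_add lookup_single Poly_Mapping.map.rep_eq)
  ultimately show False using p(2) by (auto simp: arrow_ideal_power_def)
qed

end

section \<open>The Nakayama automorphism of a trace form with a dual basis\<close>

locale dual_basis_trace = k_algebra scale
  for scale :: "'k::field \<Rightarrow> 'a::ring_1 \<Rightarrow> 'a" +
  fixes B :: "'a set" and tr :: "'a \<Rightarrow> 'k" and st :: "'a \<Rightarrow> 'a"
  assumes finite_basis: "finite B" and is_basis: "is_basis scale UNIV B"
    and linear_tr: "Vector_Spaces.linear scale (*) tr"
    and st_closed: "b \<in> B \<Longrightarrow> st b \<in> B"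
    and tr_dual: "b \<in> B \<Longrightarrow> tr (b * st b) \<noteq> 0"
    and tr_not_dual: "b \<in> B \<Longrightarrow> c \<in> B \<Longrightarrow> c \<noteq> st b \<Longrightarrow> tr (b * c) = 0"
    and inj_st: "inj_on st B"
begin

lemma tr_add: "tr (a + b) = tr a + tr b" and tr_scale: "tr (scale c a) = c * tr a"
  using linear_tr by (auto simp: Vector_Spaces.linear_iff)

lemma tr_0: "tr 0 = 0"
  using tr_scale[of 0 0] by simp

lemma tr_diff: "tr (a - b) = tr a - tr b"
  using tr_add[of "a - b" b] by simp

lemma tr_sum: "tr (sum g S) = (\<Sum>i\<in>S. tr (g i))"
  by (induction S rule: infinite_finite_induct) (simp_all add: tr_0 tr_add)

lemma bij_st: "bij_betw st B B"
  by (simp add: bij_betw_def inj_st endo_inj_surj[OF finite_basis _ inj_st] st_closed image_subsetI)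

lemma st_cases: "b \<in> B \<Longrightarrow> \<exists>p\<in>B. b = st p"
  using bij_st by (auto simp: bij_betw_def)

lemma span_basis: "span B = UNIV"
  using is_basis by (simp add: is_basis_def)

lemma tr_st: "p \<in> B \<Longrightarrow> q \<in> B \<Longrightarrow> q \<noteq> p \<Longrightarrow> tr (q * st p) = 0"
  using inj_st by (intro tr_not_dual) (auto simp: st_closed inj_on_def)

lemma functional_zero:
  fixes \<phi> :: "'a \<Rightarrow> 'k"
  assumes "\<And>a b. \<phi> (a + b) = \<phi> a + \<phi> b" "\<And>c a. \<phi> (scale c a) = c * \<phi> a" "\<And>b. b \<in> B \<Longrightarrow> \<phi> b = 0"
  shows "\<phi> a = 0"
proof -
  have "a \<in> span B" by (simp add: span_basis)
  then show ?thesis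
    by (induction rule: span_induct_alt) (use assms(2)[of 0 0] in \<open>simp_all add: assms\<close>)
qed

lemma left_nondegenerate:
  assumes "\<And>b. b \<in> B \<Longrightarrow> tr (a * b) = 0"
  shows "a = 0"
proof -
  have "a \<in> span B" by (simp add: span_basis)
  then obtain u where a: "a = (\<Sum>q\<in>B. scale (u q) q)" using span_finite[OF finite_basis] by auto
  have "u p = 0" if p: "p \<in> B" for p
  proof -
    have "tr (a * st p) = (\<Sum>q\<in>B. if q = p then u p * tr (p * st p) else 0)"
      unfolding a sum_distrib_right tr_sum
      by (rule sum.cong) (use p in \<open>auto simp: scale_mult_left tr_scale tr_st\<close>)
    also have "\<dots> = u p * tr (p * st p)" using p finite_basis by simp
    finally show ?thesis using assms[OF st_closed[OF p]] tr_dual[OF p] by simp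
  qed
  then show ?thesis unfolding a by simp
qed

lemma right_nondegenerate:
  assumes "\<And>b. b \<in> B \<Longrightarrow> tr (b * a) = 0"
  shows "a = 0"
proof -
  have "a \<in> span B" by (simp add: span_basis)
  then obtain u where a: "a = (\<Sum>q\<in>B. scale (u q) q)" using span_finite[OF finite_basis] by auto
  have "u q = 0" if q: "q \<in> B" for q
  proof -
    obtain p where p: "p \<in> B" "q = st p" using st_cases[OF q] by blast
    have "tr (p * a) = (\<Sum>x\<in>B. if x = q then u q * tr (p * q) else 0)"
      unfolding a sum_distrib_left tr_sum
      by (rule sum.cong) (use p tr_not_dual in \<open>auto simp: scale_mult_right tr_scale\<close>)
    also have "\<dots> = u q * tr (p * q)" using q finite_basis by simp
    finally show ?thesis using assms[OF p(1)] tr_dual[OF p(1)] p(2) by simp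
  qed
  then show ?thesis unfolding a by simp
qed

lemma right_eqI: "(\<And>b. b \<in> B \<Longrightarrow> tr (b * x) = tr (b * y)) \<Longrightarrow> x = y"
  using right_nondegenerate[of "x - y"] by (simp add: right_diff_distrib tr_diff)

lemma left_eqI: "(\<And>b. b \<in> B \<Longrightarrow> tr (x * b) = tr (y * b)) \<Longrightarrow> x = y"
  using left_nondegenerate[of "x - y"] by (simp add: left_diff_distrib tr_diff)

text \<open>The basis dual to the elements \<open>st q\<close> under the trace form consists of the
  \<open>q\<close> divided by \<open>tr (q * st q)\<close>; the functional is expanded in
  it.\<close>

definition left_rep :: "('a \<Rightarrow> 'k) \<Rightarrow> 'a" where
  "left_rep \<phi> = (\<Sum>q\<in>B. scale (\<phi> (st q) / tr (q * st q)) q)"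

definition right_rep :: "('a \<Rightarrow> 'k) \<Rightarrow> 'a" where
  "right_rep \<phi> = (\<Sum>q\<in>B. scale (\<phi> q / tr (q * st q)) (st q))"

lemma tr_left_rep:
  assumes "\<And>a b. \<phi> (a + b) = \<phi> a + \<phi> b" "\<And>c a. \<phi> (scale c a) = c * \<phi> a"
  shows "tr (left_rep \<phi> * a) = \<phi> a"
proof -
  have "tr (left_rep \<phi> * a) - \<phi> a = 0"
  proof (rule functional_zero[of "\<lambda>a. tr (left_rep \<phi> * a) - \<phi> a"])
    fix b assume "b \<in> B"
    then obtain p where p: "p \<in> B" "b = st p" using st_cases by blast
    have "tr (left_rep \<phi> * b) = (\<Sum>q\<in>B. if q = p then \<phi> b else 0)"
      unfolding left_rep_def sum_distrib_right tr_sum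
      by (rule sum.cong)
        (use p tr_dual in \<open>auto simp: scale_mult_left tr_scale tr_st\<close>)
    then show "tr (left_rep \<phi> * b) - \<phi> b = 0" using p finite_basis by simp
  qed (simp_all add: assms distrib_left tr_add scale_mult_right tr_scale algebra_simps)
  then show ?thesis by simp
qed

lemma tr_right_rep:
  assumes "\<And>a b. \<phi> (a + b) = \<phi> a + \<phi> b" "\<And>c a. \<phi> (scale c a) = c * \<phi> a"
  shows "tr (a * right_rep \<phi>) = \<phi> a"
proof -
  have "tr (a * right_rep \<phi>) - \<phi> a = 0"
  proof (rule functional_zero[of "\<lambda>a. tr (a * right_rep \<phi>) - \<phi> a"])
    fix p assume p: "p \<in> B"
    have "tr (p * right_rep \<phi>) = (\<Sum>q\<in>B. if q = p then \<phi> p else 0)"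
      unfolding right_rep_def sum_distrib_left tr_sum
      by (rule sum.cong)
        (use p tr_dual in \<open>auto simp: scale_mult_right tr_scale tr_st\<close>)
    then show "tr (p * right_rep \<phi>) - \<phi> p = 0" using p finite_basis by simp
  qed (simp_all add: assms distrib_right tr_add scale_mult_left tr_scale algebra_simps)
  then show ?thesis by simp
qed

definition nak :: "'a \<Rightarrow> 'a" where "nak a = right_rep (\<lambda>b. tr (a * b))"

definition nak_inv :: "'a \<Rightarrow> 'a" where "nak_inv a = left_rep (\<lambda>b. tr (b * a))"

lemma tr_nak: "tr (b * nak a) = tr (a * b)"
  unfolding nak_def by (rule tr_right_rep) (simp_all add: distrib_left tr_add scale_mult_right tr_scale)

lemma tr_nak_inv: "tr (nak_inv a * b) = tr (b * a)"
  unfolding nak_inv_def by (rule tr_left_rep) (simp_all add: distrib_right tr_add scale_mult_left tr_scale)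

lemma nak_nak_inv: "nak (nak_inv a) = a"
  by (rule right_eqI) (simp add: tr_nak tr_nak_inv)

lemma nak_inv_nak: "nak_inv (nak a) = a"
  by (rule left_eqI) (simp add: tr_nak tr_nak_inv)

lemma nak_add: "nak (a + b) = nak a + nak b"
  by (rule right_eqI) (simp add: tr_nak distrib_left distrib_right tr_add)

lemma nak_scale: "nak (scale c a) = scale c (nak a)"
  by (rule right_eqI) (simp add: tr_nak scale_mult_left scale_mult_right tr_scale)

text \<open>Applying \<open>tr_nak\<close> twice gives tr (c * nak a * nak b) = tr (b * c * nak a) =
  tr (a * b * c), and the last term is tr (c * nak (a * b)).\<close>

lemma nak_mult: "nak (a * b) = nak a * nak b"
  by (rule right_eqI) (metis mult.assoc tr_nak)

lemma nak_one: "nak 1 = 1"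
  by (rule right_eqI) (simp add: tr_nak)

lemma nak_0: "nak 0 = 0"
  using nak_scale[of 0 0] by simp

lemma linear_nak: "Vector_Spaces.linear scale scale nak"
  by (simp add: Vector_Spaces.linear_iff vector_space_axioms nak_add nak_scale)

lemma nakayama_eq: "nakayama_automorphism scale (\<lambda>a b. tr (a * b)) = nak"
  unfolding nakayama_automorphism_def
proof (rule the_equality)
  have "bij nak" by (rule bijI') (metis nak_inv_nak, metis nak_nak_inv)
  then show "algebra_automorphism scale nak \<and> (\<forall>a b. tr (a * b) = tr (b * nak a))"
    by (simp add: algebra_automorphism_def linear_nak nak_one nak_mult tr_nak)
  fix N assume "algebra_automorphism scale N \<and> (\<forall>a b. tr (a * b) = tr (b * N a))"
  then show "N = nak" by (intro ext right_eqI) (metis tr_nak)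
qed

definition \<tau> :: "'a \<Rightarrow> 'a" where "\<tau> b = st (st b)"

lemma \<tau>_closed: "b \<in> B \<Longrightarrow> \<tau> b \<in> B"
  by (simp add: \<tau>_def st_closed)

lemma inj_\<tau>: "inj_on \<tau> B"
  using inj_st st_closed by (auto simp: inj_on_def \<tau>_def)

text \<open>The pairing \<open>tr (p * nak b) = tr (b * p)\<close> with a basis element
  \<open>p\<close> is nonzero only for \<open>p = st b\<close>. By injectivity of \<open>st\<close>,
  this is also the only one that pairs nontrivially with \<open>st (st b)\<close>. The scalar
  compares the two values.\<close>

lemma nak_basis:
  assumes b: "b \<in> B"
  obtains c where "c \<noteq> 0" "nak b = scale c (\<tau> b)"
proof
  let ?q = "st b" let ?c = "tr (b * ?q) / tr (?q * st ?q)"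
  show "?c \<noteq> 0" using tr_dual st_closed b by simp
  show "nak b = scale ?c (\<tau> b)"
  proof (rule right_eqI)
    fix p assume p: "p \<in> B"
    show "tr (p * nak b) = tr (p * scale ?c (\<tau> b))"
    proof (cases "p = ?q")
      case True
      then show ?thesis
        using tr_dual[OF st_closed[OF b]] by (simp add: tr_nak \<tau>_def scale_mult_right tr_scale)
    next
      case False
      then have "tr (p * st ?q) = 0"
        using p b inj_st by (intro tr_not_dual) (auto simp: st_closed inj_on_def)
      then show ?thesis
        using tr_not_dual[OF b p False] by (simp add: tr_nak \<tau>_def scale_mult_right tr_scale)
    qed
  qed
qed

lemma funpow_nak_basis: "b \<in> B \<Longrightarrow> \<exists>c. c \<noteq> 0 \<and> (nak ^^ j) b = scale c ((\<tau> ^^ j) b) \<and> (\<tau> ^^ j) b \<in> B"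
proof (induction j)
  case 0
  then show ?case by (intro exI[of _ 1]) simp
next
  case (Suc j)
  then obtain c where c: "c \<noteq> 0" "(nak ^^ j) b = scale c ((\<tau> ^^ j) b)" "(\<tau> ^^ j) b \<in> B" by blast
  obtain d where d: "d \<noteq> 0" "nak ((\<tau> ^^ j) b) = scale d (\<tau> ((\<tau> ^^ j) b))" using nak_basis[OF c(3)] by blast
  show ?case using c d by (intro exI[of _ "c * d"]) (simp add: nak_scale \<tau>_closed)
qed

lemma funpow_nak_mult: "(nak ^^ j) (a * b) = (nak ^^ j) a * (nak ^^ j) b"
  by (induction j) (simp_all add: nak_mult)

end

text \<open>By the pigeonhole principle and injectivity, some power between 1 and
  \<open>card S\<close> fixes \<open>x\<close>, and every such exponent divides n!.\<close>

lemma funpow_fact_fixed: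
  assumes S: "finite S" "f ` S \<subseteq> S" "inj_on f S" "card S \<le> n" and x: "x \<in> S"
  shows "(f ^^ fact n) x = x"
proof -
  have S': "(f ^^ i) y \<in> S" if "y \<in> S" for i y
    using that S(2) by (induction i) auto
  have inj: "y = z" if "(f ^^ i) y = (f ^^ i) z" "y \<in> S" "z \<in> S" for i y z
    using that
  proof (induction i)
    case (Suc i)
    then show ?case using S(3) S' by (auto dest!: inj_onD)
  qed simp
  have "\<not> inj_on (\<lambda>i. (f ^^ i) x) {..card S}"
  proof
    assume "inj_on (\<lambda>i. (f ^^ i) x) {..card S}"
    then have "card {..card S} \<le> card S"
      by (rule card_inj_on_le) (use S(1) S'[OF x] in auto)
    then show False by simp
  qed
  then obtain i j where "i \<le> card S" "j \<le> card S" "(f ^^ i) x = (f ^^ j) x" "i < j"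
    unfolding inj_on_def by (metis atMost_iff linorder_neqE_nat)
  then have "(f ^^ i) x = (f ^^ i) ((f ^^ (j - i)) x)" by (simp flip: funpow_add[THEN fun_cong, simplified comp_def])
  then have k: "(f ^^ (j - i)) x = x" by (rule inj[OF _ x S'[OF x], symmetric])
  have "j - i dvd fact n" using \<open>i < j\<close> \<open>j \<le> card S\<close> S(4) by (intro dvd_fact) auto
  then obtain l where l: "fact n = (j - i) * l" by (auto simp: dvd_def)
  have "((f ^^ (j - i)) ^^ l) x = x" by (induction l) (simp_all add: k)
  then show ?thesis by (simp add: l funpow_mult mult.commute)
qed

text \<open>On a finite set, an injective map that preserves \<open>S\<close> maps it onto itself,
  so all preimages of \<open>S\<close> within \<open>B\<close> are already in
  \<open>S\<close>.\<close>

lemma inj_on_complement_closed: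
  assumes "finite B" "inj_on f B" "S \<subseteq> B" "f ` S \<subseteq> S" "x \<in> B" "x \<notin> S"
  shows "f x \<notin> S"
proof
  assume "f x \<in> S"
  moreover have "f ` S = S"
    by (rule endo_inj_surj) (use assms in \<open>auto intro: finite_subset inj_on_subset\<close>)
  ultimately obtain y where "y \<in> S" "f y = f x" by (metis imageE)
  then show False using assms by (metis inj_onD subsetD)
qed

section \<open>Socles and the duality on the path basis\<close>

locale monomial_frobenius = quiver_algebra Q scale I \<pi>
  for Q :: "('v, 'e) pre_digraph" and scale :: "'k::field \<Rightarrow> 'a::ring_1 \<Rightarrow> 'a"
    and I :: "(('v, 'e) qpath \<Rightarrow>\<^sub>0 'k) set" and \<pi> :: "(('v, 'e) qpath \<Rightarrow>\<^sub>0 'k) \<Rightarrow> 'a" +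
  fixes B :: "'a set" and tr :: "'a \<Rightarrow> 'k"
  assumes frobenius: "frobenius_algebra scale"
    and path_basis: "path_basis Q scale \<pi> B"
    and tr_linear: "Vector_Spaces.linear scale (*) tr"
    and tr_socle: "p \<in> B \<Longrightarrow> p \<in> socle UNIV \<Longrightarrow> tr p = 1"
    and tr_not_socle: "p \<in> B \<Longrightarrow> p \<notin> socle UNIV \<Longrightarrow> tr p = 0"
    and products: "p \<in> B \<Longrightarrow> q \<in> B \<Longrightarrow> \<exists>r\<in>B. \<exists>c. p * q = scale c r"
    and duals: "p \<in> B \<Longrightarrow> \<exists>!q. q \<in> B \<and> p * q \<noteq> 0 \<and> p * q \<in> socle UNIV"
begin

lemma independent_B: "independent B" and span_B: "span B = UNIV" and B_paths: "B \<subseteq> pc ` paths Q"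
  using path_basis by (auto simp: path_basis_def is_basis_def)

lemma span_paths: "a \<in> span (pc ` paths Q)"
  using span_mono[OF B_paths] span_B by auto

lemma finite_B: "finite B"
proof -
  obtain S where "finite S" "span S = UNIV" using frobenius by (auto simp: frobenius_algebra_def is_basis_def)
  then show ?thesis using independent_span_bound[OF _ independent_B, of S] by simp
qed

lemma short_inj:
  assumes "p \<in> paths Q" "length (snd p) < 2" "q \<in> paths Q" "pc p = scale c (pc q)"
  shows "q = p"
proof (rule ccontr)
  assume "q \<noteq> p"
  then have "pc p \<in> span (pc ` {q \<in> paths Q. q \<noteq> p})"
    unfolding assms(4) using assms(3) by (intro span_scale span_base) auto
  then show False using short_independent[OF assms(1,2)] by blast
qed

lemma short_in_B: "p \<in> paths Q \<Longrightarrow> length (snd p) < 2 \<Longrightarrow> pc p \<in> B"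
proof (rule ccontr)
  assume p: "p \<in> paths Q" "length (snd p) < 2" "pc p \<notin> B"
  then have "B \<subseteq> pc ` {q \<in> paths Q. q \<noteq> p}" using B_paths by auto
  then have "pc p \<in> span (pc ` {q \<in> paths Q. q \<noteq> p})" using span_mono span_B by blast
  then show False using short_independent[OF p(1,2)] by blast
qed

lemma path_verts: "p \<in> paths Q \<Longrightarrow> fst p \<in> verts Q \<and> target Q p \<in> verts Q"
  by (auto simp: paths_def dest: awalk_hd_in_verts awalk_last_in_verts)

lemma target_Nil [simp]: "target Q (v, []) = v"
  by (simp add: target_def)

lemma source_mult: "p \<in> paths Q \<Longrightarrow> pc (fst p, []) * pc p = pc p"
  using pc_mult[of "(fst p, [])" p] path_verts[of p] by (simp add: trivial_path)

lemma target_mult: "p \<in> paths Q \<Longrightarrow> pc p * pc (target Q p, []) = pc p"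
  using pc_mult[of p "(target Q p, [])"] path_verts[of p] by (simp add: trivial_path)

lemma vertex_mult: "u \<in> verts Q \<Longrightarrow> v \<in> verts Q \<Longrightarrow> pc (u, []) * pc (v, []) = (if u = v then pc (u, []) else 0)"
  using pc_mult[of "(u, [])" "(v, [])"] by (simp add: trivial_path)

lemma awalk_target: "awalk u p w \<Longrightarrow> target Q (u, p) = w"
  by (auto simp: target_def awalk_def)

lemma path_Cons:
  assumes "(u, a # as) \<in> paths Q"
  shows "a \<in> arcs Q" "u = tail Q a" "(head Q a, as) \<in> paths Q"
    "pc (u, a # as) = pc (tail Q a, [a]) * pc (head Q a, as)"
proof -
  obtain w where w: "awalk u (a # as) w" using assms by (auto simp: paths_def)
  then show a: "a \<in> arcs Q" "u = tail Q a" by (auto simp: awalk_Cons_iff)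
  have h: "awalk (head Q a) as w" using w by (simp add: awalk_Cons_iff)
  then show "(head Q a, as) \<in> paths Q" using awalk_target[OF h] by (simp add: paths_def)
  moreover have "target Q (tail Q a, [a]) = head Q a"
    using a by (intro awalk_target) (simp add: awalk_simps)
  ultimately show "pc (u, a # as) = pc (tail Q a, [a]) * pc (head Q a, as)"
    using pc_mult[OF arc_path[OF a(1)], of "(head Q a, as)"] a by simp
qed

text \<open>The expected shape of the right socle: elements annihilated by the arrow ideal. One
  inclusion is \<open>socle_killed\<close>; the converse is shown in \<open>killed_socle\<close> for
  elements between two fixed vertices.\<close>

definition killed :: "'a set" where
  "killed = {s. \<forall>p\<in>paths Q. snd p \<noteq> [] \<longrightarrow> s * pc p = 0}"

lemma right_submodule_killed: "right_submodule killed"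
  unfolding right_submodule_def
proof (intro conjI ballI allI)
  fix s a assume s: "s \<in> killed"
  have "a \<in> span (pc ` paths Q)" by (rule span_paths)
  then show "s * a \<in> killed"
  proof (induction rule: span_induct_alt)
    case (step c x y)
    then obtain q where q: "q \<in> paths Q" "x = pc q" by auto
    have "s * x * pc p = 0" if "p \<in> paths Q" "snd p \<noteq> []" for p
      unfolding mult.assoc q(2) pc_mult[OF q(1) that(1)]
      using s path_append[OF q(1) that(1)] that(2) by (auto simp: killed_def)
    then show ?case using step.IH
      by (auto simp: killed_def distrib_left distrib_right scale_mult_left scale_mult_right)
  qed (simp add: killed_def)
qed (auto simp: killed_def distrib_right)

text \<open>Nilpotency bounds the length of the paths with nonzero product, so a longest one exists,
  and nothing survives a further arrow.\<close>

lemma extension: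
  assumes "a \<noteq> 0"
  shows "\<exists>q\<in>paths Q. a * pc q \<noteq> 0 \<and> a * pc q \<in> killed"
proof -
  obtain M where M: "\<And>p. p \<in> paths Q \<Longrightarrow> length (snd p) \<ge> M \<Longrightarrow> pc p = 0" using nilpotency by blast
  have "\<exists>v\<in>verts Q. a * pc (v, []) \<noteq> 0"
  proof (rule ccontr)
    assume "\<not> ?thesis"
    then have "(\<Sum>v\<in>verts Q. a * pc (v, [])) = 0" by simp
    moreover have "a * 1 = (\<Sum>v\<in>verts Q. a * pc (v, []))" by (subst one_eq) (rule sum_distrib_left)
    ultimately show False using assms by simp
  qed
  then obtain v where "v \<in> verts Q" "a * pc (v, []) \<noteq> 0" ..
  then have "(v, []) \<in> paths Q \<and> a * pc (v, []) \<noteq> 0" by (simp add: trivial_path)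
  \<comment> \<open>A maximal length is obtained as a minimum of
    \<open>M - length (snd q)\<close>.\<close>
  then obtain q where q: "q \<in> paths Q" "a * pc q \<noteq> 0"
    and min: "\<forall>p. p \<in> paths Q \<and> a * pc p \<noteq> 0 \<longrightarrow> M - length (snd q) \<le> M - length (snd p)"
    using ex_has_least_nat[of "\<lambda>q. q \<in> paths Q \<and> a * pc q \<noteq> 0" "(v, [])" "\<lambda>q. M - length (snd q)"] by blast
  have max: "length (snd p) \<le> length (snd q)" if "p \<in> paths Q \<and> a * pc p \<noteq> 0" for p
  proof -
    have "length (snd p) < M" using M[of p] that by (cases "M \<le> length (snd p)") auto
    then show ?thesis using min[rule_format, OF that] by linarith
  qed
  have "a * pc q * pc p = 0" if p: "p \<in> paths Q" "snd p \<noteq> []" for p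
  proof (cases "target Q q = fst p")
    case True
    have "a * pc (fst q, snd q @ snd p) = 0"
      using max[of "(fst q, snd q @ snd p)"] path_append[OF q(1) p(1) True] p(2) by auto
    then show ?thesis using True by (simp add: mult.assoc pc_mult[OF q(1) p(1)])
  qed (simp add: mult.assoc pc_mult[OF q(1) p(1)])
  then show ?thesis using q by (auto simp: killed_def)
qed

text \<open>By \<open>extension\<close> a simple submodule contains a nonzero element of the
  submodule \<open>killed\<close>, hence it lies inside it.\<close>

lemma socle_killed: "socle UNIV \<subseteq> killed"
  unfolding socle_def
proof (rule hull_minimal[where S = right_submodule, OF _ right_submodule_killed], rule Union_least)
  fix S :: "'a set" assume "S \<in> {S. simple_submodule S \<and> S \<subseteq> UNIV}"
  then have S: "right_submodule S" "S \<noteq> {0}" "\<And>N. right_submodule N \<Longrightarrow> N \<subseteq> S \<Longrightarrow> N = {0} \<or> N = S"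
    by (auto simp: simple_submodule_def)
  then obtain s where s: "s \<in> S" "s \<noteq> 0" by (auto simp: right_submodule_def)
  then obtain q where "s * pc q \<noteq> 0" "s * pc q \<in> killed" using extension by blast
  moreover have "s * pc q \<in> S" using S(1) s by (auto simp: right_submodule_def)
  moreover have "right_submodule (S \<inter> killed)"
    using S(1) right_submodule_killed by (auto simp: right_submodule_def)
  ultimately have "S \<inter> killed = S" using S(3)[of "S \<inter> killed"] by blast
  then show "S \<subseteq> killed" by blast
qed

lemma right_submodule_socle: "right_submodule (socle M)"
  unfolding socle_def by (rule hull_in) (auto simp: right_submodule_def)

lemma socle_scale: "s \<in> socle M \<Longrightarrow> scale c s \<in> socle M"
proof -
  assume "s \<in> socle M"
  then have "s * scale c 1 \<in> socle M" using right_submodule_socle[of M] by (simp add: right_submodule_def)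
  then show ?thesis by (simp add: scale_mult_right)
qed

lemma socle_mono: "M \<subseteq> M' \<Longrightarrow> socle M \<subseteq> socle M'"
  unfolding socle_def by (intro hull_mono Union_mono) auto

lemma socle_indec: "s \<in> socle (indec_projective \<pi> v) \<Longrightarrow> v \<in> verts Q \<Longrightarrow> pc (v, []) * s = s"
proof -
  assume s: "s \<in> socle (indec_projective \<pi> v)" and v: "v \<in> verts Q"
  have "right_submodule (indec_projective \<pi> v)"
    unfolding right_submodule_def indec_projective_def
  proof (intro conjI ballI allI)
    let ?R = "range (\<lambda>a. pc (v, []) * a)"
    show "0 \<in> ?R" by (rule range_eqI[of _ _ 0]) simp
    fix x c assume "x \<in> ?R"
    then obtain a where x: "x = pc (v, []) * a" by auto
    show "x * c \<in> ?R" by (rule range_eqI[of _ _ "a * c"]) (simp add: x mult.assoc)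
    fix y assume "y \<in> ?R"
    then obtain b where y: "y = pc (v, []) * b" by auto
    show "x + y \<in> ?R" by (rule range_eqI[of _ _ "a + b"]) (simp add: x y distrib_left)
  qed
  then have "socle (indec_projective \<pi> v) \<subseteq> indec_projective \<pi> v"
    unfolding socle_def by (intro hull_minimal[where S = right_submodule]) auto
  then obtain a where "s = pc (v, []) * a" using s by (auto simp: indec_projective_def)
  then show "pc (v, []) * s = s" using vertex_mult[OF v v] by (simp flip: mult.assoc)
qed

text \<open>Right multiplication turns \<open>s\<close> into a multiple of itself: arrows kill it,
  and among the trivial paths only the one at its end \<open>w\<close> acts, as identity. The line
  through \<open>s\<close> is therefore a simple submodule.\<close>

lemma killed_socle:
  assumes s: "s \<in> killed" and w: "w \<in> verts Q" "s * pc (w, []) = s" and v: "pc (v, []) * s = s"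
  shows "s \<in> socle (indec_projective \<pi> v)"
proof (cases "s = 0")
  case True
  then show ?thesis using right_submodule_socle by (auto simp: right_submodule_def)
next
  case False
  have mult: "\<exists>c. s * a = scale c s" for a
  proof -
    have "a \<in> span (pc ` paths Q)" by (rule span_paths)
    then show ?thesis
    proof (induction rule: span_induct_alt)
      case base
      show ?case by (rule exI[of _ 0]) simp
    next
      case (step c x y)
      then obtain q d where q: "q \<in> paths Q" "x = pc q" and d: "s * y = scale d s" by auto
      have "\<exists>e. s * x = scale e s"
      proof (cases "snd q = []")
        case True
        then obtain u where q': "q = (u, [])" by (cases q) auto
        have "s * x = s * pc (w, []) * pc (u, [])" using q(2) q' w(2) by simp
        also have "\<dots> = s * (if w = u then pc (w, []) else 0)"
          unfolding mult.assoc using vertex_mult[OF w(1), of u] path_verts[OF q(1)] q' by simp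
        also have "\<dots> = scale (if w = u then 1 else 0) s" using w(2) by (cases "w = u") auto
        finally show ?thesis ..
      next
        case False
        then show ?thesis using s q by (intro exI[of _ 0]) (simp add: killed_def)
      qed
      then obtain e where "s * x = scale e s" ..
      then show ?case using d
        by (intro exI[of _ "c * e + d"]) (simp add: distrib_left scale_mult_right scale_left_distrib)
    qed
  qed
  let ?S = "range (\<lambda>c. scale c s)"
  have "right_submodule ?S"
    unfolding right_submodule_def
  proof (intro conjI ballI allI)
    show "0 \<in> ?S" by (rule range_eqI[of _ _ 0]) simp
    fix x a assume "x \<in> ?S"
    then obtain c where x: "x = scale c s" by auto
    obtain d where "s * a = scale d s" using mult by blast
    then show "x * a \<in> ?S" using x by (auto simp: scale_mult_left)
    fix y assume "y \<in> ?S"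
    then show "x + y \<in> ?S" using x by (auto simp flip: scale_left_distrib)
  qed
  moreover have "?S \<noteq> {0}"
  proof
    assume "?S = {0}"
    moreover have "scale 1 s \<in> ?S" by (rule rangeI)
    ultimately show False using False by simp
  qed
  moreover have "N = {0} \<or> N = ?S" if N: "right_submodule N" "N \<subseteq> ?S" for N
  proof (cases "N = {0}")
    case False
    then obtain x where x: "x \<in> N" "x \<noteq> 0" using N(1) by (auto simp: right_submodule_def)
    then obtain c where c: "x = scale c s" using N(2) by auto
    have "scale d s \<in> N" for d
    proof -
      have "x * scale (d / c) 1 \<in> N" using x(1) N(1) by (simp add: right_submodule_def)
      moreover have "x * scale (d / c) 1 = scale d s" using x(2) c by (simp add: scale_mult_right)
      ultimately show ?thesis by (simp only:)
    qed
    then have "?S \<subseteq> N" by auto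
    then show ?thesis using N(2) by blast
  qed simp
  moreover have "?S \<subseteq> indec_projective \<pi> v"
  proof
    fix y assume "y \<in> ?S"
    then obtain c where "y = scale c s" by auto
    then show "y \<in> indec_projective \<pi> v"
      unfolding indec_projective_def using v by (intro range_eqI[of _ _ "scale c s"]) (simp add: scale_mult_right)
  qed
  ultimately have "?S \<in> {S. simple_submodule S \<and> S \<subseteq> indec_projective \<pi> v}"
    by (simp add: simple_submodule_def)
  moreover have "s \<in> ?S" by (rule range_eqI[of _ _ 1]) simp
  ultimately show ?thesis unfolding socle_def by (intro hull_inc) blast
qed

definition st :: "'a \<Rightarrow> 'a" where
  "st p = (THE q. q \<in> B \<and> p * q \<noteq> 0 \<and> p * q \<in> socle UNIV)"

lemma st: "p \<in> B \<Longrightarrow> st p \<in> B \<and> p * st p \<noteq> 0 \<and> p * st p \<in> socle UNIV"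
  unfolding st_def by (rule theI'[OF duals])

lemma st_eqI: "p \<in> B \<Longrightarrow> q \<in> B \<Longrightarrow> p * q \<noteq> 0 \<Longrightarrow> p * q \<in> socle UNIV \<Longrightarrow> st p = q"
  using duals[of p] st[of p] by blast

lemma trace_scale: "tr (scale c a) = c * tr a" and trace_add: "tr (a + b) = tr a + tr b"
  using tr_linear by (auto simp: Vector_Spaces.linear_iff)

lemma trace_zero: "tr 0 = 0"
  using trace_scale[of 0 0] by simp

text \<open>By the multiplicativity of the basis, \<open>p * q\<close> is a multiple of some
  \<open>r\<close> in \<open>B\<close>, and the trace of \<open>r\<close> detects whether it lies in
  the socle.\<close>

lemma trace_pair:
  assumes "p \<in> B" "q \<in> B"
  shows "tr (p * q) \<noteq> 0 \<longleftrightarrow> q = st p"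
proof -
  obtain r c where r: "r \<in> B" "p * q = scale c r" using products assms by blast
  have "tr (p * q) \<noteq> 0 \<longleftrightarrow> p * q \<noteq> 0 \<and> p * q \<in> socle UNIV"
  proof (cases "c = 0")
    case False
    have "r \<in> socle UNIV" if "p * q \<in> socle UNIV"
      using socle_scale[OF that, of "1 / c"] False r by simp
    then have "p * q \<in> socle UNIV \<longleftrightarrow> r \<in> socle UNIV" using socle_scale r(2) by metis
    moreover have "r \<noteq> 0" using independent_B r(1) dependent_zero by blast
    ultimately show ?thesis using tr_socle[OF r(1)] tr_not_socle[OF r(1)] False r(2) by (auto simp: trace_scale)
  qed (simp add: r trace_zero)
  then show ?thesis using st st_eqI assms by blast
qed

lemma vertex_in_B: "v \<in> verts Q \<Longrightarrow> pc (v, []) \<in> B"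
  by (rule short_in_B) (simp_all add: trivial_path)

text \<open>Here the bases of the socles contained in \<open>B\<close> enter. Each element
  \<open>r\<close> of such a basis satisfies \<open>pc (v, []) * r = r\<close>, so it is the dual of
  the trivial path at \<open>v\<close>; uniqueness of the dual leaves a single candidate.\<close>

lemma socle_vertex:
  assumes v: "v \<in> verts Q" and s: "s \<in> socle (indec_projective \<pi> v)"
  shows "\<exists>c. s = scale c (st (pc (v, [])))"
proof -
  obtain S where S: "S \<subseteq> B" "is_basis scale (socle (indec_projective \<pi> v)) S"
    using path_basis v by (auto simp: path_basis_def)
  have "r = st (pc (v, []))" if r: "r \<in> S" for r
  proof -
    have rs: "r \<in> socle (indec_projective \<pi> v)" using S(2) r by (auto simp: is_basis_def)
    have "r \<noteq> 0" using independent_B r S(1) dependent_zero by blast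
    then show ?thesis
      using socle_indec[OF rs v] rs socle_mono[of "indec_projective \<pi> v" UNIV] r S(1)
      by (intro st_eqI[symmetric] vertex_in_B[OF v]) auto
  qed
  then have "span S \<subseteq> span {st (pc (v, []))}" by (intro span_mono) auto
  then show ?thesis using S(2) s by (auto simp: is_basis_def span_singleton)
qed

text \<open>A nonzero \<open>a\<close> can be multiplied by a path into the socle of its projective.
  All elements there are multiples of the dual of the trivial path, on which the trace does not
  vanish.\<close>

lemma nondegenerate_vertex:
  assumes v: "v \<in> verts Q" "pc (v, []) * a = a" and zero: "\<And>b. b \<in> B \<Longrightarrow> tr (a * b) = 0"
  shows "a = 0"
proof (rule ccontr)
  assume "a \<noteq> 0"
  then obtain q where q: "q \<in> paths Q" "a * pc q \<noteq> 0" "a * pc q \<in> killed" using extension by blast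
  let ?s = "a * pc q" and ?e = "pc (v, [])"
  have "?s * pc (target Q q, []) = ?s" using target_mult[OF q(1)] by (simp add: mult.assoc)
  moreover have "?e * ?s = ?s" using v(2) by (simp flip: mult.assoc)
  ultimately have "?s \<in> socle (indec_projective \<pi> v)"
    using path_verts[OF q(1)] by (intro killed_socle[OF q(3)]) auto
  then obtain c where c: "?s = scale c (st ?e)" using socle_vertex[OF v(1)] by blast
  obtain P where P: "P \<in> paths Q" "st ?e = pc P" using st[OF vertex_in_B[OF v(1)]] B_paths by blast
  have "?e * st ?e = st ?e"
    using pc_mult[OF trivial_path[OF v(1)] P(1)] st[OF vertex_in_B[OF v(1)]] P(2) by (auto split: if_splits)
  then have "tr ?s \<noteq> 0"
    using trace_pair[OF vertex_in_B[OF v(1)], of "st ?e"] st[OF vertex_in_B[OF v(1)]] c q(2) by (auto simp: trace_scale)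
  moreover have "tr (a * b) = 0" for b
  proof -
    have "b \<in> span B" by (simp add: span_B)
    then show ?thesis
      by (induction rule: span_induct_alt)
        (simp_all add: zero distrib_left scale_mult_right trace_add trace_scale trace_zero)
  qed
  ultimately show False by blast
qed

text \<open>For \<open>s\<close> in \<open>killed\<close> ending at \<open>w\<close>, the functional
  \<open>F s\<close> vanishes on every path but the trivial one at \<open>w\<close>, so it is
  determined by \<open>F s 1\<close>; nondegeneracy does the rest. The abstract form
  \<open>F\<close> is used because the trace form is so far known to be nondegenerate only for
  elements with a fixed source.\<close>

lemma killed_proportional:
  assumes s: "s \<in> killed" "s * pc (w, []) = s" and t: "t \<in> killed" "t * pc (w, []) = t" "t \<noteq> 0"
    and w: "w \<in> verts Q"
  shows "\<exists>c. s = scale c t"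
proof -
  obtain F where F: "bilinear_form scale F" "nondegenerate F" "\<And>a b c. F (a * b) c = F a (b * c)"
    using frobenius by (auto simp: frobenius_algebra_def)
  have lin: "F a (b + b') = F a b + F a b'" "F a (scale c b) = c * F a b"
    "F (b + b') a = F b a + F b' a" "F (scale c b) a = c * F b a" for a b b' c
    using F(1) by (auto simp: bilinear_form_def Vector_Spaces.linear_iff)
  have z: "F a 0 = 0" for a using lin(2)[of a 0 0] by simp
  have on_path: "F x (pc q) = (if snd q = [] \<and> fst q = w then F x 1 else 0)"
    if "x \<in> killed" "x * pc (w, []) = x" "q \<in> paths Q" for x q
  proof -
    have "x * pc q = (if snd q = [] \<and> fst q = w then x else 0)"
    proof (cases "snd q = []")
      case True
      then obtain u where q': "q = (u, [])" by (cases q) auto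
      have "x * pc q = x * pc (w, []) * pc (u, [])" using that(2) q' by simp
      also have "\<dots> = x * (if w = u then pc (w, []) else 0)"
        unfolding mult.assoc using vertex_mult[OF w, of u] path_verts[OF that(3)] q' by simp
      finally show ?thesis using that(2) q' by auto
    qed (use that in \<open>simp add: killed_def\<close>)
    moreover have "F x (pc q) = F (x * pc q) 1" by (simp add: F(3))
    moreover have "F 0 1 = 0" using lin(4)[of 0 0 1] by simp
    ultimately show ?thesis by simp
  qed
  have proportional: "F s 1 * F t b = F t 1 * F s b" for b
  proof -
    have "b \<in> span (pc ` paths Q)" by (rule span_paths)
    then show ?thesis
    proof (induction rule: span_induct_alt)
      case (step c x y)
      then obtain q where "q \<in> paths Q" "x = pc q" by auto
      then have "F s 1 * F t x = F t 1 * F s x" using on_path s t by simp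
      then show ?case using step.IH by (simp add: lin algebra_simps)
    qed (simp add: z)
  qed
  have "F t b = 0" if "F t 1 = 0" for b
  proof -
    have "b \<in> span (pc ` paths Q)" by (rule span_paths)
    then show ?thesis
    proof (induction rule: span_induct_alt)
      case (step c x y)
      then obtain q where "q \<in> paths Q" "x = pc q" by auto
      then have "F t x = 0" using on_path[of t q] t that by simp
      then show ?case using step.IH by (simp add: lin)
    qed (simp add: z)
  qed
  then have nz: "F t 1 \<noteq> 0" using F(2) t(3) unfolding nondegenerate_def by blast
  have "F (scale (F s 1) t + scale (- F t 1) s) b = 0" for b by (simp only: lin proportional) simp
  then have "scale (F s 1) t + scale (- F t 1) s = 0" using F(2) unfolding nondegenerate_def by blast
  then have "scale (F t 1) s = scale (F s 1) t" by (simp add: add_eq_0_iff2)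
  then have "scale (1 / F t 1) (scale (F t 1) s) = scale (1 / F t 1) (scale (F s 1) t)" by simp
  then show ?thesis using nz by auto
qed

text \<open>If \<open>p\<close> and \<open>p'\<close> share the dual \<open>q\<close>, then
  \<open>p * q\<close> and \<open>p' * q\<close> are socle elements with the same end, hence
  proportional, and so \<open>p\<close> and \<open>p'\<close> start at the same vertex. There a
  combination of them orthogonal to \<open>B\<close> vanishes, which contradicts independence unless
  they coincide.\<close>

lemma inj_st: "inj_on st B"
proof (rule inj_onI)
  fix p p' assume p: "p \<in> B" "p' \<in> B" and eq: "st p = st p'"
  let ?q = "st p"
  have "p \<in> pc ` paths Q" "p' \<in> pc ` paths Q" "?q \<in> pc ` paths Q" using p B_paths st[OF p(1)] by auto
  then obtain P P' R where P: "P \<in> paths Q" "p = pc P" "P' \<in> paths Q" "p' = pc P'" "R \<in> paths Q" "?q = pc R"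
    by (elim imageE)
  let ?e = "pc (fst P, [])" and ?e' = "pc (fst P', [])"
  have q: "?q \<in> B" and s: "p * ?q \<noteq> 0" "p * ?q \<in> killed" and s': "p' * ?q \<noteq> 0" "p' * ?q \<in> killed"
    using st[OF p(1)] st[OF p(2)] eq socle_killed by auto
  have "x * ?q * pc (target Q R, []) = x * ?q" for x
    using target_mult[OF P(5)] P(6) by (simp add: mult.assoc)
  then obtain c where c: "p * ?q = scale c (p' * ?q)"
    using killed_proportional[OF s(2) _ s'(2) _ s'(1)] path_verts[OF P(5)] by blast
  have e: "?e * p = p" "?e' * p' = p'" using source_mult P by auto
  have "fst P = fst P'"
  proof (rule ccontr)
    assume "fst P \<noteq> fst P'"
    then have z: "?e * ?e' = 0" using vertex_mult path_verts P by simp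
    have "?e' * (p' * ?q) = p' * ?q" using e(2) by (simp flip: mult.assoc)
    moreover have "?e * (?e' * (p' * ?q)) = 0" using z by (simp flip: mult.assoc)
    ultimately have "?e * scale c (p' * ?q) = 0" by (simp add: scale_mult_right)
    moreover have "?e * (p * ?q) = p * ?q" using e(1) by (simp flip: mult.assoc)
    ultimately show False using c s(1) by simp
  qed
  then have e': "?e * p' = p'" using e(2) by simp
  let ?t = "tr (p * ?q)" and ?t' = "tr (p' * ?q)"
  \<comment> \<open>The coefficients make the pairing with \<open>q\<close> cancel; all other basis
    elements pair to zero with both paths.\<close>
  let ?a = "scale ?t' p + scale (- ?t) p'"
  have "?a = 0"
  proof (rule nondegenerate_vertex[of "fst P"])
    show "fst P \<in> verts Q" using path_verts P(1) by blast
    show "?e * ?a = ?a" by (simp only: distrib_left scale_mult_right e(1) e')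
    fix b assume b: "b \<in> B"
    have "tr (?a * b) = ?t' * tr (p * b) - ?t * tr (p' * b)"
      by (simp only: distrib_right scale_mult_left trace_add trace_scale) simp
    then show "tr (?a * b) = 0"
      using trace_pair[OF p(1) b] trace_pair[OF p(2) b] eq by (cases "b = ?q") auto
  qed
  then have "scale ?t' p = scale ?t p'" by (simp add: add_eq_0_iff2)
  then have "scale (1 / ?t') (scale ?t' p) = scale (1 / ?t') (scale ?t p')" by simp
  moreover have "?t' \<noteq> 0" using trace_pair[OF p(2) q] eq by simp
  ultimately have "p = scale (?t / ?t') p'" by simp
  then have "p \<in> span {p'}" by (auto simp: span_singleton)
  show "p = p'"
  proof (rule ccontr)
    assume "p \<noteq> p'"
    then have "span {p'} \<subseteq> span (B - {p})" using p by (intro span_mono) auto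
    then have "dependent B" using \<open>p \<in> span {p'}\<close> p(1) by (auto simp: dependent_def)
    then show False using independent_B by blast
  qed
qed

end

sublocale monomial_frobenius \<subseteq> dual: dual_basis_trace scale B tr st
proof (intro dual_basis_trace.intro dual_basis_trace_axioms.intro)
  show "k_algebra scale" by unfold_locales
  show "finite B" by (rule finite_B)
  show "is_basis scale UNIV B" using path_basis by (simp add: path_basis_def)
  show "Vector_Spaces.linear scale (*) tr" by (rule tr_linear)
  show "st b \<in> B" if "b \<in> B" for b using st[OF that] by blast
  show "tr (b * st b) \<noteq> 0" if "b \<in> B" for b using trace_pair[OF that] st[OF that] by blast
  show "tr (b * c) = 0" if "b \<in> B" "c \<in> B" "c \<noteq> st b" for b c using trace_pair[OF that(1,2)] that(3) by blast
  show "inj_on st B" by (rule inj_st)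
qed

section \<open>The Nakayama automorphism on vertices and arrows\<close>

context monomial_frobenius begin

text \<open>Multiplying \<open>y\<close> by itself again and again writes it as a multiple of ever
  longer paths, which vanish eventually.\<close>

lemma idempotent_zero:
  assumes p: "p \<in> paths Q" "snd p \<noteq> []" and y: "y = scale c (pc p)" "y * y = y"
  shows "y = 0"
proof (rule ccontr)
  assume "y \<noteq> 0"
  have "\<exists>q d. q \<in> paths Q \<and> n \<le> length (snd q) \<and> y = scale d (pc q)" for n
  proof (induction n)
    case 0
    show ?case using p(1) y(1) by (intro exI[of _ p] exI[of _ c]) simp
  next
    case (Suc n)
    then obtain q d where q: "q \<in> paths Q" "n \<le> length (snd q)" "y = scale d (pc q)" by blast
    have "y = scale d (pc q) * scale c (pc p)" using y(2) by (simp only: flip: q(3) y(1))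
    then have yy: "y = scale (d * c) (pc q * pc p)" by (simp add: scale_mult_left scale_mult_right)
    have t: "target Q q = fst p"
    proof (rule ccontr)
      assume "target Q q \<noteq> fst p"
      then have "pc q * pc p = 0" by (simp add: pc_mult[OF q(1) p(1)])
      then show False using yy \<open>y \<noteq> 0\<close> by simp
    qed
    have "y = scale (d * c) (pc (fst q, snd q @ snd p))" unfolding yy pc_mult[OF q(1) p(1)] by (simp add: t)
    moreover have "Suc n \<le> length (snd (fst q, snd q @ snd p))" using q(2) p(2) by (cases "snd p") auto
    ultimately show ?case using path_append[OF q(1) p(1) t] by blast
  qed
  moreover obtain M where M: "\<And>p. p \<in> paths Q \<Longrightarrow> length (snd p) \<ge> M \<Longrightarrow> pc p = 0" using nilpotency by blast
  ultimately obtain q d where "q \<in> paths Q" "M \<le> length (snd q)" "y = scale d (pc q)" by blast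
  then show False using M[of q] \<open>y \<noteq> 0\<close> by simp
qed

abbreviation ar :: "'e \<Rightarrow> 'a" where "ar a \<equiv> pc (tail Q a, [a])"

lemma arrow_in_B: "a \<in> arcs Q \<Longrightarrow> ar a \<in> B"
  by (rule short_in_B) (simp_all add: arc_path)

lemma nonzero_B: "b \<in> B \<Longrightarrow> b \<noteq> 0"
  using independent_B dependent_zero by blast

lemma nak_nonzero: "dual.nak b = 0 \<Longrightarrow> b = 0"
  using dual.nak_inv_nak[of b] dual.nak_inv_nak[of 0] dual.nak_0 by simp

definition E where "E = (\<lambda>v. pc (v, [])) ` verts Q"
definition Ar where "Ar = ar ` arcs Q"

lemma E_B: "E \<subseteq> B" and Ar_B: "Ar \<subseteq> B"
  by (auto simp: E_def Ar_def vertex_in_B arrow_in_B)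

lemma E_Ar: "x \<in> E \<Longrightarrow> x \<notin> Ar"
proof
  assume "x \<in> E" "x \<in> Ar"
  then obtain v a where "v \<in> verts Q" "a \<in> arcs Q" "pc (v, []) = scale 1 (ar a)" by (auto simp: E_def Ar_def)
  then show False using short_inj[OF trivial_path _ arc_path, of v a 1] by simp
qed

text \<open>The automorphism preserves idempotents, and a nonzero idempotent that is a multiple of a
  path can only come from a trivial path.\<close>

lemma \<tau>_E: "dual.\<tau> ` E \<subseteq> E"
proof
  fix x assume "x \<in> dual.\<tau> ` E"
  then obtain v where v: "v \<in> verts Q" "x = dual.\<tau> (pc (v, []))" by (auto simp: E_def)
  let ?e = "pc (v, [])"
  have eB: "?e \<in> B" by (rule vertex_in_B[OF v(1)])
  obtain c where c: "c \<noteq> 0" "dual.nak ?e = scale c x" using dual.nak_basis[OF eB] v(2) by metis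
  obtain P where P: "P \<in> paths Q" "x = pc P" using dual.\<tau>_closed[OF eB] v(2) B_paths by blast
  have "dual.nak ?e * dual.nak ?e = dual.nak ?e"
    using vertex_mult[OF v(1) v(1)] by (simp flip: dual.nak_mult)
  then have "snd P = []"
    using idempotent_zero[OF P(1), of "dual.nak ?e" c] c(2) P(2) nak_nonzero[of ?e] nonzero_B[OF eB] by blast
  then have "x = pc (fst P, [])" using P(2) by (cases P) simp
  then show "x \<in> E" using path_verts[OF P(1)] by (auto simp: E_def)
qed

lemma \<tau>_not_E: "b \<in> B \<Longrightarrow> b \<notin> E \<Longrightarrow> dual.\<tau> b \<notin> E"
  by (rule inj_on_complement_closed[OF finite_B dual.inj_\<tau> E_B \<tau>_E])

text \<open>Each arrow goes to a multiple of a basis path outside \<open>E\<close>, which has length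
  at least one, and lengths add up under multiplication.\<close>

lemma nak_path:
  "(u, as) \<in> paths Q \<Longrightarrow> dual.nak (pc (u, as)) \<noteq> 0 \<Longrightarrow>
    \<exists>c q. q \<in> paths Q \<and> length as \<le> length (snd q) \<and> dual.nak (pc (u, as)) = scale c (pc q)"
proof (induction as arbitrary: u)
  case Nil
  then have eB: "pc (u, []) \<in> B" using path_verts[OF Nil(1)] by (simp add: vertex_in_B)
  obtain c where c: "dual.nak (pc (u, [])) = scale c (dual.\<tau> (pc (u, [])))" using dual.nak_basis[OF eB] by blast
  moreover obtain q where "q \<in> paths Q" "dual.\<tau> (pc (u, [])) = pc q"
    using dual.\<tau>_closed[OF eB] B_paths by blast
  ultimately show ?case by (intro exI[of _ c] exI[of _ q]) simp
next
  case (Cons a as)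
  note p = path_Cons[OF Cons.prems(1)]
  have m: "dual.nak (pc (u, a # as)) = dual.nak (ar a) * dual.nak (pc (head Q a, as))"
    by (simp add: p(4) dual.nak_mult)
  then have "dual.nak (pc (head Q a, as)) \<noteq> 0" using Cons.prems(2) by auto
  then obtain c q where q: "q \<in> paths Q" "length as \<le> length (snd q)" "dual.nak (pc (head Q a, as)) = scale c (pc q)"
    using Cons.IH[OF p(3)] by blast
  have aB: "ar a \<in> B" by (rule arrow_in_B[OF p(1)])
  obtain d where d: "dual.nak (ar a) = scale d (dual.\<tau> (ar a))" using dual.nak_basis[OF aB] by blast
  obtain r where r: "r \<in> paths Q" "dual.\<tau> (ar a) = pc r" using dual.\<tau>_closed[OF aB] B_paths by blast
  have "dual.\<tau> (ar a) \<notin> E" using \<tau>_not_E[OF aB] E_Ar p(1) by (auto simp: Ar_def)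
  then have "snd r \<noteq> []" using r path_verts[OF r(1)] by (cases r) (auto simp: E_def)
  have m': "dual.nak (pc (u, a # as)) = scale (d * c) (pc r * pc q)"
    by (simp add: m d r(2) q(3) scale_mult_left scale_mult_right)
  have t: "target Q r = fst q"
  proof (rule ccontr)
    assume "target Q r \<noteq> fst q"
    then have "pc r * pc q = 0" by (simp add: pc_mult[OF r(1) q(1)])
    then show False using m' Cons.prems(2) by simp
  qed
  have "dual.nak (pc (u, a # as)) = scale (d * c) (pc (fst r, snd r @ snd q))"
    unfolding m' pc_mult[OF r(1) q(1)] by (simp add: t)
  moreover have "length (a # as) \<le> length (snd (fst r, snd r @ snd q))"
    using q(2) \<open>snd r \<noteq> []\<close> by (cases "snd r") auto
  ultimately show ?case using path_append[OF r(1) q(1) t] by blast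
qed

text \<open>A priori an arrow might go to a longer path. The paths of length at least two in
  \<open>B\<close> are preserved, however, since \<open>nak_path\<close> shows that lengths do not
  drop and by \<open>short_inj\<close> the class of an arrow is not a multiple of the class of
  another path. By finiteness and injectivity nothing else lands among them, nor among the trivial
  paths.\<close>

lemma \<tau>_Ar: "dual.\<tau> ` Ar \<subseteq> Ar"
proof
  fix y assume "y \<in> dual.\<tau> ` Ar"
  then obtain x where x: "x \<in> Ar" "y = dual.\<tau> x" by auto
  let ?R = "B - E - Ar"
  have "dual.\<tau> ` ?R \<subseteq> ?R"
  proof
    fix z assume "z \<in> dual.\<tau> ` ?R"
    then obtain b where b: "b \<in> B" "b \<notin> E" "b \<notin> Ar" "z = dual.\<tau> b" by auto
    obtain u as where P: "(u, as) \<in> paths Q" "b = pc (u, as)" using b(1) B_paths by auto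
    have "as \<noteq> []" using b(2) P path_verts[OF P(1)] by (auto simp: E_def)
    moreover have "as \<noteq> [a]" for a using b(3) P path_Cons(1,2)[of u a "[]"] by (auto simp: Ar_def)
    ultimately have len: "2 \<le> length as" by (cases as; cases "tl as") auto
    obtain c where c: "c \<noteq> 0" "dual.nak b = scale c z" using dual.nak_basis[OF b(1)] b(4) by metis
    have "dual.nak b \<noteq> 0" using nak_nonzero[of b] nonzero_B[OF b(1)] by blast
    then obtain d q where q: "q \<in> paths Q" "length as \<le> length (snd q)" "dual.nak b = scale d (pc q)"
      using nak_path[OF P(1)] P(2) by blast
    have "scale c z = scale d (pc q)" using c(2) q(3) by simp
    then have "scale (1 / c) (scale c z) = scale (1 / c) (scale d (pc q))" by simp
    then have z: "z = scale (d / c) (pc q)" using c(1) by simp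
    have "z \<notin> Ar"
    proof
      assume "z \<in> Ar"
      then obtain a where a: "a \<in> arcs Q" "z = ar a" by (auto simp: Ar_def)
      then have "q = (tail Q a, [a])" using z by (intro short_inj[OF arc_path[OF a(1)] _ q(1), of "d / c"]) auto
      then show False using q(2) len by simp
    qed
    then show "z \<in> ?R" using \<tau>_not_E[OF b(1,2)] dual.\<tau>_closed[OF b(1)] b(4) by simp
  qed
  then have "dual.\<tau> x \<notin> ?R"
    using x(1) Ar_B by (intro inj_on_complement_closed[OF finite_B dual.inj_\<tau>]) auto
  moreover have "dual.\<tau> x \<notin> E" using x(1) Ar_B E_Ar by (intro \<tau>_not_E) auto
  moreover have "dual.\<tau> x \<in> B" using x(1) Ar_B dual.\<tau>_closed by auto
  ultimately show "y \<in> Ar" using x(2) by blast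
qed

definition m :: nat where "m = fact (card (arcs Q))"

lemma \<tau>_pow_Ar: "x \<in> Ar \<Longrightarrow> (dual.\<tau> ^^ m) x = x"
  unfolding m_def
  by (rule funpow_fact_fixed[OF _ \<tau>_Ar inj_on_subset[OF dual.inj_\<tau> Ar_B]])
    (simp_all add: Ar_def card_image_le)

lemma nak_pow_arrow: "a \<in> arcs Q \<Longrightarrow> \<exists>c. c \<noteq> 0 \<and> (dual.nak ^^ m) (ar a) = scale c (ar a)"
  using dual.funpow_nak_basis[OF arrow_in_B, of a m] \<tau>_pow_Ar[of "ar a"] by (auto simp: Ar_def)

text \<open>The exponent \<open>m\<close> is chosen for the orbits of arrows only. A vertex is fixed
  as the source of a fixed arrow; a vertex without outgoing arrows gives a socle element that is its
  own dual, so it is fixed by \<open>\<tau>\<close>.\<close>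

lemma nak_pow_vertex:
  assumes v: "v \<in> verts Q"
  shows "\<exists>c. (dual.nak ^^ m) (pc (v, [])) = scale c (pc (v, []))"
proof (cases "\<exists>a\<in>arcs Q. tail Q a = v")
  case True
  then obtain a where a: "a \<in> arcs Q" "tail Q a = v" by blast
  let ?e = "pc (v, [])"
  obtain c where c: "c \<noteq> 0" "(dual.nak ^^ m) ?e = scale c ((dual.\<tau> ^^ m) ?e)" "(dual.\<tau> ^^ m) ?e \<in> B"
    using dual.funpow_nak_basis[OF vertex_in_B[OF v]] by blast
  obtain P where P: "P \<in> paths Q" "(dual.\<tau> ^^ m) ?e = pc P" using c(3) B_paths by blast
  obtain d where d: "d \<noteq> 0" "(dual.nak ^^ m) (ar a) = scale d (ar a)" using nak_pow_arrow[OF a(1)] by blast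
  have "?e * ar a = ar a" using source_mult[OF arc_path[OF a(1)]] a(2) by simp
  then have "scale d (ar a) = scale c (pc P) * scale d (ar a)"
    using dual.funpow_nak_mult[of m ?e "ar a"] d(2) c(2) P(2) by simp
  then have "scale (1 / d) (scale d (ar a)) = scale (1 / d) (scale c (pc P) * scale d (ar a))" by simp
  then have *: "ar a = scale c (pc P * ar a)" using d(1) by (simp add: scale_mult_left scale_mult_right)
  have t: "target Q P = tail Q a"
  proof (rule ccontr)
    assume "target Q P \<noteq> tail Q a"
    then have "pc P * ar a = 0" by (simp add: pc_mult[OF P(1) arc_path[OF a(1)]])
    then show False using * nonzero_B[OF arrow_in_B[OF a(1)]] by simp
  qed
  have "ar a = scale c (pc (fst P, snd P @ [a]))"
    using * pc_mult[OF P(1) arc_path[OF a(1)]] t by simp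
  \<comment> \<open>The path \<open>P\<close> followed by \<open>a\<close> represents a multiple of
    the arrow itself, so the two paths agree and \<open>P\<close> is trivial.\<close>
  then have "(fst P, snd P @ [a]) = (tail Q a, [a])"
    using path_append[OF P(1) arc_path[OF a(1)]] t by (intro short_inj[OF arc_path[OF a(1)]]) auto
  then have "P = (v, [])" using a(2) by (cases P) simp
  then show ?thesis using c(2) P(2) by auto
next
  case False
  let ?e = "pc (v, [])"
  have idem: "?e * ?e = ?e" using vertex_mult[OF v v] by simp
  have "?e * pc p = 0" if p: "p \<in> paths Q" "snd p \<noteq> []" for p
  proof -
    obtain u b bs where "p = (u, b # bs)" using p(2) by (cases p; cases "snd p") auto
    then have "fst p \<noteq> v" using path_Cons(1,2)[of u b bs] p(1) False by auto
    then show ?thesis using pc_mult[OF trivial_path[OF v] p(1)] by simp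
  qed
  then have "?e \<in> killed" by (simp add: killed_def)
  then have "?e \<in> socle (indec_projective \<pi> v)" using idem by (intro killed_socle[OF _ v]) auto
  then have "?e \<in> socle UNIV" using socle_mono[of "indec_projective \<pi> v" UNIV] by blast
  then have "st ?e = ?e"
    using idem nonzero_B[OF vertex_in_B[OF v]] by (intro st_eqI vertex_in_B[OF v]) auto
  then have "dual.\<tau> ?e = ?e" by (simp add: dual.\<tau>_def)
  then have "(dual.\<tau> ^^ j) ?e = ?e" for j by (induction j) auto
  then have "(dual.\<tau> ^^ m) ?e = ?e" .
  then show ?thesis using dual.funpow_nak_basis[OF vertex_in_B[OF v], of m] by auto
qed

lemma nak_pow_path: "(u, as) \<in> paths Q \<Longrightarrow> \<exists>c. (dual.nak ^^ m) (pc (u, as)) = scale c (pc (u, as))"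
proof (induction as arbitrary: u)
  case Nil
  then show ?case using nak_pow_vertex path_verts[OF Nil] by simp
next
  case (Cons a as)
  note p = path_Cons[OF Cons.prems]
  obtain c where "(dual.nak ^^ m) (pc (head Q a, as)) = scale c (pc (head Q a, as))" using Cons.IH[OF p(3)] by blast
  moreover obtain d where "(dual.nak ^^ m) (ar a) = scale d (ar a)" using nak_pow_arrow[OF p(1)] by blast
  ultimately have "(dual.nak ^^ m) (pc (u, a # as)) = scale (d * c) (pc (u, a # as))"
    unfolding p(4) dual.funpow_nak_mult by (simp add: scale_mult_left scale_mult_right)
  then show ?case by blast
qed

lemma nak_pow_basis: "b \<in> B \<Longrightarrow> \<exists>c. (dual.nak ^^ m) b = scale c b"
  using B_paths nak_pow_path by fastforce

text \<open>A positive characteristic is prime, and a prime dividing the factorial of the number of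
  arrows is at most that number.\<close>

lemma m_nonzero:
  assumes "CHAR('k) = 0 \<or> CHAR('k) > card (arcs Q)"
  shows "of_nat m \<noteq> (0 :: 'k)"
proof
  assume "of_nat m = (0 :: 'k)"
  then have d: "CHAR('k) dvd fact (card (arcs Q))" by (simp add: of_nat_eq_0_iff_char_dvd m_def)
  then have "CHAR('k) \<noteq> 0" by (metis dvd_0_left_iff fact_nonzero)
  then have "prime CHAR('k)" by (intro prime_CHAR_semidom) simp
  then show False using d assms prime_dvd_fact_iff[of "CHAR('k)" "card (arcs Q)"] \<open>CHAR('k) \<noteq> 0\<close> by auto
qed

end

section \<open>Assembly of the two conclusions\<close>

sublocale frobenius_finite_order \<subseteq> bv: frobenius_bv scale tr N Ni rep
  using decomp ker_im by unfold_locales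

theorem mainTheorem2:
  fixes Q :: "('v, 'e) pre_digraph"
    and I :: "(('v, 'e) qpath \<Rightarrow>\<^sub>0 'k::field) set"
    and scale :: "'k \<Rightarrow> 'a::ring_1 \<Rightarrow> 'a"
    and \<pi> :: "(('v, 'e) qpath \<Rightarrow>\<^sub>0 'k) \<Rightarrow> 'a"
    and B :: "'a set"
    and tr :: "'a \<Rightarrow> 'k"
  assumes quiver: "fin_digraph Q"
    and admissible: "admissible_ideal Q I"
    and algebra: "k_algebra scale"
    and quotient: "path_algebra_quotient Q I scale \<pi>"
    and frobenius: "frobenius_algebra scale"
    and basis: "path_basis Q scale \<pi> B"
    and tr_linear: "Vector_Spaces.linear scale (*) tr"
    and tr_socle: "\<And>p. p \<in> B \<Longrightarrow> p \<in> socle UNIV \<Longrightarrow> tr p = 1"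
    and tr_not_socle: "\<And>p. p \<in> B \<Longrightarrow> p \<notin> socle UNIV \<Longrightarrow> tr p = 0"
    and products: "\<forall>p\<in>B. \<forall>q\<in>B. \<exists>r\<in>B. \<exists>c. p * q = scale c r"
    and duals: "\<forall>p\<in>B. \<exists>!q. q \<in> B \<and> p * q \<noteq> 0 \<and> p * q \<in> socle UNIV"
    and characteristic: "CHAR('k) = 0 \<or> CHAR('k) > card (arcs Q)"
  shows "semisimple_endomorphism scale (nakayama_automorphism scale (\<lambda>a b. tr (a * b)))
    \<and> batalin_vilkovisky_algebra (ring_of_type_algebra :: 'k ring)
        (HH scale) (HH_deg scale) (HH_bracket scale)"
proof -
  interpret monomial_frobenius Q scale I \<pi> B tr
    by (intro monomial_frobenius.intro quiver_algebra.intro quiver_algebra_axioms.intro monomial_frobenius_axioms.intro)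
      (fact quiver algebra admissible quotient frobenius basis tr_linear tr_socle tr_not_socle
        | use products duals in blast)+
  have "\<forall>b\<in>B. \<exists>c. (dual.nak ^^ m) b = scale c b" using nak_pow_basis by blast
  from bchoice[OF this] obtain \<mu> where \<mu>: "\<And>b. b \<in> B \<Longrightarrow> (dual.nak ^^ m) b = scale (\<mu> b) b"
    by blast
  have form: "frobenius_form scale tr dual.nak dual.nak_inv dual.left_rep"
  proof (intro frobenius_form.intro frobenius_form_axioms.intro)
    show "k_algebra scale" by (rule algebra)
    show "tr (dual.left_rep \<phi> * a) = \<phi> a"
      if "\<And>a b. \<phi> (a + b) = \<phi> a + \<phi> b" "\<And>c a. \<phi> (scale c a) = c * \<phi> a" for \<phi> a
      using that by (rule dual.tr_left_rep)
    show "x = y" if "\<And>a. tr (x * a) = tr (y * a)" for x y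
      using that by (rule dual.left_eqI)
  qed (simp_all add: dual.tr_add dual.tr_scale dual.nak_add dual.nak_scale dual.nak_mult dual.nak_one
      dual.nak_inv_nak dual.nak_nak_inv dual.tr_nak)
  interpret fo: frobenius_finite_order scale tr dual.nak dual.nak_inv dual.left_rep B m \<mu>
    by (rule frobenius_finite_order.intro[OF form], rule frobenius_finite_order_axioms.intro)
      (fact finite_B dual.is_basis \<mu> m_nonzero[OF characteristic])+
  show ?thesis
    unfolding dual.nakayama_eq
    using semisimple_of_diagonal_power[OF dual.linear_nak finite_B dual.is_basis m_nonzero[OF characteristic] \<mu> fo.\<mu>_nz]
      fo.bv.batalin_vilkovisky_HH by blast
qed

end
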